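(* Let $X$ be a non-singular projective toric surface and $\mathsf{\Gamma}=(0,n,m,c)$ genus $0$ discrete data with $n\ge3$ and $m=2(n-1)$. Let $$Z=\prod_{i=4}^n\mathrm{ft}_i^*(0)\cdot M^{\mathrm{trop}}(\mathbb{R}^2,\mathsf{\Gamma}),$$ let $x_1,\dots,x_n\in\mathbb{R}^2$ be points in general position, and let $[h:\mathsf{C}\to\mathbb{R}^2]$ be a curve contributing to the $0$-cycle $\prod_{i=1}^n\mathrm{ev}_i^*(x_i)\cdot Z$. Then $\mathsf{C}$ has one of the following two shapes: \begin{itemize} \item[(A)] there is a central vertex $V$ with one of the markings $p_{i_0}$ attached to it and $n-1$ further leaves from $V$, each consisting of two bounded edges, one marking and two ends, arranged as follows: a bounded edge joins $V$ to a trivalent vertex $W$ carrying one end $q$, a second bounded edge joins $W$ to a trivalent vertex $U$, and $U$ carries one marking $p_i$ and one end $q'$; \item[(B)] there is a central vertex $V$ and $n$ leaves from it, of which exactly two consist of one bounded edge joining $V$ to a trivalent vertex carrying one marking and one end, while the other $n-2$ leaves are as those with two bounded edges in (A). \end{itemize}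
   Context: **Discrete data.** Let $D_1,\dots,D_k$ be the toric divisors of $X$ and $n_1,\dots,n_k\in\mathbb{Z}^2$ the primitive generators of the corresponding rays. A contact order $c$ for $m$ markings $q_1,\dots,q_m$ assigns to each $q_l$ a divisor $D_{i}$ and a positive contact multiplicity $\mu$; set $v_l=\mu n_i$. The balancing condition $\sum_l v_l=0$ is assumed; $\Delta=(v_1,\dots,v_m)$. **Tropical moduli.** $M^{\mathrm{trop}}(\mathbb{R}^2,\mathsf{\Gamma})$ is the moduli space of labelled parametrized rational tropical curves of degree $\Delta$ with $n$ marked points (Gathmann–Kerber–Markwig): isomorphism classes of maps $h:\mathsf{C}\to\mathbb{R}^2$, where $\mathsf{C}$ is a metric tree with all vertices of valence $\ge3$ and $n+m$ labelled unbounded edges, namely the markings $p_1,\dots,p_n$ and the ends $q_1,\dots,q_m$; $h$ is affine with integral direction vector on each edge, balanced at each vertex, contracts each $p_i$, and has outgoing direction $v_l$ on $q_l$. It is a tropical fan with all weights $1$, identified with $M_{0,n+m}^{\mathrm{trop}}\times\mathbb{R}^2$. **Cycles.** For $i=4,\dots,n$, $\mathrm{ft}_i:M^{\mathrm{trop}}(\mathbb{R}^2,\mathsf{\Gamma})\to M^{\mathrm{trop}}_{0,\{1,2,3,i\}}$ remembers only the stabilized domain marked by $p_1,p_2,p_3,p_i$; $0$ denotes the point of $M_{0,4}^{\mathrm{trop}}$ given by the unique $4$-valent curve, viewed as a Cartier divisor, and $\mathrm{ft}_i^*(0)$ is its pullback in the sense of Allermann–Rau. $\mathrm{ev}_i$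 sends $[h]$ to $h(p_i)\in\mathbb{R}^2$; for a point $x=(\bar x_1,\bar x_2)$, $\mathrm{ev}_i^*(x)\cdot(-)$ means intersecting with the pullbacks of the Cartier divisors $\bar x_1,\bar x_2\in\mathbb{R}$ under the two coordinates of $\mathrm{ev}_i$. A curve contributes to a $0$-cycle if it occurs in it with nonzero multiplicity. **Central vertex and leaves.** Curves in the interiors of top-dimensional polyhedra of $Z$ have exactly one distinguished vertex $V$, of valence $n$, lying on the paths joining all the markings $p_i$; it is called the central vertex. The connected components of $\mathsf{C}\smallsetminus\{V\}$ are called leaves. *)

theory Defs
  imports "HOL-Analysis.Analysis" "HOL-Computational_Algebra.Group_Closure"
begin

section \<open>Toric surfaces and contact orders\<close>

definition int_vec :: "(real^2) set" where
  "int_vec = {z. \<forall>i. z $ i \<in> \<int>}"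

definition lattice_basis :: "real^2 \<Rightarrow> real^2 \<Rightarrow> bool" where
  "lattice_basis a b \<longleftrightarrow> a \<in> int_vec \<and> b \<in> int_vec \<and> \<bar>a$1 * b$2 - a$2 * b$1\<bar> = 1"

(* A toric surface is given by its fan. Cones generated by part of a lattice basis are
   automatically rational and strongly convex. *)
definition nonsingular_fan :: "(real^2) set set \<Rightarrow> bool" where
  "nonsingular_fan \<Sigma> \<longleftrightarrow> finite \<Sigma> \<and> \<Sigma> \<noteq> {} \<and>
     (\<forall>\<sigma>\<in>\<Sigma>. \<exists>a b B. lattice_basis a b \<and> B \<subseteq> {a, b} \<and> \<sigma> = convex_cone hull B) \<and>
     (\<forall>\<sigma>\<in>\<Sigma>. \<forall>\<tau>. \<tau> face_of \<sigma> \<and> \<tau> \<noteq> {} \<longrightarrow> \<tau> \<in> \<Sigma>) \<and>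
     (\<forall>\<sigma>\<in>\<Sigma>. \<forall>\<tau>\<in>\<Sigma>. (\<sigma> \<inter> \<tau>) face_of \<sigma> \<and> (\<sigma> \<inter> \<tau>) face_of \<tau>)"

(* Projectivity: the fan is complete and carries a strictly convex integral support function. *)
definition projective_fan :: "(real^2) set set \<Rightarrow> bool" where
  "projective_fan \<Sigma> \<longleftrightarrow> \<Union>\<Sigma> = UNIV \<and>
     (\<exists>\<psi>. convex_on UNIV \<psi> \<and>
        (\<forall>\<sigma>\<in>\<Sigma>. aff_dim \<sigma> = 2 \<longrightarrow> (\<exists>k\<in>int_vec. \<sigma> = {z. \<psi> z = k \<bullet> z})))"

(* A toric divisor is recorded as the corresponding ray of the fan. *)
definition toric_divisors :: "(real^2) set set \<Rightarrow> (real^2) set set" where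
  "toric_divisors \<Sigma> = {\<rho> \<in> \<Sigma>. aff_dim \<rho> = 1}"

definition primitive_gen :: "(real^2) set \<Rightarrow> real^2" where
  "primitive_gen \<rho> = (THE u. u \<noteq> 0 \<and> \<rho> \<inter> int_vec = range (\<lambda>k::nat. real k *\<^sub>R u))"

definition contact_order :: "(real^2) set set \<Rightarrow> ('m \<Rightarrow> (real^2) set \<times> nat) \<Rightarrow> bool" where
  "contact_order \<Sigma> c \<longleftrightarrow> (\<forall>l. fst (c l) \<in> toric_divisors \<Sigma> \<and> snd (c l) > 0)"

definition contact_vec :: "('m \<Rightarrow> (real^2) set \<times> nat) \<Rightarrow> 'm \<Rightarrow> real^2" where
  "contact_vec c l = real (snd (c l)) *\<^sub>R primitive_gen (fst (c l))"

(* Outgoing directions of all unbounded edges: \<open>Inl\<close> marks the contracted markings p,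
   \<open>Inr\<close> the ends q. *)
definition leg_dir :: "('m \<Rightarrow> (real^2) set \<times> nat) \<Rightarrow> 'n + 'm \<Rightarrow> real^2" where
  "leg_dir c = case_sum (\<lambda>_. 0) (contact_vec c)"


section \<open>Metric trees and parametrized tropical curves\<close>

(* \<open>edges\<close> are the bounded edges, with lengths \<open>len\<close>; the unbounded edge with label \<open>l\<close>
   is attached to the vertex \<open>leg l\<close>. *)
record 'l tree =
  verts :: "nat set"
  edges :: "nat set set"
  len :: "nat set \<Rightarrow> real"
  leg :: "'l \<Rightarrow> nat"

record 'l curve = "'l tree" +
  pos :: "nat \<Rightarrow> real^2"

definition is_path :: "('l, 'z) tree_scheme \<Rightarrow> nat list \<Rightarrow> nat \<Rightarrow> nat \<Rightarrow> bool" where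
  "is_path T \<pi> u w \<longleftrightarrow> \<pi> \<noteq> [] \<and> hd \<pi> = u \<and> last \<pi> = w \<and> distinct \<pi> \<and> set \<pi> \<subseteq> verts T \<and>
     successively (\<lambda>a b. {a, b} \<in> edges T) \<pi>"

definition tree_path :: "('l, 'z) tree_scheme \<Rightarrow> nat \<Rightarrow> nat \<Rightarrow> nat list" where
  "tree_path T u w = (THE \<pi>. is_path T \<pi> u w)"

definition path_edges :: "nat list \<Rightarrow> nat set set" where
  "path_edges \<pi> = {{\<pi> ! k, \<pi> ! Suc k} |k. Suc k < length \<pi>}"

definition valence :: "('l, 'z) tree_scheme \<Rightarrow> nat \<Rightarrow> nat" where
  "valence T u = card {e \<in> edges T. u \<in> e} + card {l. leg T l = u}"

definition nbrs :: "('l, 'z) tree_scheme \<Rightarrow> nat \<Rightarrow> nat set" where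
  "nbrs T u = {w. {u, w} \<in> edges T}"

definition stable_tree :: "('l, 'z) tree_scheme \<Rightarrow> bool" where
  "stable_tree T \<longleftrightarrow> finite (verts T) \<and> verts T \<noteq> {} \<and>
     (\<forall>e\<in>edges T. e \<subseteq> verts T \<and> card e = 2) \<and>
     (\<forall>u\<in>verts T. \<forall>w\<in>verts T. \<exists>!\<pi>. is_path T \<pi> u w) \<and>
     range (leg T) \<subseteq> verts T \<and>
     (\<forall>u\<in>verts T. valence T u \<ge> 3) \<and>
     (\<forall>e\<in>edges T. len T e > 0)"

definition edge_dir :: "('l, 'z) curve_scheme \<Rightarrow> nat \<Rightarrow> nat \<Rightarrow> real^2" where
  "edge_dir C u w = (pos C w - pos C u) /\<^sub>R len C {u, w}"

(* \<open>v l\<close> is the outgoing direction of h on the unbounded edge \<open>l\<close>, so h is determined by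
   its values \<open>pos\<close> at the vertices. *)
definition tropical_curve :: "('l \<Rightarrow> real^2) \<Rightarrow> 'l curve \<Rightarrow> bool" where
  "tropical_curve v C \<longleftrightarrow> stable_tree C \<and>
     (\<forall>u w. {u, w} \<in> edges C \<longrightarrow> edge_dir C u w \<in> int_vec) \<and>
     (\<forall>u\<in>verts C. (\<Sum>w\<in>nbrs C u. edge_dir C u w) + (\<Sum>l | leg C l = u. v l) = 0)"


section \<open>The moduli fans\<close>

type_synonym 'l ambient = "real ^ ('l \<times> 'l \<times> 'l \<times> 'l)"

(* The space of rational tropical curves with legs labelled by L is a fan in the quotient of the
   space of symmetric functions d on pairs of distinct labels by the vectors
   d a b = t a + t b. That quotient is realised here by double ratios: the kernel of
   \<open>double_ratio\<close> on such functions d (with at least four labels) is exactly the subspace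
   divided out. On the leg distances of a tree the (a,b,c,d) coordinate is, up to sign, the length
   of the bounded edge of the stabilized tree with legs a,b,c,d: positive if that tree has type
   ab|cd, negative for ad|bc, and zero for ac|bd. *)
definition double_ratio :: "('l \<Rightarrow> 'l \<Rightarrow> real) \<Rightarrow> ('l::finite) ambient" where
  "double_ratio D = (\<chi> k. case k of (a, b, c, d) \<Rightarrow>
     if distinct [a, b, c, d] then (D a d + D b c - D a b - D c d) / 2 else 0)"

definition leg_dist :: "('l, 'z) tree_scheme \<Rightarrow> 'l \<Rightarrow> 'l \<Rightarrow> real" where
  "leg_dist T a b = (\<Sum>e\<in>path_edges (tree_path T (leg T a) (leg T b)). len T e)"

definition tree_point :: "('l::finite, 'z) tree_scheme \<Rightarrow> 'l ambient" where
  "tree_point T = double_ratio (leg_dist T)"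

(* The closed cone of all trees of the combinatorial type of \<open>T\<close>; edges of length 0 are
   contracted. *)
definition type_cone :: "('l::finite) tree \<Rightarrow> 'l ambient set" where
  "type_cone T = {tree_point (T\<lparr>len := a\<rparr>) |a. \<forall>e\<in>edges T. a e \<ge> 0}"

(* The lattice is generated by the points of the trees with a single bounded edge, of length 1,
   separating the legs in \<open>I\<close> from the others. *)
definition tree_lattice :: "('l::finite) ambient set" where
  "tree_lattice = group_closure
     {double_ratio (\<lambda>a b. if (a \<in> I) \<noteq> (b \<in> I) then 1 else 0) |I. card I \<ge> 2 \<and> card (- I) \<ge> 2}"

definition moduli_lattice :: "(('l::finite) ambient \<times> (real^2)) set" where
  "moduli_lattice = tree_lattice \<times> int_vec"

(* The class of a curve: its domain and the image of the leg \<open>r\<close>. *)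
definition curve_point :: "'l \<Rightarrow> ('l::finite) curve \<Rightarrow> 'l ambient \<times> (real^2)" where
  "curve_point r C = (tree_point C, pos C (leg C r))"


section \<open>Intersecting with Cartier divisors\<close>

(* Weights matter only on the cells of maximal dimension \<open>wdim\<close>. *)
record 'a wcomplex =
  wdim :: int
  cells :: "'a set set"
  wt :: "'a set \<Rightarrow> real"

definition direction_space :: "'a::euclidean_space set \<Rightarrow> 'a set" where
  "direction_space \<sigma> = span {x - y |x y. x \<in> \<sigma> \<and> y \<in> \<sigma>}"

definition is_normal_vec :: "'a::euclidean_space set \<Rightarrow> 'a set \<Rightarrow> 'a set \<Rightarrow> 'a \<Rightarrow> bool" where
  "is_normal_vec \<Lambda> \<sigma> \<tau> u \<longleftrightarrow> u \<in> \<Lambda> \<inter> direction_space \<sigma> \<and>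
     \<Lambda> \<inter> direction_space \<sigma> = {w + of_int k *\<^sub>R u |w k. w \<in> \<Lambda> \<inter> direction_space \<tau>} \<and>
     (\<exists>x\<in>\<tau>. \<exists>t>0. x + t *\<^sub>R u \<in> \<sigma>)"

definition normal_vec :: "'a::euclidean_space set \<Rightarrow> 'a set \<Rightarrow> 'a set \<Rightarrow> 'a" where
  "normal_vec \<Lambda> \<sigma> \<tau> = (SOME u. is_normal_vec \<Lambda> \<sigma> \<tau> u)"

(* Determined only on \<open>direction_space \<sigma>\<close>, which is where it is evaluated. *)
definition lin_part :: "('a::euclidean_space \<Rightarrow> real) \<Rightarrow> 'a set \<Rightarrow> 'a \<Rightarrow> real" where
  "lin_part \<phi> \<sigma> = (SOME L. linear L \<and> (\<forall>x\<in>\<sigma>. \<forall>y\<in>\<sigma>. \<phi> y - \<phi> x = L (y - x)))"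

definition weil_weight ::
    "'a::euclidean_space set \<Rightarrow> ('a \<Rightarrow> real) \<Rightarrow> 'a wcomplex \<Rightarrow> 'a set \<Rightarrow> real" where
  "weil_weight \<Lambda> \<phi> X \<tau> =
     (let S = {\<sigma> \<in> cells X. aff_dim \<sigma> = wdim X \<and> \<tau> face_of \<sigma>}
      in (\<Sum>\<sigma>\<in>S. wt X \<sigma> * lin_part \<phi> \<sigma> (normal_vec \<Lambda> \<sigma> \<tau>))
         - lin_part \<phi> \<tau> (\<Sum>\<sigma>\<in>S. wt X \<sigma> *\<^sub>R normal_vec \<Lambda> \<sigma> \<tau>))"

(* The Weil divisor of a rational function \<phi> that is affine on every cell of \<open>X\<close>. *)
definition weil_divisor ::
    "'a::euclidean_space set \<Rightarrow> ('a \<Rightarrow> real) \<Rightarrow> 'a wcomplex \<Rightarrow> 'a wcomplex" where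
  "weil_divisor \<Lambda> \<phi> X =
     \<lparr>wdim = wdim X - 1,
      cells = {\<tau> \<in> cells X. aff_dim \<tau> \<le> wdim X - 1},
      wt = weil_weight \<Lambda> \<phi> X\<rparr>"

(* Refinement of \<open>X\<close> by the sign of a function that is affine on every cell. *)
definition cut :: "('a::euclidean_space \<Rightarrow> real) \<Rightarrow> 'a wcomplex \<Rightarrow> 'a wcomplex" where
  "cut f X =
     \<lparr>wdim = wdim X,
      cells = (\<Union>\<sigma>\<in>cells X. {\<sigma> \<inter> {x. f x \<ge> 0}, \<sigma> \<inter> {x. f x \<le> 0}, \<sigma> \<inter> {x. f x = 0}}) - {{}},
      wt = (\<lambda>\<sigma>'. wt X (THE \<sigma>. \<sigma> \<in> cells X \<and> aff_dim \<sigma> = wdim X \<and> \<sigma>' \<subseteq> \<sigma>))\<rparr>"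

(* Intersection of \<open>X\<close> with the Cartier divisor given by the rational function max(f,0). *)
definition cartier_intersect ::
    "'a::euclidean_space set \<Rightarrow> ('a \<Rightarrow> real) \<Rightarrow> 'a wcomplex \<Rightarrow> 'a wcomplex" where
  "cartier_intersect \<Lambda> f X = weil_divisor \<Lambda> (\<lambda>x. max (f x) 0) (cut f X)"

(* Elements of a 0-cycle that occur with nonzero multiplicity. *)
definition contributes :: "'a::euclidean_space wcomplex \<Rightarrow> 'a \<Rightarrow> bool" where
  "contributes X y \<longleftrightarrow> wdim X = 0 \<and> {y} \<in> cells X \<and> wt X {y} \<noteq> 0"


section \<open>The cycles\<close>

(* The fan of dimension (N - 3) + 2 of parametrized curves with N legs. *)
definition moduli_fan :: "(('l::finite) ambient \<times> (real^2)) wcomplex" where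
  "moduli_fan =
     \<lparr>wdim = int CARD('l) - 1,
      cells = {type_cone T \<times> UNIV |T. stable_tree T},
      wt = (\<lambda>_. 1)\<rparr>"

(* Forgetting legs and stabilizing does not change the distances between the remaining legs,
   whence it is a restriction of coordinates. *)
definition forget :: "('k \<Rightarrow> 'l) \<Rightarrow> ('l::finite) ambient \<times> (real^2) \<Rightarrow> ('k::finite) ambient" where
  "forget \<iota> y = (\<chi> k. case k of (a, b, c, d) \<Rightarrow> fst y $ (\<iota> a, \<iota> b, \<iota> c, \<iota> d))"

(* The 4-valent point of the moduli space of curves with legs 0, 1, 2, 3 as a Cartier divisor:
   \<open>max (origin_fun y) 0\<close> is the length of the bounded edge on the ray 01|23 and vanishes on
   the two other rays; the primitive vectors of the three rays add up to 0, so its divisor is the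
   origin with weight 1 + 0 + 0 - 0. *)
definition origin_fun :: "4 ambient \<Rightarrow> real" where
  "origin_fun y = y $ (0, 1, 2, 3)"

(* The four markings remembered by the i-th forgetful map. *)
definition four_legs :: "(nat \<Rightarrow> 'n) \<Rightarrow> nat \<Rightarrow> 4 \<Rightarrow> 'n + 'm" where
  "four_legs p i k =
     Inl (if k = 0 then p 1 else if k = 1 then p 2 else if k = 2 then p 3 else p i)"

definition ft :: "(nat \<Rightarrow> 'n) \<Rightarrow> nat \<Rightarrow> ('n::finite + 'm::finite) ambient \<times> (real^2) \<Rightarrow> 4 ambient" where
  "ft p i = forget (four_legs p i)"

(* Evaluation at the leg \<open>a\<close> of the curve whose class (with base leg \<open>r\<close>) is \<open>y\<close>. *)
definition ev :: "('l::finite \<Rightarrow> real^2) \<Rightarrow> 'l \<Rightarrow> 'l \<Rightarrow> 'l ambient \<times> (real^2) \<Rightarrow> real^2" where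
  "ev v r a y = (THE z. \<exists>C. tropical_curve v C \<and> curve_point r C = y \<and> z = pos C (leg C a))"

definition Z_cycle :: "(nat \<Rightarrow> 'n::finite) \<Rightarrow> (('n + 'm::finite) ambient \<times> (real^2)) wcomplex" where
  "Z_cycle p = fold (\<lambda>i. cartier_intersect moduli_lattice (origin_fun \<circ> ft p i))
     [4..<Suc CARD('n)] moduli_fan"

definition point_cycle ::
    "(nat \<Rightarrow> 'n::finite) \<Rightarrow> ('m::finite \<Rightarrow> (real^2) set \<times> nat) \<Rightarrow> (real^2)^'n
     \<Rightarrow> (('n + 'm) ambient \<times> (real^2)) wcomplex" where
  "point_cycle p c x =
     fold (\<lambda>(i, j). cartier_intersect moduli_lattice
             (\<lambda>y. ev (leg_dir c) (Inl (p 1)) (Inl (p i)) y $ j - x $ p i $ j))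
       (List.product [1..<Suc CARD('n)] [1, 2]) (Z_cycle p)"

(* A property of points in general position: it holds outside finitely many proper affine
   subspaces. *)
definition for_general :: "('a::euclidean_space \<Rightarrow> bool) \<Rightarrow> bool" where
  "for_general P \<longleftrightarrow>
     (\<exists>\<H>. finite \<H> \<and> (\<forall>H\<in>\<H>. affine H \<and> H \<noteq> UNIV) \<and> (\<forall>x. x \<notin> \<Union>\<H> \<longrightarrow> P x))"


section \<open>Shapes of curves\<close>

definition central_vertex :: "('n + 'm, 'z) tree_scheme \<Rightarrow> nat \<Rightarrow> bool" where
  "central_vertex C V \<longleftrightarrow> V \<in> verts C \<and> valence C V = CARD('n) \<and>
     (\<forall>i j. i \<noteq> j \<longrightarrow> V \<in> set (tree_path C (leg C (Inl i)) (leg C (Inl j))))"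

(* Vertices of the connected component of w in the complement of V. *)
definition branch :: "('l, 'z) tree_scheme \<Rightarrow> nat \<Rightarrow> nat \<Rightarrow> nat set" where
  "branch C V w = {u. \<exists>\<pi>. is_path C \<pi> w u \<and> V \<notin> set \<pi>}"

definition legs_at :: "('l, 'z) tree_scheme \<Rightarrow> nat \<Rightarrow> 'l set" where
  "legs_at C u = {l. leg C l = u}"

definition short_leaf :: "('n + 'm, 'z) tree_scheme \<Rightarrow> nat \<Rightarrow> nat \<Rightarrow> bool" where
  "short_leaf C V U \<longleftrightarrow> {V, U} \<in> edges C \<and> branch C V U = {U} \<and> valence C U = 3 \<and>
     (\<exists>i q. legs_at C U = {Inl i, Inr q})"

definition long_leaf :: "('n + 'm, 'z) tree_scheme \<Rightarrow> nat \<Rightarrow> nat \<Rightarrow> bool" where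
  "long_leaf C V W \<longleftrightarrow> {V, W} \<in> edges C \<and> valence C W = 3 \<and> (\<exists>q. legs_at C W = {Inr q}) \<and>
     (\<exists>U. branch C V W = {W, U} \<and> {W, U} \<in> edges C \<and> valence C U = 3 \<and>
        (\<exists>i q'. legs_at C U = {Inl i, Inr q'}))"

definition shape_A :: "('n + 'm, 'z) tree_scheme \<Rightarrow> bool" where
  "shape_A C \<longleftrightarrow> (\<exists>V i0. central_vertex C V \<and> legs_at C V = {Inl i0} \<and>
     card (nbrs C V) = CARD('n) - 1 \<and> (\<forall>W\<in>nbrs C V. long_leaf C V W))"

definition shape_B :: "('n + 'm, 'z) tree_scheme \<Rightarrow> bool" where
  "shape_B C \<longleftrightarrow> (\<exists>V. central_vertex C V \<and> legs_at C V = {} \<and> card (nbrs C V) = CARD('n) \<and>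
     card {W \<in> nbrs C V. short_leaf C V W} = 2 \<and>
     (\<forall>W\<in>nbrs C V. short_leaf C V W \<or> long_leaf C V W))"

end

theory Submission
  imports Defs
begin

text \<open>
  A combinatorial type of trees is a system of pairwise compatible splits of the set of legs, and
  the cone of the type is spanned by the split vectors. Intersecting with the divisor of
  \<open>ft_(j+1)\<close> selects, among the three ways to separate \<open>p_1, p_2, p_3, p_(j+1)\<close>, exactly the trees
  in which they meet in a point. Inductively, \<open>Z\<close> is therefore the subfan, with weights one, of the
  types each of whose splits has a side containing at most one marking.

  On a cone of the moduli fan the evaluation maps are linear. For points outside the proper
  subspaces among the conditions which these linear maps impose, successive intersection with the
  coordinate hyperplanes is transversal, and a point that occurs in the final cycle lies in the
  relative interior of a maximal cone of \<open>Z\<close> on which the evaluation map is injective.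

  Let \<open>V\<close> be the vertex at which the markings meet. Each of the \<open>2n - 2\<close> bounded edges cuts off
  from \<open>V\<close> a cluster of legs with at most one marking. Changing the length of an edge moves the
  images of the markings beyond it along the sum of the directions of the ends in its cluster, so
  injectivity forces every cluster to contain a marking, and at most two clusters to contain a
  given one since three vectors in the plane are dependent. A chain of \<open>k\<close> nested clusters
  around a marking needs at least \<open>k\<close> ends, but there are only \<open>2n - 2\<close> ends. So every chain
  is as small as possible, and of the \<open>n\<close> numbers \<open>k \<le> 2\<close>, which add up to \<open>2n - 2\<close>, either one is
  \<open>0\<close> or two are \<open>1\<close>, the others being \<open>2\<close>.
\<close>

section \<open>Direction spaces, lattice normals and linear parts\<close>

text \<open>The multiplicities in the point cycle are never computed. What passes through the
  hyperplane intersections is that nonzero weight of full-dimensional cells sits on slices of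
  maximal cells, and that the complex stays balanced. Balancing is indispensable: \<open>cut\<close>
  creates cells off the hyperplane, and only balancing makes the divisor of \<open>max f 0\<close>
  vanish there. It has to be renewed after every step, since weights and normal vectors both change;
  a lattice index identity shows that around a fixed facet they change by a common factor. As
  \<open>normal_vec\<close> is an arbitrary choice, it is handled only through values of integral
  functionals vanishing on the facet. On cones of trees these functionals are coordinates of
  \<open>double_ratio\<close>: quartets of labels that see a single split.

  Balancing of the moduli cycles rests on one identity for a partition of the labels into the
  branches of a vertex. It applies because, around a cell of codimension one, all resolutions join
  one fixed branch to a second one. The map \<open>ev\<close> is a definite description that is
  linear only on the fan; \<open>agree\<close> bridges this gap.\<close>

lemma diff_mem_direction_space: "x \<in> s \<Longrightarrow> y \<in> s \<Longrightarrow> x - y \<in> direction_space s"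
  unfolding direction_space_def by (rule span_base) blast

lemma subspace_direction_space: "subspace (direction_space s)"
  unfolding direction_space_def by simp

lemma direction_space_mono: "s \<subseteq> t \<Longrightarrow> direction_space s \<subseteq> direction_space t"
  unfolding direction_space_def by (rule span_mono) blast

text \<open>A subspace is recovered from arbitrarily small displacements, so it is enough that every
  vector of \<open>D\<close> has some positive multiple that keeps the base point in
  \<open>Q\<close>. Direction spaces of slices are found this way in
  \<open>direction_space_H\<close>.\<close>

lemma direction_space_eqI:
  assumes "y \<in> Q" "subspace D" "\<And>x. x \<in> Q \<Longrightarrow> x - y \<in> D"
    and "\<And>v. v \<in> D \<Longrightarrow> \<exists>e>0. y + e *\<^sub>R v \<in> Q"
  shows "direction_space Q = D"
proof
  have "a - b \<in> D" if "a \<in> Q" "b \<in> Q" for a b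
    using subspace_diff[OF assms(2) assms(3)[OF that(1)] assms(3)[OF that(2)]] by simp
  then show "direction_space Q \<subseteq> D"
    unfolding direction_space_def by (intro span_minimal assms(2)) auto
  show "D \<subseteq> direction_space Q"
  proof
    fix v assume "v \<in> D"
    then obtain e where "e > 0" "y + e *\<^sub>R v \<in> Q" using assms(4) by blast
    then have "e *\<^sub>R v \<in> direction_space Q"
      using diff_mem_direction_space[of "y + e *\<^sub>R v" Q y] assms(1) by simp
    then have "inverse e *\<^sub>R (e *\<^sub>R v) \<in> direction_space Q"
      using subspace_direction_space subspace_scale by blast
    then show "v \<in> direction_space Q" using \<open>e > 0\<close> by simp
  qed
qed

lemma aff_dim_direction_space:
  fixes s :: "'a::euclidean_space set"
  assumes "s \<noteq> {}" shows "aff_dim s = int (dim (direction_space s))"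
proof -
  obtain a where a: "a \<in> s" using assms by blast
  have "span ((\<lambda>x. x - a) ` s) = direction_space s"
  proof
    show "span ((\<lambda>x. x - a) ` s) \<subseteq> direction_space s"
      by (rule span_minimal[OF _ subspace_direction_space]) (use a diff_mem_direction_space in auto)
    have "x - y \<in> span ((\<lambda>x. x - a) ` s)" if "x \<in> s" "y \<in> s" for x y
    proof -
      have "(x - a) - (y - a) \<in> span ((\<lambda>x. x - a) ` s)"
        by (rule span_diff) (use that in \<open>auto intro: span_base\<close>)
      then show ?thesis by simp
    qed
    then show "direction_space s \<subseteq> span ((\<lambda>x. x - a) ` s)"
      unfolding direction_space_def by (intro span_minimal) auto
  qed
  moreover have "aff_dim s = int (dim ((\<lambda>x. x - a) ` s))"
    by (rule aff_dim_eq_dim_subtract) (rule hull_inc[OF a])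
  ultimately show ?thesis using dim_span by metis
qed

text \<open>Both signs of \<open>t\<close> are allowed. This is what later forces a functional that
  is nonnegative on \<open>s\<close> and zero at \<open>y\<close> to vanish in all directions of
  \<open>s\<close>.\<close>

lemma rel_interior_move:
  fixes s :: "'a::euclidean_space set"
  assumes "y \<in> rel_interior s" "v \<in> direction_space s"
  shows "\<exists>e>0. \<forall>t. \<bar>t\<bar> \<le> e \<longrightarrow> y + t *\<^sub>R v \<in> s"
proof -
  have ys: "y \<in> s" using assms(1) rel_interior_subset by blast
  obtain e where e: "e > 0" "ball y e \<inter> affine hull s \<subseteq> s"
    using assms(1) mem_rel_interior_ball by blast
  have "direction_space s \<subseteq> span ((\<lambda>x. - y + x) ` s)"
    unfolding direction_space_def
  proof (rule span_minimal)
    show "{x - z |x z. x \<in> s \<and> z \<in> s} \<subseteq> span ((\<lambda>x. - y + x) ` s)"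
    proof clarify
      fix x z assume "x \<in> s" "z \<in> s"
      then have "(- y + x) - (- y + z) \<in> span ((\<lambda>x. - y + x) ` s)"
        by (intro span_diff) (auto intro: span_base)
      then show "x - z \<in> span ((\<lambda>x. - y + x) ` s)" by simp
    qed
  qed simp
  then have sp: "t *\<^sub>R v \<in> span ((\<lambda>x. - y + x) ` s)" for t
    using assms(2) by (blast intro: span_scale)
  have "affine hull s = (\<lambda>x. y + x) ` span ((\<lambda>x. - y + x) ` s)"
    by (rule affine_hull_span_gen) (rule hull_inc[OF ys])
  then have hull: "y + t *\<^sub>R v \<in> affine hull s" for t using sp by blast
  \<comment> \<open>The \<open>1\<close> covers \<open>v = 0\<close>, and the \<open>2\<close> keeps
    the displacement strictly inside the ball.\<close>
  define d where "d = e / (2 * (norm v + 1))"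
  have d: "d > 0" unfolding d_def using e(1) by (simp add: add_nonneg_pos)
  have "y + t *\<^sub>R v \<in> s" if "\<bar>t\<bar> \<le> d" for t
  proof -
    have "norm (t *\<^sub>R v) \<le> d * norm v" using that by (simp add: mult_right_mono)
    also have "\<dots> \<le> d * (norm v + 1)" using d by (simp add: mult_left_mono)
    also have "\<dots> = e / 2" unfolding d_def using norm_ge_zero[of v] by (simp add: divide_simps) (smt (verit) norm_ge_zero)
    also have "\<dots> < e" using e(1) by simp
    finally have "y + t *\<^sub>R v \<in> ball y e" by (simp add: dist_norm)
    then show ?thesis using e(2) hull by blast
  qed
  then show ?thesis using d by blast
qed

lemma subspace_kernel_on:
  assumes "subspace D" "linear g" shows "subspace {v \<in> D. g v = (0::real)}"
  using assms by (auto simp: subspace_def linear_add linear_scale linear_0)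

lemma dim_kernel_on:
  fixes D :: "'a::euclidean_space set" and g :: "'a \<Rightarrow> real"
  assumes "subspace D" "linear g" "v \<in> D" "g v \<noteq> 0"
  shows "dim D = Suc (dim {v \<in> D. g v = 0})"
proof -
  let ?K = "{v \<in> D. g v = 0}"
  have K: "subspace ?K" using assms(1,2) by (rule subspace_kernel_on)
  have "D \<subseteq> span (insert v ?K)"
  proof
    fix w assume w: "w \<in> D"
    have "w - (g w / g v) *\<^sub>R v \<in> ?K"
      using w assms by (auto simp: linear_diff linear_scale intro!: subspace_diff subspace_scale)
    then have "w - (g w / g v) *\<^sub>R v \<in> span ?K" by (rule span_base)
    then show "w \<in> span (insert v ?K)" unfolding span_insert by blast
  qed
  moreover have "span (insert v ?K) \<subseteq> D"
    by (rule span_minimal[OF _ assms(1)]) (use assms in auto)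
  ultimately have "dim D = dim (insert v ?K)" by (metis dim_span subset_antisym)
  moreover have "span ?K = ?K" by (rule span_eq_iff[THEN iffD2, OF K])
  then have "v \<notin> span ?K" using assms(4) by blast
  then have "dim (insert v ?K) = dim ?K + 1" unfolding dim_insert by (rule if_not_P)
  ultimately show ?thesis by linarith
qed

text \<open>\<open>lin_part\<close> is chosen by \<open>SOME\<close>, so off
  \<open>direction_space s\<close> it may be any linear extension. Its linearity still holds
  globally, which is what makes the correction term of an empty sum vanish.\<close>

lemma lin_part_affine:
  assumes A: "linear A" and eq: "\<And>x. x \<in> s \<Longrightarrow> \<phi> x = A x + c"
  shows linear_lin_part: "linear (lin_part \<phi> s)"
    and lin_part_eq: "v \<in> direction_space s \<Longrightarrow> lin_part \<phi> s v = A v"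
proof -
  have "linear A \<and> (\<forall>x\<in>s. \<forall>y\<in>s. \<phi> y - \<phi> x = A (y - x))"
    using A eq by (simp add: linear_diff)
  then have *: "linear (lin_part \<phi> s) \<and> (\<forall>x\<in>s. \<forall>y\<in>s. \<phi> y - \<phi> x = lin_part \<phi> s (y - x))"
    unfolding lin_part_def by (rule someI[where P="\<lambda>L. linear L \<and> (\<forall>x\<in>s. \<forall>y\<in>s. \<phi> y - \<phi> x = L (y - x))"])
  then show lin: "linear (lin_part \<phi> s)" by blast
  assume "v \<in> direction_space s"
  then show "lin_part \<phi> s v = A v" unfolding direction_space_def
  proof (rule linear_eq_on_span[OF lin A, rotated])
    fix b assume "b \<in> {x - y |x y. x \<in> s \<and> y \<in> s}"
    then obtain x y where "b = x - y" "x \<in> s" "y \<in> s" by blast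
    then show "lin_part \<phi> s b = A b" using * eq A by (metis add_diff_cancel_right linear_diff)
  qed
qed

lemma lin_part_cong: "(\<And>x. x \<in> s \<Longrightarrow> \<phi> x = \<psi> x) \<Longrightarrow> lin_part \<phi> s = lin_part \<psi> s"
  unfolding lin_part_def by (rule arg_cong[where f=Eps]) (auto simp: fun_eq_iff)

section \<open>Subgroups of a real vector space and integral functionals on them\<close>

definition add_subgroup :: "'a::ab_group_add set \<Rightarrow> bool" where
  "add_subgroup G \<longleftrightarrow> 0 \<in> G \<and> (\<forall>a\<in>G. \<forall>b\<in>G. a - b \<in> G)"

lemma add_subgroup_minus: "add_subgroup G \<Longrightarrow> a \<in> G \<Longrightarrow> - a \<in> G"
  unfolding add_subgroup_def by (metis diff_0)

lemma add_subgroup_add: "add_subgroup G \<Longrightarrow> a \<in> G \<Longrightarrow> b \<in> G \<Longrightarrow> a + b \<in> G"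
  using add_subgroup_minus[of G b] unfolding add_subgroup_def by (metis diff_minus_eq_add)

lemma add_subgroup_scale_int:
  fixes G :: "'a::real_vector set"
  assumes "add_subgroup G" "a \<in> G" shows "of_int k *\<^sub>R a \<in> G"
proof (induction k rule: int_induct[where k=0])
  case base then show ?case using assms by (simp add: add_subgroup_def)
next
  case (step1 i) then show ?case
    using add_subgroup_add[OF assms(1) step1(2) assms(2)] by (simp add: scaleR_left_distrib)
next
  case (step2 i) then show ?case
    using assms by (simp add: scaleR_left_diff_distrib add_subgroup_def)
qed

lemma add_subgroup_Int: "add_subgroup G \<Longrightarrow> subspace D \<Longrightarrow> add_subgroup (G \<inter> D)"
  by (auto simp: add_subgroup_def subspace_0 subspace_diff)

text \<open>The values of \<open>g\<close> on \<open>G\<close> form a nonzero subgroup of the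
  integers, generated by its least positive element.\<close>

lemma exists_lattice_generator:
  fixes G :: "'a::real_vector set" and g :: "'a \<Rightarrow> real"
  assumes G: "add_subgroup G" and g: "linear g" and int: "\<And>v. v \<in> G \<Longrightarrow> g v \<in> \<int>"
    and ex: "v \<in> G" "g v \<noteq> 0"
  obtains u where "u \<in> G" "g u > 0" "\<And>v. v \<in> G \<Longrightarrow> \<exists>k::int. g v = of_int k * g u"
proof -
  have "\<exists>w\<in>G. g w > 0"
    using ex add_subgroup_minus[OF G, of v] linear_neg[OF g, of v] by (cases "g v > 0") (auto intro: bexI[of _ "- v"])
  then obtain w where w: "w \<in> G" "g w > 0" by blast
  have ex_n: "\<exists>n::nat. n > 0 \<and> (\<exists>u\<in>G. g u = real n)"
  proof -
    obtain z where "g w = of_int z" using int[OF w(1)] Ints_cases by blast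
    then show ?thesis using w by (intro exI[of _ "nat z"]) (auto intro!: bexI[of _ w])
  qed
  define P where "P n \<longleftrightarrow> n > 0 \<and> (\<exists>u\<in>G. g u = real n)" for n
  define n where "n = (LEAST n. P n)"
  have "P n" unfolding n_def using ex_n[folded P_def] by (rule LeastI_ex)
  then have n: "n > 0" "\<exists>u\<in>G. g u = real n" unfolding P_def by auto
  have least: "n \<le> m" if "0 < m" "\<exists>u\<in>G. g u = real m" for m
    unfolding n_def by (rule Least_le) (use that in \<open>simp add: P_def\<close>)
  obtain u where u: "u \<in> G" "g u = real n" using n(2) by blast
  have "\<exists>k::int. g v = of_int k * g u" if v: "v \<in> G" for v
  proof -
    obtain z where z: "g v = of_int z" using int[OF v] Ints_cases by blast
    \<comment> \<open>The remainder is itself a value of \<open>g\<close> on \<open>G\<close> and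
      smaller than the least positive one, hence zero.\<close>
    define r where "r = nat (z mod int n)"
    have r: "int r = z mod int n" "r < n" unfolding r_def using n(1) by (auto simp: nat_less_iff)
    have "v - of_int (z div int n) *\<^sub>R u \<in> G"
      using G v add_subgroup_scale_int[OF G u(1)] unfolding add_subgroup_def by blast
    moreover have "g (v - of_int (z div int n) *\<^sub>R u) = of_int (z - (z div int n) * int n)"
      using g z u by (simp add: linear_diff linear_scale)
    moreover have "z - (z div int n) * int n = int r" using r(1) by (simp add: minus_div_mult_eq_mod)
    ultimately have "r = 0" using least[of r] r(2) by force
    then have "z = (z div int n) * int n" using r(1) by auto
    then have "g v = of_int (z div int n) * g u" using z u(2) by (metis of_int_mult of_int_of_nat_eq)
    then show ?thesis by blast
  qed
  then show ?thesis using that u n(1) by simp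
qed

lemma exists_lattice_nonzero:
  fixes D :: "'a::real_vector set" and g :: "'a \<Rightarrow> real"
  assumes "linear g" "D \<subseteq> span (\<Lambda> \<inter> D)" "v \<in> D" "g v \<noteq> 0"
  shows "\<exists>u\<in>\<Lambda> \<inter> D. g u \<noteq> 0"
proof (rule ccontr)
  assume "\<not> ?thesis"
  then have "\<forall>w\<in>span (\<Lambda> \<inter> D). g w = 0"
    using linear_eq_0_on_span[OF assms(1)] by blast
  then show False using assms by blast
qed

text \<open>Project onto the kernel along a lattice vector \<open>b0\<close> with
  \<open>g b0 \<noteq> 0\<close>. Multiplying the projection by \<open>g b0\<close> clears the
  denominator: \<open>g b0 *\<^sub>R b - g b *\<^sub>R b0\<close> is again a lattice vector, because
  both coefficients are integers.\<close>

lemma lattice_spans_kernel: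
  fixes D :: "'a::real_vector set" and g :: "'a \<Rightarrow> real"
  assumes \<Lambda>: "add_subgroup \<Lambda>" and g: "linear g" "\<And>v. v \<in> \<Lambda> \<Longrightarrow> g v \<in> \<int>"
    and D: "subspace D" "D \<subseteq> span (\<Lambda> \<inter> D)"
  shows "{v \<in> D. g v = 0} \<subseteq> span (\<Lambda> \<inter> {v \<in> D. g v = 0})"
proof (cases "\<exists>v\<in>D. g v \<noteq> 0")
  case False
  then have "{v \<in> D. g v = 0} = D" by blast
  then show ?thesis using D by simp
next
  case True
  then obtain b0 where b0: "b0 \<in> \<Lambda>" "b0 \<in> D" "g b0 \<noteq> 0"
    using exists_lattice_nonzero[OF g(1) D(2)] by blast
  let ?K = "\<Lambda> \<inter> {v \<in> D. g v = 0}"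
  have "g b0 *\<^sub>R d - g d *\<^sub>R b0 \<in> span ?K" if "d \<in> span (\<Lambda> \<inter> D)" for d
    using that
  proof (induction d rule: span_induct_alt)
    case base then show ?case using g by (simp add: linear_0 span_zero)
  next
    case (step c b y)
    obtain m k :: int where m: "g b0 = of_int m" and k: "g b = of_int k"
      using g(2) b0(1) step(1) by (metis IntE Ints_cases)
    have "g b0 *\<^sub>R b - g b *\<^sub>R b0 \<in> \<Lambda>" unfolding m k
      using \<Lambda> add_subgroup_scale_int[OF \<Lambda>] b0 step(1) unfolding add_subgroup_def by blast
    moreover have "g b0 *\<^sub>R b - g b *\<^sub>R b0 \<in> D"
      using D(1) b0(2) step(1) by (intro subspace_diff subspace_scale) auto
    moreover have "g (g b0 *\<^sub>R b - g b *\<^sub>R b0) = 0" using g by (simp add: linear_diff linear_scale)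
    ultimately have "g b0 *\<^sub>R b - g b *\<^sub>R b0 \<in> span ?K" by (intro span_base) auto
    then have "c *\<^sub>R (g b0 *\<^sub>R b - g b *\<^sub>R b0) + (g b0 *\<^sub>R y - g y *\<^sub>R b0) \<in> span ?K"
      using step(2) by (intro span_add span_scale)
    moreover have "c *\<^sub>R (g b0 *\<^sub>R b - g b *\<^sub>R b0) + (g b0 *\<^sub>R y - g y *\<^sub>R b0)
        = g b0 *\<^sub>R (c *\<^sub>R b + y) - g (c *\<^sub>R b + y) *\<^sub>R b0"
      using g by (simp add: linear_add linear_scale algebra_simps)
    ultimately show ?case by simp
  qed
  then have "g b0 *\<^sub>R d \<in> span ?K" if "d \<in> D" "g d = 0" for d using that D(2) by fastforce
  then have "inverse (g b0) *\<^sub>R (g b0 *\<^sub>R d) \<in> span ?K" if "d \<in> D" "g d = 0" for d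
    using that span_scale by blast
  then show ?thesis using b0(3) by auto
qed

text \<open>All that is ever known about \<open>normal_vec\<close>: its value under \<open>g\<close>
  is the positive generator of the values of \<open>g\<close> on the lattice of \<open>P\<close>.
  Two choices thus differ by a direction of \<open>Q\<close>. The assumption \<open>inward\<close>
  makes an admissible vector exist, and \<open>side\<close> fixes the sign for whichever vector is
  chosen.\<close>

lemma normal_vec_props:
  fixes P Q :: "'a::euclidean_space set" and g :: "'a \<Rightarrow> real"
  assumes \<Lambda>: "add_subgroup \<Lambda>" and g: "linear g" "\<And>v. v \<in> \<Lambda> \<Longrightarrow> g v \<in> \<int>"
    and D: "direction_space P \<subseteq> span (\<Lambda> \<inter> direction_space P)"
    and Q: "direction_space Q = {v \<in> direction_space P. g v = 0}"
    and nz: "v \<in> direction_space P" "g v \<noteq> 0"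
    and inward: "\<And>u. u \<in> direction_space P \<Longrightarrow> g u > 0 \<Longrightarrow> \<exists>x\<in>Q. \<exists>t>0. x + t *\<^sub>R u \<in> P"
    and side: "\<And>x y. x \<in> Q \<Longrightarrow> y \<in> P \<Longrightarrow> g x \<le> g y"
  defines "n \<equiv> normal_vec \<Lambda> P Q"
  shows "n \<in> \<Lambda>" "n \<in> direction_space P" "g n > 0"
    "\<And>v. v \<in> \<Lambda> \<Longrightarrow> v \<in> direction_space P \<Longrightarrow> \<exists>k::int. g v = of_int k * g n"
proof -
  let ?G = "\<Lambda> \<inter> direction_space P"
  have G: "add_subgroup ?G" using \<Lambda> subspace_direction_space by (rule add_subgroup_Int)
  obtain u0 where u0: "u0 \<in> ?G" "g u0 \<noteq> 0" using exists_lattice_nonzero[OF g(1) D nz] by blast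
  obtain u where u: "u \<in> ?G" "g u > 0" "\<And>v. v \<in> ?G \<Longrightarrow> \<exists>k::int. g v = of_int k * g u"
    using exists_lattice_generator[OF G g(1) _ u0] g(2) by blast
  have "?G = {w + of_int k *\<^sub>R u |w k. w \<in> \<Lambda> \<inter> direction_space Q}"
  proof
    show "?G \<subseteq> {w + of_int k *\<^sub>R u |w k. w \<in> \<Lambda> \<inter> direction_space Q}"
    proof
      fix v assume v: "v \<in> ?G"
      then obtain k :: int where k: "g v = of_int k * g u" using u(3) by blast
      have "v - of_int k *\<^sub>R u \<in> ?G"
        using G v add_subgroup_scale_int[OF G u(1)] unfolding add_subgroup_def by blast
      moreover have "g (v - of_int k *\<^sub>R u) = 0" using k g(1) by (simp add: linear_diff linear_scale)
      ultimately have "v - of_int k *\<^sub>R u \<in> \<Lambda> \<inter> direction_space Q" using Q by blast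
      then show "v \<in> {w + of_int k *\<^sub>R u |w k. w \<in> \<Lambda> \<inter> direction_space Q}"
        by (intro CollectI exI[of _ "v - of_int k *\<^sub>R u"] exI[of _ k]) simp
    qed
    show "{w + of_int k *\<^sub>R u |w k. w \<in> \<Lambda> \<inter> direction_space Q} \<subseteq> ?G"
      using Q add_subgroup_add[OF G _ add_subgroup_scale_int[OF G u(1)]] by blast
  qed
  then have "is_normal_vec \<Lambda> P Q u"
    unfolding is_normal_vec_def using u(1,2) inward by blast
  then have n: "is_normal_vec \<Lambda> P Q n" unfolding n_def normal_vec_def by (rule someI)
  then show "n \<in> \<Lambda>" "n \<in> direction_space P" unfolding is_normal_vec_def by auto
  have mult: "\<exists>k::int. g v = of_int k * g n" if "v \<in> ?G" for v
  proof -
    have "v \<in> {w + of_int k *\<^sub>R n |w k. w \<in> \<Lambda> \<inter> direction_space Q}"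
      using that n unfolding is_normal_vec_def by simp
    then obtain w and k :: int where "v = w + of_int k *\<^sub>R n" "w \<in> \<Lambda> \<inter> direction_space Q"
      by blast
    then show ?thesis using Q g(1) by (intro exI[of _ k]) (auto simp: linear_add linear_scale)
  qed
  then show "\<And>v. v \<in> \<Lambda> \<Longrightarrow> v \<in> direction_space P \<Longrightarrow> \<exists>k::int. g v = of_int k * g n" by blast
  have "g n \<noteq> 0" using mult[OF u(1)] u(2) by auto
  moreover obtain x t where "x \<in> Q" "t > 0" "x + t *\<^sub>R n \<in> P" using n unfolding is_normal_vec_def by blast
  then have "t * g n \<ge> 0" using side[of x "x + t *\<^sub>R n"] g(1) by (simp add: linear_add linear_scale)
  ultimately show "g n > 0" using \<open>t > 0\<close> by (simp add: zero_le_mult_iff)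
qed

text \<open>Both sides are the index of the image of \<open>G\<close> under \<open>(L, g)\<close>, computed by projecting
  to one coordinate or to the other.\<close>

lemma lattice_index_dvd:
  fixes G :: "'a::real_vector set" and L g :: "'a \<Rightarrow> real"
  assumes G: "add_subgroup G" and lin: "linear L" "linear g"
    and n: "n \<in> G"
    and u: "u \<in> G" "\<And>v. v \<in> G \<Longrightarrow> \<exists>k::int. g v = of_int k * g u"
    and u': "u' \<in> G" "L u' = 0"
    and c: "\<And>v. v \<in> G \<Longrightarrow> g v = 0 \<Longrightarrow> \<exists>k::int. L v = of_int k * c"
  shows "\<exists>k::int. L n * g u' = of_int k * (c * g u)"
proof -
  obtain b b' :: int where b: "g n = of_int b * g u" "g u' = of_int b' * g u"
    using u(2) n u'(1) by blast
  have "n - of_int b *\<^sub>R u \<in> G" "u' - of_int b' *\<^sub>R u \<in> G"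
    using G add_subgroup_scale_int[OF G u(1)] n u'(1) unfolding add_subgroup_def by blast+
  moreover have "g (n - of_int b *\<^sub>R u) = 0" "g (u' - of_int b' *\<^sub>R u) = 0"
    using b lin by (simp_all add: linear_diff linear_scale)
  ultimately obtain k k' :: int where
    "L (n - of_int b *\<^sub>R u) = of_int k * c" "L (u' - of_int b' *\<^sub>R u) = of_int k' * c"
    using c by meson
  then have k: "L n = of_int b * L u + of_int k * c" "of_int b' * L u = - of_int k' * c"
    using lin u'(2) by (simp_all add: linear_diff linear_scale algebra_simps)
  have "L n * of_int b' = of_int b * (of_int b' * L u) + of_int k * of_int b' * c"
    unfolding k(1) by (simp add: algebra_simps)
  also have "\<dots> = of_int (k * b' - b * k') * c" unfolding k(2) by (simp add: algebra_simps)
  finally have "L n * g u' = of_int (k * b' - b * k') * (c * g u)"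
    unfolding b(2) by (simp add: mult.assoc[symmetric])
  then show ?thesis by blast
qed

text \<open>Two positive numbers that are integral multiples of each other agree. The second
  divisibility is \<open>lattice_index_dvd\<close> with the roles of \<open>L\<close> and
  \<open>g\<close> exchanged.\<close>

lemma lattice_index_eq:
  fixes G :: "'a::real_vector set" and L g :: "'a \<Rightarrow> real"
  assumes G: "add_subgroup G" and lin: "linear L" "linear g"
    and n: "n \<in> G" "L n > 0" "\<And>v. v \<in> G \<Longrightarrow> \<exists>k::int. L v = of_int k * L n"
    and u: "u \<in> G" "g u > 0" "\<And>v. v \<in> G \<Longrightarrow> \<exists>k::int. g v = of_int k * g u"
    and u': "u' \<in> G" "L u' = 0" "g u' > 0"
      "\<And>v. v \<in> G \<Longrightarrow> L v = 0 \<Longrightarrow> \<exists>k::int. g v = of_int k * g u'"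
    and c: "c \<in> G" "g c = 0" "L c > 0"
      "\<And>v. v \<in> G \<Longrightarrow> g v = 0 \<Longrightarrow> \<exists>k::int. L v = of_int k * L c"
  shows "L n * g u' = L c * g u"
proof -
  obtain k :: int where k: "L n * g u' = of_int k * (L c * g u)"
    using lattice_index_dvd[OF G lin n(1) u(1,3) u'(1,2) c(4)] by blast
  obtain k' :: int where k': "g u * L c = of_int k' * (g u' * L n)"
    using lattice_index_dvd[OF G lin(2,1) u(1) n(1,3) c(1,2) u'(4)] by blast
  have pos: "L c * g u > 0" "L n * g u' > 0" using n(2) u(2) u'(3) c(3) by simp_all
  have "real_of_int k > 0" using k pos by (metis zero_less_mult_pos2)
  moreover have "real_of_int k' > 0" using k' pos by (metis zero_less_mult_pos2 mult.commute)
  ultimately have "k \<ge> 1" "k' \<ge> 1" by linarith+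
  then have "real_of_int k \<ge> 1" "real_of_int k' \<ge> 1" by linarith+
  then have "1 * (L c * g u) \<le> real_of_int k * (L c * g u)"
      "1 * (L n * g u') \<le> real_of_int k' * (L n * g u')"
    using pos by (intro mult_right_mono; simp)+
  then have "L n * g u' \<ge> L c * g u" "g u * L c \<ge> g u' * L n"
    unfolding k[symmetric] k'[symmetric] mult.commute[of "g u'"] using k' by (simp_all add: mult.commute)
  then show ?thesis by (simp add: mult.commute)
qed

section \<open>Intersecting a balanced fan with generic hyperplanes\<close>

lemma linear_functional_inner:
  fixes g :: "'a::euclidean_space \<Rightarrow> real"
  assumes "linear g" obtains a where "\<And>y. g y = a \<bullet> y"
proof
  show "g y = adjoint g 1 \<bullet> y" for y
    using adjoint_works[OF assms, of y 1] by (simp add: inner_commute)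
qed

lemma face_of_functional_ge:
  fixes g :: "'a::euclidean_space \<Rightarrow> real"
  assumes "convex s" "linear g" "\<And>y. y \<in> s \<Longrightarrow> b \<le> g y"
  shows "s \<inter> {y. g y = b} face_of s"
proof -
  obtain a where a: "\<And>y. g y = a \<bullet> y" using linear_functional_inner[OF assms(2)] by blast
  show ?thesis using face_of_Int_supporting_hyperplane_ge[OF assms(1), where a=a and b=b] assms(3) a by simp
qed

section \<open>Cutting polyhedral complexes along a hyperplane\<close>

definition side :: "('a \<Rightarrow> real) \<Rightarrow> real \<Rightarrow> 'a set" where
  "side f \<epsilon> = {y. \<epsilon> * f y \<ge> 0}"

lemma
  fixes g :: "'a::euclidean_space \<Rightarrow> real"
  assumes "linear g"
  shows convex_side: "convex (side (\<lambda>y. g y - b) \<epsilon>)"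
    and interior_side: "\<epsilon> * (g y - b) > 0 \<Longrightarrow> y \<in> interior (side (\<lambda>y. g y - b) \<epsilon>)"
    and convex_level: "convex {y. g y = b}"
proof -
  obtain a where a: "\<And>y. g y = a \<bullet> y" using linear_functional_inner[OF assms] by blast
  have "side (\<lambda>y. g y - b) \<epsilon> = {y. inner (\<epsilon> *\<^sub>R a) y \<ge> \<epsilon> * b}"
    by (auto simp: side_def a algebra_simps)
  then show "convex (side (\<lambda>y. g y - b) \<epsilon>)"
    by (simp only: convex_halfspace_ge)
  show "convex {y. g y = b}" using convex_hyperplane[of a b] by (simp add: a)
  have "open {y. (\<epsilon> *\<^sub>R a) \<bullet> y > \<epsilon> * b}" by (rule open_halfspace_gt)
  moreover have "{y. (\<epsilon> *\<^sub>R a) \<bullet> y > \<epsilon> * b} \<subseteq> side (\<lambda>y. g y - b) \<epsilon>"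
    by (auto simp: side_def a algebra_simps)
  moreover assume "\<epsilon> * (g y - b) > 0"
  then have "y \<in> {y. (\<epsilon> *\<^sub>R a) \<bullet> y > \<epsilon> * b}" by (simp add: a algebra_simps)
  ultimately show "y \<in> interior (side (\<lambda>y. g y - b) \<epsilon>)" by (meson interior_maximal subsetD)
qed

lemma cut_cellE:
  assumes "c \<in> cells (cut f X)"
  obtains q h where "q \<in> cells X" "c = q \<inter> h" "h = side f 1 \<or> h = side f (-1) \<or> h = {y. f y = 0}" "c \<noteq> {}"
proof -
  have "{x. f x \<ge> 0} = side f 1" "{x. f x \<le> 0} = side f (-1)" by (auto simp: side_def)
  then have "\<exists>q\<in>cells X. c \<in> {q \<inter> side f 1, q \<inter> side f (-1), q \<inter> {y. f y = 0}}" "c \<noteq> {}"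
    using assms unfolding cut_def by simp_all
  then show ?thesis using that by (elim bexE insertE) blast+
qed

lemma cut_cellI:
  assumes "q \<in> cells X" "q \<inter> h \<noteq> {}" "h = side f 1 \<or> h = side f (-1) \<or> h = {y. f y = 0}"
  shows "q \<inter> h \<in> cells (cut f X)"
proof -
  have "{x. f x \<ge> 0} = side f 1" "{x. f x \<le> 0} = side f (-1)" by (auto simp: side_def)
  then show ?thesis using assms unfolding cut_def by auto
qed

text \<open>The face condition makes a cell of full dimension recoverable from any of its
  full-dimensional subsets, so that the \<open>THE\<close> in \<open>cut\<close> finds the intended
  weight.\<close>

definition polyhedral :: "'a::euclidean_space wcomplex \<Rightarrow> bool" where
  "polyhedral X \<longleftrightarrow> finite (cells X) \<and>
     (\<forall>c\<in>cells X. convex c \<and> c \<noteq> {} \<and> aff_dim c \<le> wdim X) \<and>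
     (\<forall>c\<in>cells X. \<forall>c'\<in>cells X. c \<inter> c' face_of c)"

text \<open>The two half-spaces and the hyperplane meet in common faces themselves, and faces can be
  intersected: \<open>q \<inter> q'\<close> is a face of \<open>q\<close> and
  \<open>h \<inter> h'\<close> is a face of \<open>h\<close>.\<close>

lemma polyhedral_cut:
  assumes X: "polyhedral X" and g: "linear g"
  shows "polyhedral (cut (\<lambda>y. g y - b) X)"
  unfolding polyhedral_def
proof (intro conjI ballI)
  let ?f = "\<lambda>y. g y - b"
  show "finite (cells (cut ?f X))" using X by (simp add: cut_def polyhedral_def)
  have cvh: "convex h" if "h = side ?f 1 \<or> h = side ?f (-1) \<or> h = {y. ?f y = 0}" for h
    using that convex_side[OF g] convex_level[OF g, of b] by auto
  fix c assume c: "c \<in> cells (cut ?f X)"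
  obtain q h where q: "q \<in> cells X" "c = q \<inter> h" "c \<noteq> {}"
    "h = side ?f 1 \<or> h = side ?f (-1) \<or> h = {y. ?f y = 0}" using cut_cellE[OF c] by metis
  then show "convex c" "c \<noteq> {}" using X cvh by (auto simp: polyhedral_def convex_Int)
  have "aff_dim c \<le> aff_dim q" using q(2) by (simp add: aff_dim_subset)
  then show "aff_dim c \<le> wdim (cut ?f X)" using q(1) X by (force simp: polyhedral_def cut_def)
  fix c' assume c': "c' \<in> cells (cut ?f X)"
  obtain q' h' where q': "q' \<in> cells X" "c' = q' \<inter> h'"
    "h' = side ?f 1 \<or> h' = side ?f (-1) \<or> h' = {y. ?f y = 0}" using cut_cellE[OF c'] by metis
  have zero: "{y. ?f y = 0} face_of side ?f \<epsilon>" if \<epsilon>: "\<epsilon> = 1 \<or> \<epsilon> = -1" for \<epsilon>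
  proof -
    have "side ?f \<epsilon> \<inter> {y. \<epsilon> *\<^sub>R g y = \<epsilon> * b} face_of side ?f \<epsilon>"
      by (rule face_of_functional_ge[OF convex_side[OF g]])
        (use linear_compose_scale_right[OF g, of \<epsilon>] in \<open>auto simp: side_def algebra_simps\<close>)
    moreover have "side ?f \<epsilon> \<inter> {y. \<epsilon> *\<^sub>R g y = \<epsilon> * b} = {y. ?f y = 0}"
      using \<epsilon> by (auto simp: side_def)
    ultimately show ?thesis by simp
  qed
  have "h \<inter> h' face_of h"
  proof -
    have "side ?f 1 \<inter> side ?f (-1) = {y. ?f y = 0}" "side ?f (-1) \<inter> side ?f 1 = {y. ?f y = 0}"
      "side ?f 1 \<inter> {y. ?f y = 0} = {y. ?f y = 0}" "side ?f (-1) \<inter> {y. ?f y = 0} = {y. ?f y = 0}"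
      "{y. ?f y = 0} \<inter> side ?f 1 = {y. ?f y = 0}" "{y. ?f y = 0} \<inter> side ?f (-1) = {y. ?f y = 0}"
      by (auto simp: side_def)
    then show ?thesis using q(4) q'(3) zero[of 1] zero[of "-1"] cvh
      by (elim disjE) (simp_all add: face_of_refl)
  qed
  moreover have "q \<inter> q' face_of q" using X q(1) q'(1) by (simp add: polyhedral_def)
  ultimately have "(q \<inter> q') \<inter> (h \<inter> h') face_of q \<inter> h" by (rule face_of_Int_Int[rotated])
  then show "c \<inter> c' face_of c" using q(2) q'(2) by (simp add: Int_ac)
qed

lemma polyhedral_weil_divisor: "polyhedral X \<Longrightarrow> polyhedral (weil_divisor \<Lambda> \<phi> X)"
  by (auto simp: polyhedral_def weil_divisor_def)

lemma polyhedral_top_unique: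
  assumes X: "polyhedral X" and c: "c \<in> cells X" "c' \<in> cells X"
    and \<sigma>: "\<sigma> \<subseteq> c" "\<sigma> \<subseteq> c'" "aff_dim c' \<le> aff_dim \<sigma>" "aff_dim c \<le> aff_dim \<sigma>"
  shows "c = c'"
proof -
  have "c \<inter> c' face_of c" "c' \<inter> c face_of c'" "convex c" "convex c'" using X c by (auto simp: polyhedral_def)
  moreover have "aff_dim \<sigma> \<le> aff_dim (c \<inter> c')" using \<sigma> by (intro aff_dim_subset) auto
  ultimately have "c \<inter> c' = c" "c' \<inter> c = c'"
    using face_of_aff_dim_lt[of c "c \<inter> c'"] face_of_aff_dim_lt[of c' "c' \<inter> c"] \<sigma>(3,4)
    by (auto simp: Int_commute)
  then show ?thesis by blast
qed

lemma polyhedral_cut_wt: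
  assumes X: "polyhedral X" and q: "q \<in> cells X" "\<sigma> \<subseteq> q" and dim: "aff_dim \<sigma> = wdim X"
  shows "wt (cut f X) \<sigma> = wt X q"
proof -
  have "(THE q. q \<in> cells X \<and> aff_dim q = wdim X \<and> \<sigma> \<subseteq> q) = q"
  proof (rule the_equality)
    have "aff_dim q = wdim X" using aff_dim_subset[OF q(2)] X q(1) dim by (force simp: polyhedral_def)
    then show "q \<in> cells X \<and> aff_dim q = wdim X \<and> \<sigma> \<subseteq> q" using q by blast
    then show "q' = q" if "q' \<in> cells X \<and> aff_dim q' = wdim X \<and> \<sigma> \<subseteq> q'" for q'
      using polyhedral_top_unique[OF X, of q' q \<sigma>] that dim by auto
  qed
  then show ?thesis by (simp add: cut_def)
qed

text \<open>A cell inside the hyperplane lies on both sides, so both values are available for it.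
  The choice \<epsilon> = -1 then gives zero at once.\<close>

lemma lin_part_side:
  assumes g: "linear g" and \<epsilon>: "\<epsilon> = 1 \<or> \<epsilon> = -1" and c: "c \<subseteq> side (\<lambda>y. g y - b) \<epsilon>"
  shows "linear (lin_part (\<lambda>y. max (g y - b) 0) c)"
    and "v \<in> direction_space c \<Longrightarrow>
      lin_part (\<lambda>y. max (g y - b) 0) c v = (if \<epsilon> = 1 then g v else 0)"
proof -
  let ?A = "\<lambda>v. if \<epsilon> = 1 then g v else 0"
  have A: "linear ?A" using g by (cases "\<epsilon> = 1") (simp_all add: linear_zero)
  have eq: "max (g y - b) 0 = ?A y + (if \<epsilon> = 1 then - b else 0)" if "y \<in> c" for y
    using c \<epsilon> that by (auto simp: side_def max_def)
  show "linear (lin_part (\<lambda>y. max (g y - b) 0) c)" by (rule linear_lin_part[OF A eq])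
  show "lin_part (\<lambda>y. max (g y - b) 0) c v = ?A v" if "v \<in> direction_space c"
    by (rule lin_part_eq[OF A eq that])
qed

lemma interior_move:
  fixes y v :: "'a::euclidean_space"
  assumes "y \<in> interior B"
  obtains e where "e > 0" "\<And>t. \<bar>t\<bar> \<le> e \<Longrightarrow> y + t *\<^sub>R v \<in> interior B"
proof -
  have y: "y \<in> rel_interior (interior B)" using assms by (simp add: rel_interior_open)
  have "direction_space (interior B) = UNIV"
  proof (rule direction_space_eqI[OF assms])
    fix w :: 'a
    obtain r where r: "r > 0" "ball y r \<subseteq> interior B" using assms open_contains_ball_eq by blast
    have "r / (2 * (norm w + 1)) * norm w < r"
      using r(1) norm_ge_zero[of w] by (simp add: divide_simps) (smt (verit) mult_nonneg_nonneg norm_ge_zero)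
    then have "y + (r / (2 * (norm w + 1))) *\<^sub>R w \<in> ball y r" using r(1)
      by (simp add: dist_norm)
    moreover have "r / (2 * (norm w + 1)) > 0" using r(1) by (simp add: add_nonneg_pos)
    ultimately show "\<exists>e>0. y + e *\<^sub>R w \<in> interior B" using r(2) by blast
  qed auto
  then show ?thesis using rel_interior_move[OF y, of v] that by blast
qed

text \<open>The setting for the evaluation conditions, stripped of trees. The assumption
  \<open>generic\<close> is transversality step by step: at a point of \<open>s\<close> satisfying
  the conditions up to \<open>j\<close>, the functional \<open>L j\<close> still varies in the
  directions of \<open>s\<close> that preserve the earlier conditions. Facets come with an integral
  functional so that lattice normals of different slices can be compared.\<close>

locale generic_intersection =
  fixes \<Lambda> :: "'a::euclidean_space set" and F :: "'a set set" and Z :: "'a wcomplex"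
    and d N :: nat and L :: "nat \<Rightarrow> 'a \<Rightarrow> real" and x :: "nat \<Rightarrow> real"
  assumes lattice: "add_subgroup \<Lambda>"
    and L_linear: "\<And>k. linear (L k)"
    and L_int: "\<And>k v. v \<in> \<Lambda> \<Longrightarrow> L k v \<in> \<int>"
    and F_finite: "finite F"
    and F_ne: "\<And>s. s \<in> F \<Longrightarrow> s \<noteq> {}"
    and F_convex: "\<And>s. s \<in> F \<Longrightarrow> convex s"
    and F_Int: "\<And>s t. s \<in> F \<Longrightarrow> t \<in> F \<Longrightarrow> s \<inter> t face_of s"
    and F_support: "\<And>s y. s \<in> F \<Longrightarrow> y \<in> s \<Longrightarrow> \<exists>t\<in>F. t face_of s \<and> y \<in> rel_interior t"
    and F_rational: "\<And>s. s \<in> F \<Longrightarrow> direction_space s \<subseteq> span (\<Lambda> \<inter> direction_space s)"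
    and F_facet: "\<And>s t. s \<in> F \<Longrightarrow> t \<in> F \<Longrightarrow> t face_of s \<Longrightarrow> aff_dim s = aff_dim t + 1 \<Longrightarrow>
      \<exists>g :: 'a \<Rightarrow> real. linear g \<and> (\<forall>v\<in>\<Lambda>. g v \<in> \<int>) \<and> (\<forall>y\<in>s. g y \<ge> 0) \<and> (\<forall>y\<in>t. g y = 0) \<and>
        direction_space t = {v \<in> direction_space s. g v = 0}"
    and Z_dim: "wdim Z = int d"
    and Z_cells: "cells Z = {s \<in> F. aff_dim s \<le> int d}"
    and Z_balanced: "\<And>t. t \<in> F \<Longrightarrow> aff_dim t = int d - 1 \<Longrightarrow>
      (\<Sum>s | s \<in> F \<and> aff_dim s = int d \<and> t face_of s. wt Z s *\<^sub>R normal_vec \<Lambda> s t) \<in> direction_space t"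
    and generic: "\<And>s y j. s \<in> F \<Longrightarrow> y \<in> s \<Longrightarrow> j < N \<Longrightarrow> (\<And>k. k \<le> j \<Longrightarrow> L k y = x k) \<Longrightarrow>
      \<exists>v\<in>direction_space s. (\<forall>k<j. L k v = 0) \<and> L j v \<noteq> 0"
begin

abbreviation f :: "nat \<Rightarrow> 'a \<Rightarrow> real" where "f j \<equiv> (\<lambda>y. L j y - x j)"

primrec X :: "nat \<Rightarrow> 'a wcomplex" where
  "X 0 = Z"
| "X (Suc j) = cartier_intersect \<Lambda> (f j) (X j)"

text \<open>\<open>K j\<close> is the linear space parallel to \<open>H j\<close>. The cells of
  \<open>X j\<close> that matter are slices \<open>s \<inter> H j\<close>, with direction space
  \<open>direction_space s \<inter> K j\<close>.\<close>

definition H :: "nat \<Rightarrow> 'a set" where "H j = {y. \<forall>k<j. L k y = x k}"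
definition K :: "nat \<Rightarrow> 'a set" where "K j = {v. \<forall>k<j. L k v = 0}"
definition Top :: "'a set set" where "Top = {s \<in> F. aff_dim s = int d \<and> wt Z s \<noteq> 0}"

lemma H_Suc: "H (Suc j) = H j \<inter> {y. f j y = 0}" by (auto simp: H_def less_Suc_eq)
lemma K_Suc: "D \<inter> K (Suc j) = {v \<in> D \<inter> K j. L j v = 0}" by (auto simp: K_def less_Suc_eq)

lemma subspace_K: "subspace (K j)"
  by (auto simp: subspace_def K_def linear_0 linear_add linear_scale L_linear)

lemma subspace_dir_K: "subspace (direction_space s \<inter> K j)"
  using subspace_K subspace_direction_space by (rule subspace_inter[rotated])

lemma affine_H: "affine (H j)"
  unfolding affine_def H_def
  by (auto simp: linear_add linear_scale L_linear simp flip: distrib_right)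

lemma convex_H: "convex (H j)" using affine_H by (rule affine_imp_convex)

lemma H_move: "y \<in> H j \<Longrightarrow> v \<in> K j \<Longrightarrow> y + t *\<^sub>R v \<in> H j"
  by (simp add: H_def K_def linear_add linear_scale L_linear)

lemma H_diff: "y \<in> H j \<Longrightarrow> z \<in> H j \<Longrightarrow> z - y \<in> K j"
  by (simp add: H_def K_def linear_diff L_linear)

text \<open>\<open>B\<close> stands for the whole space or a closed half-space of
  \<open>cut\<close>. Since \<open>y\<close> is interior to it, it does not restrict
  directions.\<close>

lemma direction_space_H:
  assumes y: "y \<in> rel_interior s" "y \<in> H j" "y \<in> interior B"
  shows "direction_space (s \<inter> H j \<inter> B) = direction_space s \<inter> K j"
proof (rule direction_space_eqI[of y])
  have ys: "y \<in> s" using y(1) rel_interior_subset by blast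
  then show "y \<in> s \<inter> H j \<inter> B" using y interior_subset by blast
  show "subspace (direction_space s \<inter> K j)" by (rule subspace_dir_K)
  show "z - y \<in> direction_space s \<inter> K j" if "z \<in> s \<inter> H j \<inter> B" for z
    using that ys y(2) H_diff diff_mem_direction_space[of z s y] by blast
  fix v assume v: "v \<in> direction_space s \<inter> K j"
  obtain e1 where e1: "e1 > 0" "\<And>t. \<bar>t\<bar> \<le> e1 \<Longrightarrow> y + t *\<^sub>R v \<in> s"
    using rel_interior_move[OF y(1)] v by blast
  obtain e2 where e2: "e2 > 0" "\<And>t. \<bar>t\<bar> \<le> e2 \<Longrightarrow> y + t *\<^sub>R v \<in> interior B"
    using interior_move[OF y(3)] by blast
  have "y + min e1 e2 *\<^sub>R v \<in> s \<inter> H j \<inter> B"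
    using e1 e2(1) e2(2)[of "min e1 e2"] v H_move[OF y(2)] interior_subset[of B] by auto
  then show "\<exists>e>0. y + e *\<^sub>R v \<in> s \<inter> H j \<inter> B" using e1(1) e2(1) by (intro exI[of _ "min e1 e2"]) auto
qed

lemma rel_interior_H:
  assumes s: "convex s" and B: "convex B" and y: "y \<in> rel_interior s" "y \<in> H j" "y \<in> interior B"
  shows "y \<in> rel_interior (s \<inter> H j \<inter> B)"
proof -
  have "rel_interior (s \<inter> H j) = rel_interior s \<inter> H j"
    using convex_affine_rel_interior_Int[OF s affine_H] y by blast
  moreover have "y \<in> rel_interior B" using y(3) interior_subset_rel_interior by blast
  ultimately show ?thesis
    using convex_rel_interior_inter_two[of "s \<inter> H j" B] s B convex_H y by (auto simp: convex_Int)
qed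

lemma generic_direction:
  assumes "s \<in> F" "y \<in> s" "y \<in> H (Suc j)" "j < N"
  obtains v where "v \<in> direction_space s \<inter> K j" "L j v \<noteq> 0"
  using generic[OF assms(1,2,4)] assms(3) that by (auto simp: H_def K_def less_Suc_eq_le)

text \<open>By \<open>generic\<close>, each condition that can be satisfied at a point of
  \<open>rel_interior s\<close> lowers the dimension by exactly one.\<close>

lemma aff_dim_H:
  assumes s: "s \<in> F" and y: "y \<in> rel_interior s" "y \<in> H j" "y \<in> interior B" and j: "j \<le> N"
  shows "aff_dim (s \<inter> H j \<inter> B) = aff_dim s - int j"
proof -
  have ys: "y \<in> s" using y(1) rel_interior_subset by blast
  have "int (dim (direction_space s \<inter> K j)) = aff_dim s - int j" using y(2) j
  proof (induction j)
    case 0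
    then show ?case using aff_dim_direction_space[OF F_ne[OF s]] by (simp add: K_def)
  next
    case (Suc j)
    then obtain v where "v \<in> direction_space s \<inter> K j" "L j v \<noteq> 0"
      using generic_direction[OF s ys] Suc_le_lessD by blast
    then have "dim (direction_space s \<inter> K j) = Suc (dim (direction_space s \<inter> K (Suc j)))"
      unfolding K_Suc by (intro dim_kernel_on subspace_dir_K L_linear)
    moreover have "y \<in> H j" using Suc.prems(1) by (simp add: H_Suc)
    ultimately show ?case using Suc by simp
  qed
  moreover have "s \<inter> H j \<inter> B \<noteq> {}" using ys y interior_subset by blast
  ultimately show ?thesis using aff_dim_direction_space direction_space_H[OF y] by metis
qed

text \<open>By \<open>generic\<close> the functionals are triangular on the directions of
  \<open>t\<close>: at stage \<open>j\<close> there is a vector annihilated by the earlier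
  functionals, and a multiple of it corrects the value of \<open>L j\<close> alone.\<close>

lemma solve_L:
  assumes t: "t \<in> F" "y \<in> t" "y \<in> H j" "j \<le> N"
  shows "\<exists>w\<in>direction_space t. \<forall>k<j. L k w = b k"
  using t(3,4)
proof (induction j)
  case 0 then show ?case using subspace_0[OF subspace_direction_space] by blast
next
  case (Suc j)
  obtain v where v: "v \<in> direction_space t \<inter> K j" "L j v \<noteq> 0"
    using generic_direction[OF t(1,2) Suc.prems(1)] Suc.prems(2) Suc_le_lessD by blast
  obtain w where w: "w \<in> direction_space t" "\<forall>k<j. L k w = b k"
    using Suc by (auto simp: H_Suc)
  let ?w = "w + ((b j - L j w) / L j v) *\<^sub>R v"
  have "?w \<in> direction_space t"
    using w(1) v(1) by (intro subspace_add subspace_scale subspace_direction_space) auto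
  moreover have "\<forall>k<Suc j. L k ?w = b k"
    using w(2) v by (auto simp: less_Suc_eq linear_add linear_scale L_linear K_def)
  ultimately show ?case by blast
qed

lemma F_minimal:
  assumes "t \<in> F" "s \<in> F" "y \<in> rel_interior t" "y \<in> s" shows "t face_of s"
proof -
  have "y \<in> t" using assms(3) rel_interior_subset by blast
  then have "t \<subseteq> t \<inter> s" using subset_of_face_of[OF F_Int[OF assms(1,2)], of t] assms by blast
  then have "s \<inter> t = t" by blast
  then show ?thesis using F_Int[OF assms(2,1)] by simp
qed

lemma F_face_eq:
  assumes "t \<in> F" "s \<in> F" "t face_of s" "aff_dim s \<le> aff_dim t" shows "t = s"
  using face_of_aff_dim_lt[OF F_convex[OF assms(2)] assms(3)] assms(4) by linarith

text \<open>Moving from \<open>y\<close> towards a relative interior point of \<open>s\<close>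
  violates the conditions by multiples of \<open>L k u\<close>. \<open>solve_L\<close> supplies a
  direction \<open>w\<close> of \<open>t\<close> that compensates for this, and \<open>y\<close> can
  be moved along \<open>w\<close> within \<open>t\<close>.\<close>

lemma relint_up:
  assumes ts: "t \<in> F" "s \<in> F" "t face_of s" and y: "y \<in> rel_interior t" "y \<in> H j" "y \<in> interior B"
    and j: "j \<le> N"
  obtains z where "z \<in> rel_interior s" "z \<in> H j" "z \<in> interior B"
proof -
  have yt: "y \<in> t" using y(1) rel_interior_subset by blast
  then have ys: "y \<in> s" using face_of_imp_subset[OF ts(3)] by blast
  obtain z0 where z0: "z0 \<in> rel_interior s" using rel_interior_eq_empty[OF F_convex[OF ts(2)]] F_ne[OF ts(2)] by blast
  define u where "u = z0 - y"
  obtain w where w: "w \<in> direction_space t" "\<forall>k<j. L k w = - L k u"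
    using solve_L[OF ts(1) yt y(2) j, of "\<lambda>k. - L k u"] by blast
  then have uw: "u + w \<in> K j" by (simp add: K_def linear_add L_linear)
  obtain e1 where e1: "e1 > 0" "\<And>r. \<bar>r\<bar> \<le> e1 \<Longrightarrow> y + r *\<^sub>R w \<in> t"
    using rel_interior_move[OF y(1) w(1)] by blast
  obtain e2 where e2: "e2 > 0" "\<And>r. \<bar>r\<bar> \<le> e2 \<Longrightarrow> y + r *\<^sub>R (u + w) \<in> interior B"
    using interior_move[OF y(3)] by blast
  define e where "e = min e1 e2"
  \<comment> \<open>Chosen so that \<open>(1 - r) * e = r\<close>: the point at fraction
    \<open>r\<close> of the way from \<open>y + e *\<^sub>R w\<close> to \<open>z0\<close> is then
    \<open>y + r *\<^sub>R (u + w)\<close>, which stays in \<open>H j\<close>.\<close>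
  define r where "r = e / (1 + e)"
  have e: "e > 0" using e1(1) e2(1) by (simp add: e_def)
  have r: "r > 0" "r \<le> 1" "r \<le> e" using e by (auto simp: r_def divide_simps algebra_simps)
  have re: "(1 - r) * e = r" using e by (simp add: r_def divide_simps algebra_simps)
  have "y + e *\<^sub>R w \<in> s" using e1(2)[of e] e face_of_imp_subset[OF ts(3)] by (auto simp: e_def)
  then have "(y + e *\<^sub>R w) - r *\<^sub>R ((y + e *\<^sub>R w) - z0) \<in> rel_interior s"
    using rel_interior_convex_shrink[OF F_convex[OF ts(2)] z0] r by blast
  moreover have "(y + e *\<^sub>R w) - r *\<^sub>R ((y + e *\<^sub>R w) - z0) = y + ((1 - r) * e) *\<^sub>R w + r *\<^sub>R u"
    by (simp add: u_def algebra_simps)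
  ultimately have "y + r *\<^sub>R (u + w) \<in> rel_interior s" unfolding re by (simp add: algebra_simps)
  moreover have "y + r *\<^sub>R (u + w) \<in> H j" by (rule H_move[OF y(2) uw])
  moreover have "y + r *\<^sub>R (u + w) \<in> interior B" using e2(2)[of r] r by (simp add: e_def)
  ultimately show ?thesis using that by blast
qed

lemma rational_K:
  assumes "s \<in> F" shows "direction_space s \<inter> K j \<subseteq> span (\<Lambda> \<inter> (direction_space s \<inter> K j))"
proof (induction j)
  case 0 then show ?case using F_rational[OF assms] by (simp add: K_def)
next
  case (Suc j)
  then show ?case unfolding K_Suc
    by (intro lattice_spans_kernel lattice L_linear L_int subspace_dir_K)
qed

definition is_facet_fun :: "'a set \<Rightarrow> 'a set \<Rightarrow> ('a \<Rightarrow> real) \<Rightarrow> bool" where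
  "is_facet_fun s t g \<longleftrightarrow> linear g \<and> (\<forall>v\<in>\<Lambda>. g v \<in> \<int>) \<and> (\<forall>y\<in>s. g y \<ge> 0) \<and> (\<forall>y\<in>t. g y = 0) \<and>
     direction_space t = {v \<in> direction_space s. g v = 0}"

definition facet_fun :: "'a set \<Rightarrow> 'a set \<Rightarrow> 'a \<Rightarrow> real" where
  "facet_fun s t = (SOME g. is_facet_fun s t g)"

lemma facet_fun:
  assumes "s \<in> F" "t \<in> F" "t face_of s" "aff_dim s = aff_dim t + 1"
  shows "linear (facet_fun s t)" "\<And>v. v \<in> \<Lambda> \<Longrightarrow> facet_fun s t v \<in> \<int>"
    "\<And>y. y \<in> s \<Longrightarrow> facet_fun s t y \<ge> 0" "\<And>y. y \<in> t \<Longrightarrow> facet_fun s t y = 0"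
    "direction_space t = {v \<in> direction_space s. facet_fun s t v = 0}"
proof -
  have "\<exists>g. is_facet_fun s t g" using F_facet[OF assms] unfolding is_facet_fun_def .
  then have "is_facet_fun s t (facet_fun s t)" unfolding facet_fun_def by (rule someI_ex)
  then show "linear (facet_fun s t)" "\<And>v. v \<in> \<Lambda> \<Longrightarrow> facet_fun s t v \<in> \<int>"
    "\<And>y. y \<in> s \<Longrightarrow> facet_fun s t y \<ge> 0" "\<And>y. y \<in> t \<Longrightarrow> facet_fun s t y = 0"
    "direction_space t = {v \<in> direction_space s. facet_fun s t v = 0}"
    unfolding is_facet_fun_def by blast+
qed

text \<open>A nonnegative functional with a zero in the relative interior vanishes in all directions
  of \<open>s\<close>, and then \<open>s\<close> and \<open>t\<close> would have the same direction
  space.\<close>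

lemma facet_fun_pos:
  assumes ts: "s \<in> F" "t \<in> F" "t face_of s" "aff_dim s = aff_dim t + 1" and z: "z \<in> rel_interior s"
  shows "facet_fun s t z > 0"
proof (rule ccontr)
  note g = facet_fun[OF ts]
  have zs: "z \<in> s" using z rel_interior_subset by blast
  assume "\<not> ?thesis"
  then have gz: "facet_fun s t z = 0" using g(3)[OF zs] by simp
  have "direction_space s \<noteq> direction_space t"
    using aff_dim_direction_space[OF F_ne[OF ts(1)]] aff_dim_direction_space[OF F_ne[OF ts(2)]] ts(4) by auto
  then obtain v where v: "v \<in> direction_space s" "facet_fun s t v \<noteq> 0" using g(5) by blast
  obtain e where e: "e > 0" "\<And>r. \<bar>r\<bar> \<le> e \<Longrightarrow> z + r *\<^sub>R v \<in> s" using rel_interior_move[OF z v(1)] by blast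
  have "e * facet_fun s t v \<ge> 0" "- e * facet_fun s t v \<ge> 0"
    using g(3)[OF e(2)[of e]] g(3)[OF e(2)[of "-e"]] e(1) gz g(1) by (simp_all add: linear_add linear_diff linear_scale)
  then show False using e(1) v(2) by (simp add: zero_le_mult_iff mult_le_0_iff)
qed

text \<open>\<open>facet_fun s t\<close> depends neither on \<open>j\<close> nor on
  \<open>B\<close>, so it measures the normal vectors of all slices and truncations of the pair on
  one scale.\<close>

lemma facet_normal:
  assumes ts: "s \<in> F" "t \<in> F" "t face_of s" "aff_dim s = aff_dim t + 1"
    and y: "y \<in> rel_interior t" "y \<in> H j" "y \<in> interior B" and j: "j \<le> N"
  defines "n \<equiv> normal_vec \<Lambda> (s \<inter> H j \<inter> B) (t \<inter> H j \<inter> B)"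
  shows "n \<in> \<Lambda>" "n \<in> direction_space s \<inter> K j" "facet_fun s t n > 0"
    "\<And>v. v \<in> \<Lambda> \<Longrightarrow> v \<in> direction_space s \<inter> K j \<Longrightarrow> \<exists>k::int. facet_fun s t v = of_int k * facet_fun s t n"
proof -
  let ?g = "facet_fun s t" and ?P = "s \<inter> H j \<inter> B" and ?Q = "t \<inter> H j \<inter> B"
  note g = facet_fun[OF ts]
  have yt: "y \<in> t" using y(1) rel_interior_subset by blast
  have t_s: "t \<subseteq> s" using face_of_imp_subset[OF ts(3)] .
  obtain z where z: "z \<in> rel_interior s" "z \<in> H j" "z \<in> interior B"
    using relint_up[OF ts(2,1,3) y j] by blast
  have zs: "z \<in> s" using z(1) rel_interior_subset by blast
  have P: "direction_space ?P = direction_space s \<inter> K j" by (rule direction_space_H[OF z])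
  have Q: "direction_space ?Q = direction_space t \<inter> K j" by (rule direction_space_H[OF y])
  have gz: "?g z > 0" by (rule facet_fun_pos[OF ts z(1)])
  have nz: "z - y \<in> direction_space ?P" "?g (z - y) \<noteq> 0"
    using P zs yt t_s H_diff[OF y(2) z(2)] diff_mem_direction_space[of z s y] gz g(1) g(4)[OF yt]
    by (auto simp: linear_diff)
  have inward: "\<exists>a\<in>?Q. \<exists>r>0. a + r *\<^sub>R u \<in> ?P" if u: "u \<in> direction_space ?P" "?g u > 0" for u
  proof -
    define l where "l = ?g u / ?g z"
    have l: "l > 0" using u(2) gz by (simp add: l_def)
    \<comment> \<open>The facet functional takes the same value on \<open>u\<close> and on the
      subtracted multiple of \<open>z - y\<close>, so a direction of \<open>t\<close>
      remains.\<close>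
    define w where "w = u - l *\<^sub>R (z - y)"
    have "w \<in> direction_space ?P"
      unfolding w_def
      by (rule subspace_diff[OF subspace_direction_space u(1) subspace_scale[OF subspace_direction_space nz(1)]])
    moreover have "?g w = 0" using g(1) g(4)[OF yt] gz by (simp add: w_def l_def linear_diff linear_scale)
    ultimately have w: "w \<in> direction_space t" using P g(5) by blast
    obtain e1 where e1: "e1 > 0" "\<And>r. \<bar>r\<bar> \<le> e1 \<Longrightarrow> y + r *\<^sub>R w \<in> t"
      using rel_interior_move[OF y(1) w] by blast
    obtain e2 where e2: "e2 > 0" "\<And>r. \<bar>r\<bar> \<le> e2 \<Longrightarrow> y + r *\<^sub>R u \<in> interior B"
      using interior_move[OF y(3)] by blast
    define e where "e = min e1 e2"
    have e: "e > 0" using e1(1) e2(1) by (simp add: e_def)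
    \<comment> \<open>Chosen so that \<open>(1 - r * l) * e = r\<close>: the convex combination of
      \<open>y + e *\<^sub>R w\<close> and \<open>z\<close> with weight \<open>r * l\<close> on
      \<open>z\<close> is then \<open>y + r *\<^sub>R u\<close>.\<close>
    define r where "r = e / (1 + e * l)"
    have el: "e * l > 0" using e l by simp
    have pos: "1 + e * l > 0" using el by linarith
    have r: "r > 0" using e pos by (simp add: r_def)
    have "e * 1 \<le> e * (1 + e * l)" using e el by (intro mult_left_mono) auto
    then have r': "r \<le> e" "r * l \<le> 1" using pos by (auto simp: r_def divide_le_eq)
    note r = r r'
    have re: "(1 - r * l) * e = r" using el by (simp add: r_def divide_simps algebra_simps)
    have "y + e *\<^sub>R w \<in> s" using e1(2)[of e] e t_s by (auto simp: e_def)
    then have "(1 - r * l) *\<^sub>R (y + e *\<^sub>R w) + (r * l) *\<^sub>R z \<in> s"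
      using zs r l by (intro convexD[OF F_convex[OF ts(1)]]) auto
    moreover have "(1 - r * l) *\<^sub>R (y + e *\<^sub>R w) + (r * l) *\<^sub>R z
        = y + ((1 - r * l) * e) *\<^sub>R w + (r * l) *\<^sub>R (z - y)" by (simp add: algebra_simps)
    ultimately have "y + r *\<^sub>R u \<in> s" unfolding re by (simp add: w_def algebra_simps)
    moreover have "y + r *\<^sub>R u \<in> H j" using H_move[OF y(2)] u(1) P by blast
    moreover have "y + r *\<^sub>R u \<in> B" using e2(2)[of r] r interior_subset by (auto simp: e_def)
    moreover have "y \<in> ?Q" using yt y(2,3) interior_subset by blast
    ultimately show ?thesis using r(1) by blast
  qed
  have span: "direction_space ?P \<subseteq> span (\<Lambda> \<inter> direction_space ?P)" unfolding P by (rule rational_K[OF ts(1)])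
  have QP: "direction_space ?Q = {v \<in> direction_space ?P. ?g v = 0}" using P Q g(5) by blast
  have side: "?g a \<le> ?g b" if "a \<in> ?Q" "b \<in> ?P" for a b using that g(3,4) by auto
  note np = normal_vec_props[OF lattice g(1,2) span QP nz inward side]
  show "n \<in> \<Lambda>" "n \<in> direction_space s \<inter> K j" "?g n > 0"
    using np(1-3) unfolding n_def P by auto
  show "\<exists>k::int. ?g v = of_int k * ?g n" if "v \<in> \<Lambda>" "v \<in> direction_space s \<inter> K j" for v
    using np(4)[of v] that unfolding n_def P by auto
qed

text \<open>Genericity provides a direction in which \<open>L j\<close> changes. Its sign is
  adjusted to \<epsilon>, and half of an admissible step stays in the relative interior.\<close>

lemma cut_point:
  assumes s: "s \<in> F" and y: "y \<in> rel_interior s" "y \<in> H (Suc j)" and j: "j < N" and \<epsilon>: "\<epsilon> = 1 \<or> \<epsilon> = -1"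
  obtains z where "z \<in> rel_interior s" "z \<in> H j" "z \<in> interior (side (f j) \<epsilon>)"
proof -
  have ys: "y \<in> s" using y(1) rel_interior_subset by blast
  obtain v0 where v0: "v0 \<in> direction_space s \<inter> K j" "L j v0 \<noteq> 0" using generic_direction[OF s ys y(2) j] .
  define v where "v = (\<epsilon> * sgn (L j v0)) *\<^sub>R v0"
  have v: "v \<in> direction_space s \<inter> K j" unfolding v_def using v0(1) subspace_dir_K subspace_scale by blast
  have "\<epsilon> * L j v = (\<epsilon> * \<epsilon>) * (sgn (L j v0) * L j v0)"
    by (simp add: v_def linear_scale L_linear)
  also have "\<dots> > 0" using \<epsilon> v0(2) by (auto simp: sgn_real_def)
  finally have pos: "\<epsilon> * L j v > 0" .
  obtain e where e: "e > 0" "\<And>r. \<bar>r\<bar> \<le> e \<Longrightarrow> y + r *\<^sub>R v \<in> s"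
    using rel_interior_move[OF y(1)] v by blast
  have "y + e *\<^sub>R v \<in> s" using e by simp
  then have "y + e *\<^sub>R v - (1/2) *\<^sub>R (y + e *\<^sub>R v - y) \<in> rel_interior s"
    using rel_interior_convex_shrink[OF F_convex[OF s] y(1), of "y + e *\<^sub>R v" "1/2"] by simp
  moreover have "y + e *\<^sub>R v - (1/2) *\<^sub>R (y + e *\<^sub>R v - y) = y + (e/2) *\<^sub>R v"
  proof -
    have "e *\<^sub>R v = (e/2) *\<^sub>R v + (e/2) *\<^sub>R v" by (simp flip: scaleR_left_distrib)
    then show ?thesis by (simp add: add.assoc)
  qed
  ultimately have "y + (e/2) *\<^sub>R v \<in> rel_interior s" by metis
  moreover have "y + (e/2) *\<^sub>R v \<in> H j" using H_move v y(2) by (simp add: H_Suc)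
  moreover have "y + (e/2) *\<^sub>R v \<in> interior (side (f j) \<epsilon>)"
  proof (rule interior_side[OF L_linear])
    have "L j y = x j" using y(2) by (simp add: H_Suc)
    then have "\<epsilon> * (L j (y + (e/2) *\<^sub>R v) - x j) = (e/2) * (\<epsilon> * L j v)"
      by (simp add: linear_add linear_scale L_linear)
    moreover have "(e/2) * (\<epsilon> * L j v) > 0" using pos e(1) by simp
    ultimately show "\<epsilon> * (L j (y + (e/2) *\<^sub>R v) - x j) > 0" by (simp only:)
  qed
  ultimately show ?thesis using that by blast
qed

text \<open>Here the facet is the slice by the hyperplane, and the functional defining it is
  \<epsilon> times \<open>L j\<close>. For \<epsilon> = 1, its value on the normal vector is the
  factor by which the weight grows in \<open>weight_on_hyperplane\<close>.\<close>

lemma cut_normal: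
  assumes s: "s \<in> F" and y: "y \<in> rel_interior s" "y \<in> H (Suc j)" and j: "j < N" and \<epsilon>: "\<epsilon> = 1 \<or> \<epsilon> = -1"
  defines "n \<equiv> normal_vec \<Lambda> (s \<inter> H j \<inter> side (f j) \<epsilon>) (s \<inter> H (Suc j))"
  shows "n \<in> \<Lambda>" "n \<in> direction_space s \<inter> K j" "\<epsilon> * L j n > 0"
    "\<And>v. v \<in> \<Lambda> \<Longrightarrow> v \<in> direction_space s \<inter> K j \<Longrightarrow> \<exists>k::int. L j v = of_int k * L j n"
proof -
  let ?g = "\<lambda>v. \<epsilon> * L j v" and ?P = "s \<inter> H j \<inter> side (f j) \<epsilon>" and ?Q = "s \<inter> H (Suc j)"
  have ys: "y \<in> s" using y(1) rel_interior_subset by blast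
  obtain z where z: "z \<in> rel_interior s" "z \<in> H j" "z \<in> interior (side (f j) \<epsilon>)"
    using cut_point[OF s y j \<epsilon>] .
  have P: "direction_space ?P = direction_space s \<inter> K j" by (rule direction_space_H[OF z])
  have Q: "direction_space ?Q = direction_space s \<inter> K (Suc j)"
    using direction_space_H[OF y, of UNIV] by simp
  have g: "linear ?g" using linear_compose_scale_right[OF L_linear, of \<epsilon>] by simp
  have gi: "?g v \<in> \<int>" if "v \<in> \<Lambda>" for v using L_int[OF that] \<epsilon> by auto
  have QP: "direction_space ?Q = {v \<in> direction_space ?P. ?g v = 0}" unfolding P Q K_Suc using \<epsilon> by auto
  have span: "direction_space ?P \<subseteq> span (\<Lambda> \<inter> direction_space ?P)" unfolding P by (rule rational_K[OF s])
  obtain v0 where v0: "v0 \<in> direction_space ?P" "?g v0 \<noteq> 0"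
    using generic_direction[OF s ys y(2) j] P \<epsilon> by (metis mult_eq_0_iff neg_equal_0_iff_equal zero_neq_one)
  have Ly: "L j y = x j" "y \<in> H j" using y(2) by (simp_all add: H_Suc)
  have inward: "\<exists>a\<in>?Q. \<exists>r>0. a + r *\<^sub>R u \<in> ?P" if u: "u \<in> direction_space ?P" "?g u > 0" for u
  proof -
    obtain e where e: "e > 0" "\<And>r. \<bar>r\<bar> \<le> e \<Longrightarrow> y + r *\<^sub>R u \<in> s"
      using rel_interior_move[OF y(1)] u P by blast
    have "\<epsilon> * f j (y + e *\<^sub>R u) = e * ?g u" using Ly by (simp add: linear_add linear_scale L_linear)
    then have "y + e *\<^sub>R u \<in> side (f j) \<epsilon>" unfolding side_def mem_Collect_eq using e(1) u(2)
      by (metis less_imp_le mult_pos_pos)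
    moreover have "y + e *\<^sub>R u \<in> H j" using H_move[OF Ly(2)] u(1) P by blast
    ultimately have "y + e *\<^sub>R u \<in> ?P" using e by simp
    then show ?thesis using ys y(2) e(1) by blast
  qed
  have side: "?g a \<le> ?g b" if "a \<in> ?Q" "b \<in> ?P" for a b
    using that by (auto simp: H_Suc side_def algebra_simps)
  note np = normal_vec_props[OF lattice g gi span QP v0 inward side]
  show "n \<in> \<Lambda>" "n \<in> direction_space s \<inter> K j" "\<epsilon> * L j n > 0"
    using np(1-3) unfolding n_def P by auto
  show "\<exists>k::int. L j v = of_int k * L j n" if "v \<in> \<Lambda>" "v \<in> direction_space s \<inter> K j" for v
    using np(4)[of v] that \<epsilon> unfolding n_def P by auto
qed

end

lemma int_multiple_antisym:
  fixes a b :: real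
  assumes "a > 0" "b > 0" "a = of_int k * b" "b = of_int k' * a"
  shows "a = b"
proof -
  have "real_of_int k > 0" using assms(1-3) by (metis zero_less_mult_pos2)
  moreover have "real_of_int k' > 0" using assms(1,2,4) by (metis zero_less_mult_pos2)
  ultimately have "k \<ge> 1" "k' \<ge> 1" by linarith+
  then have "real_of_int k \<ge> 1" "real_of_int k' \<ge> 1" by linarith+
  then have "1 * b \<le> real_of_int k * b" "1 * a \<le> real_of_int k' * a"
    using assms(1,2) by (intro mult_right_mono; simp)+
  then show ?thesis using assms(3,4) by linarith
qed

section \<open>Induction over the hyperplanes: support and balancing\<close>

context generic_intersection
begin

declare X.simps(2) [simp del]
lemmas X_Suc = X.simps(2)

lemma H_0: "H 0 = UNIV" by (simp add: H_def)
lemma K_0: "K 0 = UNIV" by (simp add: K_def)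

lemma H_Suc_side: "\<epsilon> = 1 \<or> \<epsilon> = -1 \<Longrightarrow> s \<inter> H (Suc j) = (s \<inter> H j \<inter> side (f j) \<epsilon>) \<inter> {y. f j y = 0}"
  by (auto simp: H_Suc side_def)

lemma wdim_X: "wdim (X j) = int d - int j"
  by (induction j) (auto simp: X_Suc Z_dim cartier_intersect_def weil_divisor_def cut_def)

lemma polyhedral_X: "polyhedral (X j)"
proof (induction j)
  case 0
  then show ?case using F_finite F_convex F_ne F_Int by (simp add: polyhedral_def Z_cells Z_dim)
next
  case (Suc j)
  then show ?case by (simp add: X_Suc cartier_intersect_def polyhedral_weil_divisor polyhedral_cut L_linear)
qed

lemma polyhedral_cut_X: "polyhedral (cut (f j) (X j))"
  using polyhedral_cut[OF polyhedral_X L_linear] .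

lemma wdim_cut: "wdim (cut g Y) = wdim Y" by (simp add: cut_def)

lemma cells_X_Suc: "cells (X (Suc j)) = {c \<in> cells (cut (f j) (X j)). aff_dim c \<le> int d - int j - 1}"
  by (simp add: X_Suc cartier_intersect_def weil_divisor_def wdim_cut wdim_X)

lemma wt_X_Suc: "wt (X (Suc j)) = weil_weight \<Lambda> (\<lambda>y. max (f j y) 0) (cut (f j) (X j))"
  by (simp add: X_Suc cartier_intersect_def weil_divisor_def)

lemma aff_dim_H': "s \<in> F \<Longrightarrow> y \<in> rel_interior s \<Longrightarrow> y \<in> H j \<Longrightarrow> j \<le> N \<Longrightarrow> aff_dim (s \<inter> H j) = aff_dim s - int j"
  using aff_dim_H[of s y j UNIV] by simp

lemma direction_space_H': "y \<in> rel_interior s \<Longrightarrow> y \<in> H j \<Longrightarrow> direction_space (s \<inter> H j) = direction_space s \<inter> K j"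
  using direction_space_H[of y s j UNIV] by simp

lemma mem_cells_X:
  assumes s: "s \<in> F" "aff_dim s \<le> int d" and y: "y \<in> rel_interior s" "y \<in> H j" and j: "j \<le> N"
  shows "s \<inter> H j \<in> cells (X j)"
  using y(2) j
proof (induction j)
  case 0 then show ?case using s by (simp add: H_0 Z_cells)
next
  case (Suc j)
  have ys: "y \<in> s" using y(1) rel_interior_subset by blast
  have "s \<inter> H j \<in> cells (X j)" using Suc by (simp add: H_Suc)
  moreover have eq: "s \<inter> H (Suc j) = (s \<inter> H j) \<inter> {y. f j y = 0}" by (simp add: H_Suc Int_assoc)
  moreover have "s \<inter> H (Suc j) \<noteq> {}" using ys Suc.prems(1) by blast
  ultimately have "s \<inter> H (Suc j) \<in> cells (cut (f j) (X j))" using cut_cellI by metis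
  moreover have "aff_dim (s \<inter> H (Suc j)) \<le> int d - int j - 1"
    using aff_dim_H'[OF s(1) y(1) Suc.prems] s(2) by simp
  ultimately show ?case unfolding cells_X_Suc by blast
qed

lemma mem_cut_X:
  assumes s: "s \<in> F" "aff_dim s \<le> int d" and j: "j \<le> N" and \<epsilon>: "\<epsilon> = 1 \<or> \<epsilon> = -1"
    and z: "z \<in> rel_interior s" "z \<in> H j" "z \<in> interior (side (f j) \<epsilon>)"
  shows "s \<inter> H j \<inter> side (f j) \<epsilon> \<in> cells (cut (f j) (X j))"
proof (rule cut_cellI[OF mem_cells_X[OF s z(1,2) j]])
  show "s \<inter> H j \<inter> side (f j) \<epsilon> \<noteq> {}" using z rel_interior_subset interior_subset by blast
qed (use \<epsilon> in auto)

lemma wt_cut_X: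
  assumes s: "s \<in> F" "aff_dim s = int d" and j: "j \<le> N" and \<epsilon>: "\<epsilon> = 1 \<or> \<epsilon> = -1"
    and z: "z \<in> rel_interior s" "z \<in> H j" "z \<in> interior (side (f j) \<epsilon>)"
  shows "wt (cut (f j) (X j)) (s \<inter> H j \<inter> side (f j) \<epsilon>) = wt (X j) (s \<inter> H j)"
proof (rule polyhedral_cut_wt[OF polyhedral_X])
  show "s \<inter> H j \<in> cells (X j)" using mem_cells_X[OF s(1) _ z(1,2) j] s(2) by simp
  show "aff_dim (s \<inter> H j \<inter> side (f j) \<epsilon>) = wdim (X j)"
    using aff_dim_H[OF s(1) z j] s(2) by (simp add: wdim_X)
qed auto

text \<open>The first of two invariants of the induction on \<open>j\<close>. Repeated cutting also
  leaves full-dimensional cells that are not slices of cells of \<open>F\<close>; they must have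
  weight zero. The second invariant, \<open>balanced\<close>, is demanded along the slices of
  codimension one, which by \<open>aff_dim_H\<close> come from cells of \<open>F\<close> of
  dimension \<open>d - 1\<close>.\<close>

definition supported :: "nat \<Rightarrow> bool" where
  "supported j \<longleftrightarrow> (\<forall>c\<in>cells (X j). aff_dim c = int d - int j \<longrightarrow> wt (X j) c \<noteq> 0 \<longrightarrow>
     (\<exists>s\<in>Top. \<exists>y. c = s \<inter> H j \<and> y \<in> rel_interior s \<and> y \<in> H j))"

definition balanced :: "nat \<Rightarrow> bool" where
  "balanced j \<longleftrightarrow> (\<forall>t\<in>F. \<forall>y. aff_dim t = int d - 1 \<longrightarrow> y \<in> rel_interior t \<longrightarrow> y \<in> H j \<longrightarrow>
     (\<Sum>s | s \<in> Top \<and> t face_of s. wt (X j) (s \<inter> H j) *\<^sub>R normal_vec \<Lambda> (s \<inter> H j) (t \<inter> H j))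
       \<in> direction_space t \<inter> K j)"

lemma TopD: "s \<in> Top \<Longrightarrow> s \<in> F" "s \<in> Top \<Longrightarrow> aff_dim s = int d" by (auto simp: Top_def)

lemma Top_eqI:
  assumes "s \<in> Top" "s' \<in> Top" "z \<in> rel_interior s" "z \<in> s'" shows "s = s'"
  using F_face_eq[OF TopD(1) TopD(1) F_minimal] assms TopD(2) by (metis TopD(1) order_refl)

lemma support_cell:
  assumes s: "s \<in> F" and y: "y \<in> rel_interior (s \<inter> B)" and B: "convex B"
  obtains t where "t \<in> F" "t face_of s" "y \<in> rel_interior t" "s \<inter> B = t \<inter> B"
proof -
  have yB: "y \<in> s \<inter> B" using y rel_interior_subset by blast
  then obtain t where t: "t \<in> F" "t face_of s" "y \<in> rel_interior t" using F_support[OF s] by blast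
  have "t \<inter> B face_of s \<inter> B" using face_of_slice[OF t(2) B] .
  moreover have "y \<in> t" using t(3) rel_interior_subset by blast
  ultimately have "s \<inter> B \<subseteq> t \<inter> B" using subset_of_face_of[of "t \<inter> B" "s \<inter> B" "s \<inter> B"] y yB by blast
  then show ?thesis using that[OF t] face_of_imp_subset[OF t(2)] by blast
qed

text \<open>A full-dimensional cell with nonzero weight cannot be the part of a slice in the
  hyperplane: it would have the same directions as the slice, among them one on which
  \<open>L j\<close> does not vanish.\<close>

lemma cut_top:
  assumes sup: "supported j" and j: "j < N"
    and c: "c \<in> cells (cut (f j) (X j))" "aff_dim c = int d - int j" "wt (cut (f j) (X j)) c \<noteq> 0"
  obtains s \<epsilon> where "s \<in> Top" "\<epsilon> = 1 \<or> \<epsilon> = -1" "c = s \<inter> H j \<inter> side (f j) \<epsilon>"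
proof -
  obtain q h where q: "q \<in> cells (X j)" "c = q \<inter> h" "c \<noteq> {}"
    "h = side (f j) 1 \<or> h = side (f j) (-1) \<or> h = {y. f j y = 0}" using cut_cellE[OF c(1)] by metis
  have "wt (cut (f j) (X j)) c = wt (X j) q"
    by (rule polyhedral_cut_wt[OF polyhedral_X q(1)]) (use q(2) c(2) wdim_X in auto)
  moreover have dim_q: "aff_dim q = int d - int j"
  proof -
    have "aff_dim c \<le> aff_dim q" using q(2) by (simp add: aff_dim_subset)
    moreover have "aff_dim q \<le> int d - int j" using polyhedral_X[of j] q(1) by (auto simp: polyhedral_def wdim_X)
    ultimately show ?thesis using c(2) by simp
  qed
  ultimately obtain s y where s: "s \<in> Top" "q = s \<inter> H j" "y \<in> rel_interior s" "y \<in> H j"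
    using sup q(1) c(3) unfolding supported_def by metis
  have "h \<noteq> {y. f j y = 0}"
  proof
    assume h: "h = {y. f j y = 0}"
    obtain z where z: "z \<in> s" "z \<in> H (Suc j)" using q(2,3) s(2) h by (auto simp: H_Suc)
    obtain v where v: "v \<in> direction_space s \<inter> K j" "L j v \<noteq> 0"
      using generic_direction[OF TopD(1)[OF s(1)] z j] .
    have qd: "direction_space q = direction_space s \<inter> K j" using direction_space_H'[OF s(3,4)] s(2) by simp
    have "direction_space c \<subseteq> direction_space q" using q(2) by (intro direction_space_mono) auto
    moreover have "dim (direction_space c) = dim (direction_space q)"
    proof -
      have "q \<noteq> {}" using q(2,3) by blast
      then show ?thesis using aff_dim_direction_space[OF q(3)] aff_dim_direction_space[of q] c(2) dim_q by linarith
    qed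
    ultimately have "direction_space c = direction_space q"
      by (intro subspace_dim_equal subspace_direction_space) auto
    then have "v \<in> direction_space c" using v(1) qd by simp
    moreover have "direction_space c \<subseteq> {v. L j v = 0}" unfolding direction_space_def
    proof (rule span_minimal)
      show "{x - y |x y. x \<in> c \<and> y \<in> c} \<subseteq> {v. L j v = 0}"
        using q(2) h by (auto simp: linear_diff L_linear)
      show "subspace {v. L j v = 0}" using subspace_kernel_on[OF subspace_UNIV L_linear] by simp
    qed
    ultimately show False using v(2) by blast
  qed
  then show ?thesis using that[OF s(1)] q(2,4) s(2) by blast
qed

text \<open>Every cell of \<open>cut\<close> lies on one side, and a functional that is nonnegative
  on a cell and zero at a relative interior point is zero on the cell. Hence a single such point
  decides.\<close>

lemma cell_side:
  assumes c: "c \<in> cells (cut (f j) (X j))" and y: "y \<in> rel_interior c" and \<epsilon>: "\<epsilon> = 1 \<or> \<epsilon> = -1"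
  shows "\<epsilon> * f j y \<ge> 0 \<Longrightarrow> c \<subseteq> side (f j) \<epsilon>"
    and "f j y = 0 \<Longrightarrow> c \<subseteq> {y. f j y = 0}"
proof -
  obtain q h where q: "c = q \<inter> h" "h = side (f j) 1 \<or> h = side (f j) (-1) \<or> h = {y. f j y = 0}"
    using cut_cellE[OF c] by metis
  have cv: "convex c" using polyhedral_cut_X c by (auto simp: polyhedral_def)
  have zero: "c \<subseteq> {y. f j y = 0}" if fy: "f j y = 0"
  proof -
    have yc: "y \<in> c" using y rel_interior_subset by blast
    have face: "c \<inter> {z. \<delta> * L j z = \<delta> * x j} face_of c" if "c \<subseteq> side (f j) \<delta>" for \<delta>
      using face_of_functional_ge[OF cv, of "\<lambda>z. \<delta> * L j z" "\<delta> * x j"] that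
        linear_compose_scale_right[OF L_linear, of \<delta> j] by (auto simp: side_def algebra_simps)
    have "c \<subseteq> side (f j) 1 \<or> c \<subseteq> side (f j) (-1)" using q by (auto simp: side_def)
    then obtain \<delta> where \<delta>: "\<delta> = 1 \<or> \<delta> = -1" "c \<subseteq> side (f j) \<delta>" by blast
    have "c \<subseteq> c \<inter> {z. \<delta> * L j z = \<delta> * x j}"
      by (rule subset_of_face_of[OF face[OF \<delta>(2)]]) (use yc y fy in auto)
    then show ?thesis using \<delta>(1) by auto
  qed
  then show "f j y = 0 \<Longrightarrow> c \<subseteq> {y. f j y = 0}" .
  assume pos: "\<epsilon> * f j y \<ge> 0"
  show "c \<subseteq> side (f j) \<epsilon>"
  proof (cases "f j y = 0")
    case True then show ?thesis using zero by (auto simp: side_def)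
  next
    case False
    have "y \<in> h" using y q(1) rel_interior_subset by blast
    then have "h = side (f j) \<epsilon>" using q(2) pos False \<epsilon> by (auto simp: side_def)
    then show ?thesis using q(1) by blast
  qed
qed

lemma lin_part_cell:
  assumes c: "c \<in> cells (cut (f j) (X j))"
  shows "linear (lin_part (\<lambda>y. max (f j y) 0) c)"
proof -
  obtain q h where q: "c = q \<inter> h" "h = side (f j) 1 \<or> h = side (f j) (-1) \<or> h = {y. f j y = 0}"
    using cut_cellE[OF c] by metis
  then have "c \<subseteq> side (f j) 1 \<or> c \<subseteq> side (f j) (-1)" by (auto simp: side_def)
  then show ?thesis using lin_part_side(1)[OF L_linear] by blast
qed

definition star :: "nat \<Rightarrow> 'a set \<Rightarrow> 'a set set" where
  "star j c = {\<sigma> \<in> cells (cut (f j) (X j)). aff_dim \<sigma> = int d - int j \<and> c face_of \<sigma>}"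

text \<open>Neighbours of weight zero may be left out of both sums of \<open>weil_weight\<close>.
  With \<open>S' = {}\<close> this shows that a cell of nonzero weight has a neighbour of nonzero
  weight.\<close>

lemma weil_weight_star:
  assumes S': "S' \<subseteq> star j c" "\<And>\<sigma>. \<sigma> \<in> star j c \<Longrightarrow> \<sigma> \<notin> S' \<Longrightarrow> wt (cut (f j) (X j)) \<sigma> = 0"
  shows "wt (X (Suc j)) c =
     (\<Sum>\<sigma>\<in>S'. wt (cut (f j) (X j)) \<sigma> * lin_part (\<lambda>y. max (f j y) 0) \<sigma> (normal_vec \<Lambda> \<sigma> c))
     - lin_part (\<lambda>y. max (f j y) 0) c (\<Sum>\<sigma>\<in>S'. wt (cut (f j) (X j)) \<sigma> *\<^sub>R normal_vec \<Lambda> \<sigma> c)"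
proof -
  have fin: "finite (star j c)" using polyhedral_cut_X[of j] by (simp add: star_def polyhedral_def)
  have "(\<Sum>\<sigma>\<in>star j c. wt (cut (f j) (X j)) \<sigma> * lin_part (\<lambda>y. max (f j y) 0) \<sigma> (normal_vec \<Lambda> \<sigma> c))
     = (\<Sum>\<sigma>\<in>S'. wt (cut (f j) (X j)) \<sigma> * lin_part (\<lambda>y. max (f j y) 0) \<sigma> (normal_vec \<Lambda> \<sigma> c))"
    by (rule sum.mono_neutral_right[OF fin S'(1)]) (use S'(2) in auto)
  moreover have "(\<Sum>\<sigma>\<in>star j c. wt (cut (f j) (X j)) \<sigma> *\<^sub>R normal_vec \<Lambda> \<sigma> c)
     = (\<Sum>\<sigma>\<in>S'. wt (cut (f j) (X j)) \<sigma> *\<^sub>R normal_vec \<Lambda> \<sigma> c)"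
    by (rule sum.mono_neutral_right[OF fin S'(1)]) (use S'(2) in auto)
  ultimately show ?thesis
    unfolding wt_X_Suc weil_weight_def star_def Let_def by (simp add: wdim_X wdim_cut)
qed

text \<open>Balancing is recorded for whole slices, while the cells of \<open>cut\<close> are
  truncated by a half-space. The normal vectors of both kinds have the same value under the facet
  functional, being generators of the same group, so they differ by a direction of
  \<open>t\<close>.\<close>

lemma normal_vec_independent:
  assumes bal: "balanced j" and j: "j \<le> N"
    and t: "t \<in> F" "aff_dim t = int d - 1" and y: "y \<in> rel_interior t" "y \<in> H j" "y \<in> interior B"
  shows "(\<Sum>s | s \<in> Top \<and> t face_of s. wt (X j) (s \<inter> H j) *\<^sub>R normal_vec \<Lambda> (s \<inter> H j \<inter> B) (t \<inter> H j \<inter> B))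
       \<in> direction_space t \<inter> K j"
proof -
  let ?n = "\<lambda>s. normal_vec \<Lambda> (s \<inter> H j) (t \<inter> H j)"
  let ?m = "\<lambda>s. normal_vec \<Lambda> (s \<inter> H j \<inter> B) (t \<inter> H j \<inter> B)"
  let ?T = "{s. s \<in> Top \<and> t face_of s}"
  have "?m s - ?n s \<in> direction_space t \<inter> K j" if s: "s \<in> ?T" for s
  proof -
    have ts: "s \<in> F" "t \<in> F" "t face_of s" "aff_dim s = aff_dim t + 1" using s t by (auto simp: Top_def)
    note m = facet_normal[OF ts y j] and n = facet_normal[OF ts y(1,2) _ j, of UNIV, simplified]
    obtain k k' :: int where k: "facet_fun s t (?m s) = of_int k * facet_fun s t (?n s)"
      "facet_fun s t (?n s) = of_int k' * facet_fun s t (?m s)" using m(1,2,4) n(1,2,4) by blast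
    have "facet_fun s t (?m s) = facet_fun s t (?n s)"
      by (rule int_multiple_antisym[OF m(3) n(3) k])
    then have "facet_fun s t (?m s - ?n s) = 0" using facet_fun(1)[OF ts] by (simp add: linear_diff)
    moreover have "?m s - ?n s \<in> direction_space s \<inter> K j"
      using m(2) n(2) subspace_diff[OF subspace_dir_K] by blast
    ultimately show ?thesis using facet_fun(5)[OF ts] by blast
  qed
  then have "(\<Sum>s\<in>?T. wt (X j) (s \<inter> H j) *\<^sub>R (?m s - ?n s)) \<in> direction_space t \<inter> K j"
    by (intro subspace_sum subspace_scale subspace_dir_K)
  moreover have "(\<Sum>s\<in>?T. wt (X j) (s \<inter> H j) *\<^sub>R ?n s) \<in> direction_space t \<inter> K j"
    using bal t y unfolding balanced_def by blast
  ultimately have "(\<Sum>s\<in>?T. wt (X j) (s \<inter> H j) *\<^sub>R (?m s - ?n s)) + (\<Sum>s\<in>?T. wt (X j) (s \<inter> H j) *\<^sub>R ?n s)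
      \<in> direction_space t \<inter> K j" by (intro subspace_add subspace_dir_K)
  then show ?thesis by (simp add: scaleR_diff_right sum_subtractf)
qed

text \<open>Where \<open>f j\<close> does not vanish, \<open>max (f j) 0\<close> is locally linear, so balancing makes its
  divisor trivial.\<close>

lemma weight_off_hyperplane:
  assumes sup: "supported j" and bal: "balanced j" and j: "j < N"
    and c: "c \<in> cells (X (Suc j))" "aff_dim c = int d - int (Suc j)" and wt: "wt (X (Suc j)) c \<noteq> 0"
    and y: "y \<in> rel_interior c"
  shows "f j y = 0"
proof (rule ccontr)
  assume fy: "f j y \<noteq> 0"
  define \<epsilon> :: real where "\<epsilon> = sgn (f j y)"
  have \<epsilon>: "\<epsilon> = 1 \<or> \<epsilon> = -1" "\<epsilon> * f j y > 0" using fy by (auto simp: \<epsilon>_def sgn_real_def)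
  have y_int: "y \<in> interior (side (f j) \<epsilon>)" by (rule interior_side[OF L_linear \<epsilon>(2)])
  let ?B = "side (f j) \<epsilon>"
  have cB: "convex ?B" by (rule convex_side[OF L_linear])
  have c': "c \<in> cells (cut (f j) (X j))" using c(1) by (simp add: cells_X_Suc)
  have yc: "y \<in> c" using y rel_interior_subset by blast
  have nonzero: "\<exists>s\<in>Top. \<sigma> = s \<inter> H j \<inter> ?B" if \<sigma>: "\<sigma> \<in> star j c" "wt (cut (f j) (X j)) \<sigma> \<noteq> 0" for \<sigma>
  proof -
    obtain s \<delta> where s: "s \<in> Top" "\<delta> = 1 \<or> \<delta> = -1" "\<sigma> = s \<inter> H j \<inter> side (f j) \<delta>"
      using cut_top[OF sup j] \<sigma> unfolding star_def by blast
    have "y \<in> side (f j) \<delta>" using \<sigma>(1) yc s(3) face_of_imp_subset unfolding star_def by blast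
    then have "\<delta> = \<epsilon>" using s(2) \<epsilon> by (auto simp: side_def)
    then show ?thesis using s by blast
  qed
  have "\<exists>\<sigma>\<in>star j c. wt (cut (f j) (X j)) \<sigma> \<noteq> 0"
  proof (rule ccontr)
    assume "\<not> ?thesis"
    then have "wt (X (Suc j)) c = 0"
      using weil_weight_star[of "{}" j c] linear_0[OF lin_part_cell[OF c']] by simp
    then show False using wt by simp
  qed
  then obtain s0 where s0: "s0 \<in> Top" "s0 \<inter> H j \<inter> ?B \<in> star j c" using nonzero by blast
  have c_face: "c face_of s0 \<inter> H j \<inter> ?B" using s0(2) by (simp add: star_def)
  have ys0: "y \<in> s0" "y \<in> H j" using yc face_of_imp_subset[OF c_face] by auto
  \<comment> \<open>The cell of \<open>F\<close> around \<open>y\<close>. It turns out that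
    \<open>c\<close> is its truncated slice, and counting dimensions makes \<open>t\<close> a facet
    of the maximal cells around it.\<close>
  obtain t where t: "t \<in> F" "t face_of s0" "y \<in> rel_interior t"
    using F_support[OF TopD(1)[OF s0(1)] ys0(1)] by blast
  have y_rel: "y \<in> rel_interior (t \<inter> H j \<inter> ?B)"
    by (rule rel_interior_H[OF F_convex[OF t(1)] cB t(3) ys0(2) y_int])
  have t_sub: "t \<inter> H j \<inter> ?B \<subseteq> s0 \<inter> H j \<inter> ?B" using face_of_imp_subset[OF t(2)] by blast
  have c_eq: "c = t \<inter> H j \<inter> ?B"
  proof
    show "t \<inter> H j \<inter> ?B \<subseteq> c" using subset_of_face_of[OF c_face t_sub] yc y_rel by blast
    have "t \<inter> (H j \<inter> ?B) face_of s0 \<inter> (H j \<inter> ?B)"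
      by (rule face_of_slice[OF t(2)]) (simp add: convex_H cB convex_Int)
    moreover have "y \<in> t \<inter> (H j \<inter> ?B)" using y_rel rel_interior_subset by blast
    ultimately show "c \<subseteq> t \<inter> H j \<inter> ?B"
      using subset_of_face_of[of "t \<inter> (H j \<inter> ?B)" "s0 \<inter> (H j \<inter> ?B)" c] face_of_imp_subset[OF c_face] y
      by (auto simp: Int_assoc)
  qed
  have dim_t: "aff_dim t = int d - 1"
    using aff_dim_H[OF t(1,3) ys0(2) y_int] j c(2) c_eq by simp
  let ?T = "{s. s \<in> Top \<and> t face_of s}"
  let ?\<sigma> = "\<lambda>s. s \<inter> H j \<inter> ?B"
  have up: "\<exists>z. z \<in> rel_interior s \<and> z \<in> H j \<and> z \<in> interior ?B" if "s \<in> ?T" for s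
    using relint_up[OF t(1) _ _ t(3) ys0(2) y_int, of s] that j TopD(1) by auto
  have dims: "aff_dim (?\<sigma> s) = int d - int j" if "s \<in> ?T" for s
    using up[OF that] aff_dim_H[of s _ j ?B] that TopD j by auto
  have inj: "inj_on ?\<sigma> ?T"
  proof (rule inj_onI)
    fix s s' assume ss: "s \<in> ?T" "s' \<in> ?T" "?\<sigma> s = ?\<sigma> s'"
    obtain z where z: "z \<in> rel_interior s" "z \<in> H j" "z \<in> interior ?B" using up[OF ss(1)] by blast
    then have "z \<in> ?\<sigma> s" using rel_interior_subset interior_subset by blast
    then have "z \<in> s'" using ss(3) by blast
    then show "s = s'" using Top_eqI z(1) ss by blast
  qed
  have sub: "?\<sigma> ` ?T \<subseteq> star j c"
  proof clarify
    fix s assume s: "s \<in> Top" "t face_of s"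
    then obtain z where z: "z \<in> rel_interior s" "z \<in> H j" "z \<in> interior ?B" using up by blast
    have "?\<sigma> s \<in> cells (cut (f j) (X j))"
      using mem_cut_X[OF TopD(1)[OF s(1)] _ _ \<epsilon>(1) z] TopD(2)[OF s(1)] j by simp
    moreover have "t \<inter> (H j \<inter> ?B) face_of s \<inter> (H j \<inter> ?B)"
      by (rule face_of_slice[OF s(2)]) (simp add: convex_H cB convex_Int)
    ultimately show "?\<sigma> s \<in> star j c" unfolding star_def using dims s c_eq by (simp add: Int_assoc)
  qed
  have outside: "wt (cut (f j) (X j)) \<sigma> = 0" if \<sigma>: "\<sigma> \<in> star j c" "\<sigma> \<notin> ?\<sigma> ` ?T" for \<sigma>
  proof (rule ccontr)
    assume "wt (cut (f j) (X j)) \<sigma> \<noteq> 0"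
    then obtain s where s: "s \<in> Top" "\<sigma> = ?\<sigma> s" using nonzero \<sigma>(1) by blast
    have "c \<subseteq> \<sigma>" using \<sigma>(1) face_of_imp_subset by (auto simp: star_def)
    then have "y \<in> s" using yc s(2) by blast
    then have "t face_of s" using F_minimal[OF t(1) TopD(1)[OF s(1)] t(3)] by blast
    then show False using \<sigma>(2) s by blast
  qed
  \<comment> \<open>On every cell around \<open>c\<close> the function \<open>max (f j) 0\<close>
    has linear part \<open>A\<close>. The weight becomes \<open>A ?V - A ?V\<close>, since the
    balanced sum \<open>?V\<close> is a direction of \<open>c\<close>, where \<open>lin_part\<close>
    is determined.\<close>
  define A :: "'a \<Rightarrow> real" where "A = (\<lambda>v. if \<epsilon> = 1 then L j v else 0)"
  have A: "linear A" unfolding A_def using L_linear by (cases "\<epsilon> = 1") (simp_all add: linear_zero)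
  have wtc: "wt (cut (f j) (X j)) (?\<sigma> s) = wt (X j) (s \<inter> H j)" if "s \<in> ?T" for s
    using up[OF that] wt_cut_X[of s j \<epsilon>] that TopD \<epsilon>(1) j by auto
  have lp: "lin_part (\<lambda>y. max (f j y) 0) (?\<sigma> s) (normal_vec \<Lambda> (?\<sigma> s) c) = A (normal_vec \<Lambda> (?\<sigma> s) c)"
    if "s \<in> ?T" for s
  proof -
    have ts: "s \<in> F" "t \<in> F" "t face_of s" "aff_dim s = aff_dim t + 1" using that t dim_t by (auto simp: Top_def)
    obtain z where z: "z \<in> rel_interior s" "z \<in> H j" "z \<in> interior ?B" using up[OF \<open>s \<in> ?T\<close>] by blast
    have "normal_vec \<Lambda> (?\<sigma> s) c \<in> direction_space (?\<sigma> s)"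
      using facet_normal(2)[OF ts t(3) ys0(2) y_int] j direction_space_H[OF z] c_eq by simp
    then show ?thesis
      using lin_part_side(2)[OF L_linear \<epsilon>(1), of "?\<sigma> s" j "x j"] by (simp add: A_def)
  qed
  let ?V = "\<Sum>s\<in>?T. wt (X j) (s \<inter> H j) *\<^sub>R normal_vec \<Lambda> (?\<sigma> s) c"
  have V: "?V \<in> direction_space c"
    using normal_vec_independent[OF bal _ t(1) dim_t t(3) ys0(2) y_int] j c_eq
      direction_space_H[OF t(3) ys0(2) y_int] by simp
  have "wt (X (Suc j)) c = (\<Sum>s\<in>?T. wt (X j) (s \<inter> H j) * A (normal_vec \<Lambda> (?\<sigma> s) c))
      - lin_part (\<lambda>y. max (f j y) 0) c ?V"
    using weil_weight_star[OF sub outside] by (simp add: sum.reindex[OF inj] wtc lp)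
  also have "(\<Sum>s\<in>?T. wt (X j) (s \<inter> H j) * A (normal_vec \<Lambda> (?\<sigma> s) c)) = A ?V"
    using A by (simp add: linear_sum linear_scale)
  also have "lin_part (\<lambda>y. max (f j y) 0) c ?V = A ?V"
    using lin_part_side(2)[OF L_linear \<epsilon>(1), of c j "x j"] V c_eq by (simp add: A_def)
  finally show False using wt by simp
qed

text \<open>A cell of nonzero weight lies in the hyperplane and is a face of half of
  \<open>s \<inter> H j\<close>, hence a face of \<open>s \<inter> H (Suc j)\<close>. The latter is
  also the slice of a face \<open>t\<close> of \<open>s\<close> and so has no larger dimension. Thus
  the two are equal, and then \<open>t = s\<close> by dimension.\<close>

lemma supported_Suc:
  assumes sup: "supported j" and bal: "balanced j" and j: "j < N"
  shows "supported (Suc j)"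
  unfolding supported_def
proof (intro ballI impI)
  fix c assume c: "c \<in> cells (X (Suc j))" "aff_dim c = int d - int (Suc j)" "wt (X (Suc j)) c \<noteq> 0"
  have c': "c \<in> cells (cut (f j) (X j))" using c(1) by (simp add: cells_X_Suc)
  have cne: "c \<noteq> {}" "convex c" using polyhedral_cut_X c' by (auto simp: polyhedral_def)
  obtain y where y: "y \<in> rel_interior c" using cne rel_interior_eq_empty by blast
  have "f j y = 0" using weight_off_hyperplane[OF assms c y] .
  then have c0: "c \<subseteq> {y. f j y = 0}" using cell_side(2)[OF c' y, of 1] by simp
  have "\<exists>\<sigma>\<in>star j c. wt (cut (f j) (X j)) \<sigma> \<noteq> 0"
  proof (rule ccontr)
    assume "\<not> ?thesis"
    then have "wt (X (Suc j)) c = 0"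
      using weil_weight_star[of "{}" j c] linear_0[OF lin_part_cell[OF c']] by simp
    then show False using c(3) by simp
  qed
  then obtain \<sigma> where \<sigma>: "\<sigma> \<in> star j c" "wt (cut (f j) (X j)) \<sigma> \<noteq> 0" by blast
  obtain s \<epsilon> where s: "s \<in> Top" "\<epsilon> = 1 \<or> \<epsilon> = -1" "\<sigma> = s \<inter> H j \<inter> side (f j) \<epsilon>"
    using cut_top[OF sup j] \<sigma> unfolding star_def by blast
  have cf: "c face_of \<sigma>" using \<sigma>(1) by (simp add: star_def)
  have sub: "c \<subseteq> s \<inter> H (Suc j)" using face_of_imp_subset[OF cf] c0 s(3) H_Suc_side[OF s(2)] by blast
  have cvx: "convex (s \<inter> H (Suc j))" using F_convex[OF TopD(1)[OF s(1)]] convex_H by (simp add: convex_Int)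
  then obtain z where z: "z \<in> rel_interior (s \<inter> H (Suc j))" using sub cne(1) rel_interior_eq_empty by blast
  obtain t where t: "t \<in> F" "t face_of s" "z \<in> rel_interior t" "s \<inter> H (Suc j) = t \<inter> H (Suc j)"
    using support_cell[OF TopD(1)[OF s(1)] z convex_H] .
  have zH: "z \<in> H (Suc j)" using z rel_interior_subset by blast
  have dim: "aff_dim (s \<inter> H (Suc j)) = aff_dim t - int (Suc j)"
    unfolding t(4) using aff_dim_H'[OF t(1,3) zH] j by simp
  have "aff_dim t \<le> int d" using aff_dim_subset[OF face_of_imp_subset[OF t(2)]] TopD(2)[OF s(1)] by simp
  moreover have "c face_of s \<inter> H (Suc j)"
    by (rule face_of_subset[OF cf sub]) (use H_Suc_side[OF s(2)] s(3) in blast)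
  ultimately have c_eq: "c = s \<inter> H (Suc j)"
    using face_of_aff_dim_lt[OF cvx, of c] c(2) dim by fastforce
  then have "aff_dim t = int d" using dim c(2) by simp
  then have "t = s" using F_face_eq[OF t(1) TopD(1)[OF s(1)] t(2)] TopD(2)[OF s(1)] by simp
  then show "\<exists>s\<in>Top. \<exists>y. c = s \<inter> H (Suc j) \<and> y \<in> rel_interior s \<and> y \<in> H (Suc j)"
    using s(1) c_eq t(3) zH by blast
qed

text \<open>Up to cells of weight zero, the slice is surrounded by the two halves of
  \<open>s \<inter> H j\<close>, which have equal weight. Only the positive half has a nonzero
  linear part, and the correction term vanishes because the two normal vectors add up to a direction
  of the slice.\<close>

lemma weight_on_hyperplane:
  assumes sup: "supported j" and j: "j < N" and s: "s \<in> Top" and y: "y \<in> rel_interior s" "y \<in> H (Suc j)"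
  shows "wt (X (Suc j)) (s \<inter> H (Suc j)) = wt (X j) (s \<inter> H j) *
     L j (normal_vec \<Lambda> (s \<inter> H j \<inter> side (f j) 1) (s \<inter> H (Suc j)))"
proof -
  let ?c = "s \<inter> H (Suc j)" and ?\<sigma> = "\<lambda>\<epsilon>. s \<inter> H j \<inter> side (f j) \<epsilon>"
  let ?n = "\<lambda>\<epsilon>. normal_vec \<Lambda> (?\<sigma> \<epsilon>) ?c"
  have sF: "s \<in> F" "aff_dim s = int d" using TopD[OF s] by auto
  have ys: "y \<in> s" using y(1) rel_interior_subset by blast
  have in_star: "?\<sigma> \<epsilon> \<in> star j ?c" and wtc: "wt (cut (f j) (X j)) (?\<sigma> \<epsilon>) = wt (X j) (s \<inter> H j)"
    and dirs: "direction_space (?\<sigma> \<epsilon>) = direction_space s \<inter> K j" if \<epsilon>: "\<epsilon> = 1 \<or> \<epsilon> = -1" for \<epsilon>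
  proof -
    obtain z where z: "z \<in> rel_interior s" "z \<in> H j" "z \<in> interior (side (f j) \<epsilon>)"
      using cut_point[OF sF(1) y j \<epsilon>] .
    have "?\<sigma> \<epsilon> \<inter> {y. f j y = 0} face_of ?\<sigma> \<epsilon>"
    proof -
      have "?\<sigma> \<epsilon> \<inter> {y. \<epsilon> * L j y = \<epsilon> * x j} face_of ?\<sigma> \<epsilon>"
      proof (rule face_of_functional_ge)
        show "convex (?\<sigma> \<epsilon>)"
          by (intro convex_Int F_convex[OF sF(1)] convex_H convex_side[OF L_linear])
        show "linear (\<lambda>y. \<epsilon> * L j y)" using linear_compose_scale_right[OF L_linear, of \<epsilon> j] by simp
        show "\<epsilon> * x j \<le> \<epsilon> * L j y" if "y \<in> ?\<sigma> \<epsilon>" for y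
          using that by (simp add: side_def right_diff_distrib)
      qed
      moreover have "{y. \<epsilon> * L j y = \<epsilon> * x j} = {y. f j y = 0}" using \<epsilon> by auto
      ultimately show ?thesis by simp
    qed
    then have "?c face_of ?\<sigma> \<epsilon>" unfolding H_Suc_side[OF \<epsilon>, of s j] .
    then show "?\<sigma> \<epsilon> \<in> star j ?c"
      unfolding star_def using mem_cut_X[OF sF(1) _ _ \<epsilon> z] aff_dim_H[OF sF(1) z] sF(2) j by simp
    show "wt (cut (f j) (X j)) (?\<sigma> \<epsilon>) = wt (X j) (s \<inter> H j)" using wt_cut_X[OF sF _ \<epsilon> z] j by simp
    show "direction_space (?\<sigma> \<epsilon>) = direction_space s \<inter> K j" by (rule direction_space_H[OF z])
  qed
  have outside: "wt (cut (f j) (X j)) \<sigma> = 0" if \<sigma>: "\<sigma> \<in> star j ?c" "\<sigma> \<notin> {?\<sigma> 1, ?\<sigma> (-1)}" for \<sigma>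
  proof (rule ccontr)
    assume "wt (cut (f j) (X j)) \<sigma> \<noteq> 0"
    then obtain s' \<epsilon> where s': "s' \<in> Top" "\<epsilon> = 1 \<or> \<epsilon> = -1" "\<sigma> = s' \<inter> H j \<inter> side (f j) \<epsilon>"
      using cut_top[OF sup j] \<sigma>(1) unfolding star_def by blast
    have "?c \<subseteq> \<sigma>" using \<sigma>(1) face_of_imp_subset by (auto simp: star_def)
    then have "y \<in> s'" using ys y(2) s'(3) by blast
    then have "s = s'" using Top_eqI[OF s s'(1) y(1)] by blast
    then show False using \<sigma>(2) s' by blast
  qed
  have c_in: "?c \<in> cells (cut (f j) (X j))"
    using mem_cells_X[OF sF(1) _ y] sF(2) j by (simp add: cells_X_Suc)
  have c_side: "?c \<subseteq> side (f j) (-1)" by (auto simp: H_Suc side_def)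
  have dir_c: "direction_space ?c = {v \<in> direction_space s \<inter> K j. L j v = 0}"
    unfolding direction_space_H'[OF y] K_Suc ..
  note n1 = cut_normal[OF sF(1) y j, of 1, simplified] and n2 = cut_normal[OF sF(1) y j, of "-1", simplified]
  obtain k k' :: int where k: "L j (?n 1) = of_int k * L j (?n (-1))" "L j (?n (-1)) = of_int k' * L j (?n 1)"
    using n1(1,2,4) n2(1,2,4) by (metis IntI)
  \<comment> \<open>Up to sign, both values are the positive generator of the values of
    \<open>L j\<close> on the same lattice.\<close>
  have "L j (?n 1) = - L j (?n (-1))"
  proof (rule int_multiple_antisym)
    show "0 < L j (?n 1)" "0 < - L j (?n (-1))" using n1(3) n2(3) by auto
    show "L j (?n 1) = of_int (-k) * - L j (?n (-1))" using k(1) by (simp only: of_int_minus minus_mult_minus)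
    show "- L j (?n (-1)) = of_int (-k') * L j (?n 1)" using k(2) by (simp only: of_int_minus mult_minus_left)
  qed
  then have "L j (?n 1 + ?n (-1)) = 0" by (simp add: linear_add L_linear)
  moreover have "?n 1 + ?n (-1) \<in> direction_space s \<inter> K j"
    using n1(2) n2(2) subspace_add[OF subspace_dir_K] by blast
  ultimately have sum_c: "?n 1 + ?n (-1) \<in> direction_space ?c" unfolding dir_c by simp
  have ne: "?\<sigma> 1 \<noteq> ?\<sigma> (-1)"
  proof
    assume eq: "?\<sigma> 1 = ?\<sigma> (-1)"
    obtain z where z: "z \<in> rel_interior s" "z \<in> H j" "z \<in> interior (side (f j) 1)"
      using cut_point[OF sF(1) y j, of 1] by blast
    have "?n 1 = ?n (-1)" using eq by simp
    then show False using n1(3) n2(3) by simp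
  qed
  have sub: "{?\<sigma> 1, ?\<sigma> (-1)} \<subseteq> star j ?c" using in_star by blast
  let ?w = "wt (X j) (s \<inter> H j)"
  have lp1: "lin_part (\<lambda>y. max (f j y) 0) (?\<sigma> 1) (?n 1) = L j (?n 1)"
    using lin_part_side(2)[OF L_linear, of 1 "?\<sigma> 1" j "x j" "?n 1"] n1(2) dirs[of 1] by simp
  have lp2: "lin_part (\<lambda>y. max (f j y) 0) (?\<sigma> (-1)) (?n (-1)) = 0"
    using lin_part_side(2)[OF L_linear, of "-1" "?\<sigma> (-1)" j "x j" "?n (-1)"] n2(2) dirs[of "-1"] by simp
  have "?w *\<^sub>R ?n 1 + ?w *\<^sub>R ?n (-1) \<in> direction_space ?c"
    using sum_c subspace_scale[OF subspace_direction_space] by (metis scaleR_add_right)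
  then have lp3: "lin_part (\<lambda>y. max (f j y) 0) ?c (?w *\<^sub>R ?n 1 + ?w *\<^sub>R ?n (-1)) = 0"
    using lin_part_side(2)[OF L_linear, of "-1" ?c j "x j"] c_side by simp
  show ?thesis
    using weil_weight_star[OF sub outside] ne wtc[of 1] wtc[of "-1"] lp1 lp2 lp3 by simp
qed

text \<open>Slicing multiplies the weight of \<open>s\<close> by \<open>L j (?n s)\<close> and
  replaces the normal vector \<open>?u s\<close> by \<open>?u' s\<close>. By
  \<open>lattice_index_eq\<close> the facet functional of the weighted vector grows by the factor
  \<open>L j ?c\<close>, which depends on \<open>t\<close> but not on \<open>s\<close>. Modulo
  directions of \<open>t\<close> the new sum is therefore a multiple of the old one.\<close>

lemma balanced_Suc:
  assumes sup: "supported j" and bal: "balanced j" and j: "j < N"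
  shows "balanced (Suc j)"
  unfolding balanced_def
proof (intro ballI allI impI)
  fix t y assume t: "t \<in> F" "aff_dim t = int d - 1" and y: "y \<in> rel_interior t" "y \<in> H (Suc j)"
  let ?T = "{s. s \<in> Top \<and> t face_of s}"
  let ?u = "\<lambda>s. normal_vec \<Lambda> (s \<inter> H j) (t \<inter> H j)"
  let ?u' = "\<lambda>s. normal_vec \<Lambda> (s \<inter> H (Suc j)) (t \<inter> H (Suc j))"
  let ?n = "\<lambda>s. normal_vec \<Lambda> (s \<inter> H j \<inter> side (f j) 1) (s \<inter> H (Suc j))"
  let ?c = "normal_vec \<Lambda> (t \<inter> H j \<inter> side (f j) 1) (t \<inter> H (Suc j))"
  have yH: "y \<in> H j" using y(2) by (simp add: H_Suc)
  note c = cut_normal[OF t(1) y j, of 1, simplified]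
  have key: "wt (X (Suc j)) (s \<inter> H (Suc j)) *\<^sub>R ?u' s - (L j ?c * wt (X j) (s \<inter> H j)) *\<^sub>R ?u s \<in> direction_space t \<inter> K j"
    and u'K: "?u' s \<in> K (Suc j)" if "s \<in> ?T" for s
  proof -
    have sT: "s \<in> Top" using that by blast
    have ts: "s \<in> F" "t \<in> F" "t face_of s" "aff_dim s = aff_dim t + 1" using that t by (auto simp: Top_def)
    obtain z where z: "z \<in> rel_interior s" "z \<in> H (Suc j)"
      using relint_up[OF ts(2,1,3) y, of UNIV] j by auto
    let ?g = "facet_fun s t"
    note u = facet_normal[OF ts y(1) yH _ less_imp_le[OF j], of UNIV, simplified]
    note u' = facet_normal[OF ts y _ Suc_leI[OF j], of UNIV, simplified]
    note n = cut_normal[OF ts(1) z j, of 1, simplified]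
    have dt: "direction_space t = {v \<in> direction_space s. ?g v = 0}" using facet_fun(5)[OF ts] .
    show "?u' s \<in> K (Suc j)" using u'(2) by blast
    let ?G = "\<Lambda> \<inter> (direction_space s \<inter> K j)"
    have u'2: "?u' s \<in> direction_space s \<inter> K j" "L j (?u' s) = 0"
      using u'(2) K_Suc by blast+
    have "L j (?n s) * ?g (?u' s) = L j ?c * ?g (?u s)"
    proof (rule lattice_index_eq[where G = ?G])
      show "add_subgroup ?G" by (rule add_subgroup_Int[OF lattice subspace_dir_K])
      show "\<exists>k::int. ?g v = of_int k * ?g (?u' s)" if "v \<in> ?G" "L j v = 0" for v
      proof -
        have "v \<in> direction_space s \<inter> K (Suc j)" unfolding K_Suc using that by blast
        then show ?thesis using u'(4)[of v] that by blast
      qed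
      show "\<exists>k::int. L j v = of_int k * L j ?c" if "v \<in> ?G" "?g v = 0" for v
        using c(4)[of v] that dt by blast
      show "linear (L j)" by (rule L_linear)
      show "linear ?g" by (rule facet_fun(1)[OF ts])
      show "?n s \<in> ?G" "?u s \<in> ?G" "?u' s \<in> ?G" using n(1,2) u(1,2) u'(1) u'2(1) by blast+
      show "L j (?n s) > 0" "?g (?u s) > 0" "?g (?u' s) > 0" "L j ?c > 0" by (rule n u u' c)+
      show "L j (?u' s) = 0" by (rule u'2)
      show "\<exists>k::int. L j v = of_int k * L j (?n s)" if "v \<in> ?G" for v using n(4)[of v] that by blast
      show "\<exists>k::int. ?g v = of_int k * ?g (?u s)" if "v \<in> ?G" for v using u(4)[of v] that by blast
      show "?c \<in> ?G" "?g ?c = 0" using c(1,2) dt by blast+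
    qed
    then have "?g (L j (?n s) *\<^sub>R ?u' s - L j ?c *\<^sub>R ?u s) = 0"
      using facet_fun(1)[OF ts] by (simp add: linear_diff linear_scale)
    moreover have "L j (?n s) *\<^sub>R ?u' s - L j ?c *\<^sub>R ?u s \<in> direction_space s \<inter> K j"
      using u(2) u'2(1) by (intro subspace_diff subspace_scale subspace_dir_K) auto
    ultimately have "L j (?n s) *\<^sub>R ?u' s - L j ?c *\<^sub>R ?u s \<in> direction_space t \<inter> K j" using dt by blast
    then have "wt (X j) (s \<inter> H j) *\<^sub>R (L j (?n s) *\<^sub>R ?u' s - L j ?c *\<^sub>R ?u s) \<in> direction_space t \<inter> K j"
      by (intro subspace_scale subspace_dir_K)
    then show "wt (X (Suc j)) (s \<inter> H (Suc j)) *\<^sub>R ?u' s - (L j ?c * wt (X j) (s \<inter> H j)) *\<^sub>R ?u s \<in> direction_space t \<inter> K j"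
      using weight_on_hyperplane[OF sup j sT z] by (simp add: scaleR_diff_right mult.commute)
  qed
  let ?V' = "\<Sum>s\<in>?T. wt (X (Suc j)) (s \<inter> H (Suc j)) *\<^sub>R ?u' s"
  let ?V = "\<Sum>s\<in>?T. wt (X j) (s \<inter> H j) *\<^sub>R ?u s"
  have "(\<Sum>s\<in>?T. wt (X (Suc j)) (s \<inter> H (Suc j)) *\<^sub>R ?u' s - (L j ?c * wt (X j) (s \<inter> H j)) *\<^sub>R ?u s)
      \<in> direction_space t \<inter> K j"
    using key by (intro subspace_sum subspace_dir_K)
  then have "?V' - L j ?c *\<^sub>R ?V \<in> direction_space t \<inter> K j"
    by (simp add: sum_subtractf scaleR_sum_right)
  moreover have "L j ?c *\<^sub>R ?V \<in> direction_space t \<inter> K j"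
    using bal t y(1) yH unfolding balanced_def by (intro subspace_scale subspace_dir_K) blast
  ultimately have "(?V' - L j ?c *\<^sub>R ?V) + L j ?c *\<^sub>R ?V \<in> direction_space t \<inter> K j"
    by (intro subspace_add subspace_dir_K)
  moreover have "?V' \<in> K (Suc j)" using u'K by (intro subspace_sum subspace_scale subspace_K)
  ultimately show "?V' \<in> direction_space t \<inter> K (Suc j)" by simp
qed

lemma supported_balanced: "j \<le> N \<Longrightarrow> supported j \<and> balanced j"
proof (induction j)
  case 0
  have "supported 0"
    unfolding supported_def
  proof (intro ballI impI)
    fix c assume c: "c \<in> cells (X 0)" "aff_dim c = int d - int 0" "wt (X 0) c \<noteq> 0"
    then have "c \<in> Top" by (simp add: Top_def Z_cells)
    moreover then obtain y where "y \<in> rel_interior c"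
      using F_ne[OF TopD(1)] rel_interior_eq_empty[OF F_convex[OF TopD(1)]] by blast
    ultimately show "\<exists>s\<in>Top. \<exists>y. c = s \<inter> H 0 \<and> y \<in> rel_interior s \<and> y \<in> H 0" by (auto simp: H_0)
  qed
  moreover have "balanced 0"
    unfolding balanced_def
  proof (intro ballI allI impI)
    fix t assume t: "t \<in> F" "aff_dim t = int d - 1"
    have "(\<Sum>s | s \<in> F \<and> aff_dim s = int d \<and> t face_of s. wt Z s *\<^sub>R normal_vec \<Lambda> s t)
        = (\<Sum>s | s \<in> Top \<and> t face_of s. wt Z s *\<^sub>R normal_vec \<Lambda> s t)"
      by (rule sum.mono_neutral_right) (use F_finite in \<open>auto simp: Top_def\<close>)
    then show "(\<Sum>s | s \<in> Top \<and> t face_of s. wt (X 0) (s \<inter> H 0) *\<^sub>R normal_vec \<Lambda> (s \<inter> H 0) (t \<inter> H 0))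
       \<in> direction_space t \<inter> K 0"
      using Z_balanced[OF t] by (simp add: H_0 K_0)
  qed
  ultimately show ?case by blast
next
  case (Suc j) then show ?case using supported_Suc balanced_Suc by simp
qed

end

section \<open>Split systems and their cones\<close>

definition split_vec :: "'l::finite set \<Rightarrow> 'l ambient" where
  "split_vec I = double_ratio (\<lambda>a b. if (a \<in> I) \<noteq> (b \<in> I) then 1 else 0)"

text \<open>One of the four intersections of a side of \<open>A\<close> with a side of
  \<open>B\<close> is empty: the condition for two splits to occur in a common tree.\<close>

definition compat :: "'l set \<Rightarrow> 'l set \<Rightarrow> bool" where
  "compat A B \<longleftrightarrow> A \<inter> B = {} \<or> A \<subseteq> B \<or> B \<subseteq> A \<or> A \<union> B = UNIV"

definition nontrivial :: "'l::finite set \<Rightarrow> bool" where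
  "nontrivial I \<longleftrightarrow> card I \<ge> 2 \<and> card (- I) \<ge> 2"

text \<open>A split \<open>I | - I\<close> is represented by both of its sides.\<close>

definition split_system :: "'l::finite set set \<Rightarrow> bool" where
  "split_system S \<longleftrightarrow> (\<forall>I\<in>S. nontrivial I \<and> - I \<in> S) \<and> (\<forall>A\<in>S. \<forall>B\<in>S. compat A B)"

lemma split_systemD:
  assumes "split_system S" "I \<in> S"
  shows "nontrivial I" "- I \<in> S" "B \<in> S \<Longrightarrow> compat I B"
  using assms by (auto simp: split_system_def)

lemma nontrivial_uminus: "nontrivial (- I) = nontrivial I" by (auto simp: nontrivial_def)

lemma split_system_subset:
  "split_system S \<Longrightarrow> T \<subseteq> S \<Longrightarrow> (\<And>I. I \<in> T \<Longrightarrow> - I \<in> T) \<Longrightarrow> split_system T"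
  unfolding split_system_def by blast

lemma split_system_Int: "split_system S \<Longrightarrow> split_system T \<Longrightarrow> split_system (S \<inter> T)"
  by (auto simp: split_system_def)

lemma split_system_remove:
  assumes "split_system S" shows "split_system (S - {J, - J})"
proof (rule split_system_subset[OF assms])
  fix I assume I: "I \<in> S - {J, - J}"
  then have "- I \<in> S" using split_systemD(2)[OF assms] by blast
  moreover have "- I \<noteq> J" "- I \<noteq> - J" using I by auto
  ultimately show "- I \<in> S - {J, - J}" by blast
qed blast

lemma split_vec_uminus: "split_vec (- I) = split_vec I"
  by (simp add: split_vec_def)

definition separates :: "'l set \<Rightarrow> 'l \<Rightarrow> 'l \<Rightarrow> 'l \<Rightarrow> 'l \<Rightarrow> bool" where
  "separates I a b c d \<longleftrightarrow> a \<in> I \<and> b \<in> I \<and> c \<notin> I \<and> d \<notin> I \<or> a \<notin> I \<and> b \<notin> I \<and> c \<in> I \<and> d \<in> I"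

lemma split_vec_coord:
  assumes "distinct [a, b, c, d]"
  shows "split_vec I $ (a, b, c, d) =
    (if separates I a b c d then 1 else if separates I a d b c then -1 else 0)"
proof -
  have "split_vec I $ (a, b, c, d) = ((if (a \<in> I) \<noteq> (d \<in> I) then 1 else 0) + (if (b \<in> I) \<noteq> (c \<in> I) then 1 else 0)
      - (if (a \<in> I) \<noteq> (b \<in> I) then 1 else 0) - (if (c \<in> I) \<noteq> (d \<in> I) then 1 else 0)) / 2"
    using assms by (simp only: split_vec_def double_ratio_def vec_lambda_beta case_prod_conv if_True)
  then show ?thesis by (cases "a \<in> I"; cases "b \<in> I"; cases "c \<in> I"; cases "d \<in> I"; simp add: separates_def)
qed

lemma split_vec_coord_0: "\<not> distinct [a, b, c, d] \<Longrightarrow> split_vec I $ (a, b, c, d) = 0"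
  by (simp add: split_vec_def double_ratio_def)

lemma split_vec_coord_values: "split_vec I $ k \<in> {-1, 0, 1}"
proof -
  obtain a b c d where k: "k = (a, b, c, d)" by (metis surj_pair)
  show ?thesis
  proof (cases "distinct [a, b, c, d]")
    case True then show ?thesis unfolding k split_vec_coord[OF True] by simp
  next
    case False then show ?thesis unfolding k split_vec_coord_0[OF False] by simp
  qed
qed

lemma two_elements: "card A \<ge> 2 \<Longrightarrow> a \<in> A \<Longrightarrow> \<exists>a'\<in>A. a' \<noteq> a"
proof (rule ccontr)
  assume A: "card A \<ge> 2" "a \<in> A" and "\<not> (\<exists>a'\<in>A. a' \<noteq> a)"
  then have "A = {a}" by blast
  then show False using A(1) by simp
qed

text \<open>Two elements of \<open>J\<close> in different branches below the edge of \<open>J\<close>.\<close>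

lemma split_system_half:
  assumes S: "split_system S" and J: "J \<in> S"
  shows "\<exists>a\<in>J. \<exists>a'\<in>J. a \<noteq> a' \<and> (\<forall>I\<in>S. I \<subset> J \<longrightarrow> \<not> (a \<in> I \<and> a' \<in> I))"
proof (cases "\<exists>I\<in>S. I \<subset> J")
  case False
  have "card J \<ge> 2" using split_systemD(1)[OF S J] by (simp add: nontrivial_def)
  then have "J \<noteq> {}" by auto
  then obtain a where "a \<in> J" by blast
  moreover then obtain a' where "a' \<in> J" "a' \<noteq> a" using two_elements[OF \<open>card J \<ge> 2\<close>] by blast
  ultimately have "a \<in> J" "a' \<in> J" "a \<noteq> a'" by auto
  then show ?thesis using False by blast
next
  case True
  then have "{I \<in> S. I \<subset> J} \<noteq> {}" by blast
  then obtain M where "M \<in> {I \<in> S. I \<subset> J}" "\<forall>I\<in>{I \<in> S. I \<subset> J}. M \<subseteq> I \<longrightarrow> M = I"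
    by (rule bexE[OF finite_has_maximal[OF finite]]) (rule that)
  then have M: "M \<in> S" "M \<subset> J" "\<And>I. I \<in> S \<Longrightarrow> I \<subset> J \<Longrightarrow> M \<subseteq> I \<Longrightarrow> I = M"
    by blast+
  have "M \<noteq> {}" using split_systemD(1)[OF S M(1)] by (auto simp: nontrivial_def)
  then obtain a a' where a: "a \<in> M" "a' \<in> J" "a' \<notin> M" using M(2) by blast
  have "- J \<noteq> {}" using split_systemD(1)[OF S J] by (metis card.empty not_numeral_le_zero nontrivial_def)
  then have U: "J \<noteq> UNIV" by blast
  have "\<not> (a \<in> I \<and> a' \<in> I)" if I: "I \<in> S" "I \<subset> J" for I
  proof
    assume aI: "a \<in> I \<and> a' \<in> I"
    have "M \<inter> I \<noteq> {}" "\<not> I \<subseteq> M" using aI a by blast+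
    moreover have "M \<union> I \<noteq> UNIV" using U I(2) M(2) by blast
    ultimately have "M \<subseteq> I" using split_systemD(3)[OF S M(1) I(1)] unfolding compat_def by blast
    then show False using M(3)[OF I] a aI by blast
  qed
  then have "\<forall>I\<in>S. I \<subset> J \<longrightarrow> \<not> (a \<in> I \<and> a' \<in> I)" by blast
  moreover have "a \<in> J" "a \<noteq> a'" using a M(2) by blast+
  ultimately show ?thesis using a(2) by (intro bexI[of _ a] bexI[of _ a'] conjI) assumption+
qed

text \<open>The coordinate \<open>k\<close> is dual to \<open>split_vec J\<close> among the splits
  of \<open>S\<close> and nonnegative on all splits compatible with \<open>J\<close>. It serves as
  the facet functional for removing \<open>J\<close>, as a witness of linear independence, and as
  the integral coordinate that fixes the lattice normal.\<close>

definition quartet :: "'l::finite set set \<Rightarrow> 'l set \<Rightarrow> 'l \<times> 'l \<times> 'l \<times> 'l \<Rightarrow> bool" where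
  "quartet S J k \<longleftrightarrow> (\<forall>I\<in>S. split_vec I $ k = (if I = J \<or> I = - J then 1 else 0)) \<and>
     (\<forall>I. compat I J \<longrightarrow> split_vec I $ k \<ge> 0) \<and> split_vec J $ k = 1"

lemma compat_coord_nonneg:
  assumes "compat I J" "a \<in> J" "a' \<in> J" "b \<notin> J" "b' \<notin> J"
  shows "split_vec I $ (a, a', b, b') \<ge> 0"
proof (cases "distinct [a, a', b, b']")
  case True
  then show ?thesis using assms unfolding split_vec_coord[OF True] compat_def separates_def by auto
qed (simp add: split_vec_coord_0)

text \<open>Choose on each side of the edge two labels that part at its end point. Up to exchanging
  its sides, any other split of \<open>S\<close> lies properly inside \<open>J\<close> or
  \<open>- J\<close>; it misses the pair on the other side and cannot contain both labels of the
  pair on its own side.\<close>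

lemma quartet_exists:
  assumes S: "split_system S" and J: "J \<in> S"
  obtains k where "quartet S J k"
proof -
  have J': "- J \<in> S" using split_systemD(2)[OF S J] .
  obtain a a' where a: "a \<in> J" "a' \<in> J" "a \<noteq> a'" "\<And>I. I \<in> S \<Longrightarrow> I \<subset> J \<Longrightarrow> \<not> (a \<in> I \<and> a' \<in> I)"
    using split_system_half[OF S J] by blast
  obtain b b' where b: "b \<notin> J" "b' \<notin> J" "b \<noteq> b'" "\<And>I. I \<in> S \<Longrightarrow> I \<subset> - J \<Longrightarrow> \<not> (b \<in> I \<and> b' \<in> I)"
    using split_system_half[OF S J'] by blast
  have dist: "distinct [a, a', b, b']" using a b by auto
  have "split_vec I $ (a, a', b, b') = 0" if I: "I \<in> S" "I \<noteq> J" "I \<noteq> - J" for I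
  proof -
    have c: "compat I J" "- I \<in> S" using split_systemD(3)[OF S I(1) J] split_systemD(2)[OF S I(1)] .
    then consider "I \<subset> - J" | "I \<subset> J" | "- I \<subset> - J" | "- I \<subset> J"
      using I(2,3) unfolding compat_def by blast
    then show ?thesis
    proof cases
      case 1 then show ?thesis unfolding split_vec_coord[OF dist] separates_def using b(4)[OF I(1)] a by auto
    next
      case 2 then show ?thesis unfolding split_vec_coord[OF dist] separates_def using a(4)[OF I(1)] b by auto
    next
      case 3 then show ?thesis unfolding split_vec_coord[OF dist] separates_def using b(4)[OF c(2)] a by auto
    next
      case 4 then show ?thesis unfolding split_vec_coord[OF dist] separates_def using a(4)[OF c(2)] b by auto
    qed
  qed
  moreover have one: "split_vec J $ (a, a', b, b') = 1" unfolding split_vec_coord[OF dist] separates_def using a b by simp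
  ultimately have "quartet S J (a, a', b, b')"
    unfolding quartet_def using compat_coord_nonneg a b by (auto simp: split_vec_uminus)
  then show ?thesis using that by blast
qed

text \<open>The sum runs over both sides of every split, so the length of a split is
  \<open>x I + x (- I)\<close>.\<close>

definition split_cone :: "'l::finite set set \<Rightarrow> 'l ambient set" where
  "split_cone S = {\<Sum>I\<in>S. x I *\<^sub>R split_vec I |x. \<forall>I\<in>S. x I \<ge> 0}"

lemma split_cone_mono: "T \<subseteq> S \<Longrightarrow> split_cone T \<subseteq> split_cone S"
proof
  fix y assume T: "T \<subseteq> S" and "y \<in> split_cone T"
  then obtain x where x: "y = (\<Sum>I\<in>T. x I *\<^sub>R split_vec I)" "\<forall>I\<in>T. x I \<ge> 0" by (auto simp: split_cone_def)
  have "y = (\<Sum>I\<in>S. (if I \<in> T then x I else 0) *\<^sub>R split_vec I)"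
    unfolding x(1) by (rule sum.mono_neutral_cong_left) (use T in auto)
  then show "y \<in> split_cone S" unfolding split_cone_def using x(2)
    by (intro CollectI exI[of _ "\<lambda>I. if I \<in> T then x I else 0"]) auto
qed

lemma zero_mem_split_cone: "0 \<in> split_cone S"
  unfolding split_cone_def by (rule CollectI, rule exI[of _ "\<lambda>_. 0"]) simp

lemma split_vec_mem_cone: "I \<in> S \<Longrightarrow> split_vec I \<in> split_cone S"
  unfolding split_cone_def
  by (rule CollectI, rule exI[of _ "\<lambda>K. if K = I then 1 else 0"]) (simp add: sum.delta if_distrib[of "\<lambda>c. c *\<^sub>R _"] cong: if_cong)

lemma convex_split_cone: "convex (split_cone S)"
proof (rule convexI)
  fix y z :: "'a ambient" and u v :: real
  assume y: "y \<in> split_cone S" and z: "z \<in> split_cone S" and uv: "0 \<le> u" "0 \<le> v" "u + v = 1"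
  obtain x where x: "y = (\<Sum>I\<in>S. x I *\<^sub>R split_vec I)" "\<forall>I\<in>S. x I \<ge> 0" using y by (auto simp: split_cone_def)
  obtain w where w: "z = (\<Sum>I\<in>S. w I *\<^sub>R split_vec I)" "\<forall>I\<in>S. w I \<ge> 0" using z by (auto simp: split_cone_def)
  have "u *\<^sub>R y + v *\<^sub>R z = (\<Sum>I\<in>S. (u * x I + v * w I) *\<^sub>R split_vec I)"
    unfolding x(1) w(1) by (simp add: scaleR_sum_right sum.distrib scaleR_add_left)
  then show "u *\<^sub>R y + v *\<^sub>R z \<in> split_cone S" unfolding split_cone_def
    using x(2) w(2) uv by (intro CollectI exI[of _ "\<lambda>I. u * x I + v * w I"]) auto
qed

text \<open>The splits that occur in \<open>y\<close> with positive length, read off from \<open>y\<close> alone.\<close>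

definition support :: "'l::finite ambient \<Rightarrow> 'l set set" where
  "support y = {J. nontrivial J \<and> (\<forall>a\<in>J. \<forall>a'\<in>J. \<forall>b\<in>-J. \<forall>b'\<in>-J. a \<noteq> a' \<longrightarrow> b \<noteq> b' \<longrightarrow> y $ (a, a', b, b') > 0)}"

text \<open>Buneman's argument: clusters containing a common label and missing another one are nested.\<close>

lemma split_system_closure:
  fixes S :: "'l::finite set set"
  assumes S: "split_system S" and J: "nontrivial J"
    and sep: "\<And>a a' b b'. a \<in> J \<Longrightarrow> a' \<in> J \<Longrightarrow> b \<notin> J \<Longrightarrow> b' \<notin> J \<Longrightarrow> a \<noteq> a' \<Longrightarrow> b \<noteq> b' \<Longrightarrow>
       \<exists>I\<in>S. a \<in> I \<and> a' \<in> I \<and> b \<notin> I \<and> b' \<notin> I"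
  shows "J \<in> S"
proof -
  have J2: "card J \<ge> 2" "card (-J) \<ge> 2" using J by (auto simp: nontrivial_def)
  have "- J \<noteq> {}" "J \<noteq> {}" using J2 by (metis card.empty not_numeral_le_zero)+
  then obtain a b0 where a: "a \<in> J" and b0: "b0 \<notin> J" by blast
  have chain: "I \<subseteq> I' \<or> I' \<subseteq> I" if "I \<in> S" "I' \<in> S" "a \<in> I" "a \<in> I'" "b0 \<notin> I" "b0 \<notin> I'" for I I'
    using split_systemD(3)[OF S that(1,2)] that unfolding compat_def by blast
  \<comment> \<open>A smallest member containing \<open>a\<close> and \<open>a'\<close> but not
    \<open>b0\<close> works: for every other \<open>b\<close> outside \<open>J\<close>, some member
    of \<open>S\<close> contains the two labels and misses \<open>b0\<close> and \<open>b\<close>,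
    and by nestedness it contains the smallest one.\<close>
  have inner: "\<exists>I\<in>S. a \<in> I \<and> a' \<in> I \<and> I \<subseteq> J" if a': "a' \<in> J" "a' \<noteq> a" for a'
  proof -
    let ?A = "{I \<in> S. a \<in> I \<and> a' \<in> I \<and> b0 \<notin> I}"
    obtain b1 where b1: "b1 \<notin> J" "b1 \<noteq> b0" using two_elements[OF J2(2), of b0] b0 by auto
    have "?A \<noteq> {}" using sep[OF a a'(1) b0 b1(1)] a' b1 by blast
    then obtain M where M: "M \<in> ?A" "\<forall>I\<in>?A. I \<subseteq> M \<longrightarrow> M = I"
      by (rule bexE[OF finite_has_minimal[OF finite]]) (rule that)
    have "b \<notin> M" if b: "b \<notin> J" for b
    proof (cases "b = b0")
      case False
      then obtain I where I: "I \<in> S" "a \<in> I" "a' \<in> I" "b0 \<notin> I" "b \<notin> I" using sep[OF a a'(1) b0 b] a' by blast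
      then have "M \<subseteq> I" using chain[of I M] M by blast
      then show ?thesis using I by blast
    qed (use M in blast)
    then show ?thesis using M by blast
  qed
  \<comment> \<open>These members share \<open>a\<close> and miss \<open>b0\<close>, so they form a
    chain. Its largest element contains every label of \<open>J\<close>.\<close>
  let ?B = "{I \<in> S. a \<in> I \<and> I \<subseteq> J}"
  obtain a1 where "a1 \<in> J" "a1 \<noteq> a" using two_elements[OF J2(1) a] by blast
  then have "?B \<noteq> {}" using inner by blast
  then obtain M where M: "M \<in> ?B" "\<forall>I\<in>?B. M \<subseteq> I \<longrightarrow> M = I"
    by (rule bexE[OF finite_has_maximal[OF finite]]) (rule that)
  have "a' \<in> M" if a': "a' \<in> J" for a'
  proof (cases "a' = a")
    case False
    then obtain I where I: "I \<in> S" "a \<in> I" "a' \<in> I" "I \<subseteq> J" using inner[OF a'] by blast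
    have "b0 \<notin> I" "b0 \<notin> M" using I(4) M(1) b0 by auto
    then have "I \<subseteq> M" using chain[of I M] I M by blast
    then show ?thesis using I by blast
  qed (use M in blast)
  then have "J = M" using M(1) by blast
  then show ?thesis using M(1) by blast
qed

text \<open>On a quartet across \<open>J\<close>, splits compatible with \<open>J\<close> cannot
  cancel, so a split of positive length is seen. Conversely, a positive coordinate requires an
  occurring split that separates the quartet, and \<open>split_system_closure\<close> applies to the
  system of occurring splits.\<close>

lemma support_eq:
  fixes S :: "'l::finite set set"
  assumes S: "split_system S" and x: "\<And>I. I \<in> S \<Longrightarrow> x I \<ge> 0"
  shows "support (\<Sum>I\<in>S. x I *\<^sub>R split_vec I) = {I \<in> S. x I + x (- I) > 0}"
proof
  let ?y = "\<Sum>I\<in>S. x I *\<^sub>R split_vec I"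
  let ?P = "{I \<in> S. x I + x (- I) > 0}"
  have y: "?y $ k = (\<Sum>I\<in>S. x I * split_vec I $ k)" for k by simp
  show "?P \<subseteq> support ?y"
  proof
    fix J assume J: "J \<in> ?P"
    then have JS: "J \<in> S" "- J \<in> S" using split_systemD(2)[OF S] by auto
    have "?y $ (a, a', b, b') > 0" if ab: "a \<in> J" "a' \<in> J" "b \<in> -J" "b' \<in> -J" "a \<noteq> a'" "b \<noteq> b'" for a a' b b'
    proof -
      have dist: "distinct [a, a', b, b']" using ab by auto
      have nn: "x I * split_vec I $ (a, a', b, b') \<ge> 0" if "I \<in> S" for I
        using x[OF that] compat_coord_nonneg[OF split_systemD(3)[OF S that JS(1)]] ab by simp
      have one: "split_vec J $ (a, a', b, b') = 1" unfolding split_vec_coord[OF dist] separates_def using ab by simp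
      have ne: "J \<noteq> - J" using ab by blast
      have "0 < x J + x (- J)" using J by simp
      also have "\<dots> = (\<Sum>I\<in>{J, - J}. x I * split_vec I $ (a, a', b, b'))"
        using one ne by (simp add: split_vec_uminus)
      also have "\<dots> \<le> (\<Sum>I\<in>S. x I * split_vec I $ (a, a', b, b'))"
        by (rule sum_mono2) (use JS nn in auto)
      finally show ?thesis unfolding y .
    qed
    then show "J \<in> support ?y" unfolding support_def using split_systemD(1)[OF S JS(1)] by blast
  qed
  show "support ?y \<subseteq> ?P"
  proof
    fix J assume J: "J \<in> support ?y"
    have P: "split_system ?P"
      by (rule split_system_subset[OF S]) (use split_systemD(2)[OF S] in \<open>auto simp: add.commute\<close>)
    show "J \<in> ?P"
    proof (rule split_system_closure[OF P])
      show "nontrivial J" using J by (simp add: support_def)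
      fix a a' b b' assume ab: "a \<in> J" "a' \<in> J" "b \<notin> J" "b' \<notin> J" "a \<noteq> a'" "b \<noteq> b'"
      have dist: "distinct [a, a', b, b']" using ab by auto
      have "(\<Sum>I\<in>S. x I * split_vec I $ (a, a', b, b')) > 0"
        using J ab unfolding support_def y[symmetric] by blast
      then obtain I where I: "I \<in> S" "x I * split_vec I $ (a, a', b, b') > 0"
        by (metis (no_types, lifting) not_less sum_nonpos)
      then have xI: "x I > 0" "split_vec I $ (a, a', b, b') > 0"
        using x[OF I(1)] by (auto simp: zero_less_mult_iff)
      have PI: "I \<in> ?P" "- I \<in> ?P" using I(1) xI(1) x[of "-I"] split_systemD(2)[OF S I(1)] by auto
      have "separates I a a' b b'"
        using xI(2) unfolding split_vec_coord[OF dist] by (simp split: if_splits)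
      then consider "a \<in> I \<and> a' \<in> I \<and> b \<notin> I \<and> b' \<notin> I" | "a \<in> - I \<and> a' \<in> - I \<and> b \<notin> - I \<and> b' \<notin> - I"
        unfolding separates_def by blast
      then show "\<exists>I\<in>?P. a \<in> I \<and> a' \<in> I \<and> b \<notin> I \<and> b' \<notin> I" 
      proof cases
        case 1 show ?thesis using PI(1) 1 by (intro bexI[of _ I])
      next
        case 2 show ?thesis using PI(2) 2 by (intro bexI[of _ "- I"])
      qed
    qed
  qed
qed

lemma support_props:
  assumes S: "split_system S" and y: "y \<in> split_cone S"
  shows "support y \<subseteq> S" "split_system (support y)"
    "\<exists>x. (\<forall>I\<in>support y. x I > 0) \<and> y = (\<Sum>I\<in>support y. x I *\<^sub>R split_vec I)"
proof -
  obtain x where x: "y = (\<Sum>I\<in>S. x I *\<^sub>R split_vec I)" "\<forall>I\<in>S. x I \<ge> 0" using y by (auto simp: split_cone_def)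
  have supp: "support y = {I \<in> S. x I + x (- I) > 0}" unfolding x(1) by (rule support_eq[OF S]) (use x(2) in blast)
  then show sub: "support y \<subseteq> S" by blast
  show "split_system (support y)"
    by (rule split_system_subset[OF S sub]) (use split_systemD(2)[OF S] in \<open>auto simp: supp add.commute\<close>)
  \<comment> \<open>A split may carry its length on one side only. Averaging over the two sides
    makes all coefficients on \<open>support y\<close> positive.\<close>
  define x' where "x' I = (x I + x (- I)) / 2" for I
  have bij: "bij_betw uminus S S"
    by (rule bij_betwI[where g = uminus]) (use split_systemD(2)[OF S] in auto)
  have "(\<Sum>I\<in>S. x (- I) *\<^sub>R split_vec I) = (\<Sum>I\<in>S. x I *\<^sub>R split_vec I)"
    using sum.reindex_bij_betw[OF bij, of "\<lambda>I. x I *\<^sub>R split_vec I"] by (simp add: split_vec_uminus)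
  then have "y = (1/2) *\<^sub>R (\<Sum>I\<in>S. x I *\<^sub>R split_vec I) + (1/2) *\<^sub>R (\<Sum>I\<in>S. x (- I) *\<^sub>R split_vec I)"
    unfolding x(1) by (simp only: scaleR_left_distrib[symmetric]) simp
  also have "\<dots> = (\<Sum>I\<in>S. x' I *\<^sub>R split_vec I)"
    unfolding scaleR_sum_right sum.distrib[symmetric]
    by (rule sum.cong[OF refl]) (simp add: x'_def add_divide_distrib scaleR_add_left)
  also have "\<dots> = (\<Sum>I\<in>support y. x' I *\<^sub>R split_vec I)"
  proof (rule sum.mono_neutral_right)
    show "\<forall>I\<in>S - support y. x' I *\<^sub>R split_vec I = 0"
    proof
      fix I assume I: "I \<in> S - support y"
      then have "x I \<ge> 0" "x (- I) \<ge> 0" using x(2) split_systemD(2)[OF S] by auto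
      then show "x' I *\<^sub>R split_vec I = 0" using I by (auto simp: supp x'_def)
    qed
  qed (use sub in auto)
  finally have "y = (\<Sum>I\<in>support y. x' I *\<^sub>R split_vec I)" .
  moreover have "\<forall>I\<in>support y. x' I > 0" by (simp add: supp x'_def)
  ultimately show "\<exists>x. (\<forall>I\<in>support y. x I > 0) \<and> y = (\<Sum>I\<in>support y. x I *\<^sub>R split_vec I)" by blast
qed

lemma mem_cone_support:
  assumes "split_system S" "y \<in> split_cone S" shows "y \<in> split_cone (support y)"
proof -
  obtain x where "\<forall>I\<in>support y. x I > 0" "y = (\<Sum>I\<in>support y. x I *\<^sub>R split_vec I)"
    using support_props(3)[OF assms] by blast
  then show ?thesis unfolding split_cone_def by (intro CollectI exI[of _ x]) (auto intro: less_imp_le)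
qed

text \<open>\<open>support y\<close> depends on \<open>y\<close> alone and hence lies in both
  systems.\<close>

lemma split_cone_Int:
  assumes "split_system S" "split_system T"
  shows "split_cone S \<inter> split_cone T = split_cone (S \<inter> T)"
proof
  show "split_cone S \<inter> split_cone T \<subseteq> split_cone (S \<inter> T)"
  proof
    fix y assume y: "y \<in> split_cone S \<inter> split_cone T"
    then have "support y \<subseteq> S \<inter> T" using support_props(1)[OF assms(1)] support_props(1)[OF assms(2)] by blast
    then show "y \<in> split_cone (S \<inter> T)" using mem_cone_support[OF assms(1)] y split_cone_mono by blast
  qed
qed (simp add: split_cone_mono)

lemma support_generic: 
  assumes "split_system S"
  shows "support (\<Sum>I\<in>S. split_vec I) = S"
  using support_eq[OF assms, of "\<lambda>_. 1"] by simp

lemma rel_interior_split_cone: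
  assumes S: "split_system S" and y: "y \<in> split_cone S" and supp: "support y = S"
  shows "y \<in> rel_interior (split_cone S)"
proof -
  have "split_cone S \<noteq> {}" using y by blast
  moreover have "\<exists>e>1. (1 - e) *\<^sub>R z + e *\<^sub>R y \<in> split_cone S" if z: "z \<in> split_cone S" for z
  proof -
    obtain w where w: "z = (\<Sum>I\<in>S. w I *\<^sub>R split_vec I)" "\<forall>I\<in>S. w I \<ge> 0" using z by (auto simp: split_cone_def)
    obtain x where x: "\<forall>I\<in>S. x I > 0" "y = (\<Sum>I\<in>S. x I *\<^sub>R split_vec I)"
      using support_props(3)[OF S y] supp by auto
    \<comment> \<open>The segment from \<open>z\<close> can be prolonged beyond \<open>y\<close> as
      long as \<open>e * w I \<le> x I\<close>. The summand \<open>1\<close> avoids a division by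
      zero, and the inserted \<open>1\<close> covers \<open>S = {}\<close>.\<close>
    define e where "e = Min (insert 1 ((\<lambda>I. x I / (1 + w I)) ` S))"
    have e: "e > 0" unfolding e_def using x(1) w(2) by (auto intro!: divide_pos_pos add_pos_nonneg)
    have le: "e * w I \<le> x I" if I: "I \<in> S" for I
    proof -
      have "e \<le> x I / (1 + w I)" unfolding e_def using I by (intro Min_le) auto
      then have "e * (1 + w I) \<le> x I" using w(2) I by (simp add: pos_le_divide_eq add_pos_nonneg)
      then show ?thesis using e by (simp add: distrib_left)
    qed
    have "(1 - (1 + e)) *\<^sub>R z + (1 + e) *\<^sub>R y = (\<Sum>I\<in>S. ((1 + e) * x I - e * w I) *\<^sub>R split_vec I)"
      unfolding w(1) x(2) by (simp add: scaleR_sum_right sum_negf sum.distrib sum_subtractf scaleR_diff_left)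
    moreover have "(1 + e) * x I - e * w I \<ge> 0" if I: "I \<in> S" for I
    proof -
      have "e * x I \<ge> 0" "x I > 0" using e x(1) I by auto
      then show ?thesis using le[OF I] by (simp add: distrib_right)
    qed
    ultimately have "(1 - (1 + e)) *\<^sub>R z + (1 + e) *\<^sub>R y \<in> split_cone S"
      unfolding split_cone_def by (intro CollectI exI[of _ "\<lambda>I. (1 + e) * x I - e * w I"]) auto
    then show ?thesis using e by (intro exI[of _ "1 + e"]) auto
  qed
  ultimately show ?thesis using convex_rel_interior_iff[OF convex_split_cone] by blast
qed

section \<open>The fan of rational tropical curves\<close>

text \<open>The second factor is the position of the base leg in the plane.\<close>

definition fan_cell :: "'l::finite set set \<Rightarrow> ('l ambient \<times> (real^2)) set" where
  "fan_cell S = split_cone S \<times> UNIV"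

definition split_span :: "'l::finite set set \<Rightarrow> ('l ambient \<times> (real^2)) set" where
  "split_span S = span (split_vec ` S) \<times> UNIV"

lemma subspace_split_span: "subspace (split_span S)"
  unfolding split_span_def by (intro subspace_Times subspace_span subspace_UNIV)

lemma fan_cell_convex: "convex (fan_cell S)" and fan_cell_ne: "fan_cell S \<noteq> {}"
  unfolding fan_cell_def using zero_mem_split_cone by (auto intro: convex_Times convex_split_cone)

lemma direction_space_fan_cell: "direction_space (fan_cell S) = split_span S"
proof
  have cone: "split_cone S \<subseteq> span (split_vec ` S)"
    unfolding split_cone_def by (auto intro!: span_sum span_scale intro: span_base)
  show "direction_space (fan_cell S) \<subseteq> split_span S"
    unfolding direction_space_def
    by (rule span_minimal[OF _ subspace_split_span]) (use cone in \<open>auto simp: fan_cell_def split_span_def intro: span_diff\<close>)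
  have D: "subspace (direction_space (fan_cell S))" by (rule subspace_direction_space)
  have 1: "(v, 0) \<in> direction_space (fan_cell S)" if "v \<in> span (split_vec ` S)" for v
    using that
  proof (rule span_induct)
    show "subspace {v. (v, 0) \<in> direction_space (fan_cell S)}"
    proof (rule subspaceI)
      show "0 \<in> {v. (v, 0) \<in> direction_space (fan_cell S)}" using subspace_0[OF D] by (simp add: zero_prod_def)
    next
      fix x y assume "x \<in> {v. (v, 0) \<in> direction_space (fan_cell S)}" "y \<in> {v. (v, 0) \<in> direction_space (fan_cell S)}"
      then show "x + y \<in> {v. (v, 0) \<in> direction_space (fan_cell S)}"
        using subspace_add[OF D, of "(x, 0)" "(y, 0)"] by simp
    next
      fix c x assume "x \<in> {v. (v, 0) \<in> direction_space (fan_cell S)}"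
      then show "c *\<^sub>R x \<in> {v. (v, 0) \<in> direction_space (fan_cell S)}"
        using subspace_scale[OF D, of "(x, 0)" c] by simp
    qed
    fix v assume "v \<in> split_vec ` S"
    then have "(v, 0) \<in> fan_cell S" using split_vec_mem_cone by (auto simp: fan_cell_def)
    moreover have "(0, 0) \<in> fan_cell S" using zero_mem_split_cone by (auto simp: fan_cell_def)
    ultimately show "(v, 0) \<in> direction_space (fan_cell S)" using diff_mem_direction_space by fastforce
  qed
  have 2: "(0, w) \<in> direction_space (fan_cell S)" for w
  proof -
    have "(0, w) \<in> fan_cell S" "(0, 0) \<in> fan_cell S" using zero_mem_split_cone by (auto simp: fan_cell_def)
    then show ?thesis using diff_mem_direction_space by fastforce
  qed
  show "split_span S \<subseteq> direction_space (fan_cell S)"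
  proof
    fix u assume u: "u \<in> split_span S"
    then have "(fst u, 0) + (0, snd u) \<in> direction_space (fan_cell S)"
      using 1 2 by (intro subspace_add[OF D]) (auto simp: split_span_def)
    then show "u \<in> direction_space (fan_cell S)" by simp
  qed
qed

lemma rel_interior_fan_cell:
  assumes S: "split_system S" and y: "y \<in> fan_cell S" and supp: "support (fst y) = S"
  shows "y \<in> rel_interior (fan_cell S)"
proof -
  have "fst y \<in> rel_interior (split_cone S)"
    using rel_interior_split_cone[OF S _ supp] y by (auto simp: fan_cell_def)
  then show ?thesis unfolding fan_cell_def
    by (subst rel_interior_Times[OF convex_split_cone convex_UNIV]) (auto simp: mem_Times_iff)
qed

lemma quartet_kernel:
  assumes S: "split_system S" and J: "J \<in> S" and q: "quartet S J k"
  shows "split_span (S - {J, - J}) = {v \<in> split_span S. fst v $ k = 0}"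
proof -
  let ?S' = "S - {J, - J}"
  have lin: "linear (\<lambda>v :: 'a ambient. v $ k)" by (rule linearI) auto
  have zero: "v $ k = 0" if "v \<in> span (split_vec ` ?S')" for v
  proof (rule linear_eq_0_on_span[OF lin _ that])
    fix w assume "w \<in> split_vec ` ?S'"
    then obtain I where "w = split_vec I" "I \<in> S" "I \<noteq> J" "I \<noteq> - J" by blast
    then show "w $ k = 0" using q unfolding quartet_def by presburger
  qed
  have "split_vec ` S = insert (split_vec J) (split_vec ` ?S')"
    using J split_systemD(2)[OF S J] by (auto simp: split_vec_uminus)
  then have ins: "span (split_vec ` S) = {v. \<exists>r. v - r *\<^sub>R split_vec J \<in> span (split_vec ` ?S')}"
    using span_insert by metis
  have "v \<in> span (split_vec ` ?S')" if v: "v \<in> span (split_vec ` S)" "v $ k = 0" for v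
  proof -
    obtain r where r: "v - r *\<^sub>R split_vec J \<in> span (split_vec ` ?S')" using v(1) ins by blast
    have "(v - r *\<^sub>R split_vec J) $ k = - r" using v(2) q by (simp add: quartet_def)
    then have "r = 0" using zero[OF r] by simp
    then show ?thesis using r by simp
  qed
  moreover have "span (split_vec ` ?S') \<subseteq> span (split_vec ` S)" by (intro span_mono image_mono) auto
  ultimately have eq: "span (split_vec ` ?S') = {v \<in> span (split_vec ` S). v $ k = 0}" using zero by blast
  show ?thesis unfolding split_span_def eq by auto
qed

lemma quartet_nonneg:
  assumes S: "split_system S" and J: "J \<in> S" and q: "quartet S J k" and y: "y \<in> fan_cell S"
  shows "fst y $ k \<ge> 0"
proof -
  obtain x where x: "fst y = (\<Sum>I\<in>S. x I *\<^sub>R split_vec I)" "\<forall>I\<in>S. x I \<ge> 0"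
    using y by (auto simp: fan_cell_def split_cone_def)
  have "fst y $ k = (\<Sum>I\<in>S. x I * split_vec I $ k)" using x(1) by simp
  also have "\<dots> \<ge> 0" by (rule sum_nonneg) (use x(2) q in \<open>auto simp: quartet_def\<close>)
  finally show ?thesis .
qed

lemma linear_fst_nth: "linear (\<lambda>v :: (real^'k) \<times> (real^2). fst v $ k)"
  by (rule linearI) auto

text \<open>The plane accounts for the 4. Each pair \<open>J\<close>, \<open>- J\<close> adds one
  dimension, since the kernel of its quartet coordinate is spanned by the remaining splits and the
  plane. The factor 2 reflects that both sides of a split are counted.\<close>

lemma dim_split_span:
  fixes S :: "'l::finite set set"
  assumes "split_system S" shows "2 * dim (split_span S) = card S + 4"
  using finite[of S] assms
proof (induction "card S" arbitrary: S rule: less_induct)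
  case less
  show ?case
  proof (cases "S = {}")
    case True
    have "split_span ({} :: 'l set set) = {0} \<times> UNIV" by (simp add: split_span_def)
    then show ?thesis using True by (simp add: dim_Times)
  next
    case False
    then obtain J where J: "J \<in> S" by blast
    obtain k where k: "quartet S J k" using quartet_exists[OF less.prems(2) J] .
    have "J \<noteq> {}" using split_systemD(1)[OF less.prems(2) J] by (auto simp: nontrivial_def)
    then have "J \<noteq> - J" by blast
    then have "card {J, - J} = 2" by simp
    moreover have "{J, - J} \<subseteq> S" using J split_systemD(2)[OF less.prems(2) J] by blast
    ultimately have c: "card (S - {J, - J}) = card S - 2" "card S \<ge> 2"
      using card_Diff_subset[of "{J, - J}" S] card_mono[OF finite, of "{J, - J}" S] by auto
    have "split_system (S - {J, - J})" using split_system_remove[OF less.prems(2)] .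
    then have IH: "2 * dim (split_span (S - {J, - J})) = card (S - {J, - J}) + 4"
      using less.hyps[of "S - {J, - J}"] c by simp
    have "dim (split_span S) = Suc (dim {v \<in> split_span S. fst v $ k = 0})"
    proof (rule dim_kernel_on[OF subspace_split_span linear_fst_nth, of "(split_vec J, 0)"])
      show "(split_vec J, 0) \<in> split_span S" using J by (auto simp: split_span_def intro: span_base)
      show "fst (split_vec J, 0 :: real^2) $ k \<noteq> 0" using k by (simp add: quartet_def)
    qed
    then show ?thesis using IH c quartet_kernel[OF less.prems(2) J k] by simp
  qed
qed

lemma aff_dim_fan_cell:
  assumes "split_system S" shows "2 * aff_dim (fan_cell S) = int (card S) + 4"
  using aff_dim_direction_space[OF fan_cell_ne, of S] dim_split_span[OF assms]
  unfolding direction_space_fan_cell by linarith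

lemma fan_cell_Int: "split_system S \<Longrightarrow> split_system T \<Longrightarrow> fan_cell S \<inter> fan_cell T = fan_cell (S \<inter> T)"
  using split_cone_Int[of S T] by (auto simp: fan_cell_def)

lemma fan_cell_mono: "T \<subseteq> S \<Longrightarrow> fan_cell T \<subseteq> fan_cell S"
  unfolding fan_cell_def by (intro Sigma_mono split_cone_mono) simp_all

lemma fan_cell_subset_iff:
  assumes "split_system S" "split_system T"
  shows "fan_cell T \<subseteq> fan_cell S \<longleftrightarrow> T \<subseteq> S"
proof
  assume sub: "fan_cell T \<subseteq> fan_cell S"
  have "(\<Sum>I\<in>T. split_vec I) \<in> split_cone T" unfolding split_cone_def
    by (rule CollectI, rule exI[of _ "\<lambda>_. 1"]) simp
  then have "(\<Sum>I\<in>T. split_vec I) \<in> split_cone S" using sub by (auto simp: fan_cell_def)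
  then show "T \<subseteq> S" using support_props(1)[OF assms(1)] support_generic[OF assms(2)] by blast
qed (rule fan_cell_mono)

lemma fan_cell_inj: "split_system S \<Longrightarrow> split_system T \<Longrightarrow> fan_cell S = fan_cell T \<Longrightarrow> S = T"
  using fan_cell_subset_iff by blast

lemma fan_cell_remove_eq:
  assumes S: "split_system S" and J: "J \<in> S" and q: "quartet S J k"
  shows "fan_cell (S - {J, - J}) = fan_cell S \<inter> {y. fst y $ k = 0}"
proof
  have sub: "fan_cell (S - {J, - J}) \<subseteq> fan_cell S" by (rule fan_cell_mono) blast
  have "fst y $ k = 0" if "y \<in> fan_cell (S - {J, - J})" for y
  proof -
    have "y - 0 \<in> direction_space (fan_cell (S - {J, - J}))"
      by (rule diff_mem_direction_space[OF that]) (simp add: fan_cell_def zero_prod_def zero_mem_split_cone)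
    then show ?thesis unfolding direction_space_fan_cell quartet_kernel[OF assms] by simp
  qed
  then show "fan_cell (S - {J, - J}) \<subseteq> fan_cell S \<inter> {y. fst y $ k = 0}" using sub by blast
  show "fan_cell S \<inter> {y. fst y $ k = 0} \<subseteq> fan_cell (S - {J, - J})"
  proof
    fix y assume y: "y \<in> fan_cell S \<inter> {y. fst y $ k = 0}"
    then have yS: "fst y \<in> split_cone S" by (auto simp: fan_cell_def)
    obtain x where x: "\<forall>I\<in>support (fst y). x I > 0" "fst y = (\<Sum>I\<in>support (fst y). x I *\<^sub>R split_vec I)"
      using support_props(3)[OF S yS] by blast
    have sub: "support (fst y) \<subseteq> S" by (rule support_props(1)[OF S yS])
    have "(\<Sum>I\<in>support (fst y). x I * split_vec I $ k) = 0" using y arg_cong[OF x(2), of "\<lambda>v. v $ k"] by simp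
    moreover have "x I * split_vec I $ k \<ge> 0" if "I \<in> support (fst y)" for I
      using x(1) that q sub by (auto simp: quartet_def less_imp_le)
    ultimately have "\<forall>I\<in>support (fst y). x I * split_vec I $ k = 0"
      using sum_nonneg_eq_0_iff[of "support (fst y)" "\<lambda>I. x I * split_vec I $ k"] by auto
    then have "\<forall>I\<in>support (fst y). I \<noteq> J \<and> I \<noteq> - J" using x(1) q sub by (force simp: quartet_def)
    then have "support (fst y) \<subseteq> S - {J, - J}" using sub by blast
    then have "fst y \<in> split_cone (S - {J, - J})" using mem_cone_support[OF S yS] split_cone_mono by blast
    then show "y \<in> fan_cell (S - {J, - J})" by (auto simp: fan_cell_def mem_Times_iff)
  qed
qed

text \<open>Splits are removed one at a time: the quartet coordinate of the removed split is a
  supporting functional, and a face of a face is a face.\<close>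

lemma fan_cell_face:
  assumes "split_system S" "split_system T" "T \<subseteq> S"
  shows "fan_cell T face_of fan_cell S"
  using assms
proof (induction "card S" arbitrary: S rule: less_induct)
  case less
  show ?case
  proof (cases "T = S")
    case True then show ?thesis by (simp add: face_of_refl fan_cell_convex)
  next
    case False
    then obtain J where J: "J \<in> S" "J \<notin> T" using less.prems by blast
    then have "- J \<notin> T" using split_systemD(2)[OF less.prems(2), of "- J"] by auto
    then have sub: "T \<subseteq> S - {J, - J}" using J less.prems by blast
    obtain k where k: "quartet S J k" using quartet_exists[OF less.prems(1) J(1)] .
    have "card (S - {J, - J}) < card S" using J(1) by (intro psubset_card_mono) auto
    then have "fan_cell T face_of fan_cell (S - {J, - J})"
      using less.hyps less.prems split_system_remove sub by blast
    also have "fan_cell (S - {J, - J}) face_of fan_cell S"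
      unfolding fan_cell_remove_eq[OF less.prems(1) J(1) k]
      by (rule face_of_functional_ge[OF fan_cell_convex linear_fst_nth quartet_nonneg[OF less.prems(1) J(1) k]])
    finally show ?thesis .
  qed
qed

lemma fan_cell_facetE:
  fixes S T :: "'l::finite set set"
  assumes S: "split_system S" and T: "split_system T" and "fan_cell T face_of fan_cell S"
    and "aff_dim (fan_cell S) = aff_dim (fan_cell T) + 1"
  obtains J where "J \<in> S" "J \<notin> T" "- J \<notin> T" "T = S - {J, - J}" "S = T \<union> {J, - J}"
proof -
  have sub: "T \<subseteq> S" using fan_cell_subset_iff[OF S T] face_of_imp_subset[OF assms(3)] by simp
  have c: "card S = card T + 2" using aff_dim_fan_cell[OF S] aff_dim_fan_cell[OF T] assms(4) by linarith
  have "S \<noteq> T" using c by auto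
  then obtain J where J: "J \<in> S" "J \<notin> T" using sub by blast
  then have J': "- J \<notin> T" "- J \<in> S" using split_systemD(2)[OF T, of "- J"] split_systemD(2)[OF S, of J] by auto
  have "J \<noteq> {}" using split_systemD(1)[OF S J(1)] by (auto simp: nontrivial_def)
  then have "J \<noteq> - J" by blast
  then have "card (T \<union> {J, - J}) = card S" using c J J' by (subst card_Un_disjoint) auto
  then have "T \<union> {J, - J} = S" using sub J J' by (intro card_subset_eq) auto
  then show ?thesis using that J J' by blast
qed

lemma tree_lattice_int: "y \<in> tree_lattice \<Longrightarrow> y $ k \<in> \<int>"
  unfolding tree_lattice_def
proof (induction y rule: group_closure.induct)
  case (base s)
  then consider "s = 0" | I where "s = split_vec I" unfolding split_vec_def by blast
  then show ?case
  proof cases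
    case (2 I) then show ?thesis using split_vec_coord_values[of I k] by auto
  qed simp
qed auto

lemma split_vec_mem_lattice: "nontrivial I \<Longrightarrow> split_vec I \<in> tree_lattice"
  unfolding tree_lattice_def split_vec_def nontrivial_def by (rule group_closure.base) blast

lemma add_subgroup_moduli_lattice: "add_subgroup moduli_lattice"
  by (auto simp: add_subgroup_def moduli_lattice_def tree_lattice_def int_vec_def zero_prod_def
      intro: group_closure.intros)

lemma split_span_rational:
  assumes S: "split_system S"
  shows "split_span S \<subseteq> span (moduli_lattice \<inter> split_span S)"
proof
  let ?D = "span (moduli_lattice \<inter> split_span S)"
  have 1: "(v, 0) \<in> ?D" if "v \<in> span (split_vec ` S)" for v
    using that
  proof (rule span_induct)
    show "subspace {v. (v, 0) \<in> ?D}"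
    proof (rule subspaceI)
      show "0 \<in> {v. (v, 0) \<in> ?D}" using span_zero[of "moduli_lattice \<inter> split_span S"] by (simp add: zero_prod_def)
    next
      fix x y assume "x \<in> {v. (v, 0) \<in> ?D}" "y \<in> {v. (v, 0) \<in> ?D}"
      then show "x + y \<in> {v. (v, 0) \<in> ?D}" using span_add[of "(x, 0)" _ "(y, 0)"] by simp
    next
      fix c x assume "x \<in> {v. (v, 0) \<in> ?D}"
      then show "c *\<^sub>R x \<in> {v. (v, 0) \<in> ?D}" using span_scale[of "(x, 0)" _ c] by simp
    qed
    fix v assume "v \<in> split_vec ` S"
    then obtain I where I: "I \<in> S" "v = split_vec I" by blast
    have "split_vec I \<in> tree_lattice" using split_vec_mem_lattice split_systemD(1)[OF S I(1)] by blast
    then have "(v, 0) \<in> moduli_lattice \<inter> split_span S"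
      using I by (auto simp: moduli_lattice_def split_span_def int_vec_def intro: span_base)
    then show "(v, 0) \<in> ?D" by (rule span_base)
  qed
  have 2: "(0, w) \<in> ?D" for w :: "real^2"
  proof -
    have "(0 :: 'a ambient, axis i 1 :: real^2) \<in> moduli_lattice \<inter> split_span S" for i
      by (auto simp: moduli_lattice_def split_span_def int_vec_def axis_def tree_lattice_def span_zero
          intro: group_closure.intros)
    then have ax: "(0 :: 'a ambient, axis i 1 :: real^2) \<in> ?D" for i by (rule span_base)
    have "(\<Sum>i\<in>UNIV. w $ i *\<^sub>R (0 :: 'a ambient, axis i 1 :: real^2)) \<in> ?D"
      by (intro span_sum span_scale ax)
    moreover have "(\<Sum>i\<in>UNIV. w $ i *\<^sub>R (0 :: 'a ambient, axis i 1 :: real^2)) = (0, w)"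
      by (rule prod_eqI) (simp_all add: fst_sum snd_sum vec_eq_iff axis_def if_distrib[of "\<lambda>c. _ * c"] sum.delta cong: if_cong)
    ultimately show ?thesis by simp
  qed
  fix u assume "u \<in> split_span S"
  then have "(fst u, 0) + (0, snd u) \<in> ?D" using 1 2 by (intro span_add) (auto simp: split_span_def)
  then show "u \<in> ?D" by simp
qed

text \<open>The quartet coordinate is integral on the lattice and equals 1 on the lattice vector of
  \<open>J\<close>. So it also equals 1 on the chosen normal vector, and the difference lies in its
  kernel.\<close>

lemma fan_cell_normal_vec:
  assumes S: "split_system S" and J: "J \<in> S"
  defines "n \<equiv> normal_vec moduli_lattice (fan_cell S) (fan_cell (S - {J, - J}))"
  shows "n - (split_vec J, 0) \<in> split_span (S - {J, - J})"
proof -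
  obtain k where k: "quartet S J k" using quartet_exists[OF S J] .
  let ?g = "\<lambda>v :: 'a ambient \<times> (real^2). fst v $ k"
  have int: "?g v \<in> \<int>" if "v \<in> moduli_lattice" for v
    using that tree_lattice_int[of "fst v" k] by (auto simp: moduli_lattice_def)
  have rat: "direction_space (fan_cell S) \<subseteq> span (moduli_lattice \<inter> direction_space (fan_cell S))"
    unfolding direction_space_fan_cell by (rule split_span_rational[OF S])
  have Q: "direction_space (fan_cell (S - {J, - J})) = {v \<in> direction_space (fan_cell S). ?g v = 0}"
    unfolding direction_space_fan_cell by (rule quartet_kernel[OF S J k])
  have sJ: "(split_vec J, 0) \<in> direction_space (fan_cell S)"
    unfolding direction_space_fan_cell using J by (auto simp: split_span_def intro: span_base)
  have gJ: "?g (split_vec J, 0) = 1" using k by (simp add: quartet_def)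
  \<comment> \<open>Start where all remaining splits have positive length. There the component of
    \<open>u\<close> along the facet is harmless for small steps, and the rest of \<open>u\<close>
    lengthens the edge of \<open>J\<close>.\<close>
  have inward: "\<exists>a\<in>fan_cell (S - {J, - J}). \<exists>t>0. a + t *\<^sub>R u \<in> fan_cell S"
    if u: "u \<in> direction_space (fan_cell S)" "?g u > 0" for u
  proof -
    let ?y = "(\<Sum>I\<in>S. split_vec I, 0) :: 'a ambient \<times> (real^2)"
    define w where "w = u - ?g u *\<^sub>R (split_vec J, 0)"
    let ?S' = "S - {J, - J}"
    have S': "split_system ?S'" using split_system_remove[OF S] .
    let ?z = "(\<Sum>I\<in>?S'. split_vec I, 0) :: 'a ambient \<times> (real^2)"
    have "w \<in> direction_space (fan_cell S)" unfolding w_def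
      using u(1) sJ by (intro subspace_diff subspace_scale subspace_direction_space)
    moreover have "?g w = 0" using gJ by (simp add: w_def)
    ultimately have w: "w \<in> direction_space (fan_cell ?S')" using Q by blast
    have "?z \<in> fan_cell ?S'" unfolding fan_cell_def split_cone_def
      by (auto intro!: exI[of _ "\<lambda>_. 1"])
    then have "?z \<in> rel_interior (fan_cell ?S')"
      by (rule rel_interior_fan_cell[OF S']) (simp add: support_generic[OF S'])
    then obtain e where e: "e > 0" "\<And>t. \<bar>t\<bar> \<le> e \<Longrightarrow> ?z + t *\<^sub>R w \<in> fan_cell ?S'"
      using rel_interior_move[OF _ w] by blast
    have "?z + e *\<^sub>R w \<in> fan_cell S" using e fan_cell_subset_iff[OF S S'] by auto
    then obtain x where x: "fst (?z + e *\<^sub>R w) = (\<Sum>I\<in>S. x I *\<^sub>R split_vec I)" "\<forall>I\<in>S. x I \<ge> 0"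
      by (auto simp: fan_cell_def split_cone_def mem_Times_iff)
    have "fst (?z + e *\<^sub>R u) = fst (?z + e *\<^sub>R w) + (e * ?g u) *\<^sub>R split_vec J" by (simp add: w_def algebra_simps)
    also have "\<dots> = (\<Sum>I\<in>S. (x I + (if I = J then e * ?g u else 0)) *\<^sub>R split_vec I)"
      unfolding x(1) using J by (simp add: scaleR_add_left sum.distrib if_distrib[of "\<lambda>c. c *\<^sub>R _"] sum.delta cong: if_cong)
    finally have "fst (?z + e *\<^sub>R u) \<in> split_cone S" unfolding split_cone_def
      using x(2) e(1) u(2) by (intro CollectI exI[of _ "\<lambda>I. x I + (if I = J then e * ?g u else 0)"]) auto
    then have "?z + e *\<^sub>R u \<in> fan_cell S" by (auto simp: fan_cell_def mem_Times_iff)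
    then show ?thesis using e(1) \<open>?z \<in> fan_cell ?S'\<close> by blast
  qed
  have side: "?g a \<le> ?g b" if "a \<in> fan_cell (S - {J, - J})" "b \<in> fan_cell S" for a b
    using that quartet_nonneg[OF S J k] fan_cell_remove_eq[OF S J k] by auto
  note np = normal_vec_props[OF add_subgroup_moduli_lattice linear_fst_nth int rat Q sJ _ inward side, folded n_def]
  have "(split_vec J, 0) \<in> moduli_lattice"
    using split_vec_mem_lattice[OF split_systemD(1)[OF S J]] by (auto simp: moduli_lattice_def int_vec_def)
  then obtain m :: int where "?g (split_vec J, 0) = of_int m * ?g n"
    using np(4)[of "(split_vec J, 0)"] sJ gJ by auto
  then have m: "1 = of_int m * ?g n" using gJ by simp
  have n: "n \<in> moduli_lattice" "n \<in> direction_space (fan_cell S)" "?g n > 0"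
    using np(1-3) gJ by auto
  obtain r :: int where r: "?g n = of_int r" using int[OF n(1)] Ints_cases by blast
  then have "m * r = 1" using m by (metis of_int_eq_1_iff of_int_mult)
  moreover have "r > 0" using r n(3) by simp
  ultimately have "r = 1" using zmult_eq_1_iff[of m r] by auto
  then have "?g (n - (split_vec J, 0)) = 0" using r gJ by simp
  moreover have "n - (split_vec J, 0) \<in> direction_space (fan_cell S)"
    using n(2) sJ by (intro subspace_diff subspace_direction_space)
  ultimately show ?thesis using Q unfolding direction_space_fan_cell by blast
qed

section \<open>Curves whose markings meet in one vertex\<close>

text \<open>For the branches \<B> of a vertex, the sets \<open>E0 \<union> B\<close> are the splits
  joining \<open>E0\<close> to one other branch. The function \<delta> of a split on pairs of labels
  is quadratic in the indicator of a side. The \<open>card \<B> - 1\<close> summands contribute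
  \<delta> of \<open>E0\<close> once each, and the mixed terms take it away twice, because the
  indicators of the other blocks add up to \<open>1 - i E0 x\<close>.\<close>

lemma sum_split_vec_partition:
  fixes \<B> :: "'l::finite set set"
  assumes part: "\<Union>\<B> = UNIV" "\<And>A B. A \<in> \<B> \<Longrightarrow> B \<in> \<B> \<Longrightarrow> A \<noteq> B \<Longrightarrow> A \<inter> B = {}" and E0: "E0 \<in> \<B>"
  shows "(\<Sum>B\<in>\<B> - {E0}. split_vec (E0 \<union> B))
    = (\<Sum>B\<in>\<B> - {E0}. split_vec B) + (real (card \<B>) - 3) *\<^sub>R split_vec E0"
proof -
  define i :: "'l set \<Rightarrow> 'l \<Rightarrow> real" where "i I x = (if x \<in> I then 1 else 0)" for I x
  define \<delta> where "\<delta> I x y = i I x + i I y - 2 * (i I x * i I y)" for I x y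
  have \<delta>: "(if (x \<in> I) \<noteq> (y \<in> I) then 1 else 0) = \<delta> I x y" for I x y by (simp add: \<delta>_def i_def)
  have one: "(\<Sum>B\<in>\<B>. i B x) = 1" for x
  proof -
    have "x \<in> \<Union>\<B>" using part(1) by simp
    then obtain B where B: "B \<in> \<B>" "x \<in> B" by (rule UnionE)
    have "i B' x = (if B' = B then 1 else 0)" if "B' \<in> \<B>" for B'
      using part(2)[OF B(1) that] B(2) by (auto simp: i_def)
    then have "(\<Sum>B\<in>\<B>. i B x) = (\<Sum>B'\<in>\<B>. if B' = B then 1 else 0)" by (intro sum.cong) auto
    then show ?thesis using B(1) by simp
  qed
  have rest: "(\<Sum>B\<in>\<B> - {E0}. i B x) = 1 - i E0 x" for x
    using one[of x] E0 by (simp add: sum_diff1)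
  have un: "i (E0 \<union> B) x = i E0 x + i B x" if "B \<in> \<B> - {E0}" for B x
    using part(2)[OF E0, of B] that by (auto simp: i_def)
  have c: "real (card (\<B> - {E0})) = real (card \<B>) - 1"
  proof -
    have "card \<B> > 0" using E0 by (auto simp: card_gt_0_iff)
    then show ?thesis using E0 by (simp add: of_nat_diff Suc_leI)
  qed
  have key: "(\<Sum>B\<in>\<B> - {E0}. \<delta> (E0 \<union> B) x y) = (\<Sum>B\<in>\<B> - {E0}. \<delta> B x y) + (real (card \<B>) - 3) * \<delta> E0 x y" for x y
  proof -
    have "(\<Sum>B\<in>\<B> - {E0}. \<delta> (E0 \<union> B) x y) = (\<Sum>B\<in>\<B> - {E0}. \<delta> B x y + (i E0 x + i E0 y - 2 * (i E0 x * i E0 y))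
        - 2 * i E0 x * i B y - 2 * i E0 y * i B x)"
      by (rule sum.cong[OF refl]) (simp only: un \<delta>_def, simp add: algebra_simps)
    also have "\<dots> = (\<Sum>B\<in>\<B> - {E0}. \<delta> B x y) + real (card (\<B> - {E0})) * (i E0 x + i E0 y - 2 * (i E0 x * i E0 y))
        - 2 * i E0 x * (\<Sum>B\<in>\<B> - {E0}. i B y) - 2 * i E0 y * (\<Sum>B\<in>\<B> - {E0}. i B x)"
      by (simp add: sum.distrib sum_subtractf sum_distrib_left)
    also have "\<dots> = (\<Sum>B\<in>\<B> - {E0}. \<delta> B x y) + (real (card \<B>) - 3) * \<delta> E0 x y"
      unfolding c rest by (simp add: \<delta>_def algebra_simps)
    finally show ?thesis .
  qed
  show ?thesis
  proof (rule vec_eq_iff[THEN iffD2], rule allI)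
    fix k :: "'l \<times> 'l \<times> 'l \<times> 'l"
    obtain a b u d where k: "k = (a, b, u, d)" by (metis surj_pair)
    have sv: "split_vec I $ k = (if distinct [a, b, u, d] then (\<delta> I a d + \<delta> I b u - \<delta> I a b - \<delta> I u d) / 2 else 0)" for I
      unfolding k split_vec_def double_ratio_def vec_lambda_beta case_prod_conv \<delta> ..
    show "(\<Sum>B\<in>\<B> - {E0}. split_vec (E0 \<union> B)) $ k
        = ((\<Sum>B\<in>\<B> - {E0}. split_vec B) + (real (card \<B>) - 3) *\<^sub>R split_vec E0) $ k"
    proof (cases "distinct [a, b, u, d]")
      case True
      have "(\<Sum>B\<in>\<B> - {E0}. split_vec (E0 \<union> B)) $ k
          = ((\<Sum>B\<in>\<B> - {E0}. \<delta> (E0 \<union> B) a d) + (\<Sum>B\<in>\<B> - {E0}. \<delta> (E0 \<union> B) b u)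
            - (\<Sum>B\<in>\<B> - {E0}. \<delta> (E0 \<union> B) a b) - (\<Sum>B\<in>\<B> - {E0}. \<delta> (E0 \<union> B) u d)) / 2"
        unfolding sum_component sv if_P[OF True] by (simp add: sum_divide_distrib[symmetric] sum.distrib sum_subtractf)
      also have "\<dots> = ((\<Sum>B\<in>\<B> - {E0}. \<delta> B a d) + (\<Sum>B\<in>\<B> - {E0}. \<delta> B b u)
            - (\<Sum>B\<in>\<B> - {E0}. \<delta> B a b) - (\<Sum>B\<in>\<B> - {E0}. \<delta> B u d)) / 2
            + (real (card \<B>) - 3) * ((\<delta> E0 a d + \<delta> E0 b u - \<delta> E0 a b - \<delta> E0 u d) / 2)"
        unfolding key by (simp add: field_simps)
      also have "\<dots> = ((\<Sum>B\<in>\<B> - {E0}. split_vec B) + (real (card \<B>) - 3) *\<^sub>R split_vec E0) $ k"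
        unfolding sum_component sv if_P[OF True] vector_add_component vector_scaleR_component real_scaleR_def
        by (simp add: sum_divide_distrib[symmetric] sum.distrib sum_subtractf)
      finally show ?thesis .
    next
      case False
      then show ?thesis unfolding vector_add_component vector_scaleR_component sum_component sv if_not_P[OF False] by simp
    qed
  qed
qed

text \<open>A single label corresponds to the length of a leg, which \<open>double_ratio\<close>
  divides out.\<close>

lemma split_vec_trivial: "card I \<le> 1 \<Longrightarrow> split_vec I = 0"
proof -
  assume "card I \<le> 1"
  then have I: "\<And>x y. x \<in> I \<Longrightarrow> y \<in> I \<Longrightarrow> x = y" using card_le_Suc0_iff_eq[of I] by simp
  show ?thesis
  proof (rule vec_eq_iff[THEN iffD2], rule allI)
    fix k :: "'a \<times> 'a \<times> 'a \<times> 'a"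
    obtain a b c d where k: "k = (a, b, c, d)" by (metis surj_pair)
    show "split_vec I $ k = 0 $ k"
    proof (cases "distinct [a, b, c, d]")
      case True
      have d: "a \<noteq> b" "a \<noteq> d" "b \<noteq> c" "c \<noteq> d" using True by auto
      have "\<not> separates I a b c d" "\<not> separates I a d b c"
        using I[of a b] I[of c d] I[of a d] I[of b c] d unfolding separates_def by blast+
      then show ?thesis unfolding k split_vec_coord[OF True] by simp
    qed (simp add: k split_vec_coord_0)
  qed
qed

text \<open>A minimal member \<open>A\<close> contains some \<open>a\<close> outside
  \<open>P\<close> and a further label \<open>b\<close>. Dropping \<open>A\<close> from the family
  and \<open>a\<close> from the ground set preserves the hypotheses, as every other member that
  contains \<open>a\<close> or \<open>b\<close> contains \<open>A\<close> properly.\<close>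

lemma laminar_bound:
  fixes \<L> :: "'l set set"
  assumes "finite X" "\<And>A. A \<in> \<L> \<Longrightarrow> A \<subseteq> X" "\<And>A. A \<in> \<L> \<Longrightarrow> card A \<ge> 2" "P \<subseteq> X"
    "\<And>A a b. A \<in> \<L> \<Longrightarrow> a \<in> A \<inter> P \<Longrightarrow> b \<in> A \<inter> P \<Longrightarrow> a = b"
    "\<And>A B. A \<in> \<L> \<Longrightarrow> B \<in> \<L> \<Longrightarrow> A \<inter> B = {} \<or> A \<subseteq> B \<or> B \<subseteq> A"
  shows "card \<L> + card P \<le> card X"
  using assms
proof (induction "card X" arbitrary: X \<L> rule: less_induct)
  case less
  have fin: "finite \<L>" by (rule finite_subset[of _ "Pow X"]) (use less.prems(1,2) in auto)
  show ?case
  proof (cases "\<L> = {}")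
    case True then show ?thesis using card_mono[OF less.prems(1,4)] by simp
  next
    case False
    then obtain A where A: "A \<in> \<L>" and Amin: "\<forall>B\<in>\<L>. B \<subseteq> A \<longrightarrow> A = B"
      by (rule bexE[OF finite_has_minimal[OF fin]]) (rule that)
    have "A \<noteq> {}" using less.prems(3)[OF A] by auto
    then obtain a0 where a0: "a0 \<in> A" by blast
    obtain a1 where a1: "a1 \<in> A" "a1 \<noteq> a0" using two_elements[OF less.prems(3)[OF A] a0] by blast
    obtain a b where ab: "a \<in> A" "b \<in> A" "a \<noteq> b" "a \<notin> P"
    proof (cases "a0 \<in> P")
      case True
      then have "a1 \<notin> P" using less.prems(5)[OF A, of a0 a1] a0 a1 by blast
      then show ?thesis using that[of a1 a0] a0 a1 by blast
    qed (use that[of a0 a1] a0 a1 in blast)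
    have aX: "a \<in> X" using less.prems(2)[OF A] ab(1) by blast
    let ?r = "\<lambda>B. B - {a}"
    have up: "A \<subset> B" if B: "B \<in> \<L> - {A}" "a \<in> B \<or> b \<in> B" for B
    proof -
      have "A \<inter> B \<noteq> {}" using B(2) ab by blast
      then have "A \<subseteq> B \<or> B \<subseteq> A" using less.prems(6)[OF A, of B] B(1) by blast
      then show ?thesis using Amin B(1) by blast
    qed
    have inj: "inj_on ?r (\<L> - {A})"
    proof (rule inj_onI)
      fix B B' assume B: "B \<in> \<L> - {A}" "B' \<in> \<L> - {A}" "B - {a} = B' - {a}"
      have "a \<in> B \<longleftrightarrow> a \<in> B'"
      proof
        assume "a \<in> B"
        then have "b \<in> B" using up[OF B(1)] ab by blast
        then have "b \<in> B'" using B(3) ab(3) by blast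
        then show "a \<in> B'" using up[OF B(2)] ab by blast
      next
        assume "a \<in> B'"
        then have "b \<in> B'" using up[OF B(2)] ab by blast
        then have "b \<in> B" using B(3) ab(3) by blast
        then show "a \<in> B" using up[OF B(1)] ab by blast
      qed
      then show "B = B'" using B(3) by blast
    qed
    have "card (?r ` (\<L> - {A})) + card P \<le> card (X - {a})"
    proof (rule less.hyps)
      show "card (X - {a}) < card X" using aX less.prems(1) by (intro psubset_card_mono) auto
      show "finite (X - {a})" using less.prems(1) by simp
      show "P \<subseteq> X - {a}" using less.prems(4) ab(4) by blast
    next
      fix C assume "C \<in> ?r ` (\<L> - {A})"
      then obtain B where B: "B \<in> \<L> - {A}" "C = B - {a}" by blast
      show "C \<subseteq> X - {a}" using less.prems(2)[of B] B by blast
      show "card C \<ge> 2"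
      proof (cases "a \<in> B")
        case True
        then have AB: "A \<subset> B" using up[OF B(1)] by blast
        have "finite B" using less.prems(1,2) B(1) finite_subset by blast
        then have "card A < card B" using AB by (rule psubset_card_mono)
        then show ?thesis using less.prems(3)[OF A] True B(2) by (simp add: card_Diff_singleton)
      next
        case False
        then have "C = B" using B(2) by blast
        then show ?thesis using less.prems(3)[of B] B(1) by blast
      qed
    next
      fix C u v assume "C \<in> ?r ` (\<L> - {A})" "u \<in> C \<inter> P" "v \<in> C \<inter> P"
      then obtain B where "B \<in> \<L>" "u \<in> B \<inter> P" "v \<in> B \<inter> P" by blast
      then show "u = v" by (rule less.prems(5))
    next
      fix C D assume "C \<in> ?r ` (\<L> - {A})" "D \<in> ?r ` (\<L> - {A})"
      then obtain B B' where "B \<in> \<L>" "B' \<in> \<L>" "C = B - {a}" "D = B' - {a}" by blast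
      then show "C \<inter> D = {} \<or> C \<subseteq> D \<or> D \<subseteq> C" using less.prems(6)[of B B'] by blast
    qed
    moreover have "card (?r ` (\<L> - {A})) = card \<L> - 1" using card_image[OF inj] A by simp
    moreover have "card \<L> \<ge> 1" using A fin by (metis One_nat_def Suc_leI card_gt_0_iff empty_iff)
    moreover have "card (X - {a}) = card X - 1" using aX by simp
    moreover have "card X \<ge> 1" using aX less.prems(1) by (metis One_nat_def Suc_leI card_gt_0_iff empty_iff)
    ultimately show ?thesis by linarith
  qed
qed

lemma card_lt_2_cases:
  assumes "finite A" "\<not> card A \<ge> 2" shows "A = {} \<or> (\<exists>a. A = {a})"
proof -
  consider "card A = 0" | "card A = 1" using assms(2) by linarith
  then show ?thesis using assms(1) by cases (simp, metis card_1_singletonE)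
qed

section \<open>Split systems in which the first markings meet in one vertex\<close>

locale marked =
  fixes q :: "nat \<Rightarrow> 'l::finite" and n :: nat
  assumes inj_q: "inj_on q {1..n}" and n3: "3 \<le> n"
begin

definition P :: "nat \<Rightarrow> 'l set" where "P j = q ` {1..j}"
definition small :: "nat \<Rightarrow> 'l set \<Rightarrow> bool" where "small j I \<longleftrightarrow> card (I \<inter> P j) \<le> 1"
text \<open>No edge has two of the first \<open>j\<close> markings on each of its sides; for
  \<open>3 \<le> j\<close> this says that these markings meet in a single vertex.\<close>

definition centered :: "nat \<Rightarrow> 'l set set \<Rightarrow> bool" where
  "centered j S \<longleftrightarrow> split_system S \<and> (\<forall>I\<in>S. small j I \<or> small j (- I))"

lemma card_P: "j \<le> n \<Longrightarrow> card (P j) = j"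
  unfolding P_def using inj_on_subset[OF inj_q, of "{1..j}"] by (simp add: card_image)

lemma smallD: "small j I \<Longrightarrow> a \<in> I \<Longrightarrow> b \<in> I \<Longrightarrow> a \<in> P j \<Longrightarrow> b \<in> P j \<Longrightarrow> a = b"
  using card_le_Suc0_iff_eq[of "I \<inter> P j"] by (auto simp: small_def)

lemma smallI: "(\<And>a b. a \<in> I \<Longrightarrow> b \<in> I \<Longrightarrow> a \<in> P j \<Longrightarrow> b \<in> P j \<Longrightarrow> a = b) \<Longrightarrow> small j I"
  using card_le_Suc0_iff_eq[of "I \<inter> P j"] by (auto simp: small_def)

lemma small_subset: "small j I \<Longrightarrow> A \<subseteq> I \<Longrightarrow> small j A"
  unfolding small_def by (meson Int_mono card_mono finite le_trans order_refl)

lemma P_mono: "i \<le> j \<Longrightarrow> P i \<subseteq> P j" by (auto simp: P_def)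

lemma small_mono: "i \<le> j \<Longrightarrow> small j I \<Longrightarrow> small i I"
  unfolding small_def using P_mono[of i j] by (meson Int_mono card_mono finite le_trans order_refl)

text \<open>Two sets with at most one marking each cannot cover three markings. Consequently a split
  has at most one small side.\<close>

lemma small_union:
  assumes "3 \<le> j" "j \<le> n" "small j A" "small j B" shows "A \<union> B \<noteq> UNIV"
proof
  assume "A \<union> B = UNIV"
  then have "P j = (A \<inter> P j) \<union> (B \<inter> P j)" by blast
  then have "card (P j) \<le> card (A \<inter> P j) + card (B \<inter> P j)" using card_Un_le by metis
  then show False using assms card_P by (simp add: small_def)
qed

lemma small_compl: "3 \<le> j \<Longrightarrow> j \<le> n \<Longrightarrow> small j I \<Longrightarrow> \<not> small j (- I)"
  using small_union[of j I "- I"] by auto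

lemma small_compl_card:
  assumes "3 \<le> j" "j \<le> n" "small j I" shows "card (- I) \<ge> 2"
proof -
  have "P j = (I \<inter> P j) \<union> (- I \<inter> P j)" by blast
  then have "card (P j) \<le> card (I \<inter> P j) + card (- I \<inter> P j)" using card_Un_le by metis
  moreover have "card (- I \<inter> P j) \<le> card (- I)" by (intro card_mono) auto
  ultimately show ?thesis using assms card_P by (simp add: small_def)
qed

lemma small_nested:
  assumes "3 \<le> j" "j \<le> n" "small j A" "small j B" "compat A B"
  shows "A \<inter> B = {} \<or> A \<subseteq> B \<or> B \<subseteq> A"
  using assms(5) small_union[OF assms(1-4)] unfolding compat_def by blast

lemma centered_card:
  assumes j: "3 \<le> j" "j \<le> n" and S: "centered j S"
  shows "card S = 2 * card {I \<in> S. small j I}"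
proof -
  let ?L = "{I \<in> S. small j I}"
  have sys: "split_system S" using S by (simp add: centered_def)
  have eq: "S = ?L \<union> uminus ` ?L"
  proof
    show "?L \<union> uminus ` ?L \<subseteq> S" using split_systemD(2)[OF sys] by auto
    show "S \<subseteq> ?L \<union> uminus ` ?L"
    proof
      fix I assume I: "I \<in> S"
      show "I \<in> ?L \<union> uminus ` ?L"
      proof (cases "small j I")
        case False
        then have "- I \<in> ?L" using S I split_systemD(2)[OF sys I] by (auto simp: centered_def)
        then have "- (- I) \<in> uminus ` ?L" by (rule imageI)
        then show ?thesis by simp
      qed (use I in blast)
    qed
  qed
  have "?L \<inter> uminus ` ?L = {}" using small_compl[OF j] by auto
  moreover have "card (uminus ` ?L) = card ?L" by (rule card_image) (auto intro: inj_onI)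
  ultimately have "card (?L \<union> uminus ` ?L) = 2 * card ?L"
    using card_Un_disjoint[OF finite finite, of ?L "uminus ` ?L"] by linarith
  then show ?thesis using arg_cong[OF eq, of card] by (rule trans[rotated])
qed

text \<open>The small sides form a laminar family with at most one marking in each member, so
  \<open>laminar_bound\<close> applies. Equality means full dimension in the cycle after the
  divisors up to \<open>j\<close>.\<close>

lemma centered_bound:
  assumes j: "3 \<le> j" "j \<le> n" and S: "centered j S"
  shows "card S + 2 * j \<le> 2 * CARD('l)"
proof -
  let ?L = "{I \<in> S. small j I}"
  have sys: "split_system S" using S by (simp add: centered_def)
  have "card ?L + card (P j) \<le> CARD('l)"
  proof (rule laminar_bound[OF finite])
    show "card A \<ge> 2" if "A \<in> ?L" for A using split_systemD(1)[OF sys] that by (auto simp: nontrivial_def)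
    show "a = b" if "A \<in> ?L" "a \<in> A \<inter> P j" "b \<in> A \<inter> P j" for A a b using smallD[of j A a b] that by blast
    show "A \<inter> B = {} \<or> A \<subseteq> B \<or> B \<subseteq> A" if "A \<in> ?L" "B \<in> ?L" for A B
      using small_nested[OF j, of A B] split_systemD(3)[OF sys, of A B] that by blast
  qed auto
  then show ?thesis using centered_card[OF assms] card_P[OF j(2)] by simp
qed

definition insert_split :: "'l set \<Rightarrow> 'l set set \<Rightarrow> 'l set set" where
  "insert_split J T = T \<union> {J, - J}"

lemma card_insert_split:
  assumes "split_system T" "nontrivial J" "J \<notin> T"
  shows "card (insert_split J T) = card T + 2"
proof -
  have "- J \<notin> T" using split_systemD(2)[OF assms(1), of "- J"] assms(3) by auto
  moreover have "J \<noteq> {}" using assms(2) by (auto simp: nontrivial_def)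
  then have "J \<noteq> - J" by blast
  ultimately show ?thesis unfolding insert_split_def using assms(3) by (subst card_Un_disjoint) auto
qed

lemma compat_uminus: "compat A (- B) \<longleftrightarrow> compat A B" "compat (- A) B \<longleftrightarrow> compat A B" "compat A B \<longleftrightarrow> compat B A"
  unfolding compat_def by blast+

lemma split_system_insert:
  assumes T: "split_system T" and J: "nontrivial J" "\<And>I. I \<in> T \<Longrightarrow> compat I J"
  shows "split_system (insert_split J T)"
proof -
  have "compat J J" by (simp add: compat_def)
  then have "compat A B" if "A \<in> insert_split J T" "B \<in> insert_split J T" for A B
    using that T J(2) compat_uminus unfolding insert_split_def split_system_def
    by (metis Un_iff insertE singletonD)
  moreover have "nontrivial I \<and> - I \<in> insert_split J T" if "I \<in> insert_split J T" for I
    using that T J(1) nontrivial_uminus unfolding insert_split_def split_system_def by auto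
  ultimately show ?thesis by (simp add: split_system_def)
qed

lemma centered_insert:
  assumes "centered j T" "nontrivial J" "\<And>I. I \<in> T \<Longrightarrow> compat I J" "small j J \<or> small j (- J)"
  shows "centered j (insert_split J T)"
  using assms split_system_insert[of T J] unfolding centered_def by (auto simp: insert_split_def)

lemma centered_remove:
  assumes "centered j (insert_split J T)" "split_system T" shows "centered j T"
  using assms by (auto simp: centered_def insert_split_def)

text \<open>If \<open>T\<close> has codimension one in the cycle of \<open>j\<close> markings, these
  are the maximal cells around it. Taking the small side lists every split once.\<close>

definition resolutions :: "nat \<Rightarrow> 'l set set \<Rightarrow> 'l set set" where
  "resolutions j T = {J. small j J \<and> J \<notin> T \<and> centered j (insert_split J T)}"

lemma resolutionsD:
  assumes "J \<in> resolutions j T"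
  shows "small j J" "J \<notin> T" "nontrivial J" "I \<in> T \<Longrightarrow> compat I J" "centered j (insert_split J T)"
proof -
  show c: "small j J" "J \<notin> T" "centered j (insert_split J T)" using assms by (auto simp: resolutions_def)
  have s: "split_system (insert_split J T)" using c(3) by (simp add: centered_def)
  have J: "J \<in> insert_split J T" by (simp add: insert_split_def)
  show "nontrivial J" using split_systemD(1)[OF s J] .
  show "I \<in> T \<Longrightarrow> compat I J" using split_systemD(3)[OF s _ J, of I] by (simp add: insert_split_def)
qed

text \<open>Since \<open>T\<close> is just one split short of the bound for centered
  systems, no two resolutions can be made simultaneously.\<close>

lemma resolutions_crossing:
  assumes j: "3 \<le> j" "j \<le> n" and T: "split_system T" "card T + 2 * j + 2 = 2 * CARD('l)"
    and J: "J \<in> resolutions j T" and J': "nontrivial J'" "J' \<notin> T" "small j J' \<or> small j (- J')"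
      "\<And>I. I \<in> T \<Longrightarrow> compat I J'" "compat J J'"
  shows "J' = J \<or> J' = - J"
proof (rule ccontr)
  assume ne: "\<not> ?thesis"
  note r = resolutionsD[OF J]
  have s: "split_system (insert_split J T)" using r(5) by (simp add: centered_def)
  have c: "centered j (insert_split J' (insert_split J T))"
  proof (rule centered_insert[OF r(5) J'(1) _ J'(3)])
    fix I assume "I \<in> insert_split J T"
    then show "compat I J'" using J'(4,5) compat_uminus(2) unfolding insert_split_def by blast
  qed
  have "J' \<notin> insert_split J T" using ne J'(2) by (simp add: insert_split_def)
  then have "card (insert_split J' (insert_split J T)) = card T + 4"
    using card_insert_split[OF s J'(1)] card_insert_split[OF T(1) r(3,2)] by simp
  then show False using centered_bound[OF j c] T(2) by simp
qed

text \<open>The maximal members of \<open>T\<close> and single labels inside \<open>J\<close>: the branches, lying on the side of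
  \<open>J\<close>, of the vertex that the split \<open>J\<close> resolves.\<close>

definition pieces :: "'l set set \<Rightarrow> 'l set \<Rightarrow> 'l set set" where
  "pieces T J = {M. (M \<in> T \<or> (\<exists>a. M = {a})) \<and> M \<subseteq> J \<and> (\<forall>M'. (M' \<in> T \<or> (\<exists>a. M' = {a})) \<longrightarrow> M' \<subseteq> J \<longrightarrow> M \<subseteq> M' \<longrightarrow> M = M')}"

lemma pieces_cover:
  assumes "M \<in> T \<or> (\<exists>a. M = {a})" "M \<subseteq> J"
  obtains M' where "M' \<in> pieces T J" "M \<subseteq> M'"
proof -
  let ?A = "{M'. (M' \<in> T \<or> (\<exists>a. M' = {a})) \<and> M' \<subseteq> J \<and> M \<subseteq> M'}"
  have "?A \<noteq> {}" using assms by blast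
  then obtain M' where M': "M' \<in> ?A" "\<forall>B\<in>?A. M' \<subseteq> B \<longrightarrow> M' = B"
    by (rule bexE[OF finite_has_maximal[OF finite]]) (rule that)
  then have "M' \<in> pieces T J" unfolding pieces_def by blast
  then show ?thesis using that M'(1) by blast
qed

lemma pieces_max:
  "M \<in> pieces T J \<Longrightarrow> M' \<in> T \<or> (\<exists>a. M' = {a}) \<Longrightarrow> M' \<subseteq> J \<Longrightarrow> M \<subseteq> M' \<Longrightarrow> M = M'"
  unfolding pieces_def by blast

lemma compat_singleton: "compat {a} B" by (auto simp: compat_def)

lemma piece_compat:
  assumes "split_system T" "M \<in> T \<or> (\<exists>a. M = {a})" "M' \<in> T \<or> (\<exists>a. M' = {a})"
  shows "compat M M'"
  using assms(2,3) split_systemD(3)[OF assms(1)] compat_singleton compat_uminus(3) by metis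

lemma pieces_disjoint:
  assumes T: "split_system T" and J: "J \<noteq> UNIV" and M: "M \<in> pieces T J" "M' \<in> pieces T J" "M \<noteq> M'"
  shows "M \<inter> M' = {}"
proof -
  have m: "M \<in> T \<or> (\<exists>a. M = {a})" "M \<subseteq> J" "M' \<in> T \<or> (\<exists>a. M' = {a})" "M' \<subseteq> J"
    using M unfolding pieces_def by simp_all
  have "compat M M'" by (rule piece_compat[OF T m(1,3)])
  moreover have "M \<union> M' \<noteq> UNIV" using m(2,4) J by blast
  moreover have "\<not> M \<subseteq> M'" "\<not> M' \<subseteq> M"
    using pieces_max[OF M(1) m(3,4)] pieces_max[OF M(2) m(1,2)] M(3) by auto
  ultimately show ?thesis unfolding compat_def by blast
qed

lemma pieces_Union: "\<Union>(pieces T J) = J"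
proof
  show "\<Union>(pieces T J) \<subseteq> J" unfolding pieces_def by blast
  show "J \<subseteq> \<Union>(pieces T J)"
  proof
    fix a assume "a \<in> J"
    then obtain M' where "M' \<in> pieces T J" "{a} \<subseteq> M'" using pieces_cover[of "{a}" T J] by blast
    then show "a \<in> \<Union>(pieces T J)" by blast
  qed
qed

lemma pieces_nonempty: "split_system T \<Longrightarrow> M \<in> pieces T J \<Longrightarrow> M \<noteq> {}"
  using split_systemD(1)[of T M] by (auto simp: pieces_def nontrivial_def)

lemma pieces_card:
  assumes T: "split_system T" and J: "J \<notin> T" "card J \<ge> 2"
  shows "card (pieces T J) \<ge> 2"
proof (rule ccontr)
  assume "\<not> ?thesis"
  then have c: "pieces T J = {} \<or> (\<exists>M. pieces T J = {M})" by (intro card_lt_2_cases) auto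
  have "J \<noteq> {}" using J(2) by auto
  then have "pieces T J \<noteq> {}" using pieces_Union[of T J] by auto
  then obtain M where M': "pieces T J = {M}" using c by blast
  then have M: "M \<in> pieces T J" by simp
  have "J = M" using M' pieces_Union[of T J] by simp
  then have "J \<in> T \<or> (\<exists>a. J = {a})" using M by (simp add: pieces_def)
  then show False using J by auto
qed

text \<open>All branches, on both sides of \<open>J\<close>, of the vertex that \<open>J\<close>
  resolves.\<close>

definition parts :: "'l set set \<Rightarrow> 'l set \<Rightarrow> 'l set set" where
  "parts T J = pieces T J \<union> pieces T (- J)"

context
  fixes j T J
  assumes j: "3 \<le> j" "j \<le> n" and T: "split_system T" "card T + 2 * j + 2 = 2 * CARD('l)"
    and J: "J \<in> resolutions j T"
begin

lemma J_props: "J \<noteq> {}" "J \<noteq> UNIV" "- J \<noteq> UNIV" "- J \<notin> T"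
proof -
  have "card J \<ge> 2" "card (- J) \<ge> 2" using resolutionsD(3)[OF J] by (auto simp: nontrivial_def)
  then have "J \<noteq> {}" "- J \<noteq> {}" by (metis card.empty not_numeral_le_zero)+
  then show "J \<noteq> {}" "J \<noteq> UNIV" "- J \<noteq> UNIV" by blast+
  show "- J \<notin> T" using split_systemD(2)[OF T(1), of "- J"] resolutionsD(2)[OF J] by auto
qed

lemma parts_disjoint:
  assumes "A \<in> parts T J" "B \<in> parts T J" "A \<noteq> B" shows "A \<inter> B = {}"
proof -
  have in_J: "M \<subseteq> K" if "M \<in> pieces T K" for M K using that by (simp add: pieces_def)
  consider "A \<in> pieces T J" "B \<in> pieces T J" | "A \<in> pieces T (- J)" "B \<in> pieces T (- J)"
    | "A \<in> pieces T J" "B \<in> pieces T (- J)" | "A \<in> pieces T (- J)" "B \<in> pieces T J"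
    using assms(1,2) unfolding parts_def by blast
  then show ?thesis
  proof cases
    case 1 then show ?thesis using pieces_disjoint[OF T(1) J_props(2)] assms(3) by blast
  next
    case 2 then show ?thesis using pieces_disjoint[OF T(1) J_props(3)] assms(3) by blast
  next
    case 3 then show ?thesis using in_J by blast
  next
    case 4 then show ?thesis using in_J by blast
  qed
qed

lemma parts_Union: "\<Union>(parts T J) = UNIV"
  unfolding parts_def using pieces_Union[of T J] pieces_Union[of T "- J"] by auto

lemma part_of:
  obtains A where "A \<in> parts T J" "a \<in> A"
proof -
  have "a \<in> \<Union>(parts T J)" by (simp add: parts_Union)
  then show ?thesis using that by (rule UnionE)
qed

lemma parts_nonempty: "A \<in> parts T J \<Longrightarrow> A \<noteq> {}"
  unfolding parts_def using pieces_nonempty[OF T(1)] by blast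

lemma part_type: "A \<in> parts T J \<Longrightarrow> A \<in> T \<or> (\<exists>a. A = {a})"
  unfolding parts_def pieces_def by auto

text \<open>As \<open>I\<close> is compatible with \<open>J\<close>, one of its sides lies inside
  \<open>J\<close> or \<open>- J\<close>, hence in a maximal member there.\<close>

lemma part_cover:
  assumes "I \<in> T" obtains A where "A \<in> parts T J" "I \<subseteq> A \<or> - I \<subseteq> A"
proof -
  have I': "- I \<in> T" using split_systemD(2)[OF T(1) assms] .
  have "compat I J" using resolutionsD(4)[OF J assms] .
  then consider "I \<subseteq> - J" | "I \<subseteq> J" | "- I \<subseteq> - J" | "- I \<subseteq> J" unfolding compat_def by blast
  then show ?thesis
  proof cases
    case 1 show ?thesis by (rule pieces_cover[of I T "- J"]) (use assms 1 that parts_def in auto)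
  next
    case 2 show ?thesis by (rule pieces_cover[of I T J]) (use assms 2 that parts_def in auto)
  next
    case 3 show ?thesis by (rule pieces_cover[of "- I" T "- J"]) (use I' 3 that parts_def in auto)
  next
    case 4 show ?thesis by (rule pieces_cover[of "- I" T J]) (use I' 4 that parts_def in auto)
  qed
qed

lemma card_parts: "card (parts T J) \<ge> 4"
proof -
  have "pieces T J \<inter> pieces T (- J) = {}"
  proof -
    have "M = {}" if "M \<in> pieces T J" "M \<in> pieces T (- J)" for M using that unfolding pieces_def by blast
    then show ?thesis using pieces_nonempty[OF T(1)] by blast
  qed
  then have "card (parts T J) = card (pieces T J) + card (pieces T (- J))"
    unfolding parts_def by (intro card_Un_disjoint) auto
  moreover have "card (pieces T J) \<ge> 2"
    using pieces_card[OF T(1) resolutionsD(2)[OF J]] resolutionsD(3)[OF J] by (simp add: nontrivial_def)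
  moreover have "card (pieces T (- J)) \<ge> 2"
    using pieces_card[OF T(1) J_props(4)] resolutionsD(3)[OF J] by (simp add: nontrivial_def)
  ultimately show ?thesis by linarith
qed

lemma part_subset_Union:
  assumes "A \<in> parts T J" "\<A> \<subseteq> parts T J" "A \<inter> \<Union>\<A> \<noteq> {}" shows "A \<in> \<A>"
proof -
  obtain B where "B \<in> \<A>" "A \<inter> B \<noteq> {}" using assms(3) by blast
  then show ?thesis using parts_disjoint[OF assms(1), of B] assms(2) by blast
qed

lemma compl_Union_parts:
  assumes "\<A> \<subseteq> parts T J" shows "- \<Union>\<A> = \<Union>(parts T J - \<A>)"
proof
  show "- \<Union>\<A> \<subseteq> \<Union>(parts T J - \<A>)"
  proof
    fix a assume a: "a \<in> - \<Union>\<A>"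
    have "a \<in> \<Union>(parts T J)" using parts_Union by simp
    then show "a \<in> \<Union>(parts T J - \<A>)" using a by blast
  qed
  show "\<Union>(parts T J - \<A>) \<subseteq> - \<Union>\<A>" using part_subset_Union[OF _ assms] by blast
qed

lemma card_Union_parts: "\<A> \<subseteq> parts T J \<Longrightarrow> card \<A> \<le> card (\<Union>\<A>)"
proof -
  assume A: "\<A> \<subseteq> parts T J"
  define r where "r A = (SOME a. a \<in> A)" for A :: "'l set"
  have r: "r A \<in> A" if "A \<in> \<A>" for A
    unfolding r_def using someI_ex[of "\<lambda>a. a \<in> A"] parts_nonempty A that by blast
  have "inj_on r \<A>"
  proof (rule inj_onI)
    fix B C assume BC: "B \<in> \<A>" "C \<in> \<A>" "r B = r C"
    have "r B \<in> B" "r C \<in> C" using r BC(1,2) by auto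
    then have "r B \<in> B \<inter> C" using BC(3) by simp
    then show "B = C" using parts_disjoint[of B C] BC A by blast
  qed
  then have "card \<A> = card (r ` \<A>)" by (simp add: card_image)
  also have "\<dots> \<le> card (\<Union>\<A>)" by (rule card_mono) (use r in auto)
  finally show ?thesis .
qed

text \<open>Pulling at least two branches away from at least two others inserts a new edge. Each old
  edge lies within one branch and so is compatible with the new one and different from it.\<close>

lemma union_parts_new:
  assumes \<A>: "\<A> \<subseteq> parts T J" "card \<A> \<ge> 2" "card (parts T J - \<A>) \<ge> 2"
  shows "nontrivial (\<Union>\<A>)" "\<Union>\<A> \<notin> T" "\<And>I. I \<in> T \<Longrightarrow> compat I (\<Union>\<A>)"
proof -
  show "nontrivial (\<Union>\<A>)"
    using card_Union_parts[OF \<A>(1)] card_Union_parts[of "parts T J - \<A>"] \<A> compl_Union_parts[OF \<A>(1)]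
    by (auto simp: nontrivial_def)
  have two: "\<exists>A\<in>\<C>. A \<noteq> B" if "card \<C> \<ge> 2" for \<C> and B :: "'l set"
  proof (rule ccontr)
    assume "\<not> ?thesis"
    then have "\<C> \<subseteq> {B}" by blast
    then have "card \<C> \<le> card {B}" by (intro card_mono) auto
    then show False using that by simp
  qed
  show "\<Union>\<A> \<notin> T"
  proof
    assume "\<Union>\<A> \<in> T"
    then obtain A where A: "A \<in> parts T J" "\<Union>\<A> \<subseteq> A \<or> - \<Union>\<A> \<subseteq> A" by (rule part_cover)
    obtain B C where BC: "B \<in> \<A>" "B \<noteq> A" "C \<in> parts T J - \<A>" "C \<noteq> A"
      using two[OF \<A>(2), of A] two[OF \<A>(3), of A] by blast
    have "B \<inter> A = {}" "C \<inter> A = {}" using parts_disjoint[of B A] parts_disjoint[of C A] A(1) BC \<A>(1) by blast+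
    moreover have "B \<subseteq> A \<or> C \<subseteq> A" using A(2) BC compl_Union_parts[OF \<A>(1)] by blast
    ultimately show False using parts_nonempty[of B] parts_nonempty[of C] BC \<A>(1) by blast
  qed
  fix I assume "I \<in> T"
  then obtain A where A: "A \<in> parts T J" "I \<subseteq> A \<or> - I \<subseteq> A" by (rule part_cover)
  have "A \<subseteq> \<Union>\<A> \<or> A \<inter> \<Union>\<A> = {}" using part_subset_Union[OF A(1) \<A>(1)] by blast
  then show "compat I (\<Union>\<A>)" using A(2) unfolding compat_def by blast
qed

text \<open>A resolution other than \<open>J\<close> crosses \<open>J\<close> by
  \<open>resolutions_crossing\<close>. If it met a branch without containing it, compatibility with
  the branch, which lies on one side of \<open>J\<close>, would exclude this crossing.\<close>

lemma resolution_union: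
  assumes J': "J' \<in> resolutions j T" and A: "A \<in> parts T J" "A \<inter> J' \<noteq> {}" shows "A \<subseteq> J'"
proof (cases "J' = J \<or> J' = - J")
  case True
  moreover have "A \<subseteq> J \<or> A \<subseteq> - J" using A(1) unfolding parts_def pieces_def by blast
  ultimately show ?thesis using A(2) by blast
next
  case False
  have nc: "\<not> compat J J'"
    using resolutions_crossing[OF j T J, of J'] resolutionsD[OF J'] False by blast
  have "compat A J'" using part_type[OF A(1)] resolutionsD(4)[OF J'] compat_singleton by metis
  moreover have "A \<subseteq> J \<or> A \<subseteq> - J" using A(1) unfolding parts_def pieces_def by blast
  ultimately show ?thesis using A(2) nc unfolding compat_def by blast
qed

lemma resolution_eq_Union:
  assumes J': "J' \<in> resolutions j T"
  defines "\<A> \<equiv> {A \<in> parts T J. A \<subseteq> J'}"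
  shows "J' = \<Union>\<A>" "card \<A> \<ge> 2" "card (parts T J - \<A>) \<ge> 2"
proof -
  show eq: "J' = \<Union>\<A>"
  proof
    show "J' \<subseteq> \<Union>\<A>"
    proof
      fix a assume a: "a \<in> J'"
      obtain A where "A \<in> parts T J" "a \<in> A" by (rule part_of)
      then show "a \<in> \<Union>\<A>" using resolution_union[OF J', of A] a unfolding \<A>_def by blast
    qed
  qed (auto simp: \<A>_def)
  have sub: "\<A> \<subseteq> parts T J" by (auto simp: \<A>_def)
  have big: "card \<C> \<ge> 2" if \<C>: "\<C> \<subseteq> parts T J" "\<Union>\<C> \<notin> T" "card (\<Union>\<C>) \<ge> 2" for \<C>
  proof (rule ccontr)
    assume "\<not> ?thesis"
    then have "\<C> = {} \<or> (\<exists>A. \<C> = {A})" by (intro card_lt_2_cases) auto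
    moreover have "\<C> \<noteq> {}" using \<C>(3) by auto
    ultimately obtain A where "\<C> = {A}" by blast
    then show False using \<C> part_type[of A] by auto
  qed
  show "card \<A> \<ge> 2" using big[OF sub] eq resolutionsD(2,3)[OF J'] by (simp add: nontrivial_def)
  have "- J' \<notin> T" using split_systemD(2)[OF T(1), of "- J'"] resolutionsD(2)[OF J'] by auto
  then show "card (parts T J - \<A>) \<ge> 2"
    using big[of "parts T J - \<A>"] compl_Union_parts[OF sub] eq resolutionsD(3)[OF J'] by (simp add: nontrivial_def)
qed

text \<open>Both unions are new splits with a small side, and nested sets are compatible, against
  \<open>resolutions_crossing\<close>.\<close>

lemma small_chain_impossible:
  assumes "\<A> \<subset> \<B>" "\<B> \<subseteq> parts T J" "card \<A> \<ge> 2" "card (parts T J - \<B>) \<ge> 2" "small j (\<Union>\<B>)"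
  shows False
proof -
  have "parts T J - \<B> \<subseteq> parts T J - \<A>" "\<A> \<subseteq> \<B>" using assms(1) by blast+
  then have "card (parts T J - \<B>) \<le> card (parts T J - \<A>)" "card \<A> \<le> card \<B>"
    by (auto intro: card_mono)
  then have A: "\<A> \<subseteq> parts T J" "card (parts T J - \<A>) \<ge> 2" and B: "card \<B> \<ge> 2"
    using assms(1-4) by auto
  note a = union_parts_new[OF A(1) assms(3) A(2)] and b = union_parts_new[OF assms(2) B assms(4)]
  have sub: "\<Union>\<A> \<subseteq> \<Union>\<B>" using assms(1) by blast
  have cT: "centered j T" using centered_remove[OF resolutionsD(5)[OF J] T(1)] .
  have sA: "small j (\<Union>\<A>)" by (rule small_subset[OF assms(5) sub])
  have res: "\<Union>\<A> \<in> resolutions j T"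
    unfolding resolutions_def using sA a(2) centered_insert[OF cT a(1) a(3)] by blast
  have "\<Union>\<B> = \<Union>\<A> \<or> \<Union>\<B> = - \<Union>\<A>"
    by (rule resolutions_crossing[OF j T res b(1,2) _ b(3)]) (use assms(5) sub in \<open>auto simp: compat_def\<close>)
  then show False
  proof
    assume eq: "\<Union>\<B> = \<Union>\<A>"
    obtain B where B': "B \<in> \<B>" "B \<notin> \<A>" using assms(1) by blast
    then have "B \<noteq> {}" "B \<subseteq> \<Union>\<A>" using parts_nonempty assms(2) eq by auto
    then show False using part_subset_Union[OF _ A(1), of B] B' assms(2) by blast
  next
    assume "\<Union>\<B> = - \<Union>\<A>"
    then have "\<Union>\<A> = {}" using sub by blast
    then show False using a(1) by (metis card.empty nontrivial_def not_numeral_le_zero)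
  qed
qed

text \<open>If some branch contains two of the first \<open>j\<close> markings, the vertex has
  exactly four branches, and every division of four into two pairs joins \<open>E0\<close> to one
  other branch, whichever of the remaining branches \<open>E0\<close> is. If no branch does, exactly
  one branch is free of these markings, and every resolution joins it to one other branch.\<close>

lemma distinguished_part:
  "\<exists>E0\<in>parts T J. (\<forall>B\<in>parts T J - {E0}. small j (E0 \<union> B) \<or> small j (- (E0 \<union> B))) \<and>
     (\<forall>J'\<in>resolutions j T. \<exists>B\<in>parts T J - {E0}. J' = E0 \<union> B \<or> J' = - (E0 \<union> B))"
proof -
  let ?B = "parts T J"
  have cT: "centered j T" using centered_remove[OF resolutionsD(5)[OF J] T(1)] .
  have sm: "small j A \<or> small j (- A)" if "A \<in> ?B" for A
  proof (cases "\<exists>a. A = {a}")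
    case True then show ?thesis by (auto simp: small_def intro: order.trans[OF card_mono[of "{_}"]])
  next
    case False then show ?thesis using part_type[OF that] cT by (auto simp: centered_def)
  qed
  show ?thesis
  proof (cases "\<exists>A\<in>?B. \<not> small j A")
    case True
    then obtain A where A: "A \<in> ?B" "\<not> small j A" by blast
    have sA: "small j (- A)" using sm[OF A(1)] A(2) by blast
    have sub_small: "small j (\<Union>\<C>)" if "\<C> \<subseteq> ?B - {A}" for \<C>
      by (rule small_subset[OF sA]) (use parts_disjoint[OF _ A(1)] that in blast)
    \<comment> \<open>With five branches, three of those other than \<open>A\<close> and two among
      these three would form a forbidden chain: their unions avoid \<open>A\<close>, whose
      complement is small.\<close>
    have c4: "card ?B = 4"
    proof (rule ccontr)
      assume "card ?B \<noteq> 4"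
      then have "card (?B - {A}) \<ge> 4" using card_parts A(1) by simp
      then obtain \<C> where \<C>: "\<C> \<subseteq> ?B - {A}" "card \<C> = 3" using obtain_subset_with_card_n[of 3 "?B - {A}"] by auto
      then obtain \<A> where \<A>: "\<A> \<subseteq> \<C>" "card \<A> = 2" using obtain_subset_with_card_n[of 2 \<C>] by auto
      have "\<A> \<subset> \<C>" using \<A> \<C> by auto
      moreover have "card (?B - \<C>) \<ge> 2"
      proof -
        have "card (?B - \<C>) = card ?B - 3" using \<C> by (subst card_Diff_subset) auto
        moreover have "card ?B \<ge> 5" using \<open>card (?B - {A}) \<ge> 4\<close> A(1) by simp
        ultimately show ?thesis by simp
      qed
      ultimately show False using small_chain_impossible[of \<A> \<C>] \<A>(2) \<C>(1) sub_small[OF \<C>(1)] by auto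
    qed
    have "card (?B - {A}) = 3" using c4 A(1) by simp
    then have "?B - {A} \<noteq> {}" by (metis card.empty zero_neq_numeral)
    then obtain E0 where E0: "E0 \<in> ?B" "E0 \<noteq> A" by blast
    show ?thesis
    proof (intro bexI[OF _ E0(1)] conjI ballI)
      fix B assume B: "B \<in> ?B - {E0}"
      show "small j (E0 \<union> B) \<or> small j (- (E0 \<union> B))"
      proof (cases "B = A")
        case True
        then have "- (E0 \<union> B) \<subseteq> - A" by blast
        then show ?thesis using small_subset[OF sA] by blast
      next
        case False
        then show ?thesis using sub_small[of "{E0, B}"] E0 B by auto
      qed
    next
      fix J' assume J': "J' \<in> resolutions j T"
      define \<A> where "\<A> = {A \<in> ?B. A \<subseteq> J'}"
      note u = resolution_eq_Union[OF J', folded \<A>_def]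
      have sub: "\<A> \<subseteq> ?B" by (auto simp: \<A>_def)
      have c: "card \<A> = 2" "card (?B - \<A>) = 2"
        using u(2,3) c4 card_Diff_subset[OF finite sub] by auto
      have pair: "\<exists>B\<in>?B - {E0}. \<C> = {E0, B}" if C: "E0 \<in> \<C>" "card \<C> = 2" "\<C> \<subseteq> ?B" for \<C>
      proof -
        obtain x y where "\<C> = {x, y}" "x \<noteq> y" using C(2) by (auto simp: card_2_iff)
        then have "E0 = x \<or> E0 = y" "x \<in> ?B" "y \<in> ?B" using C(1,3) by auto
        then show ?thesis
        proof (elim disjE)
          assume "E0 = x" then show ?thesis
            using \<open>\<C> = {x, y}\<close> \<open>x \<noteq> y\<close> \<open>y \<in> ?B\<close> by (intro bexI[of _ y]) simp_all
        next
          assume "E0 = y" then show ?thesis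
            using \<open>\<C> = {x, y}\<close> \<open>x \<noteq> y\<close> \<open>x \<in> ?B\<close> by (intro bexI[of _ x]) (simp_all add: insert_commute)
        qed
      qed
      show "\<exists>B\<in>?B - {E0}. J' = E0 \<union> B \<or> J' = - (E0 \<union> B)"
      proof (cases "E0 \<in> \<A>")
        case True
        then obtain B where "B \<in> ?B - {E0}" "\<A> = {E0, B}" using pair[OF _ c(1) sub] by blast
        then show ?thesis using u(1) by auto
      next
        case False
        then obtain B where B: "B \<in> ?B - {E0}" "?B - \<A> = {E0, B}" using pair[OF _ c(2)] E0(1) by blast
        then have "- J' = E0 \<union> B" using compl_Union_parts[OF sub] u(1) by simp
        then have "J' = - (E0 \<union> B)" by blast
        then show ?thesis using B(1) by blast
      qed
    qed
  next
    case False
    then have allsm: "\<And>A. A \<in> ?B \<Longrightarrow> small j A" by blast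
    let ?E = "{A \<in> ?B. A \<inter> P j = {}}"
    define \<A>0 where "\<A>0 = {A \<in> ?B. A \<subseteq> J}"
    \<comment> \<open>A resolution unites at least two branches but contains at most one
      marking.\<close>
    have empt: "\<exists>A\<in>?E. A \<subseteq> J'" if J': "J' \<in> resolutions j T" for J'
    proof (rule ccontr)
      assume none: "\<not> ?thesis"
      define \<A> where "\<A> = {A \<in> ?B. A \<subseteq> J'}"
      note u = resolution_eq_Union[OF J', folded \<A>_def]
      obtain A A' where AA: "A \<in> \<A>" "A' \<in> \<A>" "A \<noteq> A'"
        using u(2) card_le_Suc0_iff_eq[of \<A>] by (metis finite not_less_eq_eq numeral_2_eq_2)
      then have B: "A \<in> ?B" "A \<subseteq> J'" "A' \<in> ?B" "A' \<subseteq> J'" by (simp_all add: \<A>_def)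
      then have "A \<inter> P j \<noteq> {}" "A' \<inter> P j \<noteq> {}" using none by auto
      then obtain a a' where a: "a \<in> A" "a \<in> P j" "a' \<in> A'" "a' \<in> P j" by auto
      have "a \<noteq> a'" using parts_disjoint[OF B(1,3) AA(3)] a by blast
      moreover have "a \<in> J'" "a' \<in> J'" using a B by auto
      ultimately show False using smallD[OF resolutionsD(1)[OF J'] _ _ a(2,4)] by simp
    qed
    have nonE: "card (?B - ?E) = j"
    proof -
      define g where "g a = (THE A. A \<in> ?B \<and> a \<in> A)" for a
      have g: "g a = A" if "A \<in> ?B" "a \<in> A" for a A
        unfolding g_def using that parts_disjoint[OF that(1)] by (intro the_equality) auto
      have bij: "bij_betw g (P j) (?B - ?E)"
      proof (rule bij_betw_imageI)
        show "inj_on g (P j)"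
        proof (rule inj_onI)
          fix a b assume ab: "a \<in> P j" "b \<in> P j" "g a = g b"
          obtain A where A: "A \<in> ?B" "a \<in> A" by (rule part_of)
          obtain B where B: "B \<in> ?B" "b \<in> B" by (rule part_of)
          note AB = A B
          have "A = B" using g[OF A] g[OF B] ab(3) by simp
          then show "a = b" using smallD[OF allsm[OF AB(1)] AB(2)] AB(4) ab(1,2) by blast
        qed
        show "g ` P j = ?B - ?E"
        proof
          show "g ` P j \<subseteq> ?B - ?E"
          proof
            fix A assume "A \<in> g ` P j"
            then obtain a where a: "a \<in> P j" "A = g a" by blast
            obtain A' where A': "A' \<in> ?B" "a \<in> A'" by (rule part_of)
            then have "A = A'" using g[OF A'] a by simp
            then show "A \<in> ?B - ?E" using a(1) A' by blast
          qed
          show "?B - ?E \<subseteq> g ` P j"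
          proof
            fix A assume "A \<in> ?B - ?E"
            then obtain a where a: "A \<in> ?B" "a \<in> A" "a \<in> P j" by blast
            then show "A \<in> g ` P j" using g[OF a(1,2)] by blast
          qed
        qed
      qed
      show ?thesis using bij_betw_same_card[OF bij] card_P[OF j(2)] by linarith
    qed
    obtain E0 where E0: "E0 \<in> ?E" using empt[OF J] by blast
    \<comment> \<open>Two branches without markings, by themselves and together with one marked
      branch \<open>Q\<close>, would form a forbidden chain.\<close>
    have uniq: "E = E0" if E: "E \<in> ?E" for E
    proof (rule ccontr)
      assume ne: "E \<noteq> E0"
      have "?B - ?E \<noteq> {}"
      proof
        assume "?B - ?E = {}"
        then have "card (?B - ?E) = 0" by (simp only: card.empty)
        then show False using nonE j(1) by linarith
      qed
      then obtain Q where Q: "Q \<in> ?B - ?E" by blast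
      have "{E0, E} \<subset> {E0, E, Q}" using Q E E0 by blast
      moreover have "card (?B - {E0, E, Q}) \<ge> 2"
      proof -
        have "card (?B - ?E - {Q}) = j - 1" using nonE Q by simp
        moreover have "card (?B - ?E - {Q}) \<le> card (?B - {E0, E, Q})" using E E0 by (intro card_mono) auto
        ultimately show ?thesis using j(1) by simp
      qed
      moreover have "small j (\<Union>{E0, E, Q})"
      proof (rule smallI)
        fix a b assume "a \<in> \<Union>{E0, E, Q}" "b \<in> \<Union>{E0, E, Q}" "a \<in> P j" "b \<in> P j"
        then have "a \<in> Q" "b \<in> Q" using E E0 by auto
        then show "a = b" using smallD[OF allsm[of Q]] Q \<open>a \<in> P j\<close> \<open>b \<in> P j\<close> by blast
      qed
      ultimately show False using small_chain_impossible[of "{E0, E}" "{E0, E, Q}"] E E0 Q ne by auto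
    qed
    show ?thesis
    proof (rule bexI[of _ E0], intro conjI ballI)
      show "E0 \<in> ?B" using E0 by blast
    next
      fix B assume B: "B \<in> ?B - {E0}"
      have "small j (E0 \<union> B)"
      proof (rule smallI)
        fix a b assume "a \<in> E0 \<union> B" "b \<in> E0 \<union> B" "a \<in> P j" "b \<in> P j"
        then have "a \<in> B" "b \<in> B" using E0 by auto
        then show "a = b" using smallD[OF allsm[of B]] B \<open>a \<in> P j\<close> \<open>b \<in> P j\<close> by blast
      qed
      then show "small j (E0 \<union> B) \<or> small j (- (E0 \<union> B))" ..
    next
      fix J' assume J': "J' \<in> resolutions j T"
      define \<A> where "\<A> = {A \<in> ?B. A \<subseteq> J'}"
      note u = resolution_eq_Union[OF J', folded \<A>_def]
      have OA: "E0 \<in> \<A>" using empt[OF J'] uniq E0 unfolding \<A>_def by blast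
      obtain B where B: "B \<in> \<A>" "B \<noteq> E0"
        using u(2) OA card_le_Suc0_iff_eq[of \<A>] by (metis finite not_less_eq_eq numeral_2_eq_2)
      have "A = E0 \<or> A = B" if A: "A \<in> \<A>" for A
      proof (rule ccontr)
        assume ne: "\<not> ?thesis"
        then have "A \<notin> ?E" "B \<notin> ?E" using uniq[of A] uniq[of B] B(2) by auto
        moreover have C: "A \<in> ?B" "A \<subseteq> J'" "B \<in> ?B" "B \<subseteq> J'" using A B(1) by (simp_all add: \<A>_def)
        ultimately obtain a b where ab: "a \<in> A" "a \<in> P j" "b \<in> B" "b \<in> P j" by auto
        have "a \<in> J'" "b \<in> J'" using ab C by auto
        then have "a = b" using smallD[OF resolutionsD(1)[OF J'] _ _ ab(2,4)] by simp
        then show False using parts_disjoint[OF C(1,3)] ab(1,3) ne by auto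
      qed
      then have "\<A> = {E0, B}" using OA B by blast
      then have "J' = E0 \<union> B" using u(1) by simp
      moreover have "B \<in> ?B - {E0}" using B by (simp add: \<A>_def)
      ultimately show "\<exists>B\<in>?B - {E0}. J' = E0 \<union> B \<or> J' = - (E0 \<union> B)" by blast
    qed
  qed
qed

text \<open>The resolutions correspond to the branches other than \<open>E0\<close>, so
  \<open>sum_split_vec_partition\<close> rewrites the sum through the branches themselves. These are
  members of \<open>T\<close> or single labels, and the latter have zero split vector.\<close>

lemma balance_aux: "(\<Sum>J\<in>resolutions j T. split_vec J) \<in> span (split_vec ` T)"
proof -
  let ?B = "parts T J"
  obtain E0 where E0': "E0 \<in> ?B"
    "\<forall>B\<in>?B - {E0}. small j (E0 \<union> B) \<or> small j (- (E0 \<union> B))"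
    "\<forall>J'\<in>resolutions j T. \<exists>B\<in>?B - {E0}. J' = E0 \<union> B \<or> J' = - (E0 \<union> B)"
    using distinguished_part by (elim bexE conjE) (rule that)
  note E0 = E0'(1) bspec[OF E0'(2)] bspec[OF E0'(3)]
  \<comment> \<open>\<open>resolutions\<close> lists small sides only, so the small one of the two
    sides is taken.\<close>
  define g where "g B = (if small j (E0 \<union> B) then E0 \<union> B else - (E0 \<union> B))" for B
  have cT: "centered j T" using centered_remove[OF resolutionsD(5)[OF J] T(1)] .
  have new: "nontrivial (E0 \<union> B)" "E0 \<union> B \<notin> T" "\<And>I. I \<in> T \<Longrightarrow> compat I (E0 \<union> B)" if B: "B \<in> ?B - {E0}" for B
  proof -
    have "card (?B - {E0, B}) \<ge> 2" using card_parts B E0(1) 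
    proof -
      have "card {E0, B} \<le> 2" by (simp add: card_insert_if)
      then show ?thesis using card_parts B E0(1) by (subst card_Diff_subset) auto
    qed
    moreover have "E0 \<noteq> B" using B by blast
    then have "card {E0, B} \<ge> 2" by simp
    ultimately show "nontrivial (E0 \<union> B)" "E0 \<union> B \<notin> T" "\<And>I. I \<in> T \<Longrightarrow> compat I (E0 \<union> B)"
      using union_parts_new[of "{E0, B}"] B E0(1) by simp_all
  qed
  have inj: "inj_on g (?B - {E0})"
  proof (rule inj_onI)
    fix B C assume BC: "B \<in> ?B - {E0}" "C \<in> ?B - {E0}" "g B = g C"
    have ne: "E0 \<noteq> {}" by (rule parts_nonempty[OF E0(1)])
    have "E0 \<union> B \<noteq> - (E0 \<union> C)" "- (E0 \<union> B) \<noteq> E0 \<union> C" using ne by blast+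
    moreover have "X = Y" if "(if a then X else - X) = (if b then Y else - Y)" "X \<noteq> - Y" "- X \<noteq> Y"
      for X Y :: "'l set" and a b using that by (simp split: if_splits)
    ultimately have "E0 \<union> B = E0 \<union> C" using BC(3) unfolding g_def by metis
    moreover have "E0 \<inter> B = {}" "E0 \<inter> C = {}" using parts_disjoint[OF E0(1)] BC by blast+
    ultimately show "B = C" by blast
  qed
  have img: "g ` (?B - {E0}) = resolutions j T"
  proof
    show "g ` (?B - {E0}) \<subseteq> resolutions j T"
    proof
      fix K assume "K \<in> g ` (?B - {E0})"
      then obtain B where B: "B \<in> ?B - {E0}" "K = g B" by blast
      have "small j K" using E0(2)[OF B(1)] by (auto simp: B(2) g_def)
      moreover have "K \<notin> T" using new(2)[OF B(1)] split_systemD(2)[OF T(1), of "- (E0 \<union> B)"] by (auto simp: B(2) g_def)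
      moreover have "insert_split K T = insert_split (E0 \<union> B) T" by (auto simp: B(2) g_def insert_split_def)
      moreover have "centered j (insert_split (E0 \<union> B) T)"
        by (rule centered_insert[OF cT new(1)[OF B(1)] new(3)[OF B(1)] E0(2)[OF B(1)]])
      ultimately show "K \<in> resolutions j T" by (simp add: resolutions_def)
    qed
    show "resolutions j T \<subseteq> g ` (?B - {E0})"
    proof
      fix J' assume J': "J' \<in> resolutions j T"
      then obtain B where B: "B \<in> ?B - {E0}" "J' = E0 \<union> B \<or> J' = - (E0 \<union> B)" using E0(3) by blast
      have "J' = g B" using B(2) resolutionsD(1)[OF J'] small_compl[OF j, of "E0 \<union> B"] by (auto simp: g_def)
      then show "J' \<in> g ` (?B - {E0})" using B(1) by blast
    qed
  qed
  have "(\<Sum>J\<in>resolutions j T. split_vec J) = (\<Sum>B\<in>?B - {E0}. split_vec (g B))"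
    unfolding img[symmetric] by (simp add: sum.reindex[OF inj])
  also have "\<dots> = (\<Sum>B\<in>?B - {E0}. split_vec (E0 \<union> B))"
    by (rule sum.cong[OF refl]) (metis g_def split_vec_uminus)
  also have "\<dots> = (\<Sum>B\<in>?B - {E0}. split_vec B) + (real (card ?B) - 3) *\<^sub>R split_vec E0"
    by (rule sum_split_vec_partition[OF parts_Union parts_disjoint E0(1)])
  also have "\<dots> \<in> span (split_vec ` T)"
  proof -
    have "split_vec B \<in> span (split_vec ` T)" if B: "B \<in> ?B" for B
    proof (cases "B \<in> T")
      case True then show ?thesis by (intro span_base) blast
    next
      case False
      then have "split_vec B = 0" using part_type[OF B] by (intro split_vec_trivial) auto
      then show ?thesis by (simp add: span_zero)
    qed
    then show ?thesis using E0(1) by (intro span_add span_scale span_sum) auto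
  qed
  finally show ?thesis .
qed

end

lemma balance:
  assumes "3 \<le> j" "j \<le> n" "split_system T" "card T + 2 * j + 2 = 2 * CARD('l)"
  shows "(\<Sum>J\<in>resolutions j T. split_vec J) \<in> span (split_vec ` T)"
proof (cases "resolutions j T = {}")
  case False then show ?thesis using balance_aux[OF assms] by blast
qed (simp add: span_zero)

end

section \<open>Intersection with the forgetful divisors\<close>

context marked
begin

definition ft_coord :: "nat \<Rightarrow> 'l \<times> 'l \<times> 'l \<times> 'l" where "ft_coord i = (q 1, q 2, q 3, q i)"
definition ft_fun :: "nat \<Rightarrow> ('l ambient \<times> (real^2)) \<Rightarrow> real" where "ft_fun i y = fst y $ ft_coord i"

lemma linear_ft_fun: "linear (ft_fun i)"
  unfolding ft_fun_def by (rule linear_fst_nth)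

text \<open>\<open>weil_divisor\<close> keeps all cells up to the new dimension, so the cycle is
  visible only in the weights of the maximal ones. The equation
  \<open>card S + 2 * j = 2 * CARD('l)\<close> singles out the maximal cells.\<close>

definition centered_complex :: "nat \<Rightarrow> ('l ambient \<times> (real^2)) wcomplex \<Rightarrow> bool" where
  "centered_complex j X \<longleftrightarrow> wdim X = int CARD('l) + 2 - int j \<and>
     cells X = {fan_cell S |S. split_system S \<and> aff_dim (fan_cell S) \<le> wdim X} \<and>
     (\<forall>S. split_system S \<longrightarrow> card S + 2 * j = 2 * CARD('l) \<longrightarrow>
        wt X (fan_cell S) = (if centered j S then 1 else 0))"

lemma polyhedral_centered_complex: "centered_complex j X \<Longrightarrow> polyhedral X"
  unfolding polyhedral_def
proof (intro conjI ballI)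
  assume X: "centered_complex j X"
  have cells: "\<exists>S. c = fan_cell S \<and> split_system S" if "c \<in> cells X" for c
    using that X unfolding centered_complex_def by auto
  have "cells X \<subseteq> range fan_cell" using cells by blast
  then show "finite (cells X)" by (rule finite_subset) simp
  fix c assume c: "c \<in> cells X"
  obtain S where S: "c = fan_cell S" "split_system S" using cells[OF c] by blast
  then show "convex c" "c \<noteq> {}" by (simp_all add: fan_cell_convex fan_cell_ne)
  show "aff_dim c \<le> wdim X" using c X unfolding centered_complex_def by auto
  fix c' assume "c' \<in> cells X"
  then obtain S' where S': "c' = fan_cell S'" "split_system S'" using cells by blast
  have "fan_cell (S \<inter> S') face_of fan_cell S"
    by (rule fan_cell_face[OF S(2) split_system_Int[OF S(2) S'(2)]]) blast
  then show "c \<inter> c' face_of c" using fan_cell_Int[OF S(2) S'(2)] S(1) S'(1) by simp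
qed

lemma q_neq: "\<lbrakk>a \<in> {1..n}; b \<in> {1..n}; a \<noteq> b\<rbrakk> \<Longrightarrow> q a \<noteq> q b"
  using inj_q by (meson inj_onD)

lemma distinct_coord: "4 \<le> i \<Longrightarrow> i \<le> n \<Longrightarrow> distinct [q 1, q 2, q 3, q i]"
  using q_neq[of 1 2] q_neq[of 1 3] q_neq[of 1 i] q_neq[of 2 3] q_neq[of 2 i] q_neq[of 3 i] n3 by auto

lemma ft_coord_value:
  assumes "4 \<le> i" "i \<le> n"
  shows "split_vec I $ ft_coord i = (if separates I (q 1) (q 2) (q 3) (q i) then 1
    else if separates I (q 1) (q i) (q 2) (q 3) then -1 else 0)"
  unfolding ft_coord_def by (rule split_vec_coord[OF distinct_coord[OF assms]])

lemma cell_in_side: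
  assumes "\<And>I. I \<in> S \<Longrightarrow> \<epsilon> * split_vec I $ ft_coord i \<ge> 0"
  shows "fan_cell S \<subseteq> side (ft_fun i) \<epsilon>"
proof
  fix y assume "y \<in> fan_cell S"
  then obtain x where x: "fst y = (\<Sum>I\<in>S. x I *\<^sub>R split_vec I)" "\<forall>I\<in>S. x I \<ge> 0"
    by (auto simp: fan_cell_def split_cone_def)
  have "\<epsilon> * ft_fun i y = (\<Sum>I\<in>S. x I * (\<epsilon> * split_vec I $ ft_coord i))"
    unfolding ft_fun_def x(1) by (simp add: sum_distrib_left mult.left_commute)
  also have "\<dots> \<ge> 0" by (rule sum_nonneg) (use assms x(2) in auto)
  finally show "y \<in> side (ft_fun i) \<epsilon>" by (simp add: side_def)
qed

text \<open>Splits for the pairings 12|3i and 1i|23 are incompatible, so the forgetful function does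
  not change sign on a cone. This is why cutting along it creates no new cells in
  \<open>cells_cut_ft\<close>.\<close>

lemma constant_sign:
  assumes i: "4 \<le> i" "i \<le> n" and S: "split_system S"
  obtains \<epsilon> where "\<epsilon> = 1 \<or> \<epsilon> = -1" "\<And>I. I \<in> S \<Longrightarrow> \<epsilon> * split_vec I $ ft_coord i \<ge> 0"
proof (cases "\<exists>I\<in>S. separates I (q 1) (q 2) (q 3) (q i)")
  case True
  then obtain I where I: "I \<in> S" "separates I (q 1) (q 2) (q 3) (q i)" by blast
  have "\<not> separates K (q 1) (q i) (q 2) (q 3)" if "K \<in> S" for K
    using split_systemD(3)[OF S I(1) that] I(2) unfolding compat_def separates_def by auto
  then show ?thesis using that[of 1] by (simp add: ft_coord_value[OF i])
next
  case False
  then show ?thesis using that[of "-1"] by (simp add: ft_coord_value[OF i])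
qed

lemma fan_cell_zero:
  assumes S: "split_system S" and \<epsilon>: "\<epsilon> = 1 \<or> \<epsilon> = -1"
    and sign: "\<And>I. I \<in> S \<Longrightarrow> \<epsilon> * split_vec I $ ft_coord i \<ge> 0"
  shows "fan_cell S \<inter> {y. ft_fun i y = 0} = fan_cell {I \<in> S. split_vec I $ ft_coord i = 0}"
proof
  let ?k = "ft_coord i" and ?S0 = "{I \<in> S. split_vec I $ ft_coord i = 0}"
  show "fan_cell ?S0 \<subseteq> fan_cell S \<inter> {y. ft_fun i y = 0}"
  proof
    fix y assume y: "y \<in> fan_cell ?S0"
    then obtain x where x: "fst y = (\<Sum>I\<in>?S0. x I *\<^sub>R split_vec I)"
      by (auto simp: fan_cell_def split_cone_def)
    have "ft_fun i y = (\<Sum>I\<in>?S0. x I * split_vec I $ ?k)" unfolding ft_fun_def x by simp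
    also have "\<dots> = 0" by (rule sum.neutral) simp
    finally show "y \<in> fan_cell S \<inter> {y. ft_fun i y = 0}" using y fan_cell_mono[of ?S0 S] by blast
  qed
  show "fan_cell S \<inter> {y. ft_fun i y = 0} \<subseteq> fan_cell ?S0"
  proof
    fix y assume y: "y \<in> fan_cell S \<inter> {y. ft_fun i y = 0}"
    then have yS: "fst y \<in> split_cone S" by (auto simp: fan_cell_def)
    obtain x where x: "\<forall>I\<in>support (fst y). x I > 0" "fst y = (\<Sum>I\<in>support (fst y). x I *\<^sub>R split_vec I)"
      using support_props(3)[OF S yS] by blast
    have sub: "support (fst y) \<subseteq> S" by (rule support_props(1)[OF S yS])
    have "ft_fun i y = (\<Sum>I\<in>support (fst y). x I * split_vec I $ ?k)"
      unfolding ft_fun_def using arg_cong[OF x(2), of "\<lambda>v. v $ ?k"] by simp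
    then have "(\<Sum>I\<in>support (fst y). x I * (\<epsilon> * split_vec I $ ?k)) = 0"
      using y by (simp add: mult.left_commute[of _ \<epsilon>] flip: sum_distrib_left)
    moreover have "x I * (\<epsilon> * split_vec I $ ?k) \<ge> 0" if "I \<in> support (fst y)" for I
    proof (rule mult_nonneg_nonneg)
      show "x I \<ge> 0" using x(1) that by (simp add: less_imp_le)
      show "\<epsilon> * split_vec I $ ?k \<ge> 0" by (rule sign) (use that sub in blast)
    qed
    ultimately have prod0: "x I * (\<epsilon> * split_vec I $ ?k) = 0" if "I \<in> support (fst y)" for I
      using that by (intro sum_nonneg_0[OF finite, where f = "\<lambda>I. x I * (\<epsilon> * split_vec I $ ?k)"])
    have "\<forall>I\<in>support (fst y). split_vec I $ ?k = 0"
    proof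
      fix I assume I: "I \<in> support (fst y)"
      have "x I \<noteq> 0" "\<epsilon> \<noteq> 0" using x(1) I \<epsilon> by auto
      then show "split_vec I $ ?k = 0" using prod0[OF I] by simp
    qed
    then have "support (fst y) \<subseteq> ?S0" using sub by blast
    then have "fst y \<in> split_cone ?S0" using mem_cone_support[OF S yS] split_cone_mono by blast
    then show "y \<in> fan_cell ?S0" by (auto simp: fan_cell_def mem_Times_iff)
  qed
qed

lemma cells_cut_ft:
  assumes X: "centered_complex j X" and i: "4 \<le> i" "i \<le> n"
  shows "cells (cut (ft_fun i) X) = cells X"
proof
  have cellsX: "cells X = {fan_cell S |S. split_system S \<and> aff_dim (fan_cell S) \<le> wdim X}"
    using X by (simp add: centered_complex_def)
  show "cells (cut (ft_fun i) X) \<subseteq> cells X"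
  proof
    fix c assume c: "c \<in> cells (cut (ft_fun i) X)"
    obtain r h where r: "r \<in> cells X" "c = r \<inter> h"
      "h = side (ft_fun i) 1 \<or> h = side (ft_fun i) (-1) \<or> h = {y. ft_fun i y = 0}"
      by (rule cut_cellE[OF c]) (rule that)
    obtain S where S: "r = fan_cell S" "split_system S" using r(1) cellsX by auto
    obtain \<epsilon> where \<epsilon>: "\<epsilon> = 1 \<or> \<epsilon> = -1" "\<And>I. I \<in> S \<Longrightarrow> \<epsilon> * split_vec I $ ft_coord i \<ge> 0"
      using constant_sign[OF i S(2)] by blast
    have sub: "r \<subseteq> side (ft_fun i) \<epsilon>" unfolding S(1) by (rule cell_in_side[OF \<epsilon>(2)])
    have "side (ft_fun i) 1 \<inter> side (ft_fun i) (-1) = {y. ft_fun i y = 0}" by (auto simp: side_def)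
    then have "c = r \<or> c = r \<inter> {y. ft_fun i y = 0}" using r(2,3) \<epsilon>(1) sub by blast
    then show "c \<in> cells X"
    proof
      assume "c = r \<inter> {y. ft_fun i y = 0}"
      then have c_eq: "c = fan_cell {I \<in> S. split_vec I $ ft_coord i = 0}"
        using fan_cell_zero[OF S(2) \<epsilon>] S(1) by simp
      have "split_system {I \<in> S. split_vec I $ ft_coord i = 0}"
        by (rule split_system_subset[OF S(2)]) (use split_systemD(2)[OF S(2)] in \<open>auto simp: split_vec_uminus\<close>)
      moreover have "aff_dim c \<le> wdim X" using aff_dim_subset[of c r] r(1,2) cellsX by fastforce
      ultimately show ?thesis using cellsX c_eq by blast
    qed (use r(1) in simp)
  qed
  show "cells X \<subseteq> cells (cut (ft_fun i) X)"
  proof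
    fix c assume c: "c \<in> cells X"
    then obtain S where S: "c = fan_cell S" "split_system S" using cellsX by auto
    obtain \<epsilon> where \<epsilon>: "\<epsilon> = 1 \<or> \<epsilon> = -1" "\<And>I. I \<in> S \<Longrightarrow> \<epsilon> * split_vec I $ ft_coord i \<ge> 0"
      using constant_sign[OF i S(2)] by blast
    have "c \<subseteq> side (ft_fun i) \<epsilon>" unfolding S(1) by (rule cell_in_side[OF \<epsilon>(2)])
    then have eq: "c \<inter> side (ft_fun i) \<epsilon> = c" by (rule Int_absorb2)
    have "c \<inter> side (ft_fun i) \<epsilon> \<in> cells (cut (ft_fun i) X)"
    proof (rule cut_cellI[OF c])
      show "c \<inter> side (ft_fun i) \<epsilon> \<noteq> {}" by (subst eq) (simp add: S(1) fan_cell_ne)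
    qed (use \<epsilon>(1) in auto)
    then show "c \<in> cells (cut (ft_fun i) X)" unfolding eq .
  qed
qed

lemma aff_dim_fan_cell_eq_iff:
  assumes "split_system S"
  shows "aff_dim (fan_cell S) = int CARD('l) + 2 - int j \<longleftrightarrow> card S + 2 * j = 2 * CARD('l)"
  using aff_dim_fan_cell[OF assms] by linarith

lemma insert_resolution_eq:
  assumes "J \<in> resolutions j T" "split_system T"
  shows "insert_split J T - {J, - J} = T"
  using resolutionsD(2)[OF assms(1)] split_systemD(2)[OF assms(2), of "- J"] by (auto simp: insert_split_def)

text \<open>Only maximal cells with centered systems survive in the sum. Each arises from
  \<open>T\<close> by adding one split, which the small side represents uniquely.\<close>

lemma sum_star:
  fixes h :: "('l ambient \<times> (real^2)) set \<Rightarrow> 'b::comm_monoid_add"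
  assumes X: "centered_complex j X" and j: "3 \<le> j" "j \<le> n"
    and T: "split_system T" "card T + 2 * j + 2 = 2 * CARD('l)"
    and zero: "\<And>s. wt X s = 0 \<Longrightarrow> h s = 0"
  shows "(\<Sum>s | s \<in> cells X \<and> aff_dim s = wdim X \<and> fan_cell T face_of s. h s)
    = (\<Sum>J\<in>resolutions j T. h (fan_cell (insert_split J T)))"
proof -
  let ?A = "{s. s \<in> cells X \<and> aff_dim s = wdim X \<and> fan_cell T face_of s}"
  let ?c = "\<lambda>J. fan_cell (insert_split J T)"
  have wd: "wdim X = int CARD('l) + 2 - int j" and cellsX: "cells X = {fan_cell S |S. split_system S \<and> aff_dim (fan_cell S) \<le> wdim X}"
    and wts: "\<And>S. split_system S \<Longrightarrow> card S + 2 * j = 2 * CARD('l) \<Longrightarrow> wt X (fan_cell S) = (if centered j S then 1 else 0)"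
    using X by (simp_all add: centered_complex_def)
  have sys: "split_system (insert_split J T)" "card (insert_split J T) + 2 * j = 2 * CARD('l)" if "J \<in> resolutions j T" for J
    using resolutionsD[OF that] card_insert_split[OF T(1)] T(2) by (auto simp: centered_def)
  have inj: "inj_on ?c (resolutions j T)"
  proof (rule inj_onI)
    fix J J' assume J: "J \<in> resolutions j T" "J' \<in> resolutions j T" "?c J = ?c J'"
    have "insert_split J T = insert_split J' T" using fan_cell_inj[OF sys(1)[OF J(1)] sys(1)[OF J(2)] J(3)] .
    then have "J' = J \<or> J' = - J" using resolutionsD(2)[OF J(2)] by (auto simp: insert_split_def)
    then show "J = J'" using small_compl[OF j resolutionsD(1)[OF J(1)]] resolutionsD(1)[OF J(2)] by blast
  qed
  have "sum h ?A = sum h (?c ` resolutions j T)"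
  proof (rule sum.mono_neutral_right)
    show "finite ?A" using polyhedral_centered_complex[OF X] by (simp add: polyhedral_def)
    show "?c ` resolutions j T \<subseteq> ?A"
    proof clarify
      fix J assume J: "J \<in> resolutions j T"
      have "aff_dim (?c J) = wdim X" using aff_dim_fan_cell_eq_iff[OF sys(1)[OF J], of j] sys(2)[OF J] wd by simp
      moreover have "fan_cell T face_of ?c J"
        by (rule fan_cell_face[OF sys(1)[OF J] T(1)]) (unfold insert_split_def, blast)
      moreover have "?c J \<in> cells X" unfolding cellsX
        using sys(1)[OF J] calculation(1) by (intro CollectI exI[of _ "insert_split J T"] conjI) simp_all
      ultimately show "?c J \<in> cells X \<and> aff_dim (?c J) = wdim X \<and> fan_cell T face_of ?c J" by simp
    qed
    show "\<forall>s\<in>?A - ?c ` resolutions j T. h s = 0"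
    proof (rule ballI, rule ccontr)
      fix s assume s: "s \<in> ?A - ?c ` resolutions j T" and hs: "h s \<noteq> 0"
      have wt: "wt X s \<noteq> 0" using zero[of s] hs by auto
      obtain S where S: "s = fan_cell S" "split_system S" using s cellsX by auto
      have cS: "card S + 2 * j = 2 * CARD('l)" using aff_dim_fan_cell_eq_iff[OF S(2), of j] s S(1) wd by simp
      have cen: "centered j S" using wt wts[OF S(2) cS] S(1) by (simp split: if_splits)
      have dim: "aff_dim (fan_cell S) = aff_dim (fan_cell T) + 1"
        using aff_dim_fan_cell[OF S(2)] aff_dim_fan_cell[OF T(1)] cS T(2) by linarith
      have "fan_cell T face_of fan_cell S" using s S(1) by simp
      then obtain J where J: "J \<in> S" "J \<notin> T" "- J \<notin> T" "T = S - {J, - J}" "S = T \<union> {J, - J}"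
        using fan_cell_facetE[OF S(2) T(1) _ dim] by metis
      have "small j J \<or> small j (- J)" using cen J(1) by (auto simp: centered_def)
      then obtain K where K: "K = J \<or> K = - J" "small j K" by blast
      then have "insert_split K T = S" using J(5) by (auto simp: insert_split_def)
      then have "K \<in> resolutions j T" using K J(2,3) cen by (auto simp: resolutions_def)
      then show False using s S(1) \<open>insert_split K T = S\<close> by blast
    qed
  qed
  also have "\<dots> = (\<Sum>J\<in>resolutions j T. h (?c J))" by (simp add: sum.reindex[OF inj])
  finally show ?thesis .
qed

lemma normal_sum_mem:
  assumes j: "3 \<le> j" "j \<le> n" and T: "split_system T" "card T + 2 * j + 2 = 2 * CARD('l)"
  shows "(\<Sum>J\<in>resolutions j T. normal_vec moduli_lattice (fan_cell (insert_split J T)) (fan_cell T)) \<in> split_span T"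
proof -
  let ?n = "\<lambda>J. normal_vec moduli_lattice (fan_cell (insert_split J T)) (fan_cell T)"
  have "?n J - (split_vec J, 0) \<in> split_span T" if J: "J \<in> resolutions j T" for J
    using fan_cell_normal_vec[of "insert_split J T" J] resolutionsD(5)[OF J] insert_resolution_eq[OF J T(1)]
    by (simp add: centered_def insert_split_def)
  then have "(\<Sum>J\<in>resolutions j T. ?n J - (split_vec J, 0)) \<in> split_span T"
    by (intro subspace_sum subspace_split_span)
  moreover have "(\<Sum>J\<in>resolutions j T. (split_vec J, 0 :: real^2)) \<in> split_span T"
    using balance[OF j T] by (simp add: split_span_def mem_Times_iff fst_sum)
  ultimately have "(\<Sum>J\<in>resolutions j T. ?n J - (split_vec J, 0)) + (\<Sum>J\<in>resolutions j T. (split_vec J, 0)) \<in> split_span T"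
    by (intro subspace_add subspace_split_span)
  then show ?thesis by (simp add: sum_subtractf)
qed

text \<open>This is the branch of the central vertex that contains the label \<open>a\<close>: a
  largest small member of \<open>T\<close> around \<open>a\<close>, or \<open>{a}\<close> if there
  is none.\<close>

lemma block_exists:
  assumes j: "3 \<le> j" "j \<le> n" and T: "centered j T"
  obtains M where "a \<in> M" "M \<in> T \<or> M = {a}" "small j M" "\<And>I. I \<in> T \<Longrightarrow> small j I \<Longrightarrow> I \<subseteq> M \<or> I \<inter> M = {}"
proof -
  have sys: "split_system T" using T by (simp add: centered_def)
  let ?A = "{M. a \<in> M \<and> small j M \<and> (M \<in> T \<or> M = {a})}"
  have "small j {a}" by (rule smallI) auto
  then have "?A \<noteq> {}" by blast
  then obtain M where M: "M \<in> ?A" "\<forall>B\<in>?A. M \<subseteq> B \<longrightarrow> M = B"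
    by (rule bexE[OF finite_has_maximal[OF finite]]) (rule that)
  have "I \<subseteq> M \<or> I \<inter> M = {}" if I: "I \<in> T" "small j I" for I
  proof (rule ccontr)
    assume no: "\<not> ?thesis"
    have "compat M I" using M(1) I(1) split_systemD(3)[OF sys _ I(1)] compat_singleton by auto
    then have "M \<subseteq> I" using small_nested[OF j _ I(2), of M] M(1) no by blast
    then have "I \<in> ?A" using M(1) I by blast
    then have "M = I" using M(2) \<open>M \<subseteq> I\<close> by blast
    then show False using no by blast
  qed
  then show ?thesis using that[of M] M(1) by blast
qed

lemma P_Suc: "P (Suc j) = insert (q (Suc j)) (P j)" by (auto simp: P_def atLeastAtMostSuc_conv)

lemma q_mem_P: "1 \<le> a \<Longrightarrow> a \<le> j \<Longrightarrow> q a \<in> P j" by (auto simp: P_def)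

lemma q_Suc_notin: "Suc j \<le> n \<Longrightarrow> q (Suc j) \<notin> P j"
  using q_neq[of "Suc j"] unfolding P_def by fastforce

lemma small_separates:
  assumes "3 \<le> j" "Suc j \<le> n" "small j I" "separates I (q 1) (q 2) (q 3) (q (Suc j))"
  shows "q 3 \<in> I" "q (Suc j) \<in> I"
proof -
  have "\<not> (q 1 \<in> I \<and> q 2 \<in> I)"
    using smallD[OF assms(3), of "q 1" "q 2"] q_mem_P[of 1 j] q_mem_P[of 2 j] q_neq[of 1 2] assms(1,2) by auto
  then show "q 3 \<in> I" "q (Suc j) \<in> I" using assms(4) by (auto simp: separates_def)
qed

lemma separates_uminus: "separates (- I) a b c d = separates I a b c d" by (auto simp: separates_def)

text \<open>The resolution in question joins the branch \<open>A\<close> of the new marking to the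
  branch \<open>B\<close> of \<open>q 3\<close>. Every candidate contains both branches, so it is
  compatible with \<open>A \<union> B\<close> and equals it by
  \<open>resolutions_crossing\<close>.\<close>

lemma unique_resolution:
  assumes j: "3 \<le> j" "Suc j \<le> n" and T: "centered (Suc j) T" "card T + 2 * j + 2 = 2 * CARD('l)"
  shows "\<exists>J. {J \<in> resolutions j T. separates J (q 1) (q 2) (q 3) (q (Suc j))} = {J}"
proof -
  let ?i = "Suc j"
  have jn: "j \<le> n" "3 \<le> ?i" using j by auto
  have sys: "split_system T" using T(1) by (simp add: centered_def)
  have cT: "centered j T" using T(1) small_mono[of j ?i] by (auto simp: centered_def)
  obtain A where A: "q ?i \<in> A" "A \<in> T \<or> A = {q ?i}" "small ?i A" "\<And>I. I \<in> T \<Longrightarrow> small ?i I \<Longrightarrow> I \<subseteq> A \<or> I \<inter> A = {}"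
    using block_exists[OF jn(2) j(2) T(1)] by blast
  obtain B where B: "q 3 \<in> B" "B \<in> T \<or> B = {q 3}" "small ?i B" "\<And>I. I \<in> T \<Longrightarrow> small ?i I \<Longrightarrow> I \<subseteq> B \<or> I \<inter> B = {}"
    using block_exists[OF jn(2) j(2) T(1)] by blast
  have P3: "q 3 \<in> P j" "q 3 \<in> P ?i" "q ?i \<in> P ?i" using q_mem_P j by auto
  have ne: "q 3 \<noteq> q ?i" using q_neq[of 3 ?i] j by auto
  have AP: "a = q ?i" if "a \<in> A" "a \<in> P ?i" for a using smallD[OF A(3) that(1) A(1) that(2) P3(3)] .
  have BP: "a = q 3" if "a \<in> B" "a \<in> P ?i" for a using smallD[OF B(3) that(1) B(1) that(2) P3(2)] .
  define J where "J = A \<union> B"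
  have qJ: "q 3 \<in> J" "q ?i \<in> J" using A(1) B(1) by (auto simp: J_def)
  have JP: "a = q 3" if "a \<in> J" "a \<in> P j" for a
  proof -
    have "a \<in> P ?i" "a \<noteq> q ?i" using that(2) P_Suc q_Suc_notin[OF j(2)] by auto
    then show ?thesis using that(1) AP BP by (auto simp: J_def)
  qed
  have sJ: "small j J" by (rule smallI) (use JP in blast)
  have "card {q 3, q ?i} \<le> card J" using qJ by (intro card_mono) auto
  then have nJ: "nontrivial J" using ne small_compl_card[OF j(1) jn(1) sJ] by (simp add: nontrivial_def)
  have cJ: "compat I J" if I: "I \<in> T" for I
  proof -
    have *: "compat K J" if "K \<in> T" "small ?i K" for K
      using A(4)[OF that] B(4)[OF that] unfolding compat_def J_def by blast
    have "small ?i I \<or> small ?i (- I)" using T(1) I by (auto simp: centered_def)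
    then show ?thesis using *[of I] *[of "- I"] I split_systemD(2)[OF sys I] compat_uminus(2) by blast
  qed
  have JT: "J \<notin> T"
  proof
    assume "J \<in> T"
    then have "small ?i J \<or> small ?i (- J)" using T(1) by (auto simp: centered_def)
    then show False
    proof
      assume "small ?i J" then show False using smallD[of ?i J "q 3" "q ?i"] qJ P3 ne by blast
    next
      assume "small ?i (- J)"
      then have "small j (- J)" by (rule small_mono[rotated]) simp
      then show False using small_compl[OF j(1) jn(1) sJ] by blast
    qed
  qed
  have JR: "J \<in> resolutions j T"
    unfolding resolutions_def using sJ JT centered_insert[OF cT nJ cJ] by blast
  have q12: "q 1 \<notin> J" "q 2 \<notin> J"
    using JP[of "q 1"] JP[of "q 2"] q_mem_P[of 1 j] q_mem_P[of 2 j] q_neq[of 1 3] q_neq[of 2 3] j by auto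
  have "J' = J" if J': "J' \<in> resolutions j T" "separates J' (q 1) (q 2) (q 3) (q ?i)" for J'
  proof -
    have qJ': "q 3 \<in> J'" "q ?i \<in> J'" using small_separates[OF j resolutionsD(1)[OF J'(1)] J'(2)] .
    have "A \<subseteq> J'"
    proof (cases "A = {q ?i}")
      case False
      then have "compat A J'" using A(2) resolutionsD(4)[OF J'(1)] by blast
      then have "A \<subseteq> J' \<or> J' \<subseteq> A"
        using small_nested[OF j(1) jn(1) small_mono[OF _ A(3)] resolutionsD(1)[OF J'(1)]] A(1) qJ'(2) by auto
      moreover have "\<not> J' \<subseteq> A" using AP[of "q 3"] qJ'(1) P3(2) ne by blast
      ultimately show ?thesis by blast
    qed (use qJ' in simp)
    moreover have "B \<subseteq> J'"
    proof (cases "B = {q 3}")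
      case False
      then have "compat B J'" using B(2) resolutionsD(4)[OF J'(1)] by blast
      then have "B \<subseteq> J' \<or> J' \<subseteq> B"
        using small_nested[OF j(1) jn(1) small_mono[OF _ B(3)] resolutionsD(1)[OF J'(1)]] B(1) qJ'(1) by auto
      moreover have "\<not> J' \<subseteq> B"
      proof
        assume "J' \<subseteq> B"
        then have "q ?i \<in> B" using qJ'(2) by blast
        then show False using BP[OF _ P3(3)] ne by simp
      qed
      ultimately show ?thesis by blast
    qed (use qJ' in simp)
    ultimately have "compat J J'" by (auto simp: J_def compat_def)
    then have "J' = J \<or> J' = - J"
      using resolutions_crossing[OF j(1) jn(1) sys T(2) JR resolutionsD(3,2)[OF J'(1)] _ resolutionsD(4)[OF J'(1)]]
        resolutionsD(1)[OF J'(1)] by blast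
    then show ?thesis using qJ(1) qJ'(1) by blast
  qed
  moreover have "separates J (q 1) (q 2) (q 3) (q ?i)" using qJ q12 by (auto simp: separates_def)
  ultimately show ?thesis using JR by blast
qed

text \<open>If two of the markings \<open>q 1, \<dots>, q (Suc j)\<close> lie in a common branch of the vertex, then the
  forgetful function has the same sign on all cells around \<open>fan_cell T\<close>.\<close>

lemma uncentered_sign:
  assumes j: "3 \<le> j" "Suc j \<le> n" and T: "split_system T" "\<not> centered (Suc j) T"
  obtains \<epsilon> where "\<epsilon> = 1 \<or> \<epsilon> = -1"
    "\<And>J. J \<in> resolutions j T \<Longrightarrow> fan_cell (insert_split J T) \<subseteq> side (ft_fun (Suc j)) \<epsilon>"
proof (cases "resolutions j T = {}")
  case True then show ?thesis using that[of 1] by simp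
next
  case False
  let ?i = "Suc j"
  have i: "4 \<le> ?i" "?i \<le> n" and jn: "j \<le> n" using j by auto
  obtain J0 where "J0 \<in> resolutions j T" using False by blast
  then have cT: "centered j T" using centered_remove[OF resolutionsD(5) T(1)] by blast
  obtain K0 where K0: "K0 \<in> T" "\<not> small ?i K0" "\<not> small ?i (- K0)" using T by (auto simp: centered_def)
  \<comment> \<open>A cluster that is small for \<open>j\<close> but not for \<open>Suc j\<close>.
    It contains the new marking and exactly one earlier one, called \<open>a\<close> below.\<close>
  obtain K where K: "K \<in> T" "small j K" "\<not> small ?i K"
  proof (cases "small j K0")
    case True then show ?thesis using that K0 by blast
  next
    case False
    then have "small j (- K0)" using cT K0(1) by (auto simp: centered_def)
    then show ?thesis using that[of "- K0"] K0 split_systemD(2)[OF T(1) K0(1)] by blast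
  qed
  obtain b c where bc: "b \<in> K" "c \<in> K" "b \<in> P ?i" "c \<in> P ?i" "b \<noteq> c" using K(3) smallI by blast
  have "\<not> (b \<in> P j \<and> c \<in> P j)" using smallD[OF K(2) bc(1,2)] bc(5) by blast
  then obtain a where a: "a \<in> K" "a \<in> P j" and qi: "q ?i \<in> K" using bc unfolding P_Suc by blast
  have KP: "b = a" if "b \<in> K" "b \<in> P j" for b using smallD[OF K(2) that(1) a(1) that(2) a(2)] .
  have P123: "q 1 \<in> P j" "q 2 \<in> P j" "q 3 \<in> P j" using q_mem_P j by auto
  have n123: "q 1 \<noteq> q 3" "q 2 \<noteq> q 3" using q_neq[of 1 3] q_neq[of 2 3] j by auto
  show ?thesis
  proof (cases "a = q 3")
    case True
    \<comment> \<open>Here \<open>K\<close> itself separates 12|3(j+1), which excludes the pairing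
      of negative sign in every system containing \<open>K\<close>.\<close>
    have "q 1 \<notin> K" "q 2 \<notin> K" using KP P123 n123 True by metis+
    then have sep: "separates K (q 1) (q 2) (q 3) (q ?i)" using a(1) qi True by (simp add: separates_def)
    show ?thesis
    proof (rule that[of 1])
      fix J assume J: "J \<in> resolutions j T"
      have sys: "split_system (insert_split J T)" using resolutionsD(5)[OF J] by (simp add: centered_def)
      have KS: "K \<in> insert_split J T" using K(1) by (simp add: insert_split_def)
      show "fan_cell (insert_split J T) \<subseteq> side (ft_fun ?i) 1"
      proof (rule cell_in_side)
        fix I assume I: "I \<in> insert_split J T"
        have "\<not> separates I (q 1) (q ?i) (q 2) (q 3)"
          using split_systemD(3)[OF sys KS I] sep unfolding compat_def separates_def by auto
        then show "1 * split_vec I $ ft_coord ?i \<ge> 0" by (simp add: ft_coord_value[OF i])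
      qed
    qed simp
  next
    case False
    show ?thesis
    proof (rule that[of "-1"])
      fix J assume J: "J \<in> resolutions j T"
      have sys: "split_system (insert_split J T)" and cen: "centered j (insert_split J T)"
        using resolutionsD(5)[OF J] by (simp_all add: centered_def)
      have KS: "K \<in> insert_split J T" using K(1) by (simp add: insert_split_def)
      \<comment> \<open>A small cluster with \<open>q 3\<close> and the new marking would be nested
        with \<open>K\<close>. Then either \<open>K\<close> contains \<open>q 3\<close> besides
        \<open>a\<close>, or the small cluster contains \<open>a\<close> besides
        \<open>q 3\<close>.\<close>
      have no: "\<not> separates I (q 1) (q 2) (q 3) (q ?i)" if I: "I \<in> insert_split J T" "small j I" for I
      proof
        assume "separates I (q 1) (q 2) (q 3) (q ?i)"
        then have qI: "q 3 \<in> I" "q ?i \<in> I" using small_separates[OF j I(2)] by auto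
        have "I \<subseteq> K \<or> K \<subseteq> I"
          using small_nested[OF j(1) jn I(2) K(2) split_systemD(3)[OF sys I(1) KS]] qI(2) qi by blast
        then show False
        proof
          assume "I \<subseteq> K" then show False using KP[of "q 3"] qI(1) P123(3) False by blast
        next
          assume "K \<subseteq> I" then show False using smallD[OF I(2), of a "q 3"] a qI(1) P123(3) False by blast
        qed
      qed
      show "fan_cell (insert_split J T) \<subseteq> side (ft_fun ?i) (-1)"
      proof (rule cell_in_side)
        fix I assume I: "I \<in> insert_split J T"
        have "small j I \<or> small j (- I)" using cen I by (auto simp: centered_def)
        then have "\<not> separates I (q 1) (q 2) (q 3) (q ?i)"
        proof
          assume "small j (- I)"
          then have "\<not> separates (- I) (q 1) (q 2) (q 3) (q ?i)" by (rule no[OF split_systemD(2)[OF sys I]])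
          then show ?thesis by (simp only: separates_uminus not_False_eq_True)
        qed (rule no[OF I])
        then show "-1 * split_vec I $ ft_coord ?i \<ge> 0" by (simp add: ft_coord_value[OF i])
      qed
    qed simp
  qed
qed

lemma centered_ft_zero:
  assumes j: "3 \<le> j" "Suc j \<le> n" and T: "centered (Suc j) T" and I: "I \<in> T"
  shows "split_vec I $ ft_coord (Suc j) = 0"
proof -
  let ?i = "Suc j"
  have i: "4 \<le> ?i" "?i \<le> n" using j by auto
  have Pi: "q 1 \<in> P ?i" "q 2 \<in> P ?i" "q 3 \<in> P ?i" "q ?i \<in> P ?i" using q_mem_P j by auto
  have ne: "q 1 \<noteq> q 2" "q 3 \<noteq> q ?i" "q 1 \<noteq> q ?i" "q 2 \<noteq> q 3" using distinct_coord[OF i] by auto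
  have *: "\<not> separates K (q 1) (q 2) (q 3) (q ?i) \<and> \<not> separates K (q 1) (q ?i) (q 2) (q 3)" if "small ?i K" for K
    using smallD[OF that, of "q 1" "q 2"] smallD[OF that, of "q 3" "q ?i"] smallD[OF that, of "q 1" "q ?i"]
      smallD[OF that, of "q 2" "q 3"] Pi ne unfolding separates_def by blast
  have "small ?i I \<or> small ?i (- I)" using T I by (auto simp: centered_def)
  then have "\<not> separates I (q 1) (q 2) (q 3) (q ?i) \<and> \<not> separates I (q 1) (q ?i) (q 2) (q 3)"
  proof
    assume "small ?i (- I)"
    then show ?thesis by (rule *[of "- I", unfolded separates_uminus])
  qed (rule *)
  then show ?thesis by (simp add: ft_coord_value[OF i])
qed

lemma lin_part_ft:
  assumes "\<epsilon> = 1 \<or> \<epsilon> = -1" "c \<subseteq> side (ft_fun i) \<epsilon>" "v \<in> direction_space c"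
  shows "lin_part (\<lambda>y. max (ft_fun i y) 0) c v = (if \<epsilon> = 1 then ft_fun i v else 0)"
  using lin_part_side(2)[OF linear_ft_fun, of \<epsilon> c i 0 v] assms by simp

text \<open>All resolutions of \<open>T\<close> have weight one. If \<open>T\<close> is not centered
  for \<open>Suc j\<close>, the function is linear around \<open>T\<close> and balancing cancels
  everything. Otherwise it vanishes on \<open>T\<close>, and a resolution contributes 1 if it
  separates 12|3(j+1) and 0 if not, so \<open>unique_resolution\<close> gives the weight.\<close>

theorem centered_complex_Suc:
  assumes X: "centered_complex j X" and j: "3 \<le> j" "Suc j \<le> n"
  shows "centered_complex (Suc j) (cartier_intersect moduli_lattice (ft_fun (Suc j)) X)"
proof -
  let ?i = "Suc j" and ?Y = "cartier_intersect moduli_lattice (ft_fun (Suc j)) X"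
  let ?\<phi> = "\<lambda>y. max (ft_fun (Suc j) y) 0"
  have i: "4 \<le> ?i" "?i \<le> n" and jn: "j \<le> n" using j by auto
  have wd: "wdim X = int CARD('l) + 2 - int j" and cellsX: "cells X = {fan_cell S |S. split_system S \<and> aff_dim (fan_cell S) \<le> wdim X}"
    and wts: "\<And>S. split_system S \<Longrightarrow> card S + 2 * j = 2 * CARD('l) \<Longrightarrow> wt X (fan_cell S) = (if centered j S then 1 else 0)"
    using X by (simp_all add: centered_complex_def)
  have poly: "polyhedral X" by (rule polyhedral_centered_complex[OF X])
  have cells_cut: "cells (cut (ft_fun ?i) X) = cells X" by (rule cells_cut_ft[OF X i])
  have wdY: "wdim ?Y = wdim X - 1" by (simp add: cartier_intersect_def weil_divisor_def cut_def)
  have "cells ?Y = {c \<in> cells X. aff_dim c \<le> wdim X - 1}"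
    using cells_cut by (simp add: cartier_intersect_def weil_divisor_def) (simp add: cut_def)
  then have cellsY: "cells ?Y = {fan_cell S |S. split_system S \<and> aff_dim (fan_cell S) \<le> wdim ?Y}"
    unfolding wdY cellsX by fastforce
  have "wt ?Y (fan_cell T) = (if centered ?i T then 1 else 0)"
    if T: "split_system T" "card T + 2 * ?i = 2 * CARD('l)" for T
  proof -
    have T2: "card T + 2 * j + 2 = 2 * CARD('l)" using T(2) by simp
    let ?R = "resolutions j T"
    let ?c = "\<lambda>J. fan_cell (insert_split J T)" and ?t = "fan_cell T"
    let ?n = "\<lambda>J. normal_vec moduli_lattice (?c J) ?t"
    let ?A = "{s. s \<in> cells X \<and> aff_dim s = wdim X \<and> ?t face_of s}"
    have sys: "split_system (insert_split J T)" "card (insert_split J T) + 2 * j = 2 * CARD('l)" "centered j (insert_split J T)"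
      if "J \<in> ?R" for J
      using resolutionsD[OF that] card_insert_split[OF T(1)] T(2) by (auto simp: centered_def)
    have wtc: "wt (cut (ft_fun ?i) X) s = wt X s" if "s \<in> ?A" for s
      using polyhedral_cut_wt[OF poly, of s s] that by simp
    have wtR: "wt X (?c J) = 1" if "J \<in> ?R" for J using wts sys[OF that] by simp
    have "wt ?Y ?t = (\<Sum>s\<in>?A. wt (cut (ft_fun ?i) X) s * lin_part ?\<phi> s (normal_vec moduli_lattice s ?t))
        - lin_part ?\<phi> ?t (\<Sum>s\<in>?A. wt (cut (ft_fun ?i) X) s *\<^sub>R normal_vec moduli_lattice s ?t)"
      by (simp add: cartier_intersect_def weil_divisor_def weil_weight_def Let_def cells_cut) (simp add: cut_def)
    also have "(\<Sum>s\<in>?A. wt (cut (ft_fun ?i) X) s * lin_part ?\<phi> s (normal_vec moduli_lattice s ?t))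
        = (\<Sum>s\<in>?A. wt X s * lin_part ?\<phi> s (normal_vec moduli_lattice s ?t))"
      by (rule sum.cong) (simp_all add: wtc)
    also have "\<dots> = (\<Sum>J\<in>?R. wt X (?c J) * lin_part ?\<phi> (?c J) (?n J))"
      by (rule sum_star[OF X j(1) jn T(1) T2]) simp
    also have "\<dots> = (\<Sum>J\<in>?R. lin_part ?\<phi> (?c J) (?n J))" by (rule sum.cong) (simp_all add: wtR)
    also have "(\<Sum>s\<in>?A. wt (cut (ft_fun ?i) X) s *\<^sub>R normal_vec moduli_lattice s ?t)
        = (\<Sum>s\<in>?A. wt X s *\<^sub>R normal_vec moduli_lattice s ?t)"
      by (rule sum.cong) (simp_all add: wtc)
    also have "\<dots> = (\<Sum>J\<in>?R. wt X (?c J) *\<^sub>R ?n J)"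
      by (rule sum_star[OF X j(1) jn T(1) T2]) simp
    also have "\<dots> = (\<Sum>J\<in>?R. ?n J)" by (rule sum.cong) (simp_all add: wtR)
    finally have W: "wt ?Y ?t = (\<Sum>J\<in>?R. lin_part ?\<phi> (?c J) (?n J)) - lin_part ?\<phi> ?t (\<Sum>J\<in>?R. ?n J)" .
    have nsum: "(\<Sum>J\<in>?R. ?n J) \<in> direction_space ?t"
      unfolding direction_space_fan_cell by (rule normal_sum_mem[OF j(1) jn T(1) T2])
    have nJ: "?n J - (split_vec J, 0) \<in> split_span T" if J: "J \<in> ?R" for J
      using fan_cell_normal_vec[OF sys(1)[OF J], of J] insert_resolution_eq[OF J T(1)] by (simp add: insert_split_def)
    have nD: "?n J \<in> direction_space (?c J)" if J: "J \<in> ?R" for J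
    proof -
      have "split_span T \<subseteq> split_span (insert_split J T)"
        unfolding split_span_def insert_split_def by (intro Sigma_mono span_mono image_mono) auto
      then have "?n J - (split_vec J, 0) \<in> split_span (insert_split J T)" using nJ[OF J] by blast
      moreover have "(split_vec J, 0) \<in> split_span (insert_split J T)"
        by (auto simp: split_span_def insert_split_def intro: span_base)
      ultimately have "(?n J - (split_vec J, 0)) + (split_vec J, 0) \<in> split_span (insert_split J T)"
        by (intro subspace_add subspace_split_span)
      then show ?thesis by (simp add: direction_space_fan_cell)
    qed
    have t_sub: "?t \<subseteq> ?c J" for J by (rule fan_cell_mono) (auto simp: insert_split_def)
    show "wt ?Y ?t = (if centered ?i T then 1 else 0)"
    proof (cases "centered ?i T")
      case False
      show ?thesis
      proof (cases "?R = {}")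
        case True
        \<comment> \<open>\<open>lin_part\<close> is a choice, so even its value at zero needs an
          argument: the cell lies on one side, where the function is affine.\<close>
        have "lin_part ?\<phi> ?t 0 = 0"
        proof -
          obtain \<epsilon> where "\<epsilon> = 1 \<or> \<epsilon> = -1" "\<And>I. I \<in> T \<Longrightarrow> \<epsilon> * split_vec I $ ft_coord ?i \<ge> 0"
            using constant_sign[OF i T(1)] by blast
          then show ?thesis using lin_part_ft[of \<epsilon> ?t ?i 0] cell_in_side[of T \<epsilon> ?i]
            by (simp add: direction_space_fan_cell subspace_0[OF subspace_split_span] linear_0[OF linear_ft_fun])
        qed
        then show ?thesis using W True False by simp
      next
        case ne: False
        obtain \<epsilon> where \<epsilon>: "\<epsilon> = 1 \<or> \<epsilon> = -1" "\<And>J. J \<in> ?R \<Longrightarrow> ?c J \<subseteq> side (ft_fun ?i) \<epsilon>"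
          using uncentered_sign[OF j T(1) False] by blast
        define A where "A v = (if \<epsilon> = 1 then ft_fun ?i v else 0)" for v
        have A: "linear A" unfolding A_def using linear_ft_fun by (cases "\<epsilon> = 1") (simp_all add: linear_zero)
        have "(\<Sum>J\<in>?R. lin_part ?\<phi> (?c J) (?n J)) = (\<Sum>J\<in>?R. A (?n J))"
          by (rule sum.cong[OF refl]) (simp add: A_def lin_part_ft[OF \<epsilon>(1) \<epsilon>(2) nD])
        also have "\<dots> = A (\<Sum>J\<in>?R. ?n J)" using A by (simp add: linear_sum)
        also have "\<dots> = lin_part ?\<phi> ?t (\<Sum>J\<in>?R. ?n J)"
        proof -
          have "?t \<subseteq> side (ft_fun ?i) \<epsilon>" using ne \<epsilon>(2) t_sub by blast
          then show ?thesis using lin_part_ft[OF \<epsilon>(1) _ nsum] by (simp add: A_def)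
        qed
        finally show ?thesis using W False by simp
      qed
    next
      case True
      have zero: "split_vec I $ ft_coord ?i = 0" if "I \<in> T" for I by (rule centered_ft_zero[OF j True that])
      have "?t \<subseteq> side (ft_fun ?i) (-1)" by (rule cell_in_side) (simp add: zero)
      then have l0: "lin_part ?\<phi> ?t (\<Sum>J\<in>?R. ?n J) = 0" using lin_part_ft[OF _ _ nsum, of "-1"] by simp
      have span0: "ft_fun ?i v = 0" if "v \<in> split_span T" for v
      proof -
        have "fst v \<in> span (split_vec ` T)" using that by (auto simp: split_span_def)
        moreover have "linear (\<lambda>v :: 'l ambient. v $ ft_coord ?i)" by (rule linearI) auto
        ultimately show ?thesis unfolding ft_fun_def
          by (rule linear_eq_0_on_span[rotated 2]) (use zero in auto)
      qed
      have "lin_part ?\<phi> (?c J) (?n J) = (if separates J (q 1) (q 2) (q 3) (q ?i) then 1 else 0)" if J: "J \<in> ?R" for J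
      proof -
        obtain \<epsilon> where \<epsilon>: "\<epsilon> = 1 \<or> \<epsilon> = -1" "\<And>I. I \<in> insert_split J T \<Longrightarrow> \<epsilon> * split_vec I $ ft_coord ?i \<ge> 0"
          using constant_sign[OF i sys(1)[OF J]] by blast
        have "ft_fun ?i (?n J) = ft_fun ?i (?n J - (split_vec J, 0)) + split_vec J $ ft_coord ?i"
          by (simp add: ft_fun_def)
        then have f: "ft_fun ?i (?n J) = split_vec J $ ft_coord ?i" using span0[OF nJ[OF J]] by simp
        have "\<epsilon> * split_vec J $ ft_coord ?i \<ge> 0" using \<epsilon>(2)[of J] by (simp add: insert_split_def)
        then show ?thesis
          using lin_part_ft[OF \<epsilon>(1) cell_in_side[OF \<epsilon>(2)] nD[OF J]] f \<epsilon>(1) unfolding ft_coord_value[OF i]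
          by (auto split: if_splits)
      qed
      then have "(\<Sum>J\<in>?R. lin_part ?\<phi> (?c J) (?n J)) = (\<Sum>J\<in>?R. if separates J (q 1) (q 2) (q 3) (q ?i) then 1 else 0)"
        by (rule sum.cong[OF refl])
      also have "\<dots> = real (card {J \<in> ?R. separates J (q 1) (q 2) (q 3) (q ?i)})"
        by (simp add: sum.If_cases Int_def)
      also have "\<dots> = 1" using unique_resolution[OF j True T2] by auto
      finally show ?thesis using W l0 True by simp
    qed
  qed
  then show ?thesis unfolding centered_complex_def using wd wdY cellsY by auto
qed

end

section \<open>Trees and their splits\<close>

lemma is_path_single: "u \<in> verts T \<Longrightarrow> is_path T [u] u u"
  by (simp add: is_path_def)

lemma is_path_snoc:
  "is_path T \<pi> u w \<Longrightarrow> {w, x} \<in> edges T \<Longrightarrow> x \<notin> set \<pi> \<Longrightarrow> x \<in> verts T \<Longrightarrow> is_path T (\<pi> @ [x]) u x"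
  by (auto simp: is_path_def successively_append_iff)

lemma is_path_rev: "is_path T \<pi> u w \<Longrightarrow> is_path T (rev \<pi>) w u"
  by (auto simp: is_path_def hd_rev last_rev insert_commute)

lemma is_path_split:
  assumes "is_path T (xs @ w # ys) u v"
  shows "is_path T (xs @ [w]) u w" "is_path T (w # ys) w v"
  using assms by (auto simp: is_path_def successively_append_iff hd_append)

lemma is_path_ends: "is_path T \<pi> u w \<Longrightarrow> u \<in> set \<pi> \<and> w \<in> set \<pi> \<and> set \<pi> \<subseteq> verts T"
  by (auto simp: is_path_def)

lemma is_path_loop: "is_path T \<pi> u u \<Longrightarrow> \<pi> = [u]"
  by (cases \<pi>) (auto simp: is_path_def split: if_splits dest: last_in_set)

lemma path_edges_single: "path_edges [u] = {}" by (simp add: path_edges_def)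

lemma path_edges_snoc:
  assumes "\<pi> \<noteq> []" shows "path_edges (\<pi> @ [x]) = insert {last \<pi>, x} (path_edges \<pi>)"
proof
  show "path_edges (\<pi> @ [x]) \<subseteq> insert {last \<pi>, x} (path_edges \<pi>)"
  proof
    fix e assume "e \<in> path_edges (\<pi> @ [x])"
    then obtain k where k: "e = {(\<pi> @ [x]) ! k, (\<pi> @ [x]) ! Suc k}" "Suc k < Suc (length \<pi>)"
      by (auto simp: path_edges_def)
    show "e \<in> insert {last \<pi>, x} (path_edges \<pi>)"
    proof (cases "Suc k = length \<pi>")
      case True
      then have "k = length \<pi> - 1" by simp
      then show ?thesis using k assms True by (simp add: nth_append last_conv_nth)
    next
      case False
      then show ?thesis using k by (auto simp: nth_append path_edges_def)
    qed
  qed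
  show "insert {last \<pi>, x} (path_edges \<pi>) \<subseteq> path_edges (\<pi> @ [x])"
  proof
    fix e assume "e \<in> insert {last \<pi>, x} (path_edges \<pi>)"
    then consider "e = {last \<pi>, x}" | k where "e = {\<pi> ! k, \<pi> ! Suc k}" "Suc k < length \<pi>"
      by (auto simp: path_edges_def)
    then show "e \<in> path_edges (\<pi> @ [x])"
    proof cases
      case 1
      then have "e = {(\<pi> @ [x]) ! (length \<pi> - 1), (\<pi> @ [x]) ! Suc (length \<pi> - 1)}"
        using assms by (simp add: nth_append last_conv_nth)
      then show ?thesis using assms unfolding path_edges_def
        by (intro CollectI exI[of _ "length \<pi> - 1"]) simp
    next
      case (2 k)
      then show ?thesis unfolding path_edges_def
        by (intro CollectI exI[of _ k]) (simp add: nth_append)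
    qed
  qed
qed

lemma path_edges_subset: "e \<in> path_edges \<pi> \<Longrightarrow> e \<subseteq> set \<pi>"
  by (auto simp: path_edges_def)

text \<open>Valences and lengths are left open because the trees built step by step in
  \<open>laminar_realization\<close> need not be stable before all clusters are present.\<close>

locale ptree =
  fixes T :: "('l::finite, 'z) tree_scheme"
  assumes finite_V: "finite (verts T)" and V_ne: "verts T \<noteq> {}"
    and edgeD: "\<And>e. e \<in> edges T \<Longrightarrow> e \<subseteq> verts T \<and> card e = 2"
    and unique_path: "\<And>u w. u \<in> verts T \<Longrightarrow> w \<in> verts T \<Longrightarrow> \<exists>!\<pi>. is_path T \<pi> u w"
    and leg_in: "\<And>l. leg T l \<in> verts T"
begin

abbreviation "V \<equiv> verts T"
abbreviation "pth \<equiv> tree_path T"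

lemma edge_verts: "{u, w} \<in> edges T \<Longrightarrow> u \<in> V \<and> w \<in> V \<and> u \<noteq> w"
  using edgeD[of "{u, w}"] by auto

lemma pth: "u \<in> V \<Longrightarrow> w \<in> V \<Longrightarrow> is_path T (pth u w) u w"
  unfolding tree_path_def by (rule theI'[OF unique_path])

lemma path_eqI: "is_path T \<pi> u w \<Longrightarrow> pth u w = \<pi>"
proof -
  assume p: "is_path T \<pi> u w"
  then have "u \<in> V" "w \<in> V" using is_path_ends by blast+
  then show ?thesis using pth unique_path p by blast
qed

lemma path_self: "u \<in> V \<Longrightarrow> pth u u = [u]" by (intro path_eqI is_path_single)

lemma path_rev: "u \<in> V \<Longrightarrow> w \<in> V \<Longrightarrow> pth w u = rev (pth u w)"
  by (intro path_eqI is_path_rev pth)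

lemma path_edge: "{u, w} \<in> edges T \<Longrightarrow> pth u w = [u, w]"
  using edge_verts[of u w] by (intro path_eqI) (auto simp: is_path_def)

lemma path_prefix:
  assumes "r \<in> V" "v \<in> V" "w \<in> set (pth r v)"
  obtains ys where "pth r v = pth r w @ ys" "pth w v = w # ys"
proof -
  obtain xs ys where e: "pth r v = xs @ w # ys" using split_list[OF assms(3)] by blast
  then have p: "is_path T (xs @ w # ys) r v" using pth[OF assms(1,2)] by simp
  have "pth r w = xs @ [w]" "pth w v = w # ys" using is_path_split[OF p] path_eqI by blast+
  then show ?thesis using that[of ys] e by simp
qed

lemma path_mem_V: "r \<in> V \<Longrightarrow> v \<in> V \<Longrightarrow> w \<in> set (pth r v) \<Longrightarrow> w \<in> V"
  using is_path_ends[OF pth] by blast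

lemma path_ends: "r \<in> V \<Longrightarrow> v \<in> V \<Longrightarrow> r \<in> set (pth r v) \<and> v \<in> set (pth r v) \<and> pth r v \<noteq> [] \<and> last (pth r v) = v \<and> distinct (pth r v)"
  using is_path_ends[OF pth[of r v]] pth[of r v] by (auto simp: is_path_def)

text \<open>Seen from \<open>r\<close>, every edge points away from it: if \<open>w\<close> is
  already on the path to \<open>u\<close>, uniqueness of paths makes it the last vertex before
  \<open>u\<close>.\<close>

lemma path_extend:
  assumes r: "r \<in> V" and e: "{u, w} \<in> edges T"
  shows "pth r w = pth r u @ [w] \<and> w \<notin> set (pth r u) \<or> pth r u = pth r w @ [u] \<and> u \<notin> set (pth r w)"
proof -
  have uw: "u \<in> V" "w \<in> V" "u \<noteq> w" using edge_verts[OF e] by auto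
  show ?thesis
  proof (cases "w \<in> set (pth r u)")
    case False
    then show ?thesis using path_eqI[OF is_path_snoc[OF pth[OF r uw(1)] e _ uw(2)]] by blast
  next
    case True
    obtain ys where ys: "pth r u = pth r w @ ys" "pth w u = w # ys"
      using path_prefix[OF r uw(1) True] .
    have "pth w u = [w, u]" using path_edge[of w u] e by (simp add: insert_commute)
    then have "pth r u = pth r w @ [u]" using ys by simp
    moreover have "distinct (pth r u)" using path_ends[OF r uw(1)] by blast
    ultimately show ?thesis by auto
  qed
qed

text \<open>Appending an edge to the path toggles that edge on both sides. Hence a path consists of
  the edges that lie on exactly one of the two root paths of its ends.\<close>

lemma path_edges_parity:
  assumes r: "r \<in> V" and p: "is_path T \<pi> a b"
  shows "e \<in> path_edges (pth r b) \<longleftrightarrow> (e \<in> path_edges (pth r a)) \<noteq> (e \<in> path_edges \<pi>)"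
  using p
proof (induction \<pi> arbitrary: b rule: rev_induct)
  case Nil then show ?case by (simp add: is_path_def)
next
  case (snoc c \<pi>)
  show ?case
  proof (cases "\<pi> = []")
    case True
    then show ?thesis using snoc.prems by (auto simp: is_path_def path_edges_single)
  next
    case False
    have cb: "c = b" using snoc.prems by (simp add: is_path_def)
    have p: "is_path T \<pi> a (last \<pi>)" and e: "{last \<pi>, b} \<in> edges T" and b: "b \<notin> set \<pi>" "b \<in> V"
      using snoc.prems False cb by (auto simp: is_path_def successively_append_iff)
    let ?l = "last \<pi>"
    have l: "?l \<in> V" using is_path_ends[OF p] by blast
    have IH: "e \<in> path_edges (pth r ?l) \<longleftrightarrow> (e \<in> path_edges (pth r a)) \<noteq> (e \<in> path_edges \<pi>)"
      by (rule snoc.IH[OF p])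
    have "{?l, b} \<notin> path_edges \<pi>" using path_edges_subset[of "{?l, b}" \<pi>] b(1) by blast
    then have new: "e \<in> path_edges (\<pi> @ [c]) \<longleftrightarrow> (e \<in> path_edges \<pi>) \<noteq> (e = {?l, b})"
      using path_edges_snoc[OF False, of c] cb by auto
    have "e \<in> path_edges (pth r b) \<longleftrightarrow> (e \<in> path_edges (pth r ?l)) \<noteq> (e = {?l, b})"
      using path_extend[OF r e]
    proof
      assume h: "pth r b = pth r ?l @ [b] \<and> b \<notin> set (pth r ?l)"
      have "{?l, b} \<notin> path_edges (pth r ?l)" using path_edges_subset[of "{?l, b}" "pth r ?l"] h by blast
      moreover have "path_edges (pth r b) = insert {?l, b} (path_edges (pth r ?l))"
        using h path_edges_snoc[of "pth r ?l" b] path_ends[OF r l] by simp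
      ultimately show ?thesis by auto
    next
      assume h: "pth r ?l = pth r b @ [?l] \<and> ?l \<notin> set (pth r b)"
      have "{?l, b} \<notin> path_edges (pth r b)" using path_edges_subset[of "{?l, b}" "pth r b"] h by blast
      moreover have "path_edges (pth r ?l) = insert {?l, b} (path_edges (pth r b))"
        using h path_edges_snoc[of "pth r b" ?l] path_ends[OF r b(2)] by (simp add: insert_commute)
      ultimately show ?thesis by auto
    qed
    then show ?thesis using IH new by blast
  qed
qed

definition parent :: "nat \<Rightarrow> nat \<Rightarrow> nat" where "parent r w = last (butlast (pth r w))"

lemma parent:
  assumes "r \<in> V" "w \<in> V" "w \<noteq> r"
  shows "pth r w = pth r (parent r w) @ [w]" "{parent r w, w} \<in> edges T" "w \<notin> set (pth r (parent r w))"
proof -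
  have p: "is_path T (pth r w) r w" using pth assms by blast
  obtain xs where xs: "pth r w = xs @ [w]" using p by (metis append_butlast_last_id is_path_def)
  have "xs \<noteq> []" using xs p assms(3) by (auto simp: is_path_def)
  then obtain zs x where x: "xs = zs @ [x]" by (metis append_butlast_last_id)
  have px: "parent r w = x" by (simp add: parent_def xs x butlast_append)
  have p2: "is_path T (zs @ x # [w]) r w" using p xs x by simp
  then have "pth r x = zs @ [x]" using is_path_split(1) path_eqI by blast
  then show "pth r w = pth r (parent r w) @ [w]" using xs x px by simp
  show "{parent r w, w} \<in> edges T" using is_path_split(2)[OF p2] px by (simp add: is_path_def)
  show "w \<notin> set (pth r (parent r w))" using p xs x px \<open>pth r x = zs @ [x]\<close> by (auto simp: is_path_def)
qed

lemma parent_unique: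
  assumes "r \<in> V" "{u, w} \<in> edges T" "w \<notin> set (pth r u)"
  shows "w \<noteq> r" "parent r w = u"
proof -
  have uw: "u \<in> V" "w \<in> V" using edge_verts[OF assms(2)] by auto
  show wr: "w \<noteq> r" using assms(3) path_ends[OF assms(1) uw(1)] by blast
  have "pth r w = pth r u @ [w]" using path_extend[OF assms(1,2)] assms(3) path_ends[OF assms(1) uw(2)] by auto
  then have "pth r (parent r w) = pth r u" using parent(1)[OF assms(1) uw(2) wr] by simp
  then show "parent r w = u" using path_ends[OF assms(1) uw(1)] path_ends[OF assms(1), of "parent r w"]
      edge_verts[OF parent(2)[OF assms(1) uw(2) wr]] by metis
qed

text \<open>Each bounded edge is indexed by its end away from \<open>r\<close>, so sums over edges
  become sums over the vertices other than the root.\<close>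

lemma edge_bij: "r \<in> V \<Longrightarrow> bij_betw (\<lambda>w. {parent r w, w}) (V - {r}) (edges T)"
proof (rule bij_betw_imageI)
  assume r: "r \<in> V"
  show "inj_on (\<lambda>w. {parent r w, w}) (V - {r})"
  proof (rule inj_onI, rule ccontr)
    fix w w' assume w: "w \<in> V - {r}" "w' \<in> V - {r}" "{parent r w, w} = {parent r w', w'}" "w \<noteq> w'"
    then have "parent r w = w'" "parent r w' = w" by (auto simp: doubleton_eq_iff)
    then have "length (pth r w) = Suc (length (pth r w'))" "length (pth r w') = Suc (length (pth r w))"
      using arg_cong[OF parent(1)[OF r, of w], of length] arg_cong[OF parent(1)[OF r, of w'], of length] w(1,2)
      by simp_all
    then show False by linarith
  qed
  show "(\<lambda>w. {parent r w, w}) ` (V - {r}) = edges T"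
  proof
    show "(\<lambda>w. {parent r w, w}) ` (V - {r}) \<subseteq> edges T" using parent(2)[OF r] by auto
    show "edges T \<subseteq> (\<lambda>w. {parent r w, w}) ` (V - {r})"
    proof
      fix e assume e: "e \<in> edges T"
      then obtain u w where uw: "e = {u, w}" using edgeD by (metis card_2_iff)
      have E: "{u, w} \<in> edges T" "{w, u} \<in> edges T" using e uw by (auto simp: insert_commute)
      have V': "u \<in> V" "w \<in> V" using edge_verts[OF E(1)] by auto
      from path_extend[OF r E(1)] show "e \<in> (\<lambda>w. {parent r w, w}) ` (V - {r})"
      proof
        assume "pth r w = pth r u @ [w] \<and> w \<notin> set (pth r u)"
        then have "w \<noteq> r" "parent r w = u" using parent_unique[OF r E(1)] by auto
        then show ?thesis using uw V' by (intro image_eqI[of _ _ w]) auto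
      next
        assume "pth r u = pth r w @ [u] \<and> u \<notin> set (pth r w)"
        then have "u \<noteq> r" "parent r u = w" using parent_unique[OF r E(2)] by auto
        then show ?thesis using uw V' by (intro image_eqI[of _ _ u]) auto
      qed
    qed
  qed
qed

lemma edge_in_path:
  assumes "r \<in> V" "w \<in> V" "w \<noteq> r" "v \<in> V"
  shows "{parent r w, w} \<in> path_edges (pth r v) \<longleftrightarrow> w \<in> set (pth r v)"
proof
  assume "{parent r w, w} \<in> path_edges (pth r v)"
  then show "w \<in> set (pth r v)" using path_edges_subset by blast
next
  assume "w \<in> set (pth r v)"
  then obtain ys where ys: "pth r v = pth r w @ ys" using path_prefix[OF assms(1,4)] by blast
  have u: "parent r w \<in> V" using edge_verts[OF parent(2)[OF assms(1-3)]] by blast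
  have "path_edges (pth r w) = insert {last (pth r (parent r w)), w} (path_edges (pth r (parent r w)))"
    unfolding parent(1)[OF assms(1-3)] using path_edges_snoc path_ends[OF assms(1) u] by blast
  then have "{parent r w, w} \<in> path_edges (pth r w)" using path_ends[OF assms(1) u] by simp
  moreover have "path_edges (pth r w) \<subseteq> path_edges (pth r w @ ys)"
  proof
    fix e assume "e \<in> path_edges (pth r w)"
    then obtain k where "e = {pth r w ! k, pth r w ! Suc k}" "Suc k < length (pth r w)"
      by (auto simp: path_edges_def)
    then show "e \<in> path_edges (pth r w @ ys)" unfolding path_edges_def
      by (intro CollectI exI[of _ k]) (simp add: nth_append)
  qed
  ultimately show "{parent r w, w} \<in> path_edges (pth r v)" using ys by auto
qed

text \<open>For \<open>w \<noteq> r\<close> this is the cluster of legs that the edge above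
  \<open>w\<close> cuts off from the root.\<close>

definition beyond :: "nat \<Rightarrow> nat \<Rightarrow> 'l set" where "beyond r w = {l. w \<in> set (pth r (leg T l))}"

lemma leg_dist_eq:
  assumes r: "r \<in> V"
  shows "leg_dist T a b = (\<Sum>w\<in>V - {r}. len T {parent r w, w} * (if (a \<in> beyond r w) \<noteq> (b \<in> beyond r w) then 1 else 0))"
proof -
  let ?p = "pth (leg T a) (leg T b)"
  have p: "is_path T ?p (leg T a) (leg T b)" by (rule pth[OF leg_in leg_in])
  have "path_edges ?p \<subseteq> edges T"
  proof
    fix e assume "e \<in> path_edges ?p"
    then obtain k where k: "e = {?p ! k, ?p ! Suc k}" "Suc k < length ?p" by (auto simp: path_edges_def)
    have "successively (\<lambda>a b. {a, b} \<in> edges T) ?p" using p by (simp add: is_path_def)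
    then show "e \<in> edges T" using k unfolding successively_conv_nth by simp
  qed
  moreover have "finite (edges T)" using bij_betw_finite[OF edge_bij[OF r]] finite_V by simp
  ultimately have "leg_dist T a b = (\<Sum>e\<in>edges T. if e \<in> path_edges ?p then len T e else 0)"
    unfolding leg_dist_def by (simp add: sum.inter_restrict[symmetric] Int_absorb1)
  also have "\<dots> = (\<Sum>w\<in>V - {r}. if {parent r w, w} \<in> path_edges ?p then len T {parent r w, w} else 0)"
    by (rule sum.reindex_bij_betw[OF edge_bij[OF r], symmetric])
  also have "\<dots> = (\<Sum>w\<in>V - {r}. len T {parent r w, w} * (if (a \<in> beyond r w) \<noteq> (b \<in> beyond r w) then 1 else 0))"
  proof (rule sum.cong[OF refl])
    fix w assume w: "w \<in> V - {r}"
    have "{parent r w, w} \<in> path_edges ?p \<longleftrightarrow> (a \<in> beyond r w) \<noteq> (b \<in> beyond r w)"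
      using path_edges_parity[OF r p, of "{parent r w, w}"] edge_in_path[OF r _ _ leg_in, of w] w
      unfolding beyond_def by blast
    then show "(if {parent r w, w} \<in> path_edges ?p then len T {parent r w, w} else 0)
        = len T {parent r w, w} * (if (a \<in> beyond r w) \<noteq> (b \<in> beyond r w) then 1 else 0)" by simp
  qed
  finally show ?thesis .
qed

text \<open>The distance of two legs adds up the edges that separate them, so it is a combination of
  cut functions of clusters, and \<open>double_ratio\<close> is linear in the distances.\<close>

lemma tree_point_eq:
  assumes r: "r \<in> V"
  shows "tree_point T = (\<Sum>w\<in>V - {r}. len T {parent r w, w} *\<^sub>R split_vec (beyond r w))"
proof (rule vec_eq_iff[THEN iffD2], rule allI)
  fix k :: "'l \<times> 'l \<times> 'l \<times> 'l"
  obtain a b c d where k: "k = (a, b, c, d)" by (metis surj_pair)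
  let ?\<delta> = "\<lambda>I x y. (if (x \<in> I) \<noteq> (y \<in> I) then 1 else 0) :: real"
  show "tree_point T $ k = (\<Sum>w\<in>V - {r}. len T {parent r w, w} *\<^sub>R split_vec (beyond r w)) $ k"
  proof (cases "distinct [a, b, c, d]")
    case True
    have "tree_point T $ k = (leg_dist T a d + leg_dist T b c - leg_dist T a b - leg_dist T c d) / 2"
      unfolding k tree_point_def double_ratio_def vec_lambda_beta case_prod_conv if_P[OF True] ..
    also have "\<dots> = (\<Sum>w\<in>V - {r}. len T {parent r w, w} * ((?\<delta> (beyond r w) a d + ?\<delta> (beyond r w) b c
        - ?\<delta> (beyond r w) a b - ?\<delta> (beyond r w) c d) / 2))"
      unfolding leg_dist_eq[OF r]
      by (simp only: sum.distrib[symmetric] sum_subtractf[symmetric] sum_divide_distrib distrib_left right_diff_distrib times_divide_eq_right)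
    also have "\<dots> = (\<Sum>w\<in>V - {r}. len T {parent r w, w} * (split_vec (beyond r w) $ k))"
      unfolding k split_vec_def double_ratio_def vec_lambda_beta case_prod_conv if_P[OF True] ..
    finally show ?thesis by simp
  next
    case False
    have "tree_point T $ k = 0" unfolding k tree_point_def double_ratio_def vec_lambda_beta case_prod_conv if_not_P[OF False] ..
    then show ?thesis using split_vec_coord_0[OF False] k by simp
  qed
qed

lemma beyond_nested:
  assumes r: "r \<in> V" and l: "l \<in> beyond r w" "l \<in> beyond r w'"
  shows "w \<in> set (pth r w') \<or> w' \<in> set (pth r w)"
proof -
  obtain ys where ys: "pth r (leg T l) = pth r w @ ys"
    using path_prefix[OF r leg_in] l(1) unfolding beyond_def by blast
  obtain ys' where ys': "pth r (leg T l) = pth r w' @ ys'"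
    using path_prefix[OF r leg_in] l(2) unfolding beyond_def by blast
  have wV: "w \<in> V" "w' \<in> V" using l path_mem_V[OF r leg_in] unfolding beyond_def by blast+
  have "w \<in> set (pth r w)" "w' \<in> set (pth r w')" using path_ends[OF r] wV by blast+
  moreover have "\<exists>us. pth r w @ us = pth r w' \<or> pth r w = pth r w' @ us"
    using ys ys' by (metis append_eq_append_conv2)
  ultimately show ?thesis by (metis Un_iff set_append)
qed

lemma beyond_mono:
  assumes r: "r \<in> V" and w: "w' \<in> V" "w \<in> set (pth r w')"
  shows "beyond r w' \<subseteq> beyond r w"
proof
  fix l assume "l \<in> beyond r w'"
  then obtain ys where "pth r (leg T l) = pth r w' @ ys"
    using path_prefix[OF r leg_in] unfolding beyond_def by blast
  then show "l \<in> beyond r w" using w(2) by (simp add: beyond_def)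
qed

lemma beyond_laminar:
  assumes r: "r \<in> V" and w: "w \<in> V" "w' \<in> V"
  shows "beyond r w \<inter> beyond r w' = {} \<or> beyond r w \<subseteq> beyond r w' \<or> beyond r w' \<subseteq> beyond r w"
  using beyond_nested[OF r] beyond_mono[OF r w(1)] beyond_mono[OF r w(2)] by blast

definition children :: "nat \<Rightarrow> nat \<Rightarrow> nat set" where
  "children r w = {v \<in> nbrs T w. v \<noteq> r \<and> parent r v = w}"

lemma finite_nbrs: "finite (nbrs T w)"
  by (rule finite_subset[OF _ finite_V]) (auto simp: nbrs_def dest: edge_verts)

lemma children_path:
  assumes "r \<in> V" "v \<in> children r w" shows "pth r v = pth r w @ [v]" "v \<in> V" "v \<noteq> r"
  using assms parent(1)[OF assms(1), of v] edge_verts[of w v] by (auto simp: children_def nbrs_def)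

lemma nbrs_children:
  assumes r: "r \<in> V" and w: "w \<in> V"
  shows "nbrs T w = (if w = r then children r w else insert (parent r w) (children r w))"
    and "w \<noteq> r \<Longrightarrow> parent r w \<notin> children r w"
proof -
  have ch: "v \<in> children r w \<or> w \<noteq> r \<and> v = parent r w" if v: "v \<in> nbrs T w" for v
  proof -
    have e: "{w, v} \<in> edges T" "{v, w} \<in> edges T" using v by (auto simp: nbrs_def insert_commute)
    from path_extend[OF r e(1)] show ?thesis
    proof
      assume "pth r v = pth r w @ [v] \<and> v \<notin> set (pth r w)"
      then show ?thesis using parent_unique[OF r e(1)] v by (auto simp: children_def)
    next
      assume "pth r w = pth r v @ [w] \<and> w \<notin> set (pth r v)"
      then show ?thesis using parent_unique[OF r e(2)] by auto
    qed
  qed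
  have par: "parent r w \<in> nbrs T w" if "w \<noteq> r" using parent(2)[OF r w that] by (simp add: nbrs_def insert_commute)
  show "nbrs T w = (if w = r then children r w else insert (parent r w) (children r w))"
    using ch par by (auto simp: children_def)
  show "parent r w \<notin> children r w" if wr: "w \<noteq> r"
  proof
    assume "parent r w \<in> children r w"
    then have "pth r (parent r w) = pth r w @ [parent r w]" using children_path[OF r] by blast
    then show False using parent(1)[OF r w wr] by simp
  qed
qed

lemma edge_card_nbrs: "card {e \<in> edges T. u \<in> e} = card (nbrs T u)"
proof -
  have bij: "bij_betw (\<lambda>w. {u, w}) (nbrs T u) {e \<in> edges T. u \<in> e}"
  proof (rule bij_betw_imageI)
    show "inj_on (\<lambda>w. {u, w}) (nbrs T u)" by (rule inj_onI) (auto simp: doubleton_eq_iff)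
    show "(\<lambda>w. {u, w}) ` nbrs T u = {e \<in> edges T. u \<in> e}"
    proof
      show "{e \<in> edges T. u \<in> e} \<subseteq> (\<lambda>w. {u, w}) ` nbrs T u"
      proof
        fix e assume e: "e \<in> {e \<in> edges T. u \<in> e}"
        then obtain x y where "e = {x, y}" using edgeD by (metis (mono_tags, lifting) card_2_iff mem_Collect_eq)
        then obtain w where "e = {u, w}" using e by auto
        then show "e \<in> (\<lambda>w. {u, w}) ` nbrs T u" using e by (auto simp: nbrs_def)
      qed
    qed (auto simp: nbrs_def)
  qed
  show ?thesis using bij_betw_same_card[OF bij] by (rule sym)
qed

lemma beyond_decomp:
  assumes r: "r \<in> V" and w: "w \<in> V"
  shows "beyond r w = (\<Union>v\<in>children r w. beyond r v) \<union> legs_at T w"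
    and "\<And>v. v \<in> children r w \<Longrightarrow> beyond r v \<inter> legs_at T w = {}"
    and "\<And>v v'. v \<in> children r w \<Longrightarrow> v' \<in> children r w \<Longrightarrow> v \<noteq> v' \<Longrightarrow> beyond r v \<inter> beyond r v' = {}"
proof -
  show "beyond r w = (\<Union>v\<in>children r w. beyond r v) \<union> legs_at T w"
  proof
    show "beyond r w \<subseteq> (\<Union>v\<in>children r w. beyond r v) \<union> legs_at T w"
    proof
      fix l assume "l \<in> beyond r w"
      then have mem: "w \<in> set (pth r (leg T l))" by (simp add: beyond_def)
      obtain ys where ys: "pth r (leg T l) = pth r w @ ys" "pth w (leg T l) = w # ys"
        using path_prefix[OF r leg_in mem] .
      show "l \<in> (\<Union>v\<in>children r w. beyond r v) \<union> legs_at T w"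
      proof (cases ys)
        case Nil
        then have "pth w (leg T l) = [w]" using ys(2) by simp
        then have "last (pth w (leg T l)) = w" by simp
        then have "leg T l = w" using path_ends[OF w leg_in, of l] by metis
        then show ?thesis by (simp add: legs_at_def)
      next
        case (Cons v zs)
        have "is_path T (w # v # zs) w (leg T l)" using pth[OF w leg_in, of l] ys(2) Cons by simp
        then have e: "{w, v} \<in> edges T" by (simp add: is_path_def)
        have "v \<notin> set (pth r w)" using ys(1) Cons path_ends[OF r leg_in, of l] by auto
        then have "v \<in> children r w" using parent_unique[OF r e] e by (simp add: children_def nbrs_def)
        moreover have "l \<in> beyond r v" using ys(1) Cons by (simp add: beyond_def)
        ultimately show ?thesis by blast
      qed
    qed
    show "(\<Union>v\<in>children r w. beyond r v) \<union> legs_at T w \<subseteq> beyond r w"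
    proof
      fix l assume "l \<in> (\<Union>v\<in>children r w. beyond r v) \<union> legs_at T w"
      then consider v where "v \<in> children r w" "l \<in> beyond r v" | "leg T l = w" by (auto simp: legs_at_def)
      then show "l \<in> beyond r w"
      proof cases
        case (1 v)
        have "w \<in> set (pth r v)" using children_path[OF r 1(1)] path_ends[OF r w] by simp
        then show ?thesis using beyond_mono[OF r children_path(2)[OF r 1(1)]] 1(2) by blast
      next
        case 2
        then show ?thesis using path_ends[OF r leg_in, of l] by (auto simp: beyond_def)
      qed
    qed
  qed
  show "beyond r v \<inter> legs_at T w = {}" if v: "v \<in> children r w" for v
  proof -
    have "v \<notin> set (pth r w)" using children_path[OF r v] path_ends[OF r children_path(2)[OF r v]] by simp
    then show ?thesis by (auto simp: beyond_def legs_at_def)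
  qed
  show "beyond r v \<inter> beyond r v' = {}" if v: "v \<in> children r w" "v' \<in> children r w" "v \<noteq> v'" for v v'
  proof (rule ccontr)
    assume "\<not> ?thesis"
    then have "v \<in> set (pth r v') \<or> v' \<in> set (pth r v)" using beyond_nested[OF r] by blast
    moreover have "v \<notin> set (pth r w)" "v' \<notin> set (pth r w)"
      using children_path[OF r v(1)] children_path[OF r v(2)]
        path_ends[OF r children_path(2)[OF r v(1)]] path_ends[OF r children_path(2)[OF r v(2)]] by auto
    ultimately show False using children_path(1)[OF r v(1)] children_path(1)[OF r v(2)] v(3) by auto
  qed
qed

lemma finite_children: "finite (children r w)"
  by (rule finite_subset[OF _ finite_nbrs[of w]]) (auto simp: children_def)

lemma sum_beyond:
  fixes h :: "'l \<Rightarrow> 'b::comm_monoid_add"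
  assumes r: "r \<in> V" and w: "w \<in> V"
  shows "sum h (beyond r w) = (\<Sum>v\<in>children r w. sum h (beyond r v)) + sum h (legs_at T w)"
proof -
  note d = beyond_decomp[OF assms]
  have "sum h (beyond r w) = sum h (\<Union>v\<in>children r w. beyond r v) + sum h (legs_at T w)"
    unfolding d(1) by (rule sum.union_disjoint) (use d(2) in auto)
  also have "sum h (\<Union>v\<in>children r w. beyond r v) = (\<Sum>v\<in>children r w. sum h (beyond r v))"
    by (rule sum.UNION_disjoint[OF finite_children]) (use d(3) in auto)
  finally show ?thesis .
qed

lemma card_beyond:
  assumes "r \<in> V" "w \<in> V"
  shows "card (beyond r w) = (\<Sum>v\<in>children r w. card (beyond r v)) + card (legs_at T w)"
  using sum_beyond[OF assms, of "\<lambda>_. 1 :: nat"] by simp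

lemma valence_eq:
  assumes r: "r \<in> V" and w: "w \<in> V"
  shows "valence T w = card (children r w) + card (legs_at T w) + (if w = r then 0 else 1)"
  using nbrs_children[OF assms] finite_children[of r w]
  by (simp add: valence_def edge_card_nbrs legs_at_def)

lemma beyond_root: "r \<in> V \<Longrightarrow> beyond r r = UNIV"
  using path_ends[OF _ leg_in] by (auto simp: beyond_def)

lemma beyond_swap:
  assumes e: "{u, w} \<in> edges T" shows "beyond w u = - beyond u w"
proof -
  have uw: "u \<in> V" "w \<in> V" "u \<noteq> w" using edge_verts[OF e] by auto
  have "u \<in> set (pth w v) \<longleftrightarrow> w \<notin> set (pth u v)" if v: "v \<in> V" for v
    using path_extend[OF v e] path_rev[OF v uw(1)] path_rev[OF v uw(2)] path_ends[OF v uw(1)] path_ends[OF v uw(2)] by auto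
  then show ?thesis using leg_in by (auto simp: beyond_def)
qed

text \<open>The path from \<open>r\<close> to the parent avoids the edge above \<open>w\<close>. By
  \<open>path_edges_parity\<close>, moving the root along it does not change which vertices lie
  behind that edge.\<close>

lemma beyond_parent:
  assumes r: "r \<in> V" and w: "w \<in> V" "w \<noteq> r"
  shows "beyond r w = beyond (parent r w) w"
proof -
  let ?u = "parent r w"
  have e: "{?u, w} \<in> edges T" using parent(2)[OF r w] .
  have u: "?u \<in> V" "w \<noteq> ?u" using edge_verts[OF e] by auto
  have "w \<notin> set (pth ?u ?u)" using path_self[OF u(1)] u(2) by simp
  then have pu: "parent ?u w = ?u" using parent_unique(2)[OF u(1) e] by blast
  have nu: "{?u, w} \<notin> path_edges (pth r ?u)"
    using path_edges_subset[of "{?u, w}" "pth r ?u"] parent(3)[OF r w] by blast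
  have "w \<in> set (pth r v) \<longleftrightarrow> w \<in> set (pth ?u v)" if v: "v \<in> V" for v
    using path_edges_parity[OF r pth[OF u(1) v], of "{?u, w}"] nu
      edge_in_path[OF r w v] edge_in_path[OF u(1) w(1) u(2) v] pu by simp
  then show ?thesis using leg_in by (auto simp: beyond_def)
qed

text \<open>Every edge occurs in both directions and contributes both of its sides, as
  \<open>split_system\<close> requires.\<close>

definition splits :: "'l set set" where "splits = {beyond u w |u w. {u, w} \<in> edges T}"

lemma splits_eq:
  assumes r: "r \<in> V"
  shows "splits = beyond r ` (V - {r}) \<union> uminus ` beyond r ` (V - {r})"
proof
  show "splits \<subseteq> beyond r ` (V - {r}) \<union> uminus ` beyond r ` (V - {r})"
  proof
    fix I assume "I \<in> splits"
    then obtain u w where I: "I = beyond u w" and e: "{u, w} \<in> edges T" by (auto simp: splits_def)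
    have e': "{w, u} \<in> edges T" using e by (simp add: insert_commute)
    have uw: "u \<in> V" "w \<in> V" using edge_verts[OF e] by auto
    from path_extend[OF r e] show "I \<in> beyond r ` (V - {r}) \<union> uminus ` beyond r ` (V - {r})"
    proof
      assume "pth r w = pth r u @ [w] \<and> w \<notin> set (pth r u)"
      then have p: "w \<noteq> r" "parent r w = u" using parent_unique[OF r e] by auto
      then have "I = beyond r w" using beyond_parent[OF r uw(2)] I by simp
      then show ?thesis using p(1) uw by blast
    next
      assume "pth r u = pth r w @ [u] \<and> u \<notin> set (pth r w)"
      then have p: "u \<noteq> r" "parent r u = w" using parent_unique[OF r e'] by auto
      then have "I = - beyond r u" using beyond_parent[OF r uw(1)] beyond_swap[OF e'] I by simp
      then show ?thesis using p(1) uw by blast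
    qed
  qed
  have 1: "beyond r w \<in> splits \<and> - beyond r w \<in> splits" if w: "w \<in> V - {r}" for w
  proof -
    have e: "{parent r w, w} \<in> edges T" using parent(2)[OF r] w by blast
    then have e': "{w, parent r w} \<in> edges T" by (simp add: insert_commute)
    have "beyond r w = beyond (parent r w) w" using beyond_parent[OF r] w by blast
    then show ?thesis using beyond_swap[OF e] e e' unfolding splits_def by blast
  qed
  then show "beyond r ` (V - {r}) \<union> uminus ` beyond r ` (V - {r}) \<subseteq> splits" by blast
qed

end

section \<open>Stable trees and the cones spanned by their splits\<close>

locale stree = ptree T for T :: "('l::finite, 'z) tree_scheme" +
  assumes valence3: "\<And>u. u \<in> verts T \<Longrightarrow> valence T u \<ge> 3"
begin

text \<open>Induction from the leaves towards the root, measured by how much longer a root path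
  could still become. Stability makes the cluster of every child nonempty, so each child contributes
  at least one label.\<close>

lemma beyond_card:
  assumes r: "r \<in> V" and w: "w \<in> V"
  shows "card (beyond r w) \<ge> card (children r w) + card (legs_at T w)" "beyond r w \<noteq> {}"
proof -
  have "card (beyond r w) \<ge> card (children r w) + card (legs_at T w) \<and> beyond r w \<noteq> {}"
    using w
  proof (induction "card V - length (pth r w)" arbitrary: w rule: less_induct)
    case less
    have bound: "length (pth r v) \<le> card V" if "v \<in> V" for v
    proof -
      have "distinct (pth r v)" "set (pth r v) \<subseteq> V" using pth[OF r that] by (auto simp: is_path_def)
      then show ?thesis using distinct_card card_mono[OF finite_V] by metis
    qed
    have ch: "card (beyond r v) \<ge> 1" if v: "v \<in> children r w" for v
    proof -
      have "length (pth r v) = Suc (length (pth r w))" "v \<in> V" using children_path[OF r v] by auto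
      then have "beyond r v \<noteq> {}" using less.hyps[of v] bound[of v] by simp
      then show ?thesis by (simp add: card_gt_0_iff Suc_leI)
    qed
    have "card (children r w) \<le> (\<Sum>v\<in>children r w. card (beyond r v))"
      using sum_mono[of "children r w" "\<lambda>_. 1" "\<lambda>v. card (beyond r v)"] ch by simp
    then have c: "card (beyond r w) \<ge> card (children r w) + card (legs_at T w)"
      using card_beyond[OF r less.prems] by simp
    moreover have "card (children r w) + card (legs_at T w) \<ge> 2"
      using valence3[OF less.prems] valence_eq[OF r less.prems] by (simp split: if_splits)
    ultimately show ?case by auto
  qed
  then show "card (beyond r w) \<ge> card (children r w) + card (legs_at T w)" "beyond r w \<noteq> {}" by auto
qed

lemma beyond_card_2: "r \<in> V \<Longrightarrow> w \<in> V \<Longrightarrow> card (beyond r w) \<ge> 2"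
  using beyond_card(1)[of r w] valence3[of w] valence_eq[of r w] by (simp split: if_splits)

lemma beyond_strict:
  assumes r: "r \<in> V" and w: "w \<in> V" and v: "v \<in> children r w" shows "beyond r v \<noteq> beyond r w"
proof
  assume eq: "beyond r v = beyond r w"
  note d = beyond_decomp[OF r w]
  have "children r w = {v}"
  proof -
    have "v' = v" if "v' \<in> children r w" for v'
    proof (rule ccontr)
      assume "v' \<noteq> v"
      then have "beyond r v' \<inter> beyond r v = {}" using d(3) that v by blast
      moreover have "beyond r v' \<subseteq> beyond r v" using d(1) that eq by blast
      ultimately show False using beyond_card(2)[OF r children_path(2)[OF r that]] by blast
    qed
    then show ?thesis using v by blast
  qed
  moreover have "legs_at T w = {}" using d(1) d(2)[OF v] eq by blast
  ultimately show False using valence3[OF w] valence_eq[OF r w] by (simp split: if_splits)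
qed

text \<open>By stability, clusters shrink strictly along root paths. Two vertices with the same
  cluster, which is nonempty, lie on a common root path.\<close>

lemma beyond_inj:
  assumes r: "r \<in> V" shows "inj_on (beyond r) V"
proof -
  have *: "w = w'" if w: "w \<in> V" "w' \<in> V" "beyond r w = beyond r w'" "w \<in> set (pth r w')" for w w'
  proof (rule ccontr)
    assume ne: "w \<noteq> w'"
    obtain ys where ys: "pth r w' = pth r w @ ys" "pth w w' = w # ys" using path_prefix[OF r w(2,4)] .
    have "ys \<noteq> []" using ys(2) path_ends[OF w(1,2)] ne by auto
    then obtain v zs where v: "ys = v # zs" by (cases ys) auto
    have "is_path T (w # v # zs) w w'" using pth[OF w(1,2)] ys(2) v by simp
    then have e: "{w, v} \<in> edges T" by (simp add: is_path_def)
    have "v \<notin> set (pth r w)" using ys(1) v path_ends[OF r w(2)] by auto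
    then have ch: "v \<in> children r w" using parent_unique[OF r e] e by (simp add: children_def nbrs_def)
    have "v \<in> set (pth r w')" using ys(1) v by simp
    then have "beyond r w' \<subseteq> beyond r v" using beyond_mono[OF r w(2)] by blast
    moreover have "beyond r v \<subseteq> beyond r w" using beyond_decomp(1)[OF r w(1)] ch by blast
    ultimately show False using w(3) beyond_strict[OF r w(1) ch] by blast
  qed
  show ?thesis
  proof (rule inj_onI)
    fix w w' assume w: "w \<in> V" "w' \<in> V" "beyond r w = beyond r w'"
    obtain l where "l \<in> beyond r w" using beyond_card(2)[OF r w(1)] by blast
    then have "w \<in> set (pth r w') \<or> w' \<in> set (pth r w)" using beyond_nested[OF r] w(3) by blast
    then show "w = w'" using *[of w w'] *[of w' w] w by metis
  qed
qed

lemma split_system_splits: "split_system splits"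
proof -
  obtain r where r: "r \<in> V" using V_ne by blast
  have nt: "nontrivial (beyond u w)" if e: "{u, w} \<in> edges T" for u w
    using beyond_card_2[of u w] beyond_card_2[of w u] beyond_swap[OF e] edge_verts[OF e] by (simp add: nontrivial_def)
  have neg: "- I \<in> splits" if I: "I \<in> splits" for I
  proof -
    obtain u w where "I = beyond u w" and e: "{u, w} \<in> edges T" using I by (auto simp: splits_def)
    then have "- I = beyond w u" using beyond_swap[OF e] by simp
    moreover have "{w, u} \<in> edges T" using e by (simp add: insert_commute)
    ultimately
 show ?thesis unfolding splits_def by blast
  qed
  have comp: "compat A B" if A: "A \<in> splits" and B: "B \<in> splits" for A B
  proof -
    have AB: "A \<in> beyond r ` (V - {r}) \<or> - A \<in> beyond r ` (V - {r})" "B \<in> beyond r ` (V - {r}) \<or> - B \<in> beyond r ` (V - {r})"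
      using A B unfolding splits_eq[OF r] by auto
    have *: "compat A' B'" if A': "A' \<in> beyond r ` (V - {r})" "B' \<in> beyond r ` (V - {r})" for A' B'
      using beyond_laminar[OF r] A' unfolding compat_def by blast
    have cu: "compat (- X) Y = compat X Y" "compat X (- Y) = compat X Y" for X Y :: "'l set"
      unfolding compat_def by blast+
    show ?thesis using AB *[of A B] *[of "- A" B] *[of A "- B"] *[of "- A" "- B"] unfolding cu by blast
  qed
  show ?thesis using nt neg comp unfolding split_system_def splits_def by blast
qed

text \<open>Complementary clusters would lie in at most two branches at the root that exhaust all
  labels, leaving the root with valence at most two.\<close>

lemma beyond_disjoint_sides:
  assumes r: "r \<in> V" shows "beyond r ` (V - {r}) \<inter> uminus ` beyond r ` (V - {r}) = {}"
proof (rule ccontr)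
  assume "\<not> ?thesis"
  then obtain w w' where w: "w \<in> V - {r}" "w' \<in> V - {r}" "beyond r w = - beyond r w'" by auto
  have ne: "beyond r w \<noteq> {}" "beyond r w' \<noteq> {}" using beyond_card(2)[OF r] w by auto
  then have inc: "\<not> beyond r w \<subseteq> beyond r w'" "\<not> beyond r w' \<subseteq> beyond r w" using w(3) by auto
  have U: "beyond r r = beyond r w \<union> beyond r w'" using beyond_root[OF r] w(3) by simp
  obtain v where v: "v \<in> children r r" "beyond r w \<subseteq> beyond r v"
  proof -
    obtain ys where ys: "pth r w = pth r r @ ys" "pth r w = r # ys"
      using path_prefix[OF r, of w r] path_ends[OF r, of w] w(1) by auto
    have "ys \<noteq> []" using ys(2) path_ends[OF r, of w] w(1) by auto
    then obtain v zs where y: "ys = v # zs" by (cases ys) auto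
    have "is_path T (r # v # zs) r w" using pth[OF r, of w] ys(2) y w(1) by simp
    then have e: "{r, v} \<in> edges T" and "v \<noteq> r" by (auto simp: is_path_def)
    then have "v \<in> children r r" using parent_unique[OF r e] path_self[OF r] by (simp add: children_def nbrs_def)
    then show ?thesis using that beyond_mono[OF r, of w v] ys(2) y w(1) by auto
  qed
  obtain v' where v': "v' \<in> children r r" "beyond r w' \<subseteq> beyond r v'"
  proof -
    obtain ys where ys: "pth r w' = pth r r @ ys" "pth r w' = r # ys"
      using path_prefix[OF r, of w' r] path_ends[OF r, of w'] w(2) by auto
    have "ys \<noteq> []" using ys(2) path_ends[OF r, of w'] w(2) by auto
    then obtain v zs where y: "ys = v # zs" by (cases ys) auto
    have "is_path T (r # v # zs) r w'" using pth[OF r, of w'] ys(2) y w(2) by simp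
    then have e: "{r, v} \<in> edges T" and "v \<noteq> r" by (auto simp: is_path_def)
    then have "v \<in> children r r" using parent_unique[OF r e] path_self[OF r] by (simp add: children_def nbrs_def)
    then show ?thesis using that beyond_mono[OF r, of w' v] ys(2) y w(2) by auto
  qed
  note d = beyond_decomp[OF r r]
  have cov: "beyond r v \<union> beyond r v' = beyond r r" using v(2) v'(2) U beyond_root[OF r] by blast
  have "x = v \<or> x = v'" if x: "x \<in> children r r" for x
    using d(3)[OF x v(1)] d(3)[OF x v'(1)] cov beyond_card(2)[OF r children_path(2)[OF r x]] d(1) x by blast
  then have "children r r \<subseteq> {v, v'}" by blast
  then have "card (children r r) \<le> card {v, v'}" by (intro card_mono) auto
  then have "card (children r r) \<le> 2" by (auto simp: card_insert_if split: if_splits)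
  moreover have "legs_at T r = {}" using d(1) d(2)[OF v(1)] d(2)[OF v'(1)] cov by blast
  ultimately show False using valence3[OF r] valence_eq[OF r r] by simp
qed

lemma card_splits:
  assumes r: "r \<in> V" shows "card splits = 2 * (card V - 1)"
proof -
  have inj: "inj_on (beyond r) (V - {r})" using beyond_inj[OF r] by (rule inj_on_subset) blast
  have c: "card (beyond r ` (V - {r})) = card V - 1" using card_image[OF inj] r finite_V by simp
  have "card (uminus ` beyond r ` (V - {r})) = card (beyond r ` (V - {r}))"
    by (rule card_image) (auto intro: inj_onI)
  then show ?thesis unfolding splits_eq[OF r]
    using card_Un_disjoint[OF _ _ beyond_disjoint_sides[OF r]] finite_V c by simp
qed

text \<open>Coefficients on vertices are transferred to the sides away from the root, and the
  opposite sides receive 0.\<close>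

lemma sum_splits:
  fixes a :: "nat \<Rightarrow> real"
  assumes r: "r \<in> V"
  obtains x where "(\<Sum>w\<in>V - {r}. a w *\<^sub>R split_vec (beyond r w)) = (\<Sum>I\<in>splits. x I *\<^sub>R split_vec I)"
    and "\<And>w. w \<in> V - {r} \<Longrightarrow> x (beyond r w) = a w"
    and "\<And>I. I \<notin> beyond r ` (V - {r}) \<Longrightarrow> x I = 0"
proof -
  define x where "x I = (if I \<in> beyond r ` (V - {r}) then a (the_inv_into (V - {r}) (beyond r) I) else 0)" for I
  have inj: "inj_on (beyond r) (V - {r})" using beyond_inj[OF r] by (rule inj_on_subset) blast
  have xw: "x (beyond r w) = a w" if "w \<in> V - {r}" for w
    using that the_inv_into_f_f[OF inj that] by (simp add: x_def)
  have x0: "x I = 0" if "I \<notin> beyond r ` (V - {r})" for I using that by (simp add: x_def)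
  have "(\<Sum>I\<in>splits. x I *\<^sub>R split_vec I) = (\<Sum>I\<in>beyond r ` (V - {r}). x I *\<^sub>R split_vec I)"
    by (rule sum.mono_neutral_right) (use splits_eq[OF r] x0 in auto)
  also have "\<dots> = (\<Sum>w\<in>V - {r}. x (beyond r w) *\<^sub>R split_vec (beyond r w))" by (simp add: sum.reindex[OF inj])
  also have "\<dots> = (\<Sum>w\<in>V - {r}. a w *\<^sub>R split_vec (beyond r w))" by (rule sum.cong) (simp_all add: xw)
  finally show ?thesis using that[of x] xw x0 by simp
qed

lemma sum_mem_split_cone:
  assumes r: "r \<in> V" and a: "\<And>w. w \<in> V - {r} \<Longrightarrow> a w \<ge> 0"
  shows "(\<Sum>w\<in>V - {r}. a w *\<^sub>R split_vec (beyond r w)) \<in> split_cone splits"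
proof -
  obtain x where x: "(\<Sum>w\<in>V - {r}. a w *\<^sub>R split_vec (beyond r w)) = (\<Sum>I\<in>splits. x I *\<^sub>R split_vec I)"
    "\<And>w. w \<in> V - {r} \<Longrightarrow> x (beyond r w) = a w" "\<And>I. I \<notin> beyond r ` (V - {r}) \<Longrightarrow> x I = 0"
    using sum_splits[OF r, of a] by blast
  have "x I \<ge> 0" for I
  proof (cases "I \<in> beyond r ` (V - {r})")
    case True
    then obtain w where "w \<in> V - {r}" "I = beyond r w" by blast
    then show ?thesis using x(2)[of w] a[of w] by simp
  qed (simp add: x(3))
  then show ?thesis unfolding x(1) split_cone_def by (intro CollectI exI[of _ x]) simp
qed

lemma support_sum:
  assumes r: "r \<in> V" and a: "\<And>w. w \<in> V - {r} \<Longrightarrow> a w > 0"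
  shows "support (\<Sum>w\<in>V - {r}. a w *\<^sub>R split_vec (beyond r w)) = splits"
proof -
  obtain x where s: "(\<Sum>w\<in>V - {r}. a w *\<^sub>R split_vec (beyond r w)) = (\<Sum>I\<in>splits. x I *\<^sub>R split_vec I)"
    "\<And>w. w \<in> V - {r} \<Longrightarrow> x (beyond r w) = a w" "\<And>I. I \<notin> beyond r ` (V - {r}) \<Longrightarrow> x I = 0"
    using sum_splits[OF r, of a] by blast
  have nn: "x I \<ge> 0" for I
  proof (cases "I \<in> beyond r ` (V - {r})")
    case True
    then obtain w where "w \<in> V - {r}" "I = beyond r w" by blast
    then show ?thesis using s(2)[of w] a[of w] by simp
  qed (simp add: s(3))
  have pos: "x I > 0" if I: "I \<in> beyond r ` (V - {r})" for I
  proof -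
    obtain w where "w \<in> V - {r}" "I = beyond r w" using I by blast
    then show ?thesis using s(2) a by simp
  qed
  have "support (\<Sum>I\<in>splits. x I *\<^sub>R split_vec I) = {I \<in> splits. x I + x (- I) > 0}"
    by (rule support_eq[OF split_system_splits nn])
  also have "\<dots> = splits"
  proof -
    have "x I + x (- I) > 0" if I: "I \<in> splits" for I
    proof -
      have "I \<in> beyond r ` (V - {r}) \<or> - I \<in> beyond r ` (V - {r})" using I unfolding splits_eq[OF r] by auto
      then show ?thesis using pos[of I] pos[of "- I"] nn[of I] nn[of "- I"] by (auto intro: add_pos_nonneg add_nonneg_pos)
    qed
    then show ?thesis by blast
  qed
  finally show ?thesis unfolding s(1) .
qed

lemma sum_splits_vertices:
  assumes r: "r \<in> V"
  shows "(\<Sum>I\<in>splits. x I *\<^sub>R split_vec I)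
    = (\<Sum>w\<in>V - {r}. (x (beyond r w) + x (- beyond r w)) *\<^sub>R split_vec (beyond r w))"
proof -
  let ?B = "beyond r ` (V - {r})"
  have inj: "inj_on (beyond r) (V - {r})" using beyond_inj[OF r] by (rule inj_on_subset) blast
  have fin: "finite ?B" using finite_V by simp
  have "(\<Sum>I\<in>splits. x I *\<^sub>R split_vec I) = (\<Sum>I\<in>?B. x I *\<^sub>R split_vec I) + (\<Sum>I\<in>uminus ` ?B. x I *\<^sub>R split_vec I)"
    unfolding splits_eq[OF r] by (rule sum.union_disjoint[OF fin _ beyond_disjoint_sides[OF r]]) (use fin in simp)
  also have "(\<Sum>I\<in>uminus ` ?B. x I *\<^sub>R split_vec I) = (\<Sum>I\<in>?B. x (- I) *\<^sub>R split_vec I)"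
    by (subst sum.reindex) (auto intro: inj_onI simp: split_vec_uminus)
  also have "(\<Sum>I\<in>?B. x I *\<^sub>R split_vec I) + (\<Sum>I\<in>?B. x (- I) *\<^sub>R split_vec I)
      = (\<Sum>I\<in>?B. (x I + x (- I)) *\<^sub>R split_vec I)" by (simp add: sum.distrib scaleR_add_left)
  also have "\<dots> = (\<Sum>w\<in>V - {r}. (x (beyond r w) + x (- beyond r w)) *\<^sub>R split_vec (beyond r w))"
    by (simp add: sum.reindex[OF inj])
  finally show ?thesis .
qed

lemma split_cone_splits:
  assumes r: "r \<in> V"
  shows "split_cone splits = {\<Sum>w\<in>V - {r}. a w *\<^sub>R split_vec (beyond r w) |a. \<forall>w\<in>V - {r}. a w \<ge> 0}"
proof
  show "{\<Sum>w\<in>V - {r}. a w *\<^sub>R split_vec (beyond r w) |a. \<forall>w\<in>V - {r}. a w \<ge> 0} \<subseteq> split_cone splits"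
    using sum_mem_split_cone[OF r] by auto
  show "split_cone splits \<subseteq> {\<Sum>w\<in>V - {r}. a w *\<^sub>R split_vec (beyond r w) |a. \<forall>w\<in>V - {r}. a w \<ge> 0}"
  proof
    fix y assume "y \<in> split_cone splits"
    then obtain x where x: "y = (\<Sum>I\<in>splits. x I *\<^sub>R split_vec I)" "\<forall>I\<in>splits. x I \<ge> 0" by (auto simp: split_cone_def)
    have "\<forall>w\<in>V - {r}. x (beyond r w) + x (- beyond r w) \<ge> 0"
      using x(2) splits_eq[OF r] by (auto intro!: add_nonneg_nonneg)
    then show "y \<in> {\<Sum>w\<in>V - {r}. a w *\<^sub>R split_vec (beyond r w) |a. \<forall>w\<in>V - {r}. a w \<ge> 0}"
      unfolding x(1) sum_splits_vertices[OF r]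
      by (intro CollectI exI[of _ "\<lambda>w. x (beyond r w) + x (- beyond r w)"]) auto
  qed
qed

end

lemma stree_stable: "stable_tree T \<Longrightarrow> stree T"
  unfolding stable_tree_def by unfold_locales blast+

lemma is_path_cong: "verts T = verts T' \<Longrightarrow> edges T = edges T' \<Longrightarrow> is_path T = is_path T'"
  by (intro ext) (simp add: is_path_def)

lemma tree_path_cong: "verts T = verts T' \<Longrightarrow> edges T = edges T' \<Longrightarrow> tree_path T = tree_path T'"
  by (intro ext) (simp add: tree_path_def is_path_cong[of T T'])

text \<open>Everything combinatorial depends only on vertices, edges and legs. This carries facts
  over to the same tree with other lengths and to the curve built on it.\<close>

lemma ptree_cong:
  assumes T: "ptree T" and eq: "verts T = verts T'" "edges T = edges T'" "leg T = leg T'"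
  shows "ptree T'" "ptree.parent T' = ptree.parent T" "ptree.beyond T' = ptree.beyond T"
    "ptree.children T' = ptree.children T" "ptree.splits T' = ptree.splits T" "nbrs T' = nbrs T" "valence T' = valence T"
    "legs_at T' = legs_at T"
proof -
  have p: "is_path T = is_path T'" "tree_path T = tree_path T'" using eq is_path_cong tree_path_cong by blast+
  interpret ptree T by (rule T)
  show T': "ptree T'"
    using finite_V V_ne edgeD unique_path leg_in unfolding p eq by unfold_locales
  show par: "ptree.parent T' = parent" by (intro ext) (simp add: ptree.parent_def[OF T'] parent_def p)
  show bey: "ptree.beyond T' = beyond" by (intro ext) (simp add: ptree.beyond_def[OF T'] beyond_def p eq)
  show nb: "nbrs T' = nbrs T" by (intro ext) (simp add: nbrs_def eq)
  show "ptree.children T' = children" by (intro ext) (simp add: ptree.children_def[OF T'] children_def par nb)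
  show "ptree.splits T' = splits" by (simp add: ptree.splits_def[OF T'] splits_def bey eq)
  show "valence T' = valence T" by (intro ext) (simp add: valence_def eq)
  show "legs_at T' = legs_at T" by (intro ext) (simp add: legs_at_def eq)
qed

text \<open>Lengths belong to edges on one side and to splits on the other; the vertices other than
  a root index both.\<close>

lemma type_cone_eq:
  fixes T :: "('l::finite) tree"
  assumes T: "stable_tree T"
  shows "type_cone T = split_cone (ptree.splits T)"
proof -
  interpret stree T by (rule stree_stable[OF T])
  obtain r where r: "r \<in> V" using V_ne by blast
  have tp: "tree_point (T\<lparr>len := a\<rparr>) = (\<Sum>w\<in>V - {r}. a {parent r w, w} *\<^sub>R split_vec (beyond r w))" for a
  proof -
    have c: "ptree (T\<lparr>len := a\<rparr>)" "ptree.parent (T\<lparr>len := a\<rparr>) = parent" "ptree.beyond (T\<lparr>len := a\<rparr>) = beyond"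
      using ptree_cong[OF ptree_axioms, of "T\<lparr>len := a\<rparr>"] by simp_all
    show ?thesis using ptree.tree_point_eq[OF c(1), of r] r c by simp
  qed
  show ?thesis
  proof
    show "type_cone T \<subseteq> split_cone splits"
    proof
      fix y assume "y \<in> type_cone T"
      then obtain a where a: "y = tree_point (T\<lparr>len := a\<rparr>)" "\<forall>e\<in>edges T. a e \<ge> 0" by (auto simp: type_cone_def)
      show "y \<in> split_cone splits" unfolding a(1) tp
        by (rule sum_mem_split_cone[OF r]) (use a(2) parent(2)[OF r] in auto)
    qed
    show "split_cone splits \<subseteq> type_cone T"
    proof
      fix y assume "y \<in> split_cone splits"
      then obtain a where a: "y = (\<Sum>w\<in>V - {r}. a w *\<^sub>R split_vec (beyond r w))" "\<forall>w\<in>V - {r}. a w \<ge> 0"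
        unfolding split_cone_splits[OF r] by blast
      define g where "g = the_inv_into (V - {r}) (\<lambda>w. {parent r w, w})"
      have inj: "inj_on (\<lambda>w. {parent r w, w}) (V - {r})" and img: "(\<lambda>w. {parent r w, w}) ` (V - {r}) = edges T"
        using edge_bij[OF r] by (simp_all add: bij_betw_def)
      have g: "g {parent r w, w} = w" if "w \<in> V - {r}" for w
        unfolding g_def using the_inv_into_f_f[OF inj that] .
      have "y = tree_point (T\<lparr>len := \<lambda>e. a (g e)\<rparr>)" unfolding a(1) tp by (rule sum.cong) (simp_all add: g)
      moreover have "\<forall>e\<in>edges T. a (g e) \<ge> 0"
      proof
        fix e assume "e \<in> edges T"
        then obtain w where "w \<in> V - {r}" "e = {parent r w, w}" using img by blast
        then show "a (g e) \<ge> 0" using g a(2) by simp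
      qed
      ultimately show "y \<in> type_cone T" unfolding type_cone_def
        by (intro CollectI exI[of _ "\<lambda>e. a (g e)"]) simp
    qed
  qed
qed

section \<open>Realization of split systems by trees\<close>

definition attach :: "('l::finite) tree \<Rightarrow> nat \<Rightarrow> nat \<Rightarrow> 'l set \<Rightarrow> 'l tree" where
  "attach T u z A = \<lparr>verts = insert z (verts T), edges = insert {u, z} (edges T), len = (\<lambda>_. 1),
     leg = (\<lambda>l. if l \<in> A then z else leg T l)\<rparr>"

context
  fixes T :: "('l::finite) tree" and u z :: nat and A :: "'l set"
  assumes T: "ptree T" and u: "u \<in> verts T" and z: "z \<notin> verts T"
begin

interpretation ptree T by (rule T)

lemma attach_simps:
  "verts (attach T u z A) = insert z V" "edges (attach T u z A) = insert {u, z} (edges T)"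
  "leg (attach T u z A) l = (if l \<in> A then z else leg T l)" "len (attach T u z A) e = 1"
  by (simp_all add: attach_def)

lemma attach_edge: "{a, z} \<in> edges (attach T u z A) \<Longrightarrow> a = u"
  using edge_verts[of a z] z by (auto simp: attach_simps doubleton_eq_iff)

lemma attach_edge_old: "a \<noteq> z \<Longrightarrow> b \<noteq> z \<Longrightarrow> {a, b} \<in> edges (attach T u z A) \<longleftrightarrow> {a, b} \<in> edges T"
  by (auto simp: attach_simps doubleton_eq_iff)

lemma attach_path_old:
  assumes "z \<notin> set \<pi>" shows "is_path (attach T u z A) \<pi> x y \<longleftrightarrow> is_path T \<pi> x y"
proof -
  have "successively (\<lambda>a b. {a, b} \<in> edges (attach T u z A)) \<pi> \<longleftrightarrow> successively (\<lambda>a b. {a, b} \<in> edges T) \<pi>"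
  proof (rule successively_cong)
    fix a b assume "a \<in> set \<pi>" "b \<in> set \<pi>"
    then show "({a, b} \<in> edges (attach T u z A)) = ({a, b} \<in> edges T)" using attach_edge_old assms by metis
  qed simp
  moreover have "set \<pi> \<subseteq> insert z V \<longleftrightarrow> set \<pi> \<subseteq> V" using assms by blast
  ultimately show ?thesis unfolding is_path_def by (simp add: attach_simps)
qed

text \<open>Since \<open>u\<close> is the only neighbour of \<open>z\<close>, a path through
  \<open>z\<close> between old vertices would visit \<open>u\<close> twice.\<close>

lemma attach_path_VV:
  assumes xy: "x \<in> V" "y \<in> V" shows "is_path (attach T u z A) \<pi> x y \<longleftrightarrow> \<pi> = pth x y"
proof
  assume p: "is_path (attach T u z A) \<pi> x y"
  have "z \<notin> set \<pi>"
  proof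
    assume "z \<in> set \<pi>"
    then obtain xs ys where e: "\<pi> = xs @ z # ys" using split_list by metis
    have xs: "xs \<noteq> []" using p e xy z by (auto simp: is_path_def)
    have ys: "ys \<noteq> []" using p e xy z by (auto simp: is_path_def)
    have "{last xs, z} \<in> edges (attach T u z A)" using p xs by (simp add: e is_path_def successively_append_iff)
    then have 1: "last xs = u" by (rule attach_edge)
    obtain b bs where b: "ys = b # bs" using ys by (cases ys) auto
    have "{z, b} \<in> edges (attach T u z A)" using p by (simp add: e b is_path_def successively_append_iff)
    then have 2: "b = u" using attach_edge by (simp add: insert_commute)
    have "distinct (xs @ z # b # bs)" using p e b by (simp add: is_path_def)
    then show False using 1 2 xs last_in_set by fastforce
  qed
  then have "is_path T \<pi> x y" using p attach_path_old by blast
  then show "\<pi> = pth x y" using path_eqI by blast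
next
  assume "\<pi> = pth x y"
  then have p: "is_path T \<pi> x y" using pth[OF xy] by simp
  then have "z \<notin> set \<pi>" using z is_path_ends by blast
  then show "is_path (attach T u z A) \<pi> x y" using p attach_path_old by blast
qed

lemma attach_path_Vz:
  assumes x: "x \<in> V" shows "is_path (attach T u z A) \<pi> x z \<longleftrightarrow> \<pi> = pth x u @ [z]"
proof
  assume p: "is_path (attach T u z A) \<pi> x z"
  obtain xs where e: "\<pi> = xs @ [z]" using p by (metis append_butlast_last_id is_path_def)
  have xs: "xs \<noteq> []" using p e x z by (auto simp: is_path_def)
  have "{last xs, z} \<in> edges (attach T u z A)" using p xs by (simp add: e is_path_def successively_append_iff)
  then have l: "last xs = u" by (rule attach_edge)
  have "is_path (attach T u z A) xs x u"
    using p xs l by (auto simp: e is_path_def successively_append_iff hd_append)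
  then have "xs = pth x u" using attach_path_VV[OF x u] by blast
  then show "\<pi> = pth x u @ [z]" using e by simp
next
  assume e: "\<pi> = pth x u @ [z]"
  have p: "is_path (attach T u z A) (pth x u) x u" using attach_path_VV[OF x u] by blast
  have "z \<notin> set (pth x u)" using z path_mem_V[OF x u] by blast
  then show "is_path (attach T u z A) \<pi> x z" unfolding e
    by (intro is_path_snoc[OF p]) (simp_all add: attach_simps)
qed

lemma ptree_attach: "ptree (attach T u z A)"
proof
  show "finite (verts (attach T u z A))" "verts (attach T u z A) \<noteq> {}" using finite_V by (simp_all add: attach_simps)
  show "e \<subseteq> verts (attach T u z A) \<and> card e = 2" if "e \<in> edges (attach T u z A)" for e
    using that edgeD[of e] u z by (auto simp: attach_simps card_insert_if)
  show "leg (attach T u z A) l \<in> verts (attach T u z A)" for l using leg_in[of l] by (simp add: attach_simps)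
  have zz: "is_path (attach T u z A) \<pi> z z \<longleftrightarrow> \<pi> = [z]" for \<pi>
    using is_path_loop[of "attach T u z A" \<pi> z] is_path_single[of z "attach T u z A"] by (auto simp: attach_simps)
  have zV: "is_path (attach T u z A) \<pi> z x \<longleftrightarrow> \<pi> = rev (pth x u @ [z])" if x: "x \<in> V" for \<pi> x
    using attach_path_Vz[OF x, of "rev \<pi>"] is_path_rev[of "attach T u z A" \<pi> z x]
      is_path_rev[of "attach T u z A" "rev \<pi>" x z] by (metis rev_rev_ident)
  fix x y assume "x \<in> verts (attach T u z A)" "y \<in> verts (attach T u z A)"
  then consider "x \<in> V" "y \<in> V" | "x \<in> V" "y = z" | "x = z" "y \<in> V" | "x = z" "y = z"
    by (auto simp: attach_simps)
  then show "\<exists>!\<pi>. is_path (attach T u z A) \<pi> x y"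
    by cases (simp_all add: attach_path_VV attach_path_Vz zz zV)
qed

lemma attach_beyond:
  assumes r: "r \<in> V" and A: "\<And>a. a \<in> A \<Longrightarrow> leg T a = u"
  shows "\<And>w. w \<in> V \<Longrightarrow> ptree.beyond (attach T u z A) r w = beyond r w"
    "ptree.beyond (attach T u z A) r z = A"
proof -
  interpret T': ptree "attach T u z A" by (rule ptree_attach)
  have pz: "tree_path (attach T u z A) r z = pth r u @ [z]"
    by (rule T'.path_eqI) (simp add: attach_path_Vz[OF r])
  have pV: "tree_path (attach T u z A) r x = pth r x" if "x \<in> V" for x
    by (rule T'.path_eqI) (simp add: attach_path_VV[OF r that])
  have path_leg: "tree_path (attach T u z A) r (leg (attach T u z A) l) = (if l \<in> A then pth r (leg T l) @ [z] else pth r (leg T l))" for l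
    using pz pV[OF leg_in] A by (simp add: attach_simps)
  show "T'.beyond r w = beyond r w" if "w \<in> V" for w
    unfolding T'.beyond_def beyond_def path_leg using that z by auto
  show "T'.beyond r z = A"
    unfolding T'.beyond_def path_leg using path_mem_V[OF r leg_in] z by auto
qed

end

text \<open>A minimal cluster \<open>A\<close> is set aside. In a tree for the remaining clusters
  nothing separates the labels of \<open>A\<close>, so their legs sit at one vertex, and a new
  vertex taking over these legs is attached there. The label \<open>r0\<close> outside all clusters
  marks the root.\<close>

lemma laminar_realization:
  fixes \<C> :: "'l::finite set set"
  assumes "\<And>A. A \<in> \<C> \<Longrightarrow> A \<noteq> {} \<and> r0 \<notin> A"
    and "\<And>A B. A \<in> \<C> \<Longrightarrow> B \<in> \<C> \<Longrightarrow> A \<inter> B = {} \<or> A \<subseteq> B \<or> B \<subseteq> A"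
  shows "\<exists>T :: 'l tree. ptree T \<and> (\<forall>e. len T e = 1) \<and>
    bij_betw (ptree.beyond T (leg T r0)) (verts T - {leg T r0}) \<C>"
  using assms
proof (induction "card \<C>" arbitrary: \<C> rule: less_induct)
  case less
  show ?case
  proof (cases "\<C> = {}")
    case True
    define T :: "'l tree" where "T = \<lparr>verts = {0}, edges = {}, len = (\<lambda>_. 1), leg = (\<lambda>_. 0)\<rparr>"
    have "is_path T \<pi> 0 0 \<longleftrightarrow> \<pi> = [0]" for \<pi>
      using is_path_loop[of T \<pi> 0] is_path_single[of 0 T] by (auto simp: T_def)
    then have "ptree T" by unfold_locales (auto simp: T_def)
    then show ?thesis using True by (intro exI[of _ T]) (simp add: T_def bij_betw_def)
  next
    case False
    then obtain A where A: "A \<in> \<C>" and Amin: "\<forall>B\<in>\<C>. B \<subseteq> A \<longrightarrow> A = B"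
      by (rule bexE[OF finite_has_minimal[OF finite]]) (rule that)
    have "card (\<C> - {A}) < card \<C>" using A by (intro psubset_card_mono) auto
    then have "\<exists>T :: 'l tree. ptree T \<and> (\<forall>e. len T e = 1) \<and>
        bij_betw (ptree.beyond T (leg T r0)) (verts T - {leg T r0}) (\<C> - {A})"
      by (rule less.hyps) (use less.prems in auto)
    then obtain T :: "'l tree" where T: "ptree T"
      and bij: "bij_betw (ptree.beyond T (leg T r0)) (verts T - {leg T r0}) (\<C> - {A})" by blast
    interpret ptree T by (rule T)
    let ?r = "leg T r0"
    obtain a0 where a0: "a0 \<in> A" using less.prems(1)[OF A] by blast
    define u where "u = leg T a0"
    \<comment> \<open>By laminarity and minimality, another cluster that meets \<open>A\<close>
      contains it. So the root path of every leg in \<open>A\<close> passes the vertex of every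
      other leg in \<open>A\<close>.\<close>
    have on_path: "leg T a \<in> set (pth ?r (leg T b))" if ab: "a \<in> A" "b \<in> A" for a b
    proof (cases "leg T a = ?r")
      case True then show ?thesis using path_ends[OF leg_in leg_in, of r0 b] by simp
    next
      case False
      let ?B = "beyond ?r (leg T a)"
      have B: "?B \<in> \<C> - {A}" using bij_betwE[OF bij] False leg_in by blast
      have "a \<in> ?B" using path_ends[OF leg_in leg_in, of r0 a] by (simp add: beyond_def)
      then have "A \<subseteq> ?B" using less.prems(2)[OF A, of ?B] B Amin ab(1) by blast
      then show ?thesis using ab(2) by (auto simp: beyond_def)
    qed
    have leg_A: "leg T a = u" if a: "a \<in> A" for a
    proof -
      obtain ys where ys: "pth ?r (leg T a0) = pth ?r (leg T a) @ ys"
        using path_prefix[OF leg_in leg_in on_path[OF a a0]] by blast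
      obtain zs where zs: "pth ?r (leg T a) = pth ?r (leg T a0) @ zs"
        using path_prefix[OF leg_in leg_in on_path[OF a0 a]] by blast
      have "length ys = 0" using arg_cong[OF ys, of length] arg_cong[OF zs, of length] by simp
      then have "pth ?r (leg T a0) = pth ?r (leg T a)" using ys by simp
      then show ?thesis using path_ends[OF leg_in leg_in, of r0 a0] path_ends[OF leg_in leg_in, of r0 a]
        unfolding u_def by metis
    qed
    obtain z where z: "z \<notin> V" using finite_V ex_new_if_finite[OF infinite_UNIV_nat] by blast
    have u: "u \<in> V" by (simp add: u_def leg_in)
    let ?T = "attach T u z A"
    have r: "leg ?T r0 = ?r" using less.prems(1)[OF A] by (simp add: attach_def)
    note bey = attach_beyond[OF T u z leg_in[of r0] leg_A, of A]
    have "bij_betw (ptree.beyond ?T ?r) ((V - {?r}) \<union> {z}) ((\<C> - {A}) \<union> {A})"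
    proof (rule bij_betw_combine)
      show "bij_betw (ptree.beyond ?T ?r) (V - {?r}) (\<C> - {A})"
        using bij bij_betw_cong[of "V - {?r}" "ptree.beyond ?T ?r" "beyond ?r"] bey(1) by simp
      show "bij_betw (ptree.beyond ?T ?r) {z} {A}" using bey(2) by (simp add: bij_betw_def)
    qed auto
    moreover have "verts ?T - {?r} = (V - {?r}) \<union> {z}" using z leg_in[of r0] by (auto simp: attach_def)
    moreover have "(\<C> - {A}) \<union> {A} = \<C>" using A by blast
    ultimately have "bij_betw (ptree.beyond ?T (leg ?T r0)) (verts ?T - {leg ?T r0}) \<C>" using r by simp
    then show ?thesis using ptree_attach[OF T u z, of A] by (intro exI[of _ ?T]) (simp add: attach_def)
  qed
qed

text \<open>Of each split the side without \<open>r0\<close> becomes a cluster; these sides are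
  laminar because they cannot cover \<open>r0\<close>. Valence at least three follows from
  nontriviality of the splits and from distinct vertices having distinct clusters.\<close>

lemma split_system_realization:
  fixes S :: "'l::finite set set"
  assumes S: "split_system S" and N: "CARD('l) \<ge> 3"
  obtains T :: "'l tree" where "stable_tree T" "ptree.splits T = S"
proof -
  obtain r0 :: 'l where True by blast
  let ?C = "{I \<in> S. r0 \<notin> I}"
  have nt: "nontrivial I" if "I \<in> ?C" for I using split_systemD(1)[OF S] that by blast
  have "\<exists>T :: 'l tree. ptree T \<and> (\<forall>e. len T e = 1) \<and>
    bij_betw (ptree.beyond T (leg T r0)) (verts T - {leg T r0}) ?C"
  proof (rule laminar_realization)
    show "A \<noteq> {} \<and> r0 \<notin> A" if "A \<in> ?C" for A using nt[OF that] that by (auto simp: nontrivial_def)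
    show "A \<inter> B = {} \<or> A \<subseteq> B \<or> B \<subseteq> A" if "A \<in> ?C" "B \<in> ?C" for A B
      using split_systemD(3)[OF S, of A B] that unfolding compat_def by auto
  qed
  then obtain T :: "'l tree" where T: "ptree T" "\<forall>e. len T e = 1"
    and bij: "bij_betw (ptree.beyond T (leg T r0)) (verts T - {leg T r0}) ?C" by blast
  interpret ptree T by (rule T(1))
  let ?r = "leg T r0"
  have r: "?r \<in> V" by (rule leg_in)
  have bC: "beyond ?r w \<in> ?C" if "w \<in> V" "w \<noteq> ?r" for w using bij_betwE[OF bij] that by blast
  have inj: "inj_on (beyond ?r) (V - {?r})" and img: "beyond ?r ` (V - {?r}) = ?C" using bij by (simp_all add: bij_betw_def)
  have val: "valence T w \<ge> 3" if w: "w \<in> V" for w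
  proof -
    let ?ch = "children ?r w" and ?lg = "legs_at T w"
    have cb: "card (beyond ?r w) = (\<Sum>v\<in>?ch. card (beyond ?r v)) + card ?lg" by (rule card_beyond[OF r w])
    have v: "valence T w = card ?ch + card ?lg + (if w = ?r then 0 else 1)" by (rule valence_eq[OF r w])
    consider "?ch = {}" | v where "?ch = {v}" | "card ?ch \<ge> 2"
      using card_lt_2_cases[OF finite_children[of ?r w]] by blast
    then show ?thesis
    proof cases
      case 1
      then have "card (beyond ?r w) = card ?lg" using cb by simp
      moreover have "card (beyond ?r w) \<ge> 2" "w = ?r \<Longrightarrow> card (beyond ?r w) \<ge> 3"
        using N nt[OF bC[OF w]] beyond_root[OF r] by (cases "w = ?r"; simp add: nontrivial_def)+
      ultimately show ?thesis using v by (simp split: if_splits)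
    next
      case (2 x)
      have x: "x \<in> V" "x \<noteq> ?r" "pth ?r x = pth ?r w @ [x]" using children_path[OF r, of x w] 2 by auto
      show ?thesis
      proof (cases "w = ?r")
        case True
        have "CARD('l) = card (beyond ?r x) + card ?lg" using cb 2 True beyond_root[OF r] by simp
        moreover have "CARD('l) = card (beyond ?r x) + card (- beyond ?r x)"
          using card_Un_disjoint[of "beyond ?r x" "- beyond ?r x"] by simp
        ultimately have "card ?lg \<ge> 2" using nt[OF bC[OF x(1,2)]] by (simp add: nontrivial_def)
        then show ?thesis using v 2 True by simp
      next
        case False
        have "?lg \<noteq> {}"
        proof
          assume "?lg = {}"
          then have "beyond ?r w = beyond ?r x" using beyond_decomp(1)[OF r w] 2 by simp
          then have "w = x" using inj_onD[OF inj] w x False by blast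
          then show False using x(3) by simp
        qed
        then have "card ?lg \<ge> 1" by (simp add: card_gt_0_iff Suc_leI)
        then show ?thesis using v 2 False by simp
      qed
    next
      case 3
      have "card ?lg \<ge> 1" if "w = ?r"
      proof -
        have "r0 \<in> ?lg" using that by (simp add: legs_at_def)
        then show ?thesis by (metis One_nat_def Suc_leI card_gt_0_iff empty_iff finite)
      qed
      then show ?thesis using v 3 by (simp split: if_splits)
    qed
  qed
  have "stable_tree T"
    unfolding stable_tree_def using finite_V V_ne edgeD unique_path leg_in val T(2) by auto
  moreover have "splits = S"
  proof -
    have "splits = ?C \<union> uminus ` ?C" using splits_eq[OF r] img by simp
    also have "\<dots> = S"
    proof
      show "?C \<union> uminus ` ?C \<subseteq> S" using split_systemD(2)[OF S] by auto
      show "S \<subseteq> ?C \<union> uminus ` ?C"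
      proof
        fix I assume I: "I \<in> S"
        show "I \<in> ?C \<union> uminus ` ?C"
        proof (cases "r0 \<in> I")
          case True
          then have "- I \<in> ?C" using split_systemD(2)[OF S I] by simp
          then have "- (- I) \<in> uminus ` ?C" by (rule imageI)
          then show ?thesis by simp
        qed (use I in simp)
      qed
    qed
    finally show ?thesis .
  qed
  ultimately show ?thesis using that by blast
qed

lemma cells_moduli_fan:
  assumes "CARD('l::finite) \<ge> 3"
  shows "cells (moduli_fan :: (('l ambient) \<times> (real^2)) wcomplex) = {fan_cell S |S. split_system S}"
proof
  show "cells (moduli_fan :: (('l ambient) \<times> (real^2)) wcomplex) \<subseteq> {fan_cell S |S. split_system S}"
  proof
    fix c :: "('l ambient \<times> (real^2)) set" assume "c \<in> cells moduli_fan"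
    then obtain T :: "'l tree" where T: "c = type_cone T \<times> UNIV" "stable_tree T" by (auto simp: moduli_fan_def)
    then show "c \<in> {fan_cell S |S. split_system S}"
      using type_cone_eq[OF T(2)] stree.split_system_splits[OF stree_stable[OF T(2)]] by (auto simp: fan_cell_def)
  qed
  show "{fan_cell S |S. split_system S} \<subseteq> cells (moduli_fan :: (('l ambient) \<times> (real^2)) wcomplex)"
  proof clarify
    fix S :: "'l set set" assume S: "split_system S"
    obtain T :: "'l tree" where T: "stable_tree T" "ptree.splits T = S" using split_system_realization[OF S assms] .
    then show "fan_cell S \<in> cells moduli_fan"
      using type_cone_eq[OF T(1)] by (auto simp: moduli_fan_def fan_cell_def)
  qed
qed

text \<open>The start of the induction: one of the two sides of any split contains at most one of
  three markings, so all types are centered and weight one is right.\<close>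

lemma (in marked) centered_complex_moduli_fan:
  assumes "CARD('l) \<ge> 3"
  shows "centered_complex 3 (moduli_fan :: (('l ambient) \<times> (real^2)) wcomplex)"
proof -
  have cen: "centered 3 S" if S: "split_system S" for S
  proof -
    have "small 3 I \<or> small 3 (- I)" for I
    proof -
      have "P 3 = (I \<inter> P 3) \<union> (- I \<inter> P 3)" "(I \<inter> P 3) \<inter> (- I \<inter> P 3) = {}" by blast+
      then have "card (P 3) = card (I \<inter> P 3) + card (- I \<inter> P 3)" by (metis card_Un_disjoint finite)
      then show ?thesis using card_P[OF n3] by (auto simp: small_def)
    qed
    then show ?thesis using S by (simp add: centered_def)
  qed
  have "aff_dim (fan_cell S) \<le> int CARD('l) - 1" if S: "split_system S" for S :: "'l set set"
    using centered_bound[OF _ n3 cen[OF S]] aff_dim_fan_cell[OF S] by linarith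
  then show ?thesis
    unfolding centered_complex_def cells_moduli_fan[OF assms] using cen by (auto simp: moduli_fan_def)
qed

section \<open>Evaluation maps\<close>

text \<open>\<open>r\<close> is the contracted leg whose image is the second component of a class,
  and \<open>s\<close> is an auxiliary leg used to form double ratios.\<close>

locale balanced_legs =
  fixes v :: "'l::finite \<Rightarrow> real^2" and r s :: 'l
  assumes v_sum: "(\<Sum>l\<in>UNIV. v l) = 0" and v_int: "\<And>l. v l \<in> int_vec"
    and vr: "v r = 0" and rs: "r \<noteq> s" and N3: "CARD('l) \<ge> 3"
begin

text \<open>The displacement from the image of \<open>r\<close> to that of \<open>a\<close>, written
  in the coordinates of the moduli space, which makes linearity and integrality visible. By
  \<open>ev_fun_split_vec\<close>, a cluster containing \<open>a\<close> but not \<open>r\<close>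
  contributes the sum of its directions, independently of \<open>s\<close>.\<close>

definition ev_fun :: "'l \<Rightarrow> 'l ambient \<Rightarrow> real^2" where
  "ev_fun a y = (if a = r then 0 else - (\<Sum>l\<in>- {a, r, s}. y $ (a, s, r, l) *\<^sub>R v l))"

lemma linear_ev_fun: "linear (ev_fun a)"
proof (cases "a = r")
  case True
  then have "ev_fun a = (\<lambda>_. 0)" by (simp add: ev_fun_def fun_eq_iff)
  then show ?thesis by (simp add: linear_zero)
next
  case False
  have "linear (\<lambda>y :: 'l ambient. - (\<Sum>l\<in>- {a, r, s}. y $ (a, s, r, l) *\<^sub>R v l))"
    by (rule linearI) (simp_all add: scaleR_add_left sum.distrib scaleR_sum_right)
  then show ?thesis using False by (simp add: ev_fun_def[abs_def])
qed

lemma ev_fun_split_vec: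
  assumes a: "v a = 0" "a \<noteq> s" and I: "r \<notin> I"
  shows "ev_fun a (split_vec I) = (if a \<in> I then (\<Sum>l\<in>I. v l) else 0)"
proof (cases "a = r")
  case True then show ?thesis using I by (simp add: ev_fun_def)
next
  case False
  \<comment> \<open>For \<open>a\<close> in \<open>I\<close> the coordinate compares
    \<open>s\<close> with \<open>l\<close>. The part coming from \<open>s\<close> is constant in
    \<open>l\<close> and drops out by \<open>v_sum\<close>.\<close>
  define c where "c l = (if a \<in> I then (if s \<in> I then 1 else 0) - (if l \<in> I then 1 else 0) else (0::real))" for l
  have c: "split_vec I $ (a, s, r, l) = c l" if l: "l \<in> - {a, r, s}" for l
  proof -
    have "distinct [a, s, r, l]" using l False a(2) rs by auto
    then show ?thesis unfolding split_vec_coord[OF \<open>distinct [a, s, r, l]\<close>]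
      using I by (simp add: c_def separates_def)
  qed
  have "(\<Sum>l\<in>- {a, r, s}. split_vec I $ (a, s, r, l) *\<^sub>R v l) = (\<Sum>l\<in>- {a, r, s}. c l *\<^sub>R v l)"
    by (rule sum.cong) (simp_all add: c)
  also have "\<dots> = (\<Sum>l\<in>UNIV. c l *\<^sub>R v l)"
    by (rule sum.mono_neutral_left) (use a vr in \<open>auto simp: c_def\<close>)
  also have "\<dots> = - (if a \<in> I then (\<Sum>l\<in>I. v l) else 0)"
  proof (cases "a \<in> I")
    case True
    have "(\<Sum>l\<in>UNIV. c l *\<^sub>R v l)
        = (\<Sum>l\<in>UNIV. (if s \<in> I then 1 else 0 :: real) *\<^sub>R v l) - (\<Sum>l\<in>UNIV. (if l \<in> I then v l else 0))"
      unfolding sum_subtractf[symmetric] by (rule sum.cong) (use True in \<open>auto simp: c_def\<close>)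
    also have "(\<Sum>l\<in>UNIV. (if s \<in> I then 1 else 0 :: real) *\<^sub>R v l) = 0"
      using v_sum by (simp add: scaleR_sum_right[symmetric])
    also have "(\<Sum>l\<in>UNIV. (if l \<in> I then v l else 0)) = (\<Sum>l\<in>I. v l)" by (simp add: sum.If_cases)
    finally show ?thesis using True by simp
  qed (simp add: c_def)
  finally show ?thesis using False by (simp add: ev_fun_def)
qed

lemma edge_dir_uminus: "edge_dir C u w = - edge_dir C w u"
  by (simp add: edge_dir_def insert_commute flip: scaleR_minus_right)

text \<open>The balancing conditions at all vertices beyond the edge add up to this, by induction
  from the leaves towards the root.\<close>

lemma edge_dir_beyond:
  assumes C: "tropical_curve v C" and w: "w \<in> verts C" "w \<noteq> \<rho>" and \<rho>: "\<rho> \<in> verts C"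
  shows "edge_dir C (ptree.parent C \<rho> w) w = (\<Sum>l\<in>ptree.beyond C \<rho> w. v l)"
proof -
  interpret stree C using C by (intro stree_stable) (simp add: tropical_curve_def)
  show ?thesis using w
  proof (induction "card V - length (pth \<rho> w)" arbitrary: w rule: less_induct)
    case less
    have bound: "length (pth \<rho> x) \<le> card V" if "x \<in> V" for x
    proof -
      have "distinct (pth \<rho> x)" "set (pth \<rho> x) \<subseteq> V" using pth[OF \<rho> that] by (auto simp: is_path_def)
      then show ?thesis using distinct_card card_mono[OF finite_V] by metis
    qed
    have IH: "edge_dir C w x = (\<Sum>l\<in>beyond \<rho> x. v l)" if x: "x \<in> children \<rho> w" for x
    proof -
      have "length (pth \<rho> x) = Suc (length (pth \<rho> w))" "x \<in> V" "x \<noteq> \<rho>" using children_path[OF \<rho> x] by auto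
      then have "edge_dir C (parent \<rho> x) x = (\<Sum>l\<in>beyond \<rho> x. v l)" using less.hyps[of x] bound[of x] by simp
      then show ?thesis using x by (simp add: children_def)
    qed
    have "(\<Sum>x\<in>nbrs C w. edge_dir C w x) + (\<Sum>l | leg C l = w. v l) = 0"
      using C less.prems(1) by (simp add: tropical_curve_def)
    moreover have "(\<Sum>x\<in>nbrs C w. edge_dir C w x)
        = edge_dir C w (parent \<rho> w) + (\<Sum>x\<in>children \<rho> w. \<Sum>l\<in>beyond \<rho> x. v l)"
      using nbrs_children[OF \<rho> less.prems(1)] less.prems(2) finite_children[of \<rho> w] IH by simp
    moreover have "(\<Sum>l\<in>beyond \<rho> w. v l) = (\<Sum>x\<in>children \<rho> w. \<Sum>l\<in>beyond \<rho> x. v l) + (\<Sum>l | leg C l = w. v l)"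
      using sum_beyond[OF \<rho> less.prems(1), of v] by (simp add: legs_at_def)
    ultimately show ?case using edge_dir_uminus[of C w "parent \<rho> w"] by (simp add: algebra_simps)
  qed
qed

lemma pos_path:
  assumes C: "tropical_curve v C" and x: "x \<in> verts C" and \<rho>: "\<rho> \<in> verts C"
  shows "pos C x = pos C \<rho> + (\<Sum>w\<in>set (tree_path C \<rho> x) - {\<rho>}. len C {ptree.parent C \<rho> w, w} *\<^sub>R (\<Sum>l\<in>ptree.beyond C \<rho> w. v l))"
proof -
  have st: "stable_tree C" using C by (simp add: tropical_curve_def)
  interpret stree C by (rule stree_stable[OF st])
  show ?thesis using x
  proof (induction "length (pth \<rho> x)" arbitrary: x rule: less_induct)
    case less
    let ?h = "\<lambda>w. len C {parent \<rho> w, w} *\<^sub>R (\<Sum>l\<in>beyond \<rho> w. v l)"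
    show ?case
    proof (cases "x = \<rho>")
      case True then show ?thesis using path_self[OF \<rho>] by simp
    next
      case False
      note p = parent[OF \<rho> less.prems False]
      let ?u = "parent \<rho> x"
      have u: "?u \<in> V" using edge_verts[OF p(2)] by blast
      have lp: "length (pth \<rho> ?u) < length (pth \<rho> x)" using arg_cong[OF p(1), of length] by simp
      have "pos C ?u = pos C \<rho> + (\<Sum>w\<in>set (pth \<rho> ?u) - {\<rho>}. ?h w)" by (rule less.hyps[OF lp u])
      moreover have "pos C x - pos C ?u = ?h x"
      proof -
        have "len C {?u, x} > 0" using st p(2) by (simp add: stable_tree_def)
        then have "pos C x - pos C ?u = len C {?u, x} *\<^sub>R edge_dir C ?u x" by (simp add: edge_dir_def)
        then show ?thesis using edge_dir_beyond[OF C less.prems False \<rho>] by simp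
      qed
      moreover have "set (pth \<rho> x) - {\<rho>} = insert x (set (pth \<rho> ?u) - {\<rho>})"
        using arg_cong[OF p(1), of set] False by auto
      then have "(\<Sum>w\<in>set (pth \<rho> x) - {\<rho>}. ?h w) = ?h x + (\<Sum>w\<in>set (pth \<rho> ?u) - {\<rho>}. ?h w)"
        using p(3) by simp
      ultimately show ?thesis by (simp add: algebra_simps)
    qed
  qed
qed

text \<open>The edges on the way from \<open>r\<close> to \<open>a\<close> are those whose cluster
  contains \<open>a\<close>, and length times direction of such an edge is the value of
  \<open>ev_fun a\<close> on its summand of \<open>tree_point C\<close>.\<close>

lemma pos_leg:
  assumes C: "tropical_curve v C" and a: "v a = 0" "a \<noteq> s"
  shows "pos C (leg C a) = pos C (leg C r) + ev_fun a (tree_point C)"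
proof -
  interpret stree C using C by (intro stree_stable) (simp add: tropical_curve_def)
  let ?\<rho> = "leg C r"
  have \<rho>: "?\<rho> \<in> V" by (rule leg_in)
  let ?h = "\<lambda>w. len C {parent ?\<rho> w, w} *\<^sub>R (\<Sum>l\<in>beyond ?\<rho> w. v l)"
  have "pos C (leg C a) - pos C ?\<rho> = (\<Sum>w\<in>set (pth ?\<rho> (leg C a)) - {?\<rho>}. ?h w)"
    using pos_path[OF C leg_in[of a] \<rho>] by simp
  also have "\<dots> = (\<Sum>w\<in>V - {?\<rho>}. if a \<in> beyond ?\<rho> w then ?h w else 0)"
    by (rule sum.mono_neutral_cong_left)
      (use finite_V path_mem_V[OF \<rho> leg_in[of a]] in \<open>auto simp: beyond_def\<close>)
  also have "\<dots> = (\<Sum>w\<in>V - {?\<rho>}. len C {parent ?\<rho> w, w} *\<^sub>R ev_fun a (split_vec (beyond ?\<rho> w)))"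
  proof (rule sum.cong[OF refl])
    fix w assume w: "w \<in> V - {?\<rho>}"
    have "r \<notin> beyond ?\<rho> w" using w path_self[OF \<rho>] by (simp add: beyond_def)
    then show "(if a \<in> beyond ?\<rho> w then ?h w else 0) = len C {parent ?\<rho> w, w} *\<^sub>R ev_fun a (split_vec (beyond ?\<rho> w))"
      using ev_fun_split_vec[OF a] by simp
  qed
  also have "\<dots> = ev_fun a (tree_point C)"
    unfolding tree_point_eq[OF \<rho>] using linear_ev_fun by (simp add: linear_sum linear_scale)
  finally show ?thesis by (simp add: algebra_simps)
qed

lemma int_vec_sum: "(\<Sum>l\<in>A. v l) \<in> int_vec"
  using v_int by (auto simp: int_vec_def intro!: Ints_sum)

text \<open>The splits of positive length in \<open>y\<close> are realized by a tree. The edge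
  directions are then forced by \<open>edge_dir_beyond\<close>, and the positions result from adding
  up along root paths.\<close>

lemma curve_exists:
  assumes S: "split_system S" and y: "y \<in> fan_cell S"
  obtains C where "tropical_curve v C" "curve_point r C = y"
proof -
  have yS: "fst y \<in> split_cone S" using y by (auto simp: fan_cell_def)
  let ?S = "support (fst y)"
  obtain x where x: "\<forall>I\<in>?S. x I > 0" "fst y = (\<Sum>I\<in>?S. x I *\<^sub>R split_vec I)"
    using support_props(3)[OF S yS] by blast
  obtain T :: "'l tree" where T: "stable_tree T" "ptree.splits T = ?S"
    using split_system_realization[OF support_props(2)[OF S yS] N3] .
  interpret stree T by (rule stree_stable[OF T(1)])
  let ?\<rho> = "leg T r"
  have \<rho>: "?\<rho> \<in> V" by (rule leg_in)
  define a where "a w = x (beyond ?\<rho> w) + x (- beyond ?\<rho> w)" for w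
  have a_pos: "a w > 0" if "w \<in> V - {?\<rho>}" for w
    unfolding a_def using that x(1) splits_eq[OF \<rho>] T(2) by (intro add_pos_pos) auto
  have y1: "fst y = (\<Sum>w\<in>V - {?\<rho>}. a w *\<^sub>R split_vec (beyond ?\<rho> w))"
    using x(2) sum_splits_vertices[OF \<rho>, of x] T(2) by (simp add: a_def)
  define g where "g = the_inv_into (V - {?\<rho>}) (\<lambda>w. {parent ?\<rho> w, w})"
  have inj: "inj_on (\<lambda>w. {parent ?\<rho> w, w}) (V - {?\<rho>})" and img: "(\<lambda>w. {parent ?\<rho> w, w}) ` (V - {?\<rho>}) = edges T"
    using edge_bij[OF \<rho>] by (simp_all add: bij_betw_def)
  have g: "g {parent ?\<rho> w, w} = w" if "w \<in> V - {?\<rho>}" for w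
    unfolding g_def using the_inv_into_f_f[OF inj that] .
  define vs where "vs w = (\<Sum>l\<in>beyond ?\<rho> w. v l)" for w
  define C :: "'l curve" where "C = \<lparr>verts = V, edges = edges T, len = (\<lambda>e. a (g e)), leg = leg T,
    pos = (\<lambda>u. snd y + (\<Sum>w\<in>set (pth ?\<rho> u) - {?\<rho>}. a w *\<^sub>R vs w))\<rparr>"
  have C_simps: "verts C = V" "edges C = edges T" "leg C = leg T" by (simp_all add: C_def)
  have lenC: "len C {parent ?\<rho> w, w} = a w" if "w \<in> V - {?\<rho>}" for w using g[OF that] by (simp add: C_def)
  note cong = ptree_cong[OF ptree_axioms, of C, unfolded C_simps, OF refl refl refl]
  have paths: "is_path C = is_path T" "tree_path C = pth"
    using is_path_cong[of C T] tree_path_cong[of C T] C_simps by auto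
  have pos_len: "len C e > 0" if "e \<in> edges T" for e
  proof -
    have "e \<in> (\<lambda>w. {parent ?\<rho> w, w}) ` (V - {?\<rho>})" using that img by simp
    then obtain w where w: "w \<in> V - {?\<rho>}" and "e = {parent ?\<rho> w, w}" by (rule imageE) (rule that)
    then show ?thesis using lenC[OF w] a_pos[OF w] by simp
  qed
  have stC: "stable_tree C"
    unfolding stable_tree_def C_simps paths(1) cong(7)
    using finite_V V_ne edgeD unique_path leg_in valence3 pos_len by auto
  have dir: "edge_dir C (parent ?\<rho> w) w = vs w" if w: "w \<in> V - {?\<rho>}" for w
  proof -
    have w': "w \<in> V" "w \<noteq> ?\<rho>" using w by auto
    note p = parent[OF \<rho> w']
    have "set (pth ?\<rho> w) - {?\<rho>} = insert w (set (pth ?\<rho> (parent ?\<rho> w)) - {?\<rho>})"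
      using arg_cong[OF p(1), of set] w' by auto
    then have "pos C w - pos C (parent ?\<rho> w) = a w *\<^sub>R vs w" using p(3) by (simp add: C_def)
    then show ?thesis using lenC[OF w] a_pos[OF w] by (simp add: edge_dir_def)
  qed
  have int: "edge_dir C u w \<in> int_vec" if e: "{u, w} \<in> edges C" for u w
  proof -
    have "{u, w} \<in> (\<lambda>w. {parent ?\<rho> w, w}) ` (V - {?\<rho>})" using e img C_simps(2) by simp
    then obtain x where x: "{u, w} = {parent ?\<rho> x, x}" "x \<in> V - {?\<rho>}" by (rule imageE) (rule that)
    have "edge_dir C (parent ?\<rho> x) x \<in> int_vec" using dir[OF x(2)] int_vec_sum by (simp add: vs_def)
    moreover have "- z \<in> int_vec" if "z \<in> int_vec" for z using that by (auto simp: int_vec_def)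
    ultimately show ?thesis using x(1) edge_dir_uminus[of C u w] by (auto simp: doubleton_eq_iff)
  qed
  have bal: "(\<Sum>x\<in>nbrs C u. edge_dir C u x) + (\<Sum>l | leg C l = u. v l) = 0" if u: "u \<in> V" for u
  proof -
    have ch: "edge_dir C u x = vs x" if x: "x \<in> children ?\<rho> u" for x
      using dir[of x] children_path[OF \<rho> x] x by (simp add: children_def)
    have sb: "vs u = (\<Sum>x\<in>children ?\<rho> u. vs x) + (\<Sum>l | leg T l = u. v l)"
      using sum_beyond[OF \<rho> u, of v] by (simp add: vs_def legs_at_def)
    show ?thesis
    proof (cases "u = ?\<rho>")
      case True
      have "vs u = 0" using beyond_root[OF \<rho>] v_sum True by (simp add: vs_def)
      moreover have "(\<Sum>x\<in>nbrs C u. edge_dir C u x) = (\<Sum>x\<in>children ?\<rho> u. vs x)"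
        using nbrs_children(1)[OF \<rho> u] True ch by (simp add: cong(6))
      ultimately show ?thesis using sb by (simp add: C_simps)
    next
      case False
      have "(\<Sum>x\<in>nbrs C u. edge_dir C u x) = edge_dir C u (parent ?\<rho> u) + (\<Sum>x\<in>children ?\<rho> u. vs x)"
        using nbrs_children[OF \<rho> u] False finite_children[of ?\<rho> u] ch by (simp add: cong(6))
      also have "edge_dir C u (parent ?\<rho> u) = - vs u" using edge_dir_uminus[of C u] dir[of u] u False by simp
      finally show ?thesis using sb by (simp add: C_simps)
    qed
  qed
  have "tropical_curve v C" unfolding tropical_curve_def using stC int bal by (simp add: C_simps(1))
  moreover have "curve_point r C = y"
  proof -
    have "tree_point C = (\<Sum>w\<in>V - {?\<rho>}. len C {parent ?\<rho> w, w} *\<^sub>R split_vec (beyond ?\<rho> w))"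
      using ptree.tree_point_eq[OF cong(1), of ?\<rho>] \<rho> by (simp add: C_simps cong(2,3))
    also have "\<dots> = fst y" unfolding y1 by (rule sum.cong) (simp_all add: lenC)
    finally have "tree_point C = fst y" .
    moreover have "pos C (leg C r) = snd y" using path_self[OF \<rho>] by (simp add: C_def)
    ultimately show ?thesis by (simp add: curve_point_def)
  qed
  ultimately show ?thesis using that by blast
qed

text \<open>\<open>curve_exists\<close> gives the \<open>THE\<close> in \<open>ev\<close> something
  to describe, and \<open>pos_leg\<close> makes it unique.\<close>

lemma ev_eq:
  assumes S: "split_system S" and y: "y \<in> fan_cell S" and a: "v a = 0" "a \<noteq> s"
  shows "ev v r a y = snd y + ev_fun a (fst y)"
  unfolding ev_def
proof (rule the_equality)
  obtain C where C: "tropical_curve v C" "curve_point r C = y" using curve_exists[OF S y] .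
  have "pos C (leg C a) = snd y + ev_fun a (fst y)"
    using pos_leg[OF C(1) a] C(2) by (auto simp: curve_point_def)
  then show "\<exists>C. tropical_curve v C \<and> curve_point r C = y \<and> snd y + ev_fun a (fst y) = pos C (leg C a)" using C by metis
  fix z assume "\<exists>C. tropical_curve v C \<and> curve_point r C = y \<and> z = pos C (leg C a)"
  then obtain C where "tropical_curve v C" "curve_point r C = y" "z = pos C (leg C a)" by blast
  then show "z = snd y + ev_fun a (fst y)" using pos_leg[OF _ a, of C] by (auto simp: curve_point_def)
qed

end

section \<open>Rigid trees\<close>

text \<open>Linear dependence is needed for an indexed family, since different clusters may have the
  same sum of directions.\<close>

lemma dependent_combination:
  fixes f :: "'b \<Rightarrow> 'a::euclidean_space"
  assumes W: "finite W" "card W > DIM('a)"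
  obtains x :: "'b \<Rightarrow> real" where "\<exists>w\<in>W. x w \<noteq> 0" "(\<Sum>w\<in>W. x w *\<^sub>R f w) = 0"
proof (cases "inj_on f W")
  case True
  have "dependent (f ` W)" by (rule dependent_biggerset) (use W card_image[OF True] in simp_all)
  then obtain u where u: "\<exists>b\<in>f ` W. u b \<noteq> 0" "(\<Sum>b\<in>f ` W. u b *\<^sub>R b) = 0"
    using dependent_finite[of "f ` W"] W(1) by auto
  have "(\<Sum>w\<in>W. u (f w) *\<^sub>R f w) = 0" using u(2) by (simp add: sum.reindex[OF True])
  moreover have "\<exists>w\<in>W. u (f w) \<noteq> 0" using u(1) by auto
  ultimately show ?thesis using that[of "u \<circ> f"] by simp
next
  case False
  then obtain a b where ab: "a \<in> W" "b \<in> W" "a \<noteq> b" "f a = f b" by (auto simp: inj_on_def)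
  define x :: "'b \<Rightarrow> real" where "x w = (if w = a then 1 else 0) - (if w = b then 1 else 0)" for w
  have "(\<Sum>w\<in>W. x w *\<^sub>R f w) = (\<Sum>w\<in>W. (if w = a then f w else 0) - (if w = b then f w else 0))"
    by (rule sum.cong) (auto simp: x_def)
  also have "\<dots> = 0" using ab W(1) by (simp add: sum_subtractf sum.delta)
  finally have "(\<Sum>w\<in>W. x w *\<^sub>R f w) = 0" .
  moreover have "x a \<noteq> 0" using ab(3) by (simp add: x_def)
  ultimately show ?thesis using that[of x] ab(1) by blast
qed

lemma sum_eq_2_cases:
  fixes f :: "'b \<Rightarrow> nat"
  assumes "finite A" "sum f A = 2"
  shows "(\<exists>a\<in>A. f a = 2 \<and> (\<forall>b\<in>A. b \<noteq> a \<longrightarrow> f b = 0)) \<or>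
    (\<exists>a\<in>A. \<exists>b\<in>A. a \<noteq> b \<and> f a = 1 \<and> f b = 1 \<and> (\<forall>d\<in>A. d \<noteq> a \<and> d \<noteq> b \<longrightarrow> f d = 0))"
proof -
  have "\<exists>a\<in>A. f a \<noteq> 0"
  proof (rule ccontr)
    assume "\<not> ?thesis" then have "sum f A = 0" by simp
    then show False using assms(2) by simp
  qed
  then obtain a where a: "a \<in> A" "f a \<noteq> 0" by blast
  have s: "f a + sum f (A - {a}) = 2" using assms sum.remove[OF assms(1) a(1), of f] by simp
  then consider "f a = 2" "sum f (A - {a}) = 0" | "f a = 1" "sum f (A - {a}) = 1" using a(2) by linarith
  then show ?thesis
  proof cases
    case 1
    then have "\<forall>b\<in>A. b \<noteq> a \<longrightarrow> f b = 0" using assms(1) by simp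
    then show ?thesis using 1 a by blast
  next
    case 2
    then obtain b where "b \<in> A - {a}" "f b = 1" "\<forall>d\<in>A - {a}. b \<noteq> d \<longrightarrow> f d = 0"
      using sum_eq_1_iff[of "A - {a}" f] assms(1) by auto
    then show ?thesis using 2 a by (intro disjI2 bexI[of _ a] bexI[of _ b]) auto
  qed
qed

text \<open>What remains when the geometry of the plane has been used up. By \<open>card_V\<close>
  there are \<open>2 * n - 2\<close> bounded edges, and by \<open>card_l\<close> there are equally
  many ends.\<close>

locale rigid_tree = stree T + marked q n
  for T :: "('l::finite, 'z) tree_scheme" and q :: "nat \<Rightarrow> 'l" and n :: nat +
  fixes c :: nat
  assumes c: "c \<in> V"
    and small_beyond: "\<And>w. w \<in> V - {c} \<Longrightarrow> small n (beyond c w)"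
    and marked_beyond: "\<And>w. w \<in> V - {c} \<Longrightarrow> \<exists>a\<in>P n. a \<in> beyond c w"
    and at_most_two: "\<And>a. a \<in> P n \<Longrightarrow> card {w \<in> V - {c}. a \<in> beyond c w} \<le> 2"
    and card_V: "card V = 2 * n - 1"
    and card_l: "CARD('l) = 3 * n - 2"
begin

text \<open>By \<open>path_Cl\<close> this is the path from \<open>c\<close> to the leg
  \<open>a\<close>, without \<open>c\<close>. For a marking \<open>a\<close>, the set
  \<open>block a\<close> defined next consists of the ends met in these clusters.\<close>

definition chain_at :: "'l \<Rightarrow> nat set" where "chain_at a = {w \<in> V - {c}. a \<in> beyond c w}"
definition block :: "'l \<Rightarrow> 'l set" where "block a = (\<Union>w\<in>chain_at a. beyond c w) - {a}"

lemma finite_Cl: "finite (chain_at a)" using finite_V by (simp add: chain_at_def)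

lemma Cl_unique:
  assumes "a \<in> P n" "b \<in> P n" "w \<in> chain_at a" "w \<in> chain_at b" shows "a = b"
  using assms small_beyond[of w] smallD[of n "beyond c w" a b] by (simp add: chain_at_def)

lemma Cl_exists: "w \<in> V - {c} \<Longrightarrow> \<exists>a\<in>P n. w \<in> chain_at a"
  using marked_beyond[of w] by (simp add: chain_at_def)

lemma beyond_disjoint:
  assumes ab: "a \<in> P n" "b \<in> P n" "a \<noteq> b" and w: "w \<in> chain_at a" "w' \<in> chain_at b"
  shows "beyond c w \<inter> beyond c w' = {}"
proof -
  have V: "w \<in> V" "w' \<in> V" using w by (auto simp: chain_at_def)
  have "a \<in> beyond c w" "b \<in> beyond c w'" "b \<notin> beyond c w" "a \<notin> beyond c w'"
    using w Cl_unique ab by (auto simp: chain_at_def)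
  then show ?thesis using beyond_laminar[OF c V] by blast
qed

lemma Cl_nested: 
  assumes "w \<in> chain_at a" "w' \<in> chain_at a" "w \<noteq> w'"
  shows "beyond c w \<subset> beyond c w' \<or> beyond c w' \<subset> beyond c w"
proof -
  have V: "w \<in> V" "w' \<in> V" using assms by (auto simp: chain_at_def)
  have "a \<in> beyond c w \<inter> beyond c w'" using assms by (auto simp: chain_at_def)
  moreover have "beyond c w \<noteq> beyond c w'" using inj_onD[OF beyond_inj[OF c]] V assms(3) by blast
  ultimately show ?thesis using beyond_laminar[OF c V] by blast
qed

lemma sum_card_Cl: "(\<Sum>a\<in>P n. card (chain_at a)) = 2 * n - 2"
proof -
  have "(\<Sum>a\<in>P n. card (chain_at a)) = card (\<Union>a\<in>P n. chain_at a)"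
    by (rule card_UN_disjoint[symmetric]) (use finite_Cl Cl_unique in auto)
  also have "(\<Union>a\<in>P n. chain_at a) = V - {c}" using Cl_exists by (auto simp: chain_at_def)
  also have "card (V - {c}) = 2 * n - 2" using card_V c finite_V by simp
  finally show ?thesis .
qed

lemma Bl_ends: assumes "a \<in> P n" shows "block a \<subseteq> - P n"
proof
  fix b assume b: "b \<in> block a"
  then obtain w where w: "w \<in> chain_at a" "b \<in> beyond c w" "b \<noteq> a" by (auto simp: block_def)
  then have "w \<in> chain_at b" by (simp add: chain_at_def)
  then show "b \<in> - P n" using Cl_unique[OF assms, of b w] w by auto
qed

lemma Cl_two:
  assumes "card (chain_at a) = 2"
  obtains W U where "chain_at a = {W, U}" "W \<noteq> U" "beyond c U \<subset> beyond c W"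
proof -
  obtain x y where xy: "chain_at a = {x, y}" "x \<noteq> y" using assms by (auto simp: card_2_iff)
  then have "beyond c x \<subset> beyond c y \<or> beyond c y \<subset> beyond c x" by (intro Cl_nested[of _ a]) auto
  then show ?thesis using that[of x y] that[of y x] xy by auto
qed

lemma beyond_ge2: "w \<in> chain_at a \<Longrightarrow> card (beyond c w) \<ge> 2"
  using beyond_card_2[OF c, of w] by (simp add: chain_at_def)

text \<open>The innermost cluster has at least two labels, one of them \<open>a\<close>, and every
  further cluster of the chain is strictly larger.\<close>

lemma card_Bl_ge: assumes a: "a \<in> P n" shows "card (chain_at a) \<le> card (block a)"
proof -
  have "card (chain_at a) \<le> 2" using at_most_two[OF a] by (simp add: chain_at_def)
  then consider "card (chain_at a) = 0" | "card (chain_at a) = 1" | "card (chain_at a) = 2" by linarith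
  then show ?thesis
  proof cases
    case 2
    then obtain U where U: "chain_at a = {U}" by (auto simp: card_1_singleton_iff)
    then have "a \<in> beyond c U" by (auto simp: chain_at_def)
    then show ?thesis using beyond_ge2[of U a] U by (simp add: block_def)
  next
    case 3
    obtain W U where WU: "chain_at a = {W, U}" "beyond c U \<subset> beyond c W" using Cl_two[OF 3] .
    have "a \<in> beyond c W" using WU by (auto simp: chain_at_def)
    moreover have "card (beyond c U) < card (beyond c W)" using WU(2) by (intro psubset_card_mono) auto
    moreover have "block a = beyond c W - {a}" using WU by (auto simp: block_def)
    ultimately show ?thesis using beyond_ge2[of U a] WU(1) 3 by simp
  qed simp
qed

lemma card_ends: "card (- P n) = 2 * n - 2"
  using card_P[of n] card_l n3 by (simp add: Compl_eq_Diff_UNIV card_Diff_subset)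

lemma Bl_disjoint:
  assumes "a \<in> P n" "b \<in> P n" "a \<noteq> b" shows "block a \<inter> block b = {}"
  unfolding block_def using beyond_disjoint[OF assms] by blast

text \<open>The chains have total length \<open>2 * n - 2\<close>, which is also the number of ends,
  and the blocks are disjoint sets of ends. All inequalities in between are therefore
  equalities.\<close>

lemma ends_count:
  shows Bl_Union: "(\<Union>a\<in>P n. block a) = - P n" and card_Bl: "a \<in> P n \<Longrightarrow> card (block a) = card (chain_at a)"
proof -
  have 1: "(\<Sum>a\<in>P n. card (block a)) = card (\<Union>a\<in>P n. block a)"
    by (rule card_UN_disjoint[symmetric]) (use Bl_disjoint in auto)
  have sub: "(\<Union>a\<in>P n. block a) \<subseteq> - P n" using Bl_ends by blast
  have le: "card (\<Union>a\<in>P n. block a) \<le> card (- P n)" by (rule card_mono[OF finite sub])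
  have ge: "(\<Sum>a\<in>P n. card (chain_at a)) \<le> (\<Sum>a\<in>P n. card (block a))" by (rule sum_mono) (rule card_Bl_ge)
  have eq: "(\<Sum>a\<in>P n. card (block a)) = (\<Sum>a\<in>P n. card (chain_at a))"
    using 1 le ge sum_card_Cl card_ends by linarith
  then have "card (\<Union>a\<in>P n. block a) = card (- P n)" using 1 sum_card_Cl card_ends by linarith
  then show "(\<Union>a\<in>P n. block a) = - P n" using card_subset_eq[OF finite sub] by blast
  show "card (block a) = card (chain_at a)" if "a \<in> P n"
  proof (rule ccontr)
    assume "card (block a) \<noteq> card (chain_at a)"
    then have "card (chain_at a) < card (block a)" using card_Bl_ge[OF that] by simp
    then have "(\<Sum>a\<in>P n. card (chain_at a)) < (\<Sum>a\<in>P n. card (block a))"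
      using that card_Bl_ge by (intro sum_strict_mono_ex1) auto
    then show False using eq by simp
  qed
qed

lemma path_Cl: "set (pth c (leg T a)) = insert c (chain_at a)"
  using path_ends[OF c leg_in, of a] path_mem_V[OF c leg_in, of _ a] by (auto simp: chain_at_def beyond_def)

lemma leg_Cl: "leg T a = c \<or> leg T a \<in> chain_at a"
  using path_ends[OF c leg_in, of a] path_Cl by blast

text \<open>An end at \<open>c\<close> would lie in no block, but the blocks exhaust the
  ends.\<close>

lemma legs_at_c: "legs_at T c = {a \<in> P n. card (chain_at a) = 0}"
proof
  show "legs_at T c \<subseteq> {a \<in> P n. card (chain_at a) = 0}"
  proof
    fix a assume "a \<in> legs_at T c"
    then have "leg T a = c" by (simp add: legs_at_def)
    then have "insert c (chain_at a) = {c}" using path_Cl[of a] path_self[OF c] by simp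
    then have e: "chain_at a = {}" by (auto simp: chain_at_def)
    have "a \<notin> block b" for b
    proof
      assume "a \<in> block b"
      then obtain w where "w \<in> chain_at b" "a \<in> beyond c w" by (auto simp: block_def)
      then have "w \<in> chain_at a" by (simp add: chain_at_def)
      then show False using e by simp
    qed
    then have "a \<in> P n" using Bl_Union by blast
    then show "a \<in> {a \<in> P n. card (chain_at a) = 0}" using e by simp
  qed
  show "{a \<in> P n. card (chain_at a) = 0} \<subseteq> legs_at T c"
    using leg_Cl finite_Cl by (auto simp: legs_at_def)
qed

lemma children_Cl:
  assumes a: "a \<in> P n" and w: "w \<in> chain_at a" and x: "x \<in> children c w"
  shows "x \<in> chain_at a" "beyond c x \<subset> beyond c w"
proof -
  have wV: "w \<in> V" using w by (simp add: chain_at_def)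
  have xV: "x \<in> V - {c}" using children_path[OF c x] by simp
  have "beyond c x \<subseteq> beyond c w" using beyond_decomp(1)[OF c wV] x by blast
  then show sub: "beyond c x \<subset> beyond c w" using beyond_strict[OF c wV x] by blast
  obtain b where b: "b \<in> P n" "x \<in> chain_at b" using Cl_exists[OF xV] by blast
  then have "w \<in> chain_at b" using sub w by (auto simp: chain_at_def)
  then show "x \<in> chain_at a" using Cl_unique[OF a b(1) w] b by simp
qed

lemma leaf_vertex:
  assumes a: "a \<in> P n" and U: "U \<in> chain_at a" and min: "\<And>w. w \<in> chain_at a \<Longrightarrow> \<not> beyond c w \<subset> beyond c U"
  shows "legs_at T U = beyond c U" "valence T U = 1 + card (beyond c U)" "leg T a = U" "U \<in> V"
proof -
  show UV: "U \<in> V" using U by (simp add: chain_at_def)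
  have ch: "children c U = {}" using children_Cl[OF a U] min by blast
  then show l: "legs_at T U = beyond c U" using beyond_decomp(1)[OF c UV] by simp
  show "valence T U = 1 + card (beyond c U)"
    using valence_eq[OF c UV] ch l U by (simp add: chain_at_def)
  have "a \<in> legs_at T U" using l U by (simp add: chain_at_def)
  then show "leg T a = U" by (simp add: legs_at_def)
qed

lemma branch_eq:
  assumes e: "{c, w} \<in> edges T" shows "branch T c w = {u \<in> V. w \<in> set (pth c u)}"
proof
  have w: "w \<in> V" "w \<noteq> c" using edge_verts[OF e] by auto
  show "branch T c w \<subseteq> {u \<in> V. w \<in> set (pth c u)}"
  proof
    fix u assume "u \<in> branch T c w"
    then obtain \<pi> where \<pi>: "is_path T \<pi> w u" "c \<notin> set \<pi>" by (auto simp: branch_def)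
    then have "is_path T (c # \<pi>) c u" using e c by (cases \<pi>) (auto simp: is_path_def)
    then have "pth c u = c # \<pi>" by (rule path_eqI)
    then show "u \<in> {u \<in> V. w \<in> set (pth c u)}" using is_path_ends[OF \<pi>(1)] by auto
  qed
  show "{u \<in> V. w \<in> set (pth c u)} \<subseteq> branch T c w"
  proof
    fix u assume "u \<in> {u \<in> V. w \<in> set (pth c u)}"
    then have u: "u \<in> V" "w \<in> set (pth c u)" by auto
    obtain ys where ys: "pth c u = pth c w @ ys" "pth w u = w # ys" using path_prefix[OF c u] .
    have "pth c u = c # w # ys" using ys(1) path_edge[OF e] by simp
    then have "c \<notin> set (w # ys)" using path_ends[OF c u(1)] by auto
    then show "u \<in> branch T c w" unfolding branch_def
      using pth[OF w(1) u(1)] ys(2) by (intro CollectI exI[of _ "pth w u"]) simp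
  qed
qed

lemma branch_Cl:
  assumes a: "a \<in> P n" and e: "{c, w} \<in> edges T" and w: "w \<in> chain_at a" and max: "\<And>x. x \<in> chain_at a \<Longrightarrow> beyond c x \<subseteq> beyond c w"
  shows "branch T c w = chain_at a"
proof
  show "branch T c w \<subseteq> chain_at a"
  proof
    fix u assume "u \<in> branch T c w"
    then have u: "u \<in> V" "w \<in> set (pth c u)" by (auto simp: branch_eq[OF e])
    have wc: "w \<noteq> c" using w by (simp add: chain_at_def)
    then have uc: "u \<noteq> c" using u path_self[OF c] by auto
    obtain b where b: "b \<in> P n" "u \<in> chain_at b" using Cl_exists[of u] u(1) uc by blast
    have "beyond c u \<subseteq> beyond c w" by (rule beyond_mono[OF c u])
    then have "w \<in> chain_at b" using b w by (auto simp: chain_at_def)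
    then show "u \<in> chain_at a" using Cl_unique[OF a b(1) w] b by simp
  qed
  show "chain_at a \<subseteq> branch T c w"
  proof
    fix u assume u: "u \<in> chain_at a"
    then have uV: "u \<in> V" "u \<noteq> c" "a \<in> beyond c u" by (auto simp: chain_at_def)
    have wV: "w \<in> V" "w \<noteq> c" "a \<in> beyond c w" using w by (auto simp: chain_at_def)
    have "w \<in> set (pth c u) \<or> u \<in> set (pth c w)" using beyond_nested[OF c wV(3) uV(3)] .
    moreover have "w = u" if "u \<in> set (pth c w)"
      using that path_edge[OF e] uV(2) by auto
    moreover have "u \<in> set (pth c u)" using path_ends[OF c uV(1)] by simp
    ultimately have "w \<in> set (pth c u)" by metis
    then show "u \<in> branch T c w" using uV(1) by (simp add: branch_eq[OF e])
  qed
qed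

lemma disjoint_ends: assumes "a \<in> P n" "card (chain_at a) = 1"
  obtains U e where "chain_at a = {U}" "e \<notin> P n" "legs_at T U = {a, e}" "valence T U = 3" "{c, U} \<in> edges T"
proof -
  obtain U where U: "chain_at a = {U}" using assms(2) by (auto simp: card_1_singleton_iff)
  have aU: "a \<in> beyond c U" using U by (auto simp: chain_at_def)
  have "card (beyond c U - {a}) = 1" using card_Bl[OF assms(1)] U by (simp add: block_def)
  then obtain e where e: "beyond c U - {a} = {e}" by (auto simp: card_1_singleton_iff)
  then have eq: "beyond c U = {a, e}" "e \<noteq> a" using aU by auto
  have "e \<in> block a" using U eq by (simp add: block_def)
  then have eP: "e \<notin> P n" using Bl_ends[OF assms(1)] by blast
  note lv = leaf_vertex[OF assms(1), of U, unfolded U, simplified]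
  have "set (pth c U) = {c, U}" using path_Cl[of a] lv(3) U by simp
  moreover have Uc: "U \<in> V" "U \<noteq> c" using U by (auto simp: chain_at_def)
  ultimately have "parent c U = c"
    using parent[OF c Uc] path_ends[OF c, of "parent c U"] edge_verts[of "parent c U" U] by auto
  then have "{c, U} \<in> edges T" using parent(2)[OF c Uc] by simp
  then show ?thesis using that[of U e] U eP lv eq by auto
qed

text \<open>A block of two ends leaves two labels for the inner cluster and three for the outer one.
  So the outer vertex carries just the end that the inner cluster lacks.\<close>

lemma two_ends: assumes "a \<in> P n" "card (chain_at a) = 2"
  obtains W U e e' where "chain_at a = {W, U}" "W \<noteq> U" "e \<notin> P n" "e' \<notin> P n" "legs_at T U = {a, e'}" "legs_at T W = {e}"
    "valence T U = 3" "valence T W = 3" "{c, W} \<in> edges T" "{W, U} \<in> edges T" "beyond c U \<subset> beyond c W"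
proof -
  obtain W U where WU: "chain_at a = {W, U}" "W \<noteq> U" "beyond c U \<subset> beyond c W" using Cl_two[OF assms(2)] .
  have aU: "a \<in> beyond c U" "a \<in> beyond c W" and W: "W \<in> V" "W \<noteq> c" and U: "U \<in> V" "U \<noteq> c"
    using WU by (auto simp: chain_at_def)
  have block: "block a = beyond c W - {a}" using WU by (auto simp: block_def)
  then have cW: "card (beyond c W - {a}) = 2" using card_Bl[OF assms(1)] assms(2) by simp
  then have cW3: "card (beyond c W) = 3" using aU(2) by simp
  have "card (beyond c U) < card (beyond c W)" using WU(3) by (intro psubset_card_mono) auto
  then have cU: "card (beyond c U) = 2" using beyond_ge2[of U a] WU(1) cW3 by simp
  then have "card (beyond c U - {a}) = 1" using aU(1) by simp
  then obtain e' where e': "beyond c U - {a} = {e'}" by (auto simp: card_1_singleton_iff)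
  then have eqU: "beyond c U = {a, e'}" "e' \<noteq> a" using aU by auto
  have "card (beyond c W - beyond c U) = 1" using cW3 cU WU(3) by (simp add: card_Diff_subset psubset_imp_subset)
  then obtain e where e: "beyond c W - beyond c U = {e}" by (auto simp: card_1_singleton_iff)
  have eP: "e \<notin> P n" "e' \<notin> P n" using Bl_ends[OF assms(1)] block e eqU WU(3) aU by auto
  have minU: "\<not> beyond c w \<subset> beyond c U" if "w \<in> chain_at a" for w using that WU by auto
  have UCl: "U \<in> chain_at a" "W \<in> chain_at a" using WU by simp_all
  note lv = leaf_vertex[OF assms(1) UCl(1) minU]
  have sU: "set (pth c U) = {c, W, U}" using path_Cl[of a] lv(3) WU(1) by simp
  have "W \<in> set (pth c U)" using sU by simp
  then obtain ys where ys: "pth c U = pth c W @ ys" by (rule path_prefix[OF c U(1)])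
  have dU: "distinct (pth c U)" "distinct (pth c W)" using path_ends[OF c] U(1) W(1) by blast+
  have "ys \<noteq> []" using ys path_ends[OF c U(1)] path_ends[OF c W(1)] WU(2) by auto
  then have "last ys = U" using ys path_ends[OF c U(1)] by (metis last_append)
  then have "U \<in> set ys" using \<open>ys \<noteq> []\<close> last_in_set by blast
  then have "U \<notin> set (pth c W)" using dU(1) ys by auto
  moreover have "set (pth c W) \<subseteq> {c, W, U}" using sU ys by auto
  ultimately have sW: "set (pth c W) \<subseteq> {c, W}" by blast
  have pW: "parent c W = c"
    using parent[OF c W] path_ends[OF c, of "parent c W"] edge_verts[of "parent c W" W] sW by auto
  then have eW: "{c, W} \<in> edges T" using parent(2)[OF c W] by simp
  have pcW: "pth c W = [c, W]" using path_edge[OF eW] .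
  have pU: "parent c U = W"
  proof -
    have *: "pth c U = pth c (parent c U) @ [U]" "parent c U \<in> V" "parent c U \<noteq> U"
      using parent[OF c U] edge_verts[of "parent c U" U] by auto
    then have "set (pth c (parent c U)) \<subseteq> {c, W}" "W \<in> set (pth c (parent c U))"
      using sU parent(3)[OF c U] WU(2) U arg_cong[OF *(1), of set] by auto
    then have "parent c U = c \<or> parent c U = W" "parent c U \<noteq> c"
      using path_ends[OF c *(2)] path_self[OF c] W(2) by auto
    then show ?thesis by blast
  qed
  then have eU: "{W, U} \<in> edges T" using parent(2)[OF c U] by simp
  have "x = U" if x: "x \<in> children c W" for x
    using children_Cl[OF assms(1) UCl(2) x] WU(1) by auto
  moreover have "U \<in> children c W" using eU pU U by (simp add: children_def nbrs_def)
  ultimately have ch: "children c W = {U}" by blast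
  have lW: "legs_at T W = {e}"
    using beyond_decomp(1)[OF c W(1)] beyond_decomp(2)[OF c W(1), of U] ch e by auto
  then have "valence T W = 3" using valence_eq[OF c W(1)] ch W(2) by simp
  moreover have "valence T U = 3" using lv(2) cU by simp
  moreover have "legs_at T U = {a, e'}" using lv(1) eqU by simp
  ultimately show ?thesis using that[of W U e e'] WU eP lW eW eU by blast
qed

text \<open>By \<open>Cl_unique\<close> the paths from \<open>c\<close> to two markings share only
  \<open>c\<close>, so joining them gives the path between the markings.\<close>

lemma paths_through_c:
  assumes ab: "a \<in> P n" "b \<in> P n" "a \<noteq> b"
  shows "c \<in> set (pth (leg T a) (leg T b))"
proof -
  let ?A = "pth c (leg T a)" and ?B = "pth c (leg T b)"
  have disj: "set ?A \<inter> set ?B = {c}" unfolding path_Cl using Cl_unique[OF ab(1,2)] ab(3) by (auto simp: chain_at_def)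
  have A: "is_path T ?A c (leg T a)" and B: "is_path T ?B c (leg T b)" using pth[OF c leg_in] by blast+
  obtain bs where bs: "?B = c # bs" using B by (cases ?B) (auto simp: is_path_def)
  obtain as where as: "?A = c # as" using A by (cases ?A) (auto simp: is_path_def)
  have rA: "is_path T (rev as @ [c]) (leg T a) c" using is_path_rev[OF A] as by simp
  have "set as \<inter> set bs = {}" using disj as bs B A by (auto simp: is_path_def)
  then have "is_path T (rev as @ c # bs) (leg T a) (leg T b)"
    using rA B unfolding bs by (auto simp: is_path_def successively_append_iff hd_append)
  then have "pth (leg T a) (leg T b) = rev as @ c # bs" by (rule path_eqI)
  then show ?thesis by simp
qed

text \<open>The neighbour of \<open>c\<close> on the way to \<open>a\<close>, meaningful when the
  chain is nonempty. By \<open>nbrs_c\<close> and \<open>inj_nb\<close> it indexes the leaves with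
  bounded edges by markings.\<close>

definition nb :: "'l \<Rightarrow> nat" where "nb a = (THE w. w \<in> nbrs T c \<and> w \<in> chain_at a)"

lemma nb_eq: assumes "a \<in> P n" "w \<in> nbrs T c" "w \<in> chain_at a" shows "nb a = w"
  unfolding nb_def
proof (rule the_equality)
  show "w \<in> nbrs T c \<and> w \<in> chain_at a" using assms by blast
  fix u assume u: "u \<in> nbrs T c \<and> u \<in> chain_at a"
  have e: "{c, u} \<in> edges T" "{c, w} \<in> edges T" using u assms by (auto simp: nbrs_def)
  have "u \<noteq> c" "w \<noteq> c" using edge_verts[OF e(1)] edge_verts[OF e(2)] by auto
  moreover have "u \<in> set (pth c w) \<or> w \<in> set (pth c u)" using beyond_nested[OF c, of a u w] u assms by (auto simp: chain_at_def)
  ultimately show "u = w" using path_edge[OF e(1)] path_edge[OF e(2)] by auto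
qed

lemma nbrs_c: "nbrs T c = nb ` {a \<in> P n. card (chain_at a) \<noteq> 0}" and inj_nb: "inj_on nb {a \<in> P n. card (chain_at a) \<noteq> 0}"
proof -
  have ex: "\<exists>w. w \<in> nbrs T c \<and> w \<in> chain_at a \<and> nb a = w" if a: "a \<in> P n" "card (chain_at a) \<noteq> 0" for a
  proof -
    have "card (chain_at a) \<le> 2" using at_most_two[OF a(1)] by (simp add: chain_at_def)
    then have "card (chain_at a) = 1 \<or> card (chain_at a) = 2" using a(2) by linarith
    then have "\<exists>w. w \<in> chain_at a \<and> {c, w} \<in> edges T"
    proof
      assume "card (chain_at a) = 1" then show ?thesis by (rule disjoint_ends[OF a(1)]) blast
    next
      assume "card (chain_at a) = 2" then show ?thesis by (rule two_ends[OF a(1)]) blast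
    qed
    then obtain w where w: "w \<in> chain_at a" "w \<in> nbrs T c" by (auto simp: nbrs_def)
    then show ?thesis using nb_eq[OF a(1) w(2,1)] by auto
  qed
  show "nbrs T c = nb ` {a \<in> P n. card (chain_at a) \<noteq> 0}"
  proof
    show "nb ` {a \<in> P n. card (chain_at a) \<noteq> 0} \<subseteq> nbrs T c" using ex by force
    show "nbrs T c \<subseteq> nb ` {a \<in> P n. card (chain_at a) \<noteq> 0}"
    proof
      fix w assume w: "w \<in> nbrs T c"
      then have "w \<in> V - {c}" using edge_verts[of c w] by (auto simp: nbrs_def)
      then obtain a where a: "a \<in> P n" "w \<in> chain_at a" using Cl_exists by blast
      then have "card (chain_at a) \<noteq> 0" using finite_Cl by auto
      then show "w \<in> nb ` {a \<in> P n. card (chain_at a) \<noteq> 0}" using a nb_eq[OF a(1) w a(2)] by (intro image_eqI[of _ _ a]) auto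
    qed
  qed
  show "inj_on nb {a \<in> P n. card (chain_at a) \<noteq> 0}"
  proof (rule inj_onI)
    fix a b assume a: "a \<in> {a \<in> P n. card (chain_at a) \<noteq> 0}" and b: "b \<in> {a \<in> P n. card (chain_at a) \<noteq> 0}" and eq: "nb a = nb b"
    have "nb a \<in> chain_at a" "nb b \<in> chain_at b" using ex[of a] ex[of b] a b by auto
    then show "a = b" using Cl_unique[of a b "nb a"] a b eq by simp
  qed
qed

lemma valence_c: "valence T c = n"
proof -
  have "valence T c = card (nbrs T c) + card (legs_at T c)"
    by (simp add: valence_def edge_card_nbrs legs_at_def)
  also have "card (nbrs T c) = card {a \<in> P n. card (chain_at a) \<noteq> 0}" unfolding nbrs_c by (rule card_image[OF inj_nb])
  also have "\<dots> + card (legs_at T c) = card ({a \<in> P n. card (chain_at a) \<noteq> 0} \<union> {a \<in> P n. card (chain_at a) = 0})"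
    unfolding legs_at_c by (rule card_Un_disjoint[symmetric]) auto
  also have "{a \<in> P n. card (chain_at a) \<noteq> 0} \<union> {a \<in> P n. card (chain_at a) = 0} = P n" by auto
  finally show ?thesis using card_P[of n] by simp
qed

end

locale rigid_curve = rigid_tree T q n c
  for T :: "('n::finite + 'm::finite, 'z) tree_scheme" and q n c +
  assumes P_Inl: "P n = range Inl"
begin

lemma card_n: "n = CARD('n)"
  using card_P[of n] card_image[of "Inl :: 'n \<Rightarrow> 'n + 'm" UNIV] P_Inl by simp

lemma central: "central_vertex T c"
  unfolding central_vertex_def using c valence_c card_n paths_through_c P_Inl by simp

lemma ends_Inr: "e \<notin> P n \<Longrightarrow> \<exists>x. e = Inr x" and mark_Inl: "e \<in> P n \<Longrightarrow> \<exists>x. e = Inl x"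
  using P_Inl by (cases e; auto)+

lemma nb_short:
  assumes a: "a \<in> P n" "card (chain_at a) = 1" shows "short_leaf T c (nb a)" "\<not> long_leaf T c (nb a)"
proof -
  obtain U e where U: "chain_at a = {U}" "e \<notin> P n" "legs_at T U = {a, e}" "valence T U = 3" "{c, U} \<in> edges T"
    using disjoint_ends[OF a] .
  have nb: "nb a = U" using nb_eq[OF a(1), of U] U by (simp add: nbrs_def)
  have br: "branch T c U = {U}" using branch_Cl[OF a(1) U(5)] U(1) by simp
  obtain i x where "a = Inl i" "e = Inr x" using mark_Inl[OF a(1)] ends_Inr[OF U(2)] by blast
  then show "short_leaf T c (nb a)" unfolding short_leaf_def nb using U br by blast
  show "\<not> long_leaf T c (nb a)" unfolding long_leaf_def nb using U(3) ends_Inr mark_Inl a(1) \<open>a = Inl i\<close> by auto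
qed

lemma nb_long:
  assumes a: "a \<in> P n" "card (chain_at a) = 2" shows "long_leaf T c (nb a)" "\<not> short_leaf T c (nb a)"
proof -
  obtain W U e e' where U: "chain_at a = {W, U}" "W \<noteq> U" "e \<notin> P n" "e' \<notin> P n" "legs_at T U = {a, e'}" "legs_at T W = {e}"
    "valence T U = 3" "valence T W = 3" "{c, W} \<in> edges T" "{W, U} \<in> edges T" "beyond c U \<subset> beyond c W"
    using two_ends[OF a] .
  have nb: "nb a = W" using nb_eq[OF a(1), of W] U by (simp add: nbrs_def)
  have br: "branch T c W = {W, U}" using branch_Cl[OF a(1) U(9)] U(1,11) by auto
  obtain i x y where "a = Inl i" "e' = Inr x" "e = Inr y"
    using mark_Inl[OF a(1)] ends_Inr[OF U(3)] ends_Inr[OF U(4)] by blast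
  then show "long_leaf T c (nb a)" unfolding long_leaf_def nb using U br by blast
  show "\<not> short_leaf T c (nb a)" unfolding short_leaf_def nb using br U(2) by auto
qed

theorem shapes: "shape_A T \<or> shape_B T"
proof -
  \<comment> \<open>The deficits of the chain lengths add up to 2, which turns the two shapes into
    the two cases of \<open>sum_eq_2_cases\<close>.\<close>
  let ?f = "\<lambda>a. 2 - card (chain_at a)"
  have le: "card (chain_at a) \<le> 2" if "a \<in> P n" for a using at_most_two[OF that] by (simp add: chain_at_def)
  have "(\<Sum>a\<in>P n. ?f a) + (\<Sum>a\<in>P n. card (chain_at a)) = (\<Sum>a\<in>P n. 2)"
    unfolding sum.distrib[symmetric] by (rule sum.cong) (use le in auto)
  then have "(\<Sum>a\<in>P n. ?f a) = 2" using sum_card_Cl card_P[of n] n3 by simp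
  then consider
    a where "a \<in> P n" "?f a = 2" "\<forall>b\<in>P n. b \<noteq> a \<longrightarrow> ?f b = 0"
    | a b where "a \<in> P n" "b \<in> P n" "a \<noteq> b" "?f a = 1" "?f b = 1" "\<forall>d\<in>P n. d \<noteq> a \<and> d \<noteq> b \<longrightarrow> ?f d = 0"
    using sum_eq_2_cases[of "P n" ?f] by auto
  then show ?thesis
  proof cases
    case (1 a)
    have k: "card (chain_at a) = 0" "\<And>b. b \<in> P n \<Longrightarrow> b \<noteq> a \<Longrightarrow> card (chain_at b) = 2" using 1 le by force+
    have legs: "legs_at T c = {a}" unfolding legs_at_c using k 1(1) by force
    have S: "{b \<in> P n. card (chain_at b) \<noteq> 0} = P n - {a}" using k by force
    have "card (nbrs T c) = card (P n - {a})" unfolding nbrs_c S[symmetric] by (rule card_image[OF inj_nb])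
    then have "card (nbrs T c) = CARD('n) - 1" using 1(1) card_P[of n] card_n by simp
    moreover have "long_leaf T c W" if W: "W \<in> nbrs T c" for W
    proof -
      obtain b where "W = nb b" "b \<in> P n - {a}" using W unfolding nbrs_c S by (rule imageE) (rule that)
      then show ?thesis using nb_long(1)[of b] k(2) by simp
    qed
    moreover obtain i where "a = Inl i" using mark_Inl[OF 1(1)] by blast
    ultimately show ?thesis using central legs unfolding shape_A_def by blast
  next
    case (2 a b)
    have k: "card (chain_at a) = 1" "card (chain_at b) = 1" "\<And>d. d \<in> P n \<Longrightarrow> d \<noteq> a \<Longrightarrow> d \<noteq> b \<Longrightarrow> card (chain_at d) = 2"
      using 2 le by force+
    have k0: "card (chain_at d) \<noteq> 0" if "d \<in> P n" for d using k that by (cases "d = a \<or> d = b") auto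
    have legs: "legs_at T c = {}" unfolding legs_at_c using k0 by blast
    have S: "{b \<in> P n. card (chain_at b) \<noteq> 0} = P n" using k0 by blast
    have cn: "card (nbrs T c) = CARD('n)"
      using card_image[OF inj_nb] nbrs_c S card_P[of n] card_n by simp
    have img: "nbrs T c = nb ` P n" using nbrs_c S by simp
    have inj: "inj_on nb (P n)" using inj_nb S by simp
    have "{W \<in> nbrs T c. short_leaf T c W} = nb ` {a, b}"
    proof
      show "nb ` {a, b} \<subseteq> {W \<in> nbrs T c. short_leaf T c W}" using img 2(1,2) nb_short(1) k(1,2) by auto
      show "{W \<in> nbrs T c. short_leaf T c W} \<subseteq> nb ` {a, b}"
      proof
        fix W assume W: "W \<in> {W \<in> nbrs T c. short_leaf T c W}"
        then have "W \<in> nb ` P n" using img by simp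
        then obtain d where d: "W = nb d" "d \<in> P n" by (rule imageE) (rule that)
        then have "d = a \<or> d = b" using W nb_long(2)[of d] k(3)[of d] by auto
        then show "W \<in> nb ` {a, b}" using d by auto
      qed
    qed
    moreover have "card (nb ` {a, b}) = 2"
      using inj_onD[OF inj, of a b] 2(1-3) by (auto simp: card_insert_if)
    moreover have "short_leaf T c W \<or> long_leaf T c W" if W: "W \<in> nbrs T c" for W
    proof -
      have "W \<in> nb ` P n" using img W by simp
      then obtain d where d: "W = nb d" "d \<in> P n" by (rule imageE) (rule that)
      then show ?thesis using nb_long(1)[of d] nb_short(1)[of d] k by (cases "d = a \<or> d = b") auto
    qed
    ultimately show ?thesis using central legs cn unfolding shape_B_def by metis
  qed
qed

end

section \<open>The centre of a curve and the consequences of injective evaluation\<close>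

context balanced_legs
begin

lemma ev_fun_split_vec_gen:
  assumes a: "v a = 0" "a \<noteq> s"
  shows "ev_fun a (split_vec I) = (if a \<in> I then \<Sum>l\<in>I. v l else 0) - (if r \<in> I then \<Sum>l\<in>I. v l else 0)"
proof (cases "r \<in> I")
  case False then show ?thesis using ev_fun_split_vec[OF a] by simp
next
  case True
  have "(\<Sum>l\<in>I. v l) + (\<Sum>l\<in>- I. v l) = (\<Sum>l\<in>I \<union> - I. v l)"
    by (rule sum.union_disjoint[symmetric]) auto
  then have "(\<Sum>l\<in>- I. v l) = - (\<Sum>l\<in>I. v l)" using v_sum by (simp add: eq_neg_iff_add_eq_0 add.commute)
  then show ?thesis using ev_fun_split_vec[OF a, of "- I"] True by (simp add: split_vec_uminus)
qed

end

context stree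
begin

text \<open>The quartet coordinate of the cluster at \<open>w\<close> reads off the coefficient
  \<open>x w\<close>.\<close>

lemma split_vecs_independent:
  assumes c: "c \<in> V" and W: "W \<subseteq> V - {c}" and w: "w \<in> W"
    and z: "(\<Sum>u\<in>W. x u *\<^sub>R split_vec (beyond c u)) = 0"
  shows "x w = 0"
proof -
  have fin: "finite W" using W finite_V finite_subset by blast
  have in_splits: "beyond c u \<in> splits" if "u \<in> W" for u using W that splits_eq[OF c] by blast
  obtain k where k: "quartet splits (beyond c w) k" using quartet_exists[OF split_system_splits in_splits[OF w]] .
  have val: "split_vec (beyond c u) $ k = (if u = w then 1 else 0)" if u: "u \<in> W" for u
  proof -
    have "beyond c u = beyond c w \<longleftrightarrow> u = w" using inj_on_eq_iff[OF beyond_inj[OF c]] u w W by blast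
    moreover have "beyond c u \<noteq> - beyond c w" using beyond_disjoint_sides[OF c] u w W by blast
    ultimately show ?thesis using k in_splits[OF u] by (simp add: quartet_def)
  qed
  have "0 = (\<Sum>u\<in>W. x u *\<^sub>R split_vec (beyond c u)) $ k" using z by simp
  also have "\<dots> = (\<Sum>u\<in>W. if u = w then x u else 0)"
    unfolding sum_component by (rule sum.cong) (simp_all add: val)
  also have "\<dots> = x w" using fin w by simp
  finally show ?thesis by simp
qed

end

lemma rigid_tree_exists:
  fixes T :: "('l::finite, 'z) tree_scheme"
  assumes "stree T" "marked q n" "balanced_legs v r s"
    and rP: "r \<in> marked.P q n"
    and mark: "\<And>a. a \<in> marked.P q n \<Longrightarrow> v a = 0 \<and> a \<noteq> s"
    and cen: "marked.centered q n (ptree.splits T)"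
    and card_l: "CARD('l) = 3 * n - 2" and card_s: "card (ptree.splits T) = 2 * (2 * n - 2)"
    and kernel: "\<And>z. z \<in> span (split_vec ` ptree.splits T) \<Longrightarrow>
      (\<And>a. a \<in> marked.P q n \<Longrightarrow> balanced_legs.ev_fun v r s a z = 0) \<Longrightarrow> z = 0"
  obtains c where "rigid_tree T q n c"
proof -
  interpret stree T by (rule assms(1))
  interpret marked q n by (rule assms(2))
  interpret balanced_legs v r s by (rule assms(3))
  obtain \<rho> where \<rho>: "\<rho> \<in> V" using V_ne by blast
  let ?B = "{w \<in> V. \<not> small n (beyond \<rho> w)}"
  have "P n \<noteq> {}" using card_P[of n] n3 by auto
  have "\<rho> \<in> ?B" using \<rho> beyond_root[OF \<rho>] card_P[of n] n3 by (simp add: small_def)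
  then have "?B \<noteq> {}" "finite ?B" using finite_V by auto
  \<comment> \<open>A deepest vertex with at least two markings beyond it. The clusters of its
    children are small by maximality, and the side of its parent is small because its own cluster is
    not.\<close>
  then have "\<exists>c\<in>?B. \<forall>w\<in>?B. length (pth \<rho> w) \<le> length (pth \<rho> c)"
    using finite_has_maximal[of "(\<lambda>w. length (pth \<rho> w)) ` ?B"] by force
  then obtain c where c: "c \<in> V" "\<not> small n (beyond \<rho> c)"
    and max: "\<And>w. w \<in> V \<Longrightarrow> \<not> small n (beyond \<rho> w) \<Longrightarrow> length (pth \<rho> w) \<le> length (pth \<rho> c)" by blast
  have nb: "small n (beyond c w)" if w: "w \<in> nbrs T c" for w
  proof -
    consider "w \<in> children \<rho> c" | "c \<noteq> \<rho>" "w = parent \<rho> c" using nbrs_children(1)[OF \<rho> c(1)] w by (auto split: if_splits)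
    then show ?thesis
    proof cases
      case 1
      note cp = children_path[OF \<rho> 1]
      have "length (pth \<rho> w) > length (pth \<rho> c)" using cp(1) by simp
      then have "small n (beyond \<rho> w)" using max[OF cp(2)] by linarith
      moreover have "parent \<rho> w = c" using 1 by (simp add: children_def)
      ultimately show ?thesis using beyond_parent[OF \<rho> cp(2,3)] by simp
    next
      case 2
      have e: "{w, c} \<in> edges T" using w by (simp add: nbrs_def insert_commute)
      have "beyond \<rho> c = beyond w c" using beyond_parent[OF \<rho> c(1) 2(1)] 2(2) by simp
      moreover have "beyond w c \<in> splits" using e by (auto simp: splits_def)
      ultimately have "small n (- beyond w c)" using cen c(2) by (auto simp: centered_def)
      then show ?thesis using beyond_swap[OF e] by simp
    qed
  qed
  have sm: "small n (beyond c w)" if w: "w \<in> V - {c}" for w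
  proof -
    have p: "is_path T (pth c w) c w" using pth c(1) w by blast
    then obtain u ys where u: "pth c w = c # u # ys" using w
      by (cases "pth c w"; cases "tl (pth c w)") (auto simp: is_path_def)
    then have "u \<in> nbrs T c" "u \<in> set (pth c w)" using p by (auto simp: is_path_def nbrs_def)
    then show ?thesis using small_subset[OF nb beyond_mono[OF c(1)]] w by blast
  qed
  have spl: "split_vec (beyond c w) \<in> span (split_vec ` splits)" if "w \<in> V - {c}" for w
    using that splits_eq[OF c(1)] by (intro span_base) blast
  \<comment> \<open>The sum is the displacement of the marking \<open>a\<close> when edge lengths
    change by \<open>x\<close>. The term with \<open>r\<close> occurs because positions are relative
    to the base marking.\<close>
  have combination: "x w = 0"
    if W: "W \<subseteq> V - {c}" "w \<in> W" and z: "\<And>a. a \<in> P n \<Longrightarrow>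
      (\<Sum>u\<in>W. x u *\<^sub>R ((if a \<in> beyond c u then \<Sum>l\<in>beyond c u. v l else 0) - (if r \<in> beyond c u then \<Sum>l\<in>beyond c u. v l else 0))) = 0"
    for W w and x :: "nat \<Rightarrow> real"
  proof (rule split_vecs_independent[OF c(1) W])
    show "(\<Sum>u\<in>W. x u *\<^sub>R split_vec (beyond c u)) = 0"
    proof (rule kernel)
      show "(\<Sum>u\<in>W. x u *\<^sub>R split_vec (beyond c u)) \<in> span (split_vec ` splits)"
        using W spl by (intro span_sum span_scale) blast
      fix a assume a: "a \<in> P n"
      then show "ev_fun a (\<Sum>u\<in>W. x u *\<^sub>R split_vec (beyond c u)) = 0"
        using z[OF a] mark[OF a] linear_ev_fun[of a]
        by (simp add: linear_sum linear_scale ev_fun_split_vec_gen)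
    qed
  qed
  have marked_beyond: "\<exists>a\<in>P n. a \<in> beyond c w" if w: "w \<in> V - {c}" and r: "r \<in> P n" for w
  proof (rule ccontr)
    assume no: "\<not> ?thesis"
    have "(1 :: real) = 0"
      by (rule combination[of "{w}" w "\<lambda>_. 1"]) (use w no r in auto)
    then show False by simp
  qed
  have two: "card {w \<in> V - {c}. a \<in> beyond c w} \<le> 2" if a: "a \<in> P n" and r: "r \<in> P n" for a
  proof (rule ccontr)
    let ?W = "{w \<in> V - {c}. a \<in> beyond c w}"
    let ?h = "\<lambda>w. \<Sum>l\<in>beyond c w. v l"
    assume "\<not> card ?W \<le> 2"
    then have "card ?W > DIM(real^2)" "finite ?W" using finite_V by simp_all
    then obtain x :: "nat \<Rightarrow> real" where x: "\<exists>w\<in>?W. x w \<noteq> 0" "(\<Sum>w\<in>?W. x w *\<^sub>R ?h w) = 0"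
      using dependent_combination[of ?W ?h] by blast
    have half: "(\<Sum>u\<in>?W. x u *\<^sub>R (if b \<in> beyond c u then ?h u else 0)) = 0" if b: "b \<in> P n" for b
    proof (cases "b = a")
      case True
      have "(\<Sum>u\<in>?W. x u *\<^sub>R (if b \<in> beyond c u then ?h u else 0)) = (\<Sum>w\<in>?W. x w *\<^sub>R ?h w)"
        by (rule sum.cong) (use True in auto)
      then show ?thesis using x(2) by simp
    next
      case False
      have "b \<notin> beyond c u" if "u \<in> ?W" for u using smallD[OF sm[of u], of a b] that a b False by blast
      then show ?thesis by (intro sum.neutral) simp
    qed
    obtain w where w: "w \<in> ?W" "x w \<noteq> 0" using x(1) by blast
    have "x w = 0"
      by (rule combination[of ?W w x]) (use w half r in \<open>auto simp: scaleR_diff_right sum_subtractf\<close>)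
    then show False using w(2) by simp
  qed
  show ?thesis
  proof (rule that[of c], unfold_locales)
    show "card V = 2 * n - 1"
    proof -
      have "card V > 0" using c(1) finite_V card_gt_0_iff by blast
      then show ?thesis using card_splits[OF c(1)] card_s n3 by linarith
    qed
  qed (use c(1) sm marked_beyond two card_l rP in auto)
qed

section \<open>Points of the 0-cycle, and comparison of complexes that agree on the fan\<close>

context generic_intersection
begin

text \<open>With as many conditions as dimensions, the contributing cell is a slice
  \<open>s \<inter> H N\<close> consisting of one point. A direction of \<open>s\<close> annihilated
  by all functionals could be followed inside this slice, as \<open>y\<close> is a relative interior
  point of \<open>s\<close>.\<close>

lemma contributes_rigid:
  assumes "N = d" "contributes (X N) y"
  obtains s where "s \<in> F" "aff_dim s = int d" "wt Z s \<noteq> 0" "y \<in> rel_interior s"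
    "\<forall>v\<in>direction_space s. (\<forall>k<N. L k v = 0) \<longrightarrow> v = 0"
proof -
  have "{y} \<in> cells (X N)" "wt (X N) {y} \<noteq> 0" using assms(2) by (auto simp: contributes_def)
  moreover have "aff_dim {y} = int d - int N" using assms(1) by simp
  ultimately obtain s z where s: "s \<in> Top" "{y} = s \<inter> H N" "z \<in> rel_interior s" "z \<in> H N"
    using supported_balanced[of N] unfolding supported_def by blast
  then have z: "z = y" using rel_interior_subset by blast
  have "v = 0" if v: "v \<in> direction_space s" "\<And>k. k < N \<Longrightarrow> L k v = 0" for v
  proof -
    obtain e where e: "e > 0" "\<forall>t. \<bar>t\<bar> \<le> e \<longrightarrow> y + t *\<^sub>R v \<in> s"
      using rel_interior_move[OF s(3)[unfolded z] v(1)] by blast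
    then have "y + e *\<^sub>R v \<in> s" by simp
    moreover have "y + e *\<^sub>R v \<in> H N" using s(4) v(2) unfolding z by (intro H_move) (simp_all add: K_def)
    ultimately have "y + e *\<^sub>R v = y" using s(2) by blast
    then show ?thesis using e(1) by simp
  qed
  then show ?thesis using that[of s] s z by (auto simp: Top_def)
qed

end

text \<open>Weights are compared on maximal cells only, since \<open>weil_weight\<close> reads no
  others. The relation lets \<open>ev\<close> be replaced by linear functionals that equal it only
  on the fan.\<close>

definition agree :: "'a::euclidean_space wcomplex \<Rightarrow> 'a wcomplex \<Rightarrow> bool" where
  "agree X Y \<longleftrightarrow> wdim X = wdim Y \<and> cells X = cells Y \<and> (\<forall>c\<in>cells X. aff_dim c = wdim X \<longrightarrow> wt X c = wt Y c)"

lemma contributes_agree: "agree X Y \<Longrightarrow> contributes X y \<longleftrightarrow> contributes Y y"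
  unfolding agree_def contributes_def by (metis aff_dim_sing)

text \<open>The refined cells and the linear parts depend only on the values of the function on the
  cells, and weights of maximal cells pass through \<open>cut\<close> unchanged.\<close>

lemma agree_cartier_intersect:
  assumes XY: "agree X Y" and X: "polyhedral Y" and eq: "\<And>c y. c \<in> cells Y \<Longrightarrow> y \<in> c \<Longrightarrow> f y = g y"
  shows "agree (cartier_intersect \<Lambda> f X) (cartier_intersect \<Lambda> g Y)"
proof -
  have w: "wdim X = wdim Y" "cells X = cells Y" "\<And>c. c \<in> cells Y \<Longrightarrow> aff_dim c = wdim Y \<Longrightarrow> wt X c = wt Y c"
    using XY by (auto simp: agree_def)
  have XX: "polyhedral X" using X w by (simp add: polyhedral_def)
  have sub: "\<exists>q\<in>cells Y. c \<subseteq> q" if "c \<in> cells (cut g Y)" for c using that by (elim cut_cellE) blast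
  have cells: "cells (cut f X) = cells (cut g Y)"
  proof -
    have "{s \<inter> {x. f x \<ge> 0}, s \<inter> {x. f x \<le> 0}, s \<inter> {x. f x = 0}}
        = {s \<inter> {x. g x \<ge> 0}, s \<inter> {x. g x \<le> 0}, s \<inter> {x. g x = 0}}" if "s \<in> cells Y" for s
    proof -
      have "s \<inter> {x. f x \<ge> 0} = s \<inter> {x. g x \<ge> 0}" "s \<inter> {x. f x \<le> 0} = s \<inter> {x. g x \<le> 0}"
        "s \<inter> {x. f x = 0} = s \<inter> {x. g x = 0}" using eq[OF that] by auto
      then show ?thesis by simp
    qed
    then show ?thesis by (simp add: cut_def w(2))
  qed
  have wt: "wt (cut f X) c = wt (cut g Y) c" if c: "c \<in> cells (cut g Y)" "aff_dim c = wdim Y" for c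
  proof -
    obtain q where q: "q \<in> cells Y" "c \<subseteq> q" using sub[OF c(1)] by blast
    have "aff_dim q = wdim Y" using aff_dim_subset[OF q(2)] X q(1) c(2) by (force simp: polyhedral_def)
    then have "wt X q = wt Y q" using w(3) q(1) by blast
    moreover have "wt (cut f X) c = wt X q" by (rule polyhedral_cut_wt[OF XX]) (use q c w in auto)
    moreover have "wt (cut g Y) c = wt Y q" by (rule polyhedral_cut_wt[OF X]) (use q c in auto)
    ultimately show ?thesis by simp
  qed
  have lin: "lin_part (\<lambda>x. max (f x) 0) c = lin_part (\<lambda>x. max (g x) 0) c" if c: "c \<in> cells (cut g Y)" for c
  proof (rule lin_part_cong)
    fix x assume "x \<in> c"
    moreover obtain q where "q \<in> cells Y" "c \<subseteq> q" using sub[OF c] by blast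
    ultimately show "max (f x) 0 = max (g x) 0" using eq[of q x] by auto
  qed
  have dims: "wdim (cut f X) = wdim Y" "wdim (cut g Y) = wdim Y" by (simp_all add: cut_def w)
  have weil: "weil_weight \<Lambda> (\<lambda>x. max (f x) 0) (cut f X) t = weil_weight \<Lambda> (\<lambda>x. max (g x) 0) (cut g Y) t"
    if t: "t \<in> cells (cut g Y)" for t
  proof -
    let ?S = "{s \<in> cells (cut g Y). aff_dim s = wdim Y \<and> t face_of s}"
    have 1: "(\<Sum>s\<in>?S. wt (cut f X) s * lin_part (\<lambda>x. max (f x) 0) s (normal_vec \<Lambda> s t))
        = (\<Sum>s\<in>?S. wt (cut g Y) s * lin_part (\<lambda>x. max (g x) 0) s (normal_vec \<Lambda> s t))"
      by (rule sum.cong) (use wt lin in auto)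
    have 2: "(\<Sum>s\<in>?S. wt (cut f X) s *\<^sub>R normal_vec \<Lambda> s t) = (\<Sum>s\<in>?S. wt (cut g Y) s *\<^sub>R normal_vec \<Lambda> s t)"
      by (rule sum.cong) (use wt in auto)
    show ?thesis unfolding weil_weight_def Let_def dims cells 1 2 lin[OF t] ..
  qed
  show ?thesis unfolding agree_def cartier_intersect_def weil_divisor_def
    using cells dims weil by auto
qed

context generic_intersection
begin

lemma cells_X: "c \<in> cells (X j) \<Longrightarrow> \<exists>s\<in>F. c \<subseteq> s"
proof (induction j arbitrary: c)
  case 0 then show ?case using Z_cells by auto
next
  case (Suc j)
  then have "c \<in> cells (cut (f j) (X j))" by (simp add: X_Suc cartier_intersect_def weil_divisor_def)
  then obtain q where "q \<in> cells (X j)" "c \<subseteq> q" by (elim cut_cellE) blast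
  then show ?case using Suc.IH[of q] by (meson order_trans)
qed

lemma agree_fold:
  assumes g: "\<And>k s y. k < length xs \<Longrightarrow> s \<in> F \<Longrightarrow> y \<in> s \<Longrightarrow> g (xs ! k) y = L k y - x k"
  shows "agree (fold (\<lambda>p. cartier_intersect \<Lambda> (g p)) xs Z) (X (length xs))"
proof -
  have "agree (fold (\<lambda>p. cartier_intersect \<Lambda> (g p)) (take k xs) Z) (X k)" if "k \<le> length xs" for k
    using that
  proof (induction k)
    case 0 then show ?case by (simp add: agree_def)
  next
    case (Suc k)
    have "agree (cartier_intersect \<Lambda> (g (xs ! k)) (fold (\<lambda>p. cartier_intersect \<Lambda> (g p)) (take k xs) Z))
        (cartier_intersect \<Lambda> (f k) (X k))"
    proof (rule agree_cartier_intersect[OF _ polyhedral_X])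
      show "agree (fold (\<lambda>p. cartier_intersect \<Lambda> (g p)) (take k xs) Z) (X k)" using Suc by simp
      fix c y assume "c \<in> cells (X k)" "y \<in> c"
      then show "g (xs ! k) y = f k y" using g[of k] Suc.prems cells_X[of c k] by auto
    qed
    then show ?case using Suc.prems by (simp add: take_Suc_conv_app_nth X_Suc)
  qed
  from this[of "length xs"] show ?thesis by simp
qed

end

section \<open>Curves through points in general position\<close>

lemma UNIV_2: "(i::2) = 1 \<or> i = 2" by (rule exhaust_2)

text \<open>The determinant against the second basis vector turns a lattice point
  \<open>t *\<^sub>R a\<close> into \<open>t\<close> up to sign, so \<open>t\<close> is an
  integer.\<close>

lemma lattice_basis_ray:
  assumes ab: "lattice_basis a b" and \<rho>: "\<rho> = convex_cone hull {a}"
  shows "a \<noteq> 0" "\<rho> \<inter> int_vec = range (\<lambda>k::nat. real k *\<^sub>R a)"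
proof -
  have det: "\<bar>a$1 * b$2 - a$2 * b$1\<bar> = 1" and int: "a \<in> int_vec" "b \<in> int_vec" using ab by (auto simp: lattice_basis_def)
  show "a \<noteq> 0" using det by auto
  have \<rho>: "\<rho> = {t *\<^sub>R a |t. t \<ge> 0}" unfolding \<rho> by (auto simp: convex_cone_hull_separate_nonempty conic_hull_explicit)
  show "\<rho> \<inter> int_vec = range (\<lambda>k::nat. real k *\<^sub>R a)"
  proof
    show "range (\<lambda>k::nat. real k *\<^sub>R a) \<subseteq> \<rho> \<inter> int_vec"
      using int unfolding \<rho> by (auto simp: int_vec_def intro!: Ints_mult)
    show "\<rho> \<inter> int_vec \<subseteq> range (\<lambda>k::nat. real k *\<^sub>R a)"
    proof
      fix z assume "z \<in> \<rho> \<inter> int_vec"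
      then obtain t where t: "t \<ge> 0" "z = t *\<^sub>R a" "z \<in> int_vec" unfolding \<rho> by blast
      have "z$1 * b$2 - z$2 * b$1 \<in> \<int>" using t(3) int by (intro Ints_diff Ints_mult) (auto simp: int_vec_def)
      also have "z$1 * b$2 - z$2 * b$1 = t * (a$1 * b$2 - a$2 * b$1)" by (simp add: t(2) algebra_simps)
      finally have "t \<in> \<int>" using det by (auto simp: abs_if minus_in_Ints_iff split: if_splits)
          (metis Ints_minus minus_diff_eq mult.right_neutral mult_minus1_right minus_minus)
      then have "t \<in> \<nat>" using t(1) by (simp add: Nats_altdef2)
      then show "z \<in> range (\<lambda>k::nat. real k *\<^sub>R a)" using t(2) by (auto elim!: Nats_cases)
    qed
  qed
qed

text \<open>A one-dimensional cone of the fan is spanned by one vector of a lattice basis, and by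
  \<open>lattice_basis_ray\<close> that vector is what the \<open>THE\<close> describes.\<close>

lemma primitive_gen_int:
  assumes \<Sigma>: "nonsingular_fan \<Sigma>" and \<rho>: "\<rho> \<in> toric_divisors \<Sigma>"
  shows "primitive_gen \<rho> \<in> int_vec"
proof -
  have dim: "aff_dim \<rho> = 1" and \<rho>\<Sigma>: "\<rho> \<in> \<Sigma>" using \<rho> by (auto simp: toric_divisors_def)
  obtain a b B where ab: "lattice_basis a b" and B: "B \<subseteq> {a, b}" "\<rho> = convex_cone hull B"
    using \<Sigma> \<rho>\<Sigma> unfolding nonsingular_fan_def by meson
  have ba: "lattice_basis b a" using ab by (auto simp: lattice_basis_def abs_minus_commute mult.commute)
  have "B \<noteq> {}" using B dim by auto
  moreover have "B \<noteq> {a, b}"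
  proof
    assume eq: "B = {a, b}"
    have det: "a$1 * b$2 - a$2 * b$1 \<noteq> 0" using ab by (auto simp: lattice_basis_def)
    have "a \<notin> span {b}" using det by (auto simp: span_singleton algebra_simps)
    moreover have "b \<noteq> 0" "a \<noteq> b" using det by auto
    ultimately have ind: "independent {a, b}" by (simp add: independent_insert)
    have sub: "{a, b} \<subseteq> \<rho>" using B eq hull_subset[of "{a, b}"] by blast
    have "card {a, b} \<le> dim \<rho>" by (rule independent_card_le_dim[OF sub ind])
    then have "2 \<le> dim \<rho>" using \<open>a \<noteq> b\<close> by simp
    moreover have "0 \<in> affine hull \<rho>" using B(2) convex_cone_hull_contains_0 hull_inc by metis
    ultimately show False using dim aff_dim_zero[of \<rho>] by simp
  qed
  ultimately have "B = {a} \<or> B = {b}" using B(1) by blast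
  then obtain u where u: "u \<noteq> 0" "\<rho> \<inter> int_vec = range (\<lambda>k::nat. real k *\<^sub>R u)"
    using lattice_basis_ray[OF ab] lattice_basis_ray[OF ba] B(2) by metis
  have gen: "primitive_gen \<rho> = u"
    unfolding primitive_gen_def
  proof (rule the_equality)
    fix w assume w: "w \<noteq> 0 \<and> \<rho> \<inter> int_vec = range (\<lambda>k::nat. real k *\<^sub>R w)"
    have "real 1 *\<^sub>R u \<in> range (\<lambda>k::nat. real k *\<^sub>R w)" using w u(2) by blast
    moreover have "real 1 *\<^sub>R w \<in> range (\<lambda>k::nat. real k *\<^sub>R u)" using w u(2) by blast
    ultimately obtain k l where kl: "real 1 *\<^sub>R u = real k *\<^sub>R w" "real 1 *\<^sub>R w = real l *\<^sub>R u" by (elim imageE) (rule that)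
    have "u = (real l * real k) *\<^sub>R u" using arg_cong[OF kl(2), of "\<lambda>z. real k *\<^sub>R z"] kl(1) by (simp add: mult.commute)
    then have "(1 - real l * real k) *\<^sub>R u = 0" by (simp add: scaleR_diff_left)
    then have "real (l * k) = real 1" using u(1) by simp
    then have "l = 1" by (simp only: of_nat_eq_iff nat_mult_eq_1_iff)
    then show "w = u" using kl(2) by simp
  qed (use u in simp)
  have "real 1 *\<^sub>R u \<in> \<rho> \<inter> int_vec" using u(2) by blast
  then show ?thesis using gen by simp
qed

text \<open>The order in which \<open>point_cycle\<close> imposes its conditions; the position in
  this list is the index of the functionals \<open>L\<close>.\<close>

definition coords :: "nat \<Rightarrow> (nat \<times> 2) list" where "coords n = List.product [1..<Suc n] [1, 2]"

locale incidence_problem =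
  fixes \<Sigma> :: "(real^2) set set" and c :: "'m::finite \<Rightarrow> (real^2) set \<times> nat" and p :: "nat \<Rightarrow> 'n::finite"
  assumes surface: "nonsingular_fan \<Sigma>"
    and contact: "contact_order \<Sigma> c"
    and balancing: "(\<Sum>l\<in>UNIV. contact_vec c l) = 0"
    and n: "CARD('n) \<ge> 3"
    and m: "CARD('m) = 2 * (CARD('n) - 1)"
    and markings: "bij_betw p {1..CARD('n)} UNIV"
begin

abbreviation mark :: "nat \<Rightarrow> 'n + 'm" where "mark i \<equiv> Inl (p i)"
abbreviation v :: "'n + 'm \<Rightarrow> real^2" where "v \<equiv> leg_dir c"
text \<open>An arbitrary end plays the auxiliary leg of \<open>balanced_legs\<close>.\<close>

abbreviation s0 :: "'n + 'm" where "s0 \<equiv> Inr undefined"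

declare One_nat_def [simp del]

lemma card_legs: "CARD('n + 'm) = 3 * CARD('n) - 2" using m n by simp

lemma v_int: "v l \<in> int_vec"
proof (cases l)
  case (Inl a) then show ?thesis by (simp add: leg_dir_def int_vec_def)
next
  case (Inr b)
  have "primitive_gen (fst (c b)) \<in> int_vec"
    using primitive_gen_int[OF surface] contact by (simp add: contact_order_def)
  then show ?thesis using Inr by (auto simp: leg_dir_def contact_vec_def int_vec_def intro!: Ints_mult)
qed

lemma v_sum: "(\<Sum>l\<in>UNIV. v l) = 0"
proof -
  have "(\<Sum>l\<in>UNIV. v l) = (\<Sum>l\<in>UNIV. v (Inl l)) + (\<Sum>l\<in>UNIV. v (Inr l))"
    unfolding UNIV_Plus_UNIV[symmetric] by (simp add: sum.Plus comp_def del: UNIV_Plus_UNIV)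
  then show ?thesis using balancing by (simp add: leg_dir_def)
qed

sublocale balanced_legs v "mark 1" s0
proof
  show "CARD('n + 'm) \<ge> 3" using card_legs n by simp
  show "v (mark 1) = 0" by (simp add: leg_dir_def)
  show "mark 1 \<noteq> s0" by simp
  show "(\<Sum>l\<in>UNIV. v l) = 0" by (rule v_sum)
  show "v l \<in> int_vec" for l by (rule v_int)
qed

sublocale marked mark "CARD('n)"
proof
  show "inj_on mark {1..CARD('n)}" 
    by (rule inj_onI) (use inj_onD[OF bij_betw_imp_inj_on[OF markings]] in simp)
  show "3 \<le> CARD('n)" by (rule n)
qed

lemma P_eq: "P CARD('n) = range Inl"
proof -
  have "P CARD('n) = Inl ` (p ` {1..CARD('n)})" by (auto simp: P_def)
  then show ?thesis using markings by (simp add: bij_betw_def)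
qed

abbreviation Z :: "(('n + 'm) ambient \<times> (real^2)) wcomplex" where "Z \<equiv> Z_cycle p"

lemma ft_fun_eq: "origin_fun \<circ> ft p i = ft_fun i"
  by (simp add: fun_eq_iff origin_fun_def ft_def forget_def four_legs_def ft_fun_def ft_coord_def)

lemma centered_Z: "centered_complex CARD('n) Z"
proof -
  have "centered_complex (3 + k)
      (fold (\<lambda>i. cartier_intersect moduli_lattice (ft_fun i)) [4..<4 + k] moduli_fan)"
    if "3 + k \<le> CARD('n)" for k
    using that
  proof (induction k)
    case 0
    then show ?case using centered_complex_moduli_fan[OF N3] by simp
  next
    case (Suc k)
    have e: "Suc (3 + k) = 4 + k" "3 + Suc k = 4 + k" "[4..<4 + Suc k] = [4..<4 + k] @ [4 + k]" using upt_Suc_append[of 4 "4 + k"] by simp_all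
    have "centered_complex (Suc (3 + k)) (cartier_intersect moduli_lattice (ft_fun (Suc (3 + k)))
        (fold (\<lambda>i. cartier_intersect moduli_lattice (ft_fun i)) [4..<4 + k] moduli_fan))"
      using Suc by (intro centered_complex_Suc) auto
    then show ?case unfolding e(1) unfolding e(2,3) by simp
  qed
  from this[of "CARD('n) - 3"] show ?thesis using n by (simp add: Z_cycle_def ft_fun_eq)
qed

lemma wdim_Z: "wdim Z = int (2 * CARD('n))"
  using centered_Z card_legs n by (simp add: centered_complex_def)

definition L :: "nat \<Rightarrow> ('n + 'm) ambient \<times> (real^2) \<Rightarrow> real" where
  "L k y = (snd y + ev_fun (mark (fst (coords CARD('n) ! k))) (fst y)) $ snd (coords CARD('n) ! k)"
definition \<xi> :: "nat \<Rightarrow> (real^2)^'n \<Rightarrow> real" where "\<xi> k x = x $ p (fst (coords CARD('n) ! k)) $ snd (coords CARD('n) ! k)"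
definition fan :: "(('n + 'm) ambient \<times> (real^2)) set set" where "fan = {fan_cell S |S. split_system S}"
text \<open>The point configurations for which the first \<open>j + 1\<close> conditions are
  solvable. Solving on the span, and not just on the cone, yields a linear subspace, of the kind
  that \<open>for_general\<close> may exclude.\<close>

definition incidence :: "('n + 'm) set set \<Rightarrow> nat \<Rightarrow> ((real^2)^'n) set" where
  "incidence S j = {x. \<exists>y\<in>split_span S. \<forall>k\<le>j. L k y = \<xi> k x}"

lemma length_ints: "length (coords CARD('n)) = 2 * CARD('n)" by (simp add: coords_def del: upt_Suc)

lemma set_ints: "set (coords CARD('n)) = {1..CARD('n)} \<times> UNIV" 
  unfolding coords_def set_product set_upt atLeastLessThanSuc_atLeastAtMost using UNIV_2 by auto

lemma distinct_ints: "distinct (coords CARD('n))" unfolding coords_def by (rule distinct_product) auto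

lemma ints_range: "k < 2 * CARD('n) \<Longrightarrow> fst (coords CARD('n) ! k) \<in> {1..CARD('n)}"
  using nth_mem[of k "coords CARD('n)"] length_ints set_ints by auto

lemma linear_L: "linear (L k)"
proof (rule linearI)
  note ev = linear_ev_fun[of "mark (fst (coords CARD('n) ! k))"]
  show "L k (y + z) = L k y + L k z" for y z by (simp add: L_def linear_add[OF ev])
  show "L k (a *\<^sub>R y) = a *\<^sub>R L k y" for a y by (simp add: L_def linear_scale[OF ev] algebra_simps)
qed

lemma ev_fun_int: "y \<in> tree_lattice \<Longrightarrow> ev_fun a y $ j \<in> \<int>"
  unfolding ev_fun_def using v_int tree_lattice_int[of y]
  by (auto simp: int_vec_def sum_component intro!: Ints_sum Ints_mult)

lemma L_int: "y \<in> moduli_lattice \<Longrightarrow> L k y \<in> \<int>"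
  unfolding L_def moduli_lattice_def using ev_fun_int by (auto simp: int_vec_def)

lemma fan_cell_subset_span: "fan_cell S \<subseteq> split_span S"
  unfolding fan_cell_def split_span_def split_cone_def
  by (auto intro!: span_sum span_scale intro: span_base)

lemma affine_incidence: "affine (incidence S j)"
proof -
  have lin: "linear (\<xi> k)" for k by (rule linearI) (simp_all add: \<xi>_def)
  have "subspace (incidence S j)"
    unfolding subspace_def
  proof (intro conjI ballI allI)
    show "0 \<in> incidence S j"
      unfolding incidence_def using subspace_0[OF subspace_split_span] linear_0[OF linear_L] linear_0[OF lin] by force
    fix x assume "x \<in> incidence S j"
    then obtain y where y: "y \<in> split_span S" "\<forall>k\<le>j. L k y = \<xi> k x" by (auto simp: incidence_def)
    show "a *\<^sub>R x \<in> incidence S j" for a unfolding incidence_def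
      using y subspace_scale[OF subspace_split_span y(1), of a] linear_scale[OF linear_L] linear_scale[OF lin]
      by (intro CollectI bexI[of _ "a *\<^sub>R y"]) auto
    fix x' assume "x' \<in> incidence S j"
    then obtain y' where y': "y' \<in> split_span S" "\<forall>k\<le>j. L k y' = \<xi> k x'" by (auto simp: incidence_def)
    show "x + x' \<in> incidence S j" unfolding incidence_def
      using y y' subspace_add[OF subspace_split_span y(1) y'(1)] linear_add[OF linear_L] linear_add[OF lin]
      by (intro CollectI bexI[of _ "y + y'"]) auto
  qed
  then show ?thesis by (rule subspace_imp_affine)
qed

text \<open>Solve the conditions for the configuration \<open>e\<close> whose only nonzero
  coordinate is the one tested by condition \<open>j\<close>: the solution is a direction as
  demanded by \<open>generic\<close>.\<close>

lemma incidence_UNIV: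
  assumes j: "j < 2 * CARD('n)" and U: "incidence S j = UNIV"
  shows "\<exists>w\<in>split_span S. (\<forall>k<j. L k w = 0) \<and> L j w \<noteq> 0"
proof -
  define e :: "(real^2)^'n" where "e = axis (p (fst (coords CARD('n) ! j))) (axis (snd (coords CARD('n) ! j)) 1)"
  have \<xi>: "\<xi> k e = (if k = j then 1 else 0)" if k: "k \<le> j" for k
  proof -
    have "k < 2 * CARD('n)" using k j by simp
    then have "p (fst (coords CARD('n) ! k)) = p (fst (coords CARD('n) ! j)) \<longleftrightarrow> fst (coords CARD('n) ! k) = fst (coords CARD('n) ! j)"
      using inj_on_eq_iff[of p "{1..CARD('n)}"] markings ints_range j by (auto simp: bij_betw_def)
    moreover have "coords CARD('n) ! k = coords CARD('n) ! j \<longleftrightarrow> k = j"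
      using nth_eq_iff_index_eq[OF distinct_ints, of k j] length_ints j \<open>k < 2 * CARD('n)\<close> by simp
    ultimately show ?thesis by (auto simp: \<xi>_def e_def axis_def prod_eq_iff)
  qed
  have "e \<in> incidence S j" using U by simp
  then obtain y where "y \<in> split_span S" "\<forall>k\<le>j. L k y = \<xi> k e" unfolding incidence_def by blast
  then show ?thesis using \<xi> by (intro bexI[of _ y]) auto
qed

lemma facet_functional:
  assumes S: "split_system S" and T: "split_system T" and f: "fan_cell T face_of fan_cell S"
    and d: "aff_dim (fan_cell S) = aff_dim (fan_cell T) + 1"
  shows "\<exists>g :: ('n + 'm) ambient \<times> (real^2) \<Rightarrow> real. linear g \<and> (\<forall>w\<in>moduli_lattice. g w \<in> \<int>) \<and>
    (\<forall>y\<in>fan_cell S. g y \<ge> 0) \<and> (\<forall>y\<in>fan_cell T. g y = 0) \<and>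
    direction_space (fan_cell T) = {w \<in> direction_space (fan_cell S). g w = 0}"
proof -
  obtain J where J: "J \<in> S" "T = S - {J, - J}" using fan_cell_facetE[OF S T f d] .
  obtain k where k: "quartet S J k" using quartet_exists[OF S J(1)] .
  show ?thesis
  proof (intro exI[of _ "\<lambda>y. fst y $ k"] conjI ballI)
    show "linear (\<lambda>y :: ('n + 'm) ambient \<times> (real^2). fst y $ k)" by (rule linear_fst_nth)
    show "fst w $ k \<in> \<int>" if "w \<in> moduli_lattice" for w :: "('n + 'm) ambient \<times> (real^2)"
      using that tree_lattice_int[of "fst w" k] by (auto simp: moduli_lattice_def)
    show "fst y $ k \<ge> 0" if "y \<in> fan_cell S" for y by (rule quartet_nonneg[OF S J(1) k that])
    show "fst y $ k = 0" if "y \<in> fan_cell T" for y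
      using that fan_cell_remove_eq[OF S J(1) k] J(2) by blast
    show "direction_space (fan_cell T) = {w \<in> direction_space (fan_cell S). fst w $ k = 0}"
      using quartet_kernel[OF S J(1) k] J(2) by (simp add: direction_space_fan_cell)
  qed
qed

lemma cells_Z: "cells Z = {s \<in> fan. aff_dim s \<le> int (2 * CARD('n))}"
  using centered_Z wdim_Z by (auto simp: centered_complex_def fan_def)

lemma Z_balanced:
  assumes T: "split_system T" and d: "aff_dim (fan_cell T) = int (2 * CARD('n)) - 1"
  shows "(\<Sum>s | s \<in> fan \<and> aff_dim s = int (2 * CARD('n)) \<and> fan_cell T face_of s.
    wt Z s *\<^sub>R normal_vec moduli_lattice s (fan_cell T)) \<in> direction_space (fan_cell T)"
proof -
  have cT: "card T + 2 * CARD('n) + 2 = 2 * CARD('n + 'm)" using aff_dim_fan_cell[OF T] d card_legs n by simp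
  have eq: "{s. s \<in> fan \<and> aff_dim s = int (2 * CARD('n)) \<and> fan_cell T face_of s}
      = {s. s \<in> cells Z \<and> aff_dim s = wdim Z \<and> fan_cell T face_of s}" by (auto simp: cells_Z wdim_Z)
  have wt: "wt Z (fan_cell (insert_split J T)) = 1" if J: "J \<in> resolutions CARD('n) T" for J
  proof -
    note r = resolutionsD[OF J]
    have "- J \<notin> T" using split_systemD(2)[OF T, of "- J"] r(2) by auto
    then have "card (insert_split J T) = card T + 2" using card_insert_split r T by blast
    then show ?thesis using centered_Z r(5) cT by (auto simp: centered_complex_def centered_def)
  qed
  have "(\<Sum>s | s \<in> fan \<and> aff_dim s = int (2 * CARD('n)) \<and> fan_cell T face_of s. wt Z s *\<^sub>R normal_vec moduli_lattice s (fan_cell T))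
      = (\<Sum>J\<in>resolutions CARD('n) T. wt Z (fan_cell (insert_split J T)) *\<^sub>R normal_vec moduli_lattice (fan_cell (insert_split J T)) (fan_cell T))"
    unfolding eq by (rule sum_star[OF centered_Z n order_refl T cT]) simp
  also have "\<dots> = (\<Sum>J\<in>resolutions CARD('n) T. normal_vec moduli_lattice (fan_cell (insert_split J T)) (fan_cell T))"
    by (rule sum.cong) (simp_all add: wt)
  finally show ?thesis using normal_sum_mem[OF n order_refl T cT] by (simp add: direction_space_fan_cell)
qed

text \<open>A point of a cone that satisfies the first conditions places \<open>x\<close> in an
  incidence subspace. As \<open>x\<close> avoids the proper ones, that subspace is everything and
  \<open>incidence_UNIV\<close> applies.\<close>

lemma generic_position:
  assumes gen: "\<And>S j. split_system S \<Longrightarrow> j < 2 * CARD('n) \<Longrightarrow> x \<in> incidence S j \<Longrightarrow> incidence S j = UNIV"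
  shows "generic_intersection moduli_lattice fan Z (2 * CARD('n)) (2 * CARD('n)) L (\<lambda>k. \<xi> k x)"
proof (rule generic_intersection.intro)
  show "add_subgroup (moduli_lattice :: (('n + 'm) ambient \<times> (real^2)) set)" by (rule add_subgroup_moduli_lattice)
  show "linear (L k)" for k by (rule linear_L)
  show "L k w \<in> \<int>" if "w \<in> moduli_lattice" for k w using that by (rule L_int)
  show "finite fan" by (simp add: fan_def)
  fix s assume "s \<in> fan"
  then obtain S where S: "s = fan_cell S" "split_system S" by (auto simp: fan_def)
  show "s \<noteq> {}" unfolding S(1) by (rule fan_cell_ne)
  show "convex s" unfolding S(1) by (rule fan_cell_convex)
  show "direction_space s \<subseteq> span (moduli_lattice \<inter> direction_space s)"
    unfolding S(1) direction_space_fan_cell by (rule split_span_rational[OF S(2)])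
  show "\<exists>t\<in>fan. t face_of s \<and> y \<in> rel_interior t" if y: "y \<in> s" for y
  proof (rule bexI[of _ "fan_cell (support (fst y))"], rule conjI)
    have yS: "fst y \<in> split_cone S" using y S by (auto simp: fan_cell_def)
    note sp = support_props[OF S(2) yS]
    show "fan_cell (support (fst y)) \<in> fan" using sp(2) by (auto simp: fan_def)
    show "fan_cell (support (fst y)) face_of s" unfolding S(1) by (rule fan_cell_face[OF S(2) sp(2,1)])
    have "y \<in> fan_cell (support (fst y))" using mem_cone_support[OF S(2) yS] by (cases y) (simp add: fan_cell_def)
    then show "y \<in> rel_interior (fan_cell (support (fst y)))" by (rule rel_interior_fan_cell[OF sp(2) _ refl])
  qed
  show "\<exists>w\<in>direction_space s. (\<forall>k<j. L k w = 0) \<and> L j w \<noteq> 0"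
    if y: "y \<in> s" and j: "j < 2 * CARD('n)" and eq: "\<And>k. k \<le> j \<Longrightarrow> L k y = \<xi> k x" for y j
  proof -
    have "y \<in> split_span S" using y S(1) fan_cell_subset_span by blast
    then have "x \<in> incidence S j" using eq unfolding incidence_def by blast
    then show ?thesis using incidence_UNIV[OF j gen[OF S(2) j]] by (simp add: S(1) direction_space_fan_cell)
  qed
  show "(\<Sum>t | t \<in> fan \<and> aff_dim t = int (2 * CARD('n)) \<and> s face_of t. wt Z t *\<^sub>R normal_vec moduli_lattice t s) \<in> direction_space s"
    if "aff_dim s = int (2 * CARD('n)) - 1" using Z_balanced[OF S(2)] that S(1) by simp
  fix t assume "t \<in> fan"
  then obtain T where T: "t = fan_cell T" "split_system T" by (auto simp: fan_def)
  show "s \<inter> t face_of s"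
    unfolding S(1) T(1) fan_cell_Int[OF S(2) T(2)] by (rule fan_cell_face[OF S(2) split_system_Int[OF S(2) T(2)]]) simp
  show "\<exists>g :: ('n + 'm) ambient \<times> (real^2) \<Rightarrow> real. linear g \<and> (\<forall>w\<in>moduli_lattice. g w \<in> \<int>) \<and> (\<forall>y\<in>s. g y \<ge> 0) \<and>
      (\<forall>y\<in>t. g y = 0) \<and> direction_space t = {w \<in> direction_space s. g w = 0}"
    if "t face_of s" "aff_dim s = aff_dim t + 1"
    using facet_functional[OF S(2) T(2)] that S(1) T(1) by simp
qed (rule wdim_Z cells_Z)+

text \<open>The splits of the curve form the support of its class, so the class lies in the face
  they span, and a proper face misses the relative interior.\<close>

lemma split_system_of_curve:
  assumes C: "tropical_curve v C" and S: "split_system S" and y: "curve_point (mark 1) C \<in> rel_interior (fan_cell S)"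
  shows "ptree.splits C = S"
proof -
  have st: "stable_tree C" using C by (simp add: tropical_curve_def)
  interpret C: stree C by (rule stree_stable[OF st])
  obtain r where r: "r \<in> verts C" using C.V_ne by blast
  have "support (tree_point C) = C.splits"
    unfolding C.tree_point_eq[OF r] by (rule C.support_sum[OF r]) (use st C.parent(2)[OF r] in \<open>auto simp: stable_tree_def\<close>)
  then have supp: "support (fst (curve_point (mark 1) C)) = C.splits" by (simp add: curve_point_def)
  let ?y = "curve_point (mark 1) C"
  have yS: "fst ?y \<in> split_cone S" using y rel_interior_subset by (fastforce simp: fan_cell_def)
  note sp = support_props[OF S yS]
  have mem: "?y \<in> fan_cell (support (fst ?y))" using mem_cone_support[OF S yS] by (cases ?y) (simp add: fan_cell_def)
  have "fan_cell (support (fst ?y)) = fan_cell S"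
  proof (rule ccontr)
    assume "fan_cell (support (fst ?y)) \<noteq> fan_cell S"
    then have "fan_cell (support (fst ?y)) \<inter> rel_interior (fan_cell S) = {}"
      using face_of_disjoint_rel_interior fan_cell_face[OF S sp(2,1)] by blast
    then show False using mem y by blast
  qed
  then have "support (fst ?y) = S" by (rule fan_cell_inj[OF sp(2) S])
  then show ?thesis using supp by simp
qed

lemma shape:
  assumes gen: "\<And>S j. split_system S \<Longrightarrow> j < 2 * CARD('n) \<Longrightarrow> x \<in> incidence S j \<Longrightarrow> incidence S j = UNIV"
    and C: "tropical_curve v C" and contr: "contributes (point_cycle p c x) (curve_point (mark 1) C)"
  shows "shape_A C \<or> shape_B C"
proof -
  interpret I: generic_intersection moduli_lattice fan Z "2 * CARD('n)" "2 * CARD('n)" L "\<lambda>k. \<xi> k x"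
    by (rule generic_position) (rule gen)
  define g where "g = (\<lambda>(i, j) y. ev v (mark 1) (mark i) y $ j - x $ p i $ j)"
  have pc: "point_cycle p c x = fold (\<lambda>ij. cartier_intersect moduli_lattice (g ij)) (coords CARD('n)) Z"
    unfolding point_cycle_def coords_def by (rule fold_cong) (auto simp: g_def coords_def)
  have ag: "agree (point_cycle p c x) (I.X (length (coords CARD('n))))"
    unfolding pc
  proof (rule I.agree_fold)
    fix k s y assume k: "k < length (coords CARD('n))" and "s \<in> fan" and y: "y \<in> s"
    then obtain S where S: "s = fan_cell S" "split_system S" by (auto simp: fan_def)
    have "v (mark i) = 0" "mark i \<noteq> s0" for i by (auto simp: leg_dir_def)
    then show "g (coords CARD('n) ! k) y = L k y - \<xi> k x"
      using ev_eq[OF S(2)] y S(1) by (cases "coords CARD('n) ! k") (simp add: g_def L_def \<xi>_def)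
  qed
  have "contributes (I.X (2 * CARD('n))) (curve_point (mark 1) C)"
    using contr contributes_agree[OF ag[unfolded length_ints]] by blast
  then obtain s where s: "s \<in> fan" "aff_dim s = int (2 * CARD('n))" "wt Z s \<noteq> 0" "curve_point (mark 1) C \<in> rel_interior s"
    and ker: "\<forall>w\<in>direction_space s. (\<forall>k<2 * CARD('n). L k w = 0) \<longrightarrow> w = 0"
    by (rule I.contributes_rigid[OF refl]) (rule that)
  obtain S where S: "s = fan_cell S" "split_system S" using s(1) by (auto simp: fan_def)
  have spl: "ptree.splits C = S" using split_system_of_curve[OF C S(2)] s(4) S(1) by simp
  \<comment> \<open>Of the \<open>2 * CARD('n)\<close> dimensions two belong to the plane; the
    others are bounded edges, each counted with both sides.\<close>
  have card_S: "card S = 4 * CARD('n) - 4" using aff_dim_fan_cell[OF S(2)] s(2) S(1) n by simp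
  have "card S + 2 * CARD('n) = 2 * CARD('n + 'm)" unfolding card_S card_legs using n by simp
  then have cen: "centered CARD('n) S" using centered_Z S s(3) by (auto simp: centered_complex_def split: if_splits)
  have st: "stree C" using C by (intro stree_stable) (simp add: tropical_curve_def)
  obtain V where "rigid_tree C mark CARD('n) V"
  proof (rule rigid_tree_exists[OF st marked_axioms balanced_legs_axioms, unfolded spl])
    show "mark 1 \<in> P CARD('n)" by (simp add: P_eq)
    show "v a = 0 \<and> a \<noteq> s0" if "a \<in> P CARD('n)" for a using that by (auto simp: P_eq leg_dir_def)
    show "centered CARD('n) S" by (rule cen)
    show "CARD('n + 'm) = 3 * CARD('n) - 2" by (rule card_legs)
    show "card S = 2 * (2 * CARD('n) - 2)" using card_S by simp
    \<comment> \<open>A change of the tree with fixed base leg: with second component 0 the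
      functionals \<open>L\<close> reduce to coordinates of \<open>ev_fun\<close>.\<close>
    fix z assume z: "z \<in> span (split_vec ` S)" "\<And>a. a \<in> P CARD('n) \<Longrightarrow> ev_fun a z = 0"
    have "(z, 0) \<in> direction_space s" using z(1) by (simp add: S(1) direction_space_fan_cell split_span_def)
    moreover have "L k (z, 0) = 0" for k using z(2) P_eq by (simp add: L_def)
    ultimately have "(z, 0 :: real^2) = 0" using ker by blast
    then show "z = 0" by (simp add: zero_prod_def)
  qed (rule that)
  then interpret R: rigid_tree C mark "CARD('n)" V .
  interpret R: rigid_curve C mark "CARD('n)" V by unfold_locales (rule P_eq)
  show ?thesis by (rule R.shapes)
qed

end

theorem corollary24:
  fixes \<Sigma> :: "(real^2) set set"
    and c :: "'m::finite \<Rightarrow> (real^2) set \<times> nat"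
    and p :: "nat \<Rightarrow> 'n::finite"
  assumes surface: "nonsingular_fan \<Sigma>" "projective_fan \<Sigma>"
    and contact: "contact_order \<Sigma> c"
    and balancing: "(\<Sum>l\<in>UNIV. contact_vec c l) = 0"
    and n: "CARD('n) \<ge> 3"
    and m: "CARD('m) = 2 * (CARD('n) - 1)"
    and markings: "bij_betw p {1..CARD('n)} UNIV"
  shows "for_general (\<lambda>x :: (real^2)^'n. \<forall>C :: ('n + 'm) curve.
           tropical_curve (leg_dir c) C
           \<and> contributes (point_cycle p c x) (curve_point (Inl (p 1)) C)
           \<longrightarrow> shape_A C \<or> shape_B C)"
proof -
  interpret incidence_problem \<Sigma> c p
    using surface(1) contact balancing n m markings by unfold_locales
  \<comment> \<open>There are finitely many split systems and indices, hence finitely many proper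
    subspaces to avoid.\<close>
  let ?\<H> = "{incidence S j |S j. split_system S \<and> j < 2 * CARD('n) \<and> incidence S j \<noteq> UNIV}"
  have "?\<H> \<subseteq> (\<lambda>(S, j). incidence S j) ` (UNIV \<times> {..<2 * CARD('n)})" by auto
  then have fin: "finite ?\<H>" by (rule finite_subset) simp
  have "shape_A C \<or> shape_B C"
    if x: "x \<notin> \<Union>?\<H>" and C: "tropical_curve (leg_dir c) C"
      "contributes (point_cycle p c x) (curve_point (Inl (p 1)) C)"
    for x :: "(real^2)^'n" and C :: "('n + 'm) curve"
  proof (rule shape[OF _ C])
    show "incidence S j = UNIV" if "split_system S" "j < 2 * CARD('n)" "x \<in> incidence S j" for S j
      using that x by blast
  qed
  then show ?thesis unfolding for_general_def
    using fin affine_incidence by (intro exI[of _ ?\<H>] conjI) auto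
qed

end
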